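(* Let $0<p,q<\infty$, $\alpha,\beta>-1$, and let $\varphi:\mathbb{C}\to\mathbb{C}$ be a function. Then the superposition operator $S_\varphi$ maps $\mathcal{A}^p_\alpha$ into $\mathcal{A}^q_\beta$ if and only if $\varphi$ is a polynomial of degree $N$, where $N$ satisfies (i) $N\leq\frac{p}{q}$ in the case $\alpha\leq\beta$; (ii) $N<\frac{p(\beta+1)}{q(\alpha+1)}$ in the case $\alpha>\beta$. Moreover, if $S_\varphi$ maps $\mathcal{A}^p_\alpha$ into $\mathcal{A}^q_\beta$, then it is bounded and continuous.
   Context: For a function $\varphi$ on $\mathbb{C}$, the (nonlinear) superposition operator is $S_\varphi f=\varphi\circ f$ for complex-valued functions $f$. Bounded means mapping bounded sets to bounded sets. $\mathcal{P}$ is the space of Dirichlet polynomials $\sum_{n=1}^Na_nn^{-s}$ ($a_n\in\mathbb{C}$). Let $p_j$ be the $j$th prime and write $n=\prod_j p_j^{\nu_j(n)}$. The Bohr lift of $P(s)=\sum_{n=1}^N a_nn^{-s}$ is $\mathscr{B}P(z)=\sum_{n=1}^N a_nz^{\nu(n)}$, where $z=(z_1,z_2,\dots)$ and $z^{\nu(n)}=\prod_jz_j^{\nu_j(n)}$. For $0<p<\infty$ and $P\in\mathcal{P}$, $\|P\|_{\mathscr{H}^p}=\left(\int_{\mathbb{T}^\infty}|\mathscr{B}P(z)|^p\,dm_\infty(z)\right)^{1/p}$, where $m_\infty$ is the Haar probability measure on the infinite torus $\mathbb{T}^\infty$. For $\sigma\ge0$, $P_\sigma(s)=P(s+\sigma)$.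 For $0<p<\infty$ and $\alpha>-1$, the Bergman space $\mathcal{A}^p_\alpha$ is the completion of $\mathcal{P}$ with respect to the (quasi-)norm $\|P\|_{\mathcal{A}^p_\alpha}=\left(\int_0^{+\infty}\|P_\sigma\|_{\mathscr{H}^p}^p\,d\mu_\alpha(\sigma)\right)^{1/p}$, where $d\mu_\alpha(\sigma)=\frac{2^{\alpha+1}}{\Gamma(\alpha+1)}\sigma^\alpha e^{-2\sigma}d\sigma$. Its elements are identified with Dirichlet series converging on $\mathbb{C}_{1/2}=\{s\in\mathbb{C}:\Re s>1/2\}$, i.e. with analytic functions on $\mathbb{C}_{1/2}$. *)

theory Defs
  imports "HOL-Probability.Probability" "HOL-Computational_Algebra.Computational_Algebra"
begin

text \<open>
  A Dirichlet polynomial \<open>\<Sum>n. a n / n^s\<close> is represented by its coefficients \<open>a\<close>, a finitely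
  supported sequence. The series starts at 1, so the index 0 is required to carry no coefficient.
\<close>

definition dirichlet_polys :: "(nat \<Rightarrow> complex) set" where
  "dirichlet_polys = {a. a 0 = 0 \<and> finite {n. a n \<noteq> 0}}"

definition dp_eval :: "(nat \<Rightarrow> complex) \<Rightarrow> complex \<Rightarrow> complex" where
  "dp_eval a s = (\<Sum>n | a n \<noteq> 0. a n * of_nat n powr (-s))"

text \<open>The coefficients of \<open>P(s + \<sigma>)\<close>.\<close>

definition dp_shift :: "real \<Rightarrow> (nat \<Rightarrow> complex) \<Rightarrow> nat \<Rightarrow> complex" where
  "dp_shift \<sigma> a = (\<lambda>n. a n * of_real (real n powr (-\<sigma>)))"

text \<open>Enumeration starts at 0: \<open>nth_prime 0 = 2\<close>.\<close>

definition nth_prime :: "nat \<Rightarrow> nat" where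
  "nth_prime = enumerate {p. prime p}"

definition bohr_monom :: "nat \<Rightarrow> (nat \<Rightarrow> complex) \<Rightarrow> complex" where
  "bohr_monom n z = (\<Prod>j | nth_prime j dvd n. z j ^ multiplicity (nth_prime j) n)"

definition bohr_lift :: "(nat \<Rightarrow> complex) \<Rightarrow> (nat \<Rightarrow> complex) \<Rightarrow> complex" where
  "bohr_lift a z = (\<Sum>n | a n \<noteq> 0. a n * bohr_monom n z)"

definition circle_measure :: "complex measure" where
  "circle_measure =
     distr (uniform_measure lborel {0..2*pi}) (restrict_space borel (sphere 0 1)) cis"

text \<open>
  The Haar probability measure on the countably infinite torus is the product of the normalised
  arc length measures.
\<close>

definition torus_measure :: "(nat \<Rightarrow> complex) measure" where
  "torus_measure = PiM UNIV (\<lambda>_. circle_measure)"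

definition hardy_norm :: "real \<Rightarrow> (nat \<Rightarrow> complex) \<Rightarrow> real" where
  "hardy_norm p a = (\<integral>z. norm (bohr_lift a z) powr p \<partial>torus_measure) powr (1/p)"

definition mu_measure :: "real \<Rightarrow> real measure" where
  "mu_measure \<alpha> = density lborel (\<lambda>\<sigma>. ennreal (indicator {0<..} \<sigma> *
     (2 powr (\<alpha>+1) / Gamma (\<alpha>+1) * \<sigma> powr \<alpha> * exp (-2*\<sigma>))))"

definition dp_norm :: "real \<Rightarrow> real \<Rightarrow> (nat \<Rightarrow> complex) \<Rightarrow> real" where
  "dp_norm p \<alpha> a = (\<integral>\<sigma>. hardy_norm p (dp_shift \<sigma> a) powr p \<partial>mu_measure \<alpha>) powr (1/p)"

text \<open>
  The space is the completion of the Dirichlet polynomials, realised as a space of functions on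
  the half-plane \<open>C_half\<close>. Evaluation at any point of \<open>C_half\<close> is continuous on Dirichlet
  polynomials, so every Cauchy sequence converges pointwise on \<open>C_half\<close>; an element of the
  completion is identified with the pointwise limit of any Cauchy sequence that represents it.
  As elements are functions on \<open>C_half\<close> only, they are kept extensional.
\<close>

definition C_half :: "complex set" where
  "C_half = {s. Re s > 1/2}"

definition dp_Cauchy :: "real \<Rightarrow> real \<Rightarrow> (nat \<Rightarrow> nat \<Rightarrow> complex) \<Rightarrow> bool" where
  "dp_Cauchy p \<alpha> X \<longleftrightarrow> (\<forall>k. X k \<in> dirichlet_polys) \<and>
     (\<forall>e>0. \<exists>M. \<forall>k\<ge>M. \<forall>l\<ge>M. dp_norm p \<alpha> (\<lambda>n. X k n - X l n) < e)"

definition bergman_rep :: "real \<Rightarrow> real \<Rightarrow> (nat \<Rightarrow> nat \<Rightarrow> complex) \<Rightarrow> (complex \<Rightarrow> complex) \<Rightarrow> bool" where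
  "bergman_rep p \<alpha> X f \<longleftrightarrow> dp_Cauchy p \<alpha> X \<and> (\<forall>s\<in>C_half. (\<lambda>k. dp_eval (X k) s) \<longlonglongrightarrow> f s)"

definition bergman_space :: "real \<Rightarrow> real \<Rightarrow> (complex \<Rightarrow> complex) set" where
  "bergman_space p \<alpha> = {f \<in> extensional C_half. \<exists>X. bergman_rep p \<alpha> X f}"

text \<open>
  The norm of the completion: the limit of the norms along any representing Cauchy sequence
  (evaluation on \<open>C_half\<close> is injective on the completion, so the choice does not matter).
\<close>

definition bergman_norm :: "real \<Rightarrow> real \<Rightarrow> (complex \<Rightarrow> complex) \<Rightarrow> real" where
  "bergman_norm p \<alpha> f = (THE r. \<exists>X. bergman_rep p \<alpha> X f \<and> (\<lambda>k. dp_norm p \<alpha> (X k)) \<longlonglongrightarrow> r)"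

definition bergman_dist :: "real \<Rightarrow> real \<Rightarrow> (complex \<Rightarrow> complex) \<Rightarrow> (complex \<Rightarrow> complex) \<Rightarrow> real" where
  "bergman_dist p \<alpha> f g = bergman_norm p \<alpha> (\<lambda>s\<in>C_half. f s - g s)"

definition superposition :: "(complex \<Rightarrow> complex) \<Rightarrow> (complex \<Rightarrow> complex) \<Rightarrow> complex \<Rightarrow> complex" where
  "superposition \<phi> f = compose C_half \<phi> f"

definition bergman_bounded_set :: "real \<Rightarrow> real \<Rightarrow> (complex \<Rightarrow> complex) set \<Rightarrow> bool" where
  "bergman_bounded_set p \<alpha> B \<longleftrightarrow> B \<subseteq> bergman_space p \<alpha> \<and> (\<exists>C. \<forall>f\<in>B. bergman_norm p \<alpha> f \<le> C)"

definition bergman_bounded_op ::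
  "real \<Rightarrow> real \<Rightarrow> real \<Rightarrow> real \<Rightarrow> ((complex \<Rightarrow> complex) \<Rightarrow> complex \<Rightarrow> complex) \<Rightarrow> bool" where
  "bergman_bounded_op p \<alpha> q \<beta> T \<longleftrightarrow>
     (\<forall>B. bergman_bounded_set p \<alpha> B \<longrightarrow> bergman_bounded_set q \<beta> (T ` B))"

text \<open>
  For exponents below 1, \<open>bergman_dist\<close> is only a quasi-metric, but its power with that exponent
  is a metric, so the following is continuity for the topologies of the two spaces.
\<close>

definition bergman_continuous_op ::
  "real \<Rightarrow> real \<Rightarrow> real \<Rightarrow> real \<Rightarrow> ((complex \<Rightarrow> complex) \<Rightarrow> complex \<Rightarrow> complex) \<Rightarrow> bool" where
  "bergman_continuous_op p \<alpha> q \<beta> T \<longleftrightarrow>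
     (\<forall>f\<in>bergman_space p \<alpha>. \<forall>e>0. \<exists>d>0. \<forall>g\<in>bergman_space p \<alpha>.
        bergman_dist p \<alpha> g f < d \<longrightarrow> bergman_dist q \<beta> (T g) (T f) < e)"

end

theory Submission
  imports Defs "HOL-Complex_Analysis.Complex_Analysis" "HOL-Real_Asymp.Real_Asymp"
begin

text \<open>
  If \<open>f\<close> lies in \<open>A\<^sup>p\<^sub>\<alpha>\<close>, then \<open>f^N\<close> lies in the space with exponent \<open>p/N\<close>, which in the admissible range
  embeds into \<open>A\<^sup>q\<^sub>\<beta>\<close> by Hoelder's inequality in \<open>\<sigma>\<close> and the monotonicity of the Hardy norms of the
  shifts; this makes polynomials act boundedly and continuously.
  Conversely, applying \<open>\<phi>\<close> to \<open>d + R / 2^s\<close> shows that \<open>\<phi>\<close> is entire. If its \<open>N\<close>-th Taylor coefficient does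
  not vanish, a gliding hump rules out small Dirichlet polynomials \<open>h\<close>, supported on numbers with only
  large prime factors, whose powers \<open>h^N\<close> are large in \<open>A\<^sup>q\<^sub>\<beta>\<close>. For \<open>q N > p\<close> such \<open>h\<close> are products of
  factors \<open>1 + p\<^sub>j\<^sup>-\<^sup>s / 2\<close>, because their moments grow strictly with the exponent; for \<open>\<beta> < \<alpha>\<close> and
  \<open>q N \<le> p\<close> they are sums over a lacunary set of primes, which see the behaviour of the two weights at 0.
\<close>

section \<open>Moments of polynomials on the circle\<close>

text \<open>Two obstacles shape the proof. For exponents below 1 there is no duality and no triangle
  inequality, so estimates are reduced to moduli of one-variable polynomials: rotating the
  coordinate \<open>z j\<close> by \<open>w ^ k j\<close> preserves the torus measure and turns a
  Bohr lift into a polynomial in \<open>w\<close> whose coefficients are its parts of fixed weight.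
  Dilations and projections to such parts are therefore bounded for all \<open>p > 0\<close>, with
  constants that ignore the number of variables; suitable weights \<open>k\<close> yield the shifts
  in \<sigma>, single coefficients, and the blocks of the gliding hump. Secondly, elements of the
  space are pointwise limits of Cauchy sequences, so the values must be shown to determine the class
  of the sequence. This passes through coefficients: values far to the right fix the limits of the
  coefficients, and a Fatou property, \<open>dp_norm_le_of_coeff_limit\<close>, shows that a Cauchy
  sequence with null coefficients is null. A representing sequence must also converge on all of
  \<open>C_half\<close>, while point bounds are proved only far to the right; hence the test
  polynomials are also made small in the absolutely convergent sense at 1/2.\<close>

lemma space_circle_measure [simp]: "space circle_measure = sphere 0 1"
  and sets_circle_measure: "sets circle_measure = sets (restrict_space borel (sphere 0 1))"
  by (auto simp: circle_measure_def)

lemma measurable_circle_measure [measurable]: "(\<lambda>z. z) \<in> circle_measure \<rightarrow>\<^sub>M borel"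
  by (simp add: measurable_cong_sets[OF sets_circle_measure refl] measurable_restrict_space1)

lemma borel_measurable_circle_measure:
  "f \<in> borel_measurable borel \<Longrightarrow> f \<in> borel_measurable circle_measure"
  using measurable_compose[OF measurable_circle_measure] by simp

lemma measurable_into_circle_measure:
  "f \<in> M \<rightarrow>\<^sub>M borel \<Longrightarrow> (\<And>x. x \<in> space M \<Longrightarrow> norm (f x) = 1) \<Longrightarrow> f \<in> M \<rightarrow>\<^sub>M circle_measure"
  by (simp add: measurable_cong_sets[OF refl sets_circle_measure] measurable_restrict_space2)

lemma borel_measurable_cis [measurable]: "cis \<in> borel_measurable borel"
  by (intro borel_measurable_continuous_onI continuous_on_cis continuous_on_id)

lemma measurable_cis_circle:
  "cis \<in> uniform_measure lborel {0..2*pi} \<rightarrow>\<^sub>M restrict_space borel (sphere 0 1)"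
  by (intro measurable_restrict_space2) (auto simp: measurable_cong_sets[OF sets_uniform_measure])

lemma prob_space_circle_measure: "prob_space circle_measure"
  unfolding circle_measure_def
  by (intro prob_space.prob_space_distr prob_space_uniform_measure measurable_cis_circle) auto

lemma nn_integral_circle_measure:
  assumes [measurable]: "f \<in> borel_measurable borel"
  shows "(\<integral>\<^sup>+z. f z \<partial>circle_measure) = (\<integral>\<^sup>+t. f (cis t) * indicator {0..2*pi} t \<partial>lborel) / (2*pi)"
proof -
  have "f \<in> borel_measurable (restrict_space borel (sphere 0 1))"
    by (simp add: measurable_restrict_space1)
  then have "(\<integral>\<^sup>+z. f z \<partial>circle_measure) = (\<integral>\<^sup>+t. f (cis t) \<partial>uniform_measure lborel {0..2*pi})"
    unfolding circle_measure_def by (subst nn_integral_distr[OF measurable_cis_circle]) auto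
  then show ?thesis
    by (simp add: nn_integral_uniform_measure)
qed

lemma nn_integral_periodic_shift:
  fixes G :: "real \<Rightarrow> ennreal"
  assumes [measurable]: "G \<in> borel_measurable borel"
    and per: "\<And>t. G (t + 2*pi) = G t" and a: "0 \<le> a" "a \<le> 2*pi"
  shows "(\<integral>\<^sup>+t. G (a + t) * indicator {0..2*pi} t \<partial>lborel) = (\<integral>\<^sup>+t. G t * indicator {0..2*pi} t \<partial>lborel)"
proof -
  have "(\<integral>\<^sup>+t. G (a + t) * indicator {0..2*pi} t \<partial>lborel) = (\<integral>\<^sup>+t. G t * indicator {a..2*pi+a} t \<partial>lborel)"
    by (subst nn_integral_real_affine[of _ 1 a]) (auto intro!: nn_integral_cong simp: indicator_def)
  also have "\<dots> = (\<integral>\<^sup>+t. G t * indicator {a..2*pi} t + G t * indicator {2*pi<..2*pi+a} t \<partial>lborel)"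
    using a by (intro nn_integral_cong) (auto simp: indicator_def)
  also have "\<dots> = (\<integral>\<^sup>+t. G t * indicator {a..2*pi} t \<partial>lborel) + (\<integral>\<^sup>+t. G t * indicator {2*pi<..2*pi+a} t \<partial>lborel)"
    by (rule nn_integral_add) auto
  also have "(\<integral>\<^sup>+t. G t * indicator {2*pi<..2*pi+a} t \<partial>lborel) = (\<integral>\<^sup>+t. G t * indicator {0<..a} t \<partial>lborel)"
    by (subst nn_integral_real_affine[of _ 1 "2*pi"])
      (auto intro!: nn_integral_cong simp: indicator_def per add.commute[of "2*pi"])
  also have "(\<integral>\<^sup>+t. G t * indicator {a..2*pi} t \<partial>lborel) + (\<integral>\<^sup>+t. G t * indicator {0<..a} t \<partial>lborel)
     = (\<integral>\<^sup>+t. G t * indicator {a..2*pi} t + G t * indicator {0<..a} t \<partial>lborel)"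
    by (rule nn_integral_add[symmetric]) auto
  also have "\<dots> = (\<integral>\<^sup>+t. G t * indicator {0..2*pi} t \<partial>lborel)"
  proof (rule nn_integral_cong_AE)
    \<comment> \<open>The two sides can differ only at these points: the left side counts
      \<open>a\<close> twice and misses 0.\<close>
    have "AE t in lborel. t \<noteq> 0 \<and> t \<noteq> a"
      using AE_lborel_singleton[of 0] AE_lborel_singleton[of a] by eventually_elim auto
    then show "AE t in lborel. G t * indicator {a..2*pi} t + G t * indicator {0<..a} t = G t * indicator {0..2*pi} t"
      by eventually_elim (use a in \<open>auto simp: indicator_def\<close>)
  qed
  finally show ?thesis .
qed

text \<open>Writing \<open>w = cis a\<close> turns the rotation into a translation of the angle,
  which does not change the integral of a periodic function over a full period. Together with its
  version on the torus this is how the Haar property enters.\<close>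

lemma distr_circle_rotate:
  assumes w: "norm w = 1"
  shows "distr circle_measure circle_measure (\<lambda>z. w * z) = circle_measure"
proof -
  obtain a where a: "0 \<le> a" "a < 2*pi" "w = cis a"
    using that[of "Arg2pi w"] Arg2pi[of w] w by (simp add: cis_conv_exp is_Arg_def)
  have m: "(\<lambda>z. w * z) \<in> circle_measure \<rightarrow>\<^sub>M circle_measure"
    using w by (intro measurable_into_circle_measure) (auto intro!: borel_measurable_circle_measure simp: norm_mult)
  show ?thesis
  proof (rule measure_eqI)
    fix A assume "A \<in> sets (distr circle_measure circle_measure ((*) w))"
    then have A: "A \<in> sets circle_measure" by simp
    then obtain B where B: "B \<in> sets borel" "A = sphere 0 1 \<inter> B"
      by (auto simp: sets_circle_measure sets_restrict_space)
    have [measurable]: "A \<in> sets borel" using B by auto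
    have "emeasure (distr circle_measure circle_measure (\<lambda>z. w * z)) A
        = (\<integral>\<^sup>+z. indicator A z \<partial>distr circle_measure circle_measure (\<lambda>z. w * z))"
      using A by simp
    also have "\<dots> = (\<integral>\<^sup>+z. indicator A (w * z) \<partial>circle_measure)"
      using A by (subst nn_integral_distr[OF m]) auto
    also have "\<dots> = (\<integral>\<^sup>+t. indicator A (cis (a + t)) * indicator {0..2*pi} t \<partial>lborel) / (2*pi)"
      by (subst nn_integral_circle_measure) (auto simp: a cis_mult)
    also have "\<dots> = (\<integral>\<^sup>+t. indicator A (cis t) * indicator {0..2*pi} t \<partial>lborel) / (2*pi)"
      using a by (subst nn_integral_periodic_shift[where G="\<lambda>t. indicator A (cis t)"])
        (auto simp: cis_mult[symmetric])
    also have "\<dots> = (\<integral>\<^sup>+z. indicator A z \<partial>circle_measure)"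
      by (subst nn_integral_circle_measure) auto
    also have "\<dots> = emeasure circle_measure A" using A by simp
    finally show "emeasure (distr circle_measure circle_measure (\<lambda>z. w * z)) A = emeasure circle_measure A" .
  qed simp
qed

interpretation circle: prob_space circle_measure
  by (rule prob_space_circle_measure)

lemma integrable_circle_continuous:
  fixes f :: "complex \<Rightarrow> 'a::{banach,second_countable_topology}"
  assumes "continuous_on UNIV f"
  shows "integrable circle_measure f"
proof -
  have "compact (f ` sphere 0 1)"
    by (rule compact_continuous_image[OF continuous_on_subset[OF assms subset_UNIV] compact_sphere])
  then have "bounded (f ` sphere 0 1)"
    by (rule compact_imp_bounded)
  then obtain K where K: "\<forall>x\<in>f ` sphere 0 1. norm x \<le> K"
    unfolding bounded_iff ..
  have "AE z in circle_measure. norm (f z) \<le> K"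
    using K by (intro AE_I2) simp
  then show ?thesis
    by (rule circle.integrable_const_bound)
      (intro borel_measurable_circle_measure borel_measurable_continuous_onI assms)
qed

lemma integral_circle_rotate:
  fixes f :: "complex \<Rightarrow> 'a::{banach,second_countable_topology}"
  assumes "f \<in> borel_measurable circle_measure" "norm w = 1"
  shows "(\<integral>z. f (w * z) \<partial>circle_measure) = (\<integral>z. f z \<partial>circle_measure)"
proof -
  have m: "(\<lambda>z. w * z) \<in> circle_measure \<rightarrow>\<^sub>M circle_measure"
    using assms by (intro measurable_into_circle_measure) (auto intro!: borel_measurable_circle_measure simp: norm_mult)
  show ?thesis
    using integral_distr[OF m assms(1)] distr_circle_rotate[OF assms(2)] by simp
qed

text \<open>Rotation by an \<open>m\<close>-th root of -1 reverses the sign of the integrand, so the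
  integral equals its own negative.\<close>

lemma integral_circle_power:
  assumes "0 < m"
  shows "(\<integral>z. z ^ m \<partial>circle_measure) = 0"
proof -
  define u where "u = cis (pi / m)"
  have "u ^ m = -1" using assms by (simp add: u_def Complex.DeMoivre)
  then have "(\<integral>z. z ^ m \<partial>circle_measure) = (\<integral>z. - (z ^ m) \<partial>circle_measure)"
    using integral_circle_rotate[of "\<lambda>z. z ^ m" u]
    by (simp add: u_def power_mult_distrib borel_measurable_circle_measure)
  then show ?thesis by simp
qed

lemma integral_circle_power_cnj:
  "(\<integral>z. z ^ j * cnj z ^ k \<partial>circle_measure) = (if j = k then 1 else 0)"
proof -
  have *: "z * cnj z = 1" if "z \<in> sphere 0 1" for z :: complex
    using that by (simp add: complex_norm_square[symmetric])
  show ?thesis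
  proof (cases j k rule: linorder_cases)
    case equal
    have "(\<integral>z. z ^ j * cnj z ^ k \<partial>circle_measure) = (\<integral>z. 1 \<partial>circle_measure)"
      using equal by (intro Bochner_Integration.integral_cong) (auto simp: * power_mult_distrib[symmetric])
    then show ?thesis using equal circle.prob_space by simp
  next
    case greater
    have "z ^ j * cnj z ^ k = z ^ (j - k)" if "z \<in> sphere 0 1" for z
    proof -
      have "z ^ j * cnj z ^ k = z ^ (j - k) * (z * cnj z) ^ k"
        using greater by (simp add: power_mult_distrib power_add[symmetric] mult.assoc[symmetric])
      then show ?thesis using *[OF that] by simp
    qed
    then have "(\<integral>z. z ^ j * cnj z ^ k \<partial>circle_measure) = (\<integral>z. z ^ (j - k) \<partial>circle_measure)"
      by (intro Bochner_Integration.integral_cong) auto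
    then show ?thesis using greater integral_circle_power[of "j - k"] by simp
  next
    case less
    have "z ^ j * cnj z ^ k = cnj (z ^ (k - j))" if "z \<in> sphere 0 1" for z
    proof -
      have "z ^ j * cnj z ^ k = (z * cnj z) ^ j * cnj z ^ (k - j)"
        using less by (simp add: power_mult_distrib power_add[symmetric] mult.assoc)
      then show ?thesis using *[OF that] by simp
    qed
    then have "(\<integral>z. z ^ j * cnj z ^ k \<partial>circle_measure) = (\<integral>z. cnj (z ^ (k - j)) \<partial>circle_measure)"
      by (intro Bochner_Integration.integral_cong) auto
    also have "\<dots> = cnj (\<integral>z. z ^ (k - j) \<partial>circle_measure)"
      by (rule Bochner_Integration.integral_cnj)
    finally show ?thesis using less integral_circle_power[of "k - j"] by simp
  qed
qed

lemma parseval_circle_finite: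
  "(\<integral>z. (norm (\<Sum>k<n. c k * z ^ k))\<^sup>2 \<partial>circle_measure) = (\<Sum>k<n. (norm (c k))\<^sup>2)"
proof -
  have i: "integrable circle_measure (\<lambda>z. c j * cnj (c k) * (z ^ j * cnj z ^ k))" for j k
    by (intro integrable_circle_continuous continuous_intros)
  have e: "complex_of_real ((norm (\<Sum>k<n. c k * z ^ k))\<^sup>2) =
      (\<Sum>j<n. \<Sum>k<n. c j * cnj (c k) * (z ^ j * cnj z ^ k))" for z
    unfolding complex_norm_square cnj_sum sum_product
    by (intro sum.cong refl) (simp add: mult_ac)
  have "complex_of_real (\<integral>z. (norm (\<Sum>k<n. c k * z ^ k))\<^sup>2 \<partial>circle_measure)
      = (\<integral>z. (\<Sum>j<n. \<Sum>k<n. c j * cnj (c k) * (z ^ j * cnj z ^ k)) \<partial>circle_measure)"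
    unfolding integral_complex_of_real[symmetric] e ..
  also have "\<dots> = (\<Sum>j<n. \<integral>z. (\<Sum>k<n. c j * cnj (c k) * (z ^ j * cnj z ^ k)) \<partial>circle_measure)"
    by (intro Bochner_Integration.integral_sum Bochner_Integration.integrable_sum i)
  also have "\<dots> = (\<Sum>j<n. \<Sum>k<n. \<integral>z. c j * cnj (c k) * (z ^ j * cnj z ^ k) \<partial>circle_measure)"
    by (intro sum.cong refl Bochner_Integration.integral_sum i)
  also have "\<dots> = (\<Sum>j<n. \<Sum>k<n. if j = k then c j * cnj (c k) else 0)"
    by (intro sum.cong refl) (simp add: integral_circle_power_cnj)
  also have "\<dots> = complex_of_real (\<Sum>k<n. (norm (c k))\<^sup>2)"
    unfolding of_real_sum complex_norm_square by (intro sum.cong refl) (simp add: sum.delta)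
  finally show ?thesis by (simp only: of_real_eq_iff)
qed

text \<open>Absolute summability bounds all partial sums on the circle by one constant, so dominated
  convergence carries the finite identity to the limit. The applications have coefficients
  \<open>g n * r ^ n\<close> with \<open>r < 1\<close>, where this hypothesis is automatic.\<close>

lemma parseval_circle:
  assumes s: "summable (\<lambda>k. norm (c k))"
  shows "(\<lambda>k. (norm (c k))\<^sup>2) sums (\<integral>z. (norm (\<Sum>k. c k * z ^ k))\<^sup>2 \<partial>circle_measure)"
proof -
  define S where "S n z = (\<Sum>k<n. c k * z ^ k)" for n z
  define T where "T z = (\<Sum>k. c k * z ^ k)" for z
  define K where "K = (\<Sum>k. norm (c k))"
  have n: "norm (c k * z ^ k) = norm (c k)" if "norm z = 1" for z k
    using that by (simp add: norm_mult norm_power)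
  have lim: "(\<lambda>n. (norm (S n z))\<^sup>2) \<longlonglongrightarrow> (norm (T z))\<^sup>2" if "norm z = 1" for z
  proof -
    have "summable (\<lambda>k. c k * z ^ k)"
      by (rule summable_norm_cancel) (use s n[OF that] in simp)
    then show ?thesis
      unfolding S_def T_def by (intro tendsto_intros summable_LIMSEQ)
  qed
  have bd: "norm ((norm (S m z))\<^sup>2) \<le> K\<^sup>2" if "norm z = 1" for m z
  proof -
    have "norm (S m z) \<le> (\<Sum>k<m. norm (c k))"
      unfolding S_def by (rule order.trans[OF norm_sum]) (simp add: n[OF that])
    also have "\<dots> \<le> K" unfolding K_def by (intro sum_le_suminf s) auto
    finally show ?thesis by (simp add: power_mono)
  qed
  have mS: "S m \<in> borel_measurable borel" for m
    unfolding S_def by measurable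
  have mT: "T \<in> borel_measurable borel"
    unfolding T_def by (rule borel_measurable_suminf) measurable
  have "(\<lambda>m. \<integral>z. (norm (S m z))\<^sup>2 \<partial>circle_measure) \<longlonglongrightarrow> (\<integral>z. (norm (T z))\<^sup>2 \<partial>circle_measure)"
  proof (rule integral_dominated_convergence[where w="\<lambda>_. K\<^sup>2"], goal_cases)
    case 1 then show ?case
      using borel_measurable_circle_measure[OF mT] by measurable
  next
    case (2 m) then show ?case
      using borel_measurable_circle_measure[OF mS] by measurable
  next
    case 3 then show ?case by simp
  next
    case 4 then show ?case by (intro AE_I2 lim) simp
  next
    case (5 m) then show ?case by (intro AE_I2 bd) simp
  qed
  then show ?thesis
    by (simp only: S_def T_def parseval_circle_finite sums_def)
qed

text \<open>This is the identity behind the Blaschke factor (w - a) / (1 - cnj a w): its modulus is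
  at most 1 on the disc and equal to 1 on the circle.\<close>

lemma norm_reflected_diff:
  fixes a w :: complex
  shows "(norm (1 - cnj a * w))\<^sup>2 - (norm (w - a))\<^sup>2 = (1 - (norm a)\<^sup>2) * (1 - (norm w)\<^sup>2)"
  unfolding cmod_power2 by (simp add: power2_eq_square algebra_simps)

lemma norm_diff_le_reflected:
  fixes a w :: complex
  assumes "norm w \<le> 1" "norm a \<le> 1"
  shows "norm (w - a) \<le> norm (1 - cnj a * w)"
proof (rule power2_le_imp_le)
  have "0 \<le> (1 - (norm a)\<^sup>2) * (1 - (norm w)\<^sup>2)"
    using power_le_one[of "norm a" 2] power_le_one[of "norm w" 2] assms
    by (intro mult_nonneg_nonneg) simp_all
  then show "(norm (w - a))\<^sup>2 \<le> (norm (1 - cnj a * w))\<^sup>2"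
    using norm_reflected_diff[of a w] by linarith
qed simp

lemma norm_diff_eq_reflected:
  fixes a w :: complex
  assumes "norm w = 1"
  shows "norm (w - a) = norm (1 - cnj a * w)"
proof -
  have "(norm (1 - cnj a * w))\<^sup>2 - (norm (w - a))\<^sup>2 = 0"
    unfolding norm_reflected_diff assms by simp
  then have "(norm (w - a))\<^sup>2 = (norm (1 - cnj a * w))\<^sup>2"
    by linarith
  then show ?thesis
    by (rule power2_eq_imp_eq) (rule norm_ge_zero)+
qed

text \<open>Roots inside the disc are reflected in the circle.\<close>

lemma zero_free_majorant:
  fixes P :: "complex poly"
  assumes "P \<noteq> 0"
  obtains Q where "\<And>w. norm w < 1 \<Longrightarrow> poly Q w \<noteq> 0"
    and "\<And>w. norm w = 1 \<Longrightarrow> norm (poly Q w) = norm (poly P w)"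
    and "\<And>w. norm w \<le> 1 \<Longrightarrow> norm (poly P w) \<le> norm (poly Q w)"
proof -
  obtain A where A: "P = smult (lead_coeff P) (\<Prod>x\<in>#A. [:- x, 1:])"
    using alg_closed_imp_factorization[OF assms] by blast
  have "\<exists>Q. (\<forall>w. norm w < 1 \<longrightarrow> poly Q w \<noteq> 0) \<and>
      (\<forall>w. norm w = 1 \<longrightarrow> norm (poly Q w) = norm (poly (smult c (\<Prod>x\<in>#A. [:- x, 1:])) w)) \<and>
      (\<forall>w. norm w \<le> 1 \<longrightarrow> norm (poly (smult c (\<Prod>x\<in>#A. [:- x, 1:])) w) \<le> norm (poly Q w))"
    if "c \<noteq> 0" for c :: complex
  proof (induction A)
    case empty
    show ?case using that by (intro exI[of _ "[:c:]"]) auto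
  next
    case (add a A)
    then obtain Q where Q: "\<And>w. norm w < 1 \<Longrightarrow> poly Q w \<noteq> 0"
      "\<And>w. norm w = 1 \<Longrightarrow> norm (poly Q w) = norm (poly (smult c (\<Prod>x\<in>#A. [:- x, 1:])) w)"
      "\<And>w. norm w \<le> 1 \<Longrightarrow> norm (poly (smult c (\<Prod>x\<in>#A. [:- x, 1:])) w) \<le> norm (poly Q w)"
      by blast
    have e: "norm (poly (smult c (\<Prod>x\<in>#add_mset a A. [:- x, 1:])) w)
        = norm (w - a) * norm (poly (smult c (\<Prod>x\<in>#A. [:- x, 1:])) w)" for w
    proof -
      have "poly (smult c (\<Prod>x\<in>#add_mset a A. [:- x, 1:])) w
          = (w - a) * poly (smult c (\<Prod>x\<in>#A. [:- x, 1:])) w"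
        by (simp add: algebra_simps)
      then show ?thesis by (simp only: norm_mult)
    qed
    show ?case
    proof (cases "norm a < 1")
      case True
      have n: "norm (poly (Q * [:1, - cnj a:]) w) = norm (1 - cnj a * w) * norm (poly Q w)" for w
        unfolding norm_mult[symmetric] by (simp add: algebra_simps)
      show ?thesis
      proof (intro exI[of _ "Q * [:1, - cnj a:]"] conjI allI impI)
        fix w :: complex assume w: "norm w < 1"
        have "norm (cnj a * w) < 1 * 1"
          unfolding norm_mult using True w by (intro mult_strict_mono') auto
        then have "norm (1 - cnj a * w) \<noteq> 0" by auto
        then show "poly (Q * [:1, - cnj a:]) w \<noteq> 0"
          using n[of w] Q(1)[OF w] by (metis mult_eq_0_iff norm_eq_zero)
      next
        fix w :: complex assume w: "norm w = 1"
        show "norm (poly (Q * [:1, - cnj a:]) w) = norm (poly (smult c (\<Prod>x\<in>#add_mset a A. [:- x, 1:])) w)"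
          unfolding n e Q(2)[OF w] norm_diff_eq_reflected[OF w] ..
      next
        fix w :: complex assume w: "norm w \<le> 1"
        show "norm (poly (smult c (\<Prod>x\<in>#add_mset a A. [:- x, 1:])) w) \<le> norm (poly (Q * [:1, - cnj a:]) w)"
          unfolding n e
          by (rule mult_mono[OF norm_diff_le_reflected[OF w less_imp_le[OF True]] Q(3)[OF w] norm_ge_zero norm_ge_zero])
      qed
    next
      case False
      have n: "norm (poly (Q * [:- a, 1:]) w) = norm (w - a) * norm (poly Q w)" for w
        unfolding norm_mult[symmetric] by (simp add: algebra_simps)
      show ?thesis
      proof (intro exI[of _ "Q * [:- a, 1:]"] conjI allI impI)
        fix w :: complex assume w: "norm w < 1"
        then have "w \<noteq> a" using False by blast
        then show "poly (Q * [:- a, 1:]) w \<noteq> 0"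
          using n[of w] Q(1)[OF w] by (metis mult_eq_0_iff norm_eq_zero right_minus_eq)
      next
        fix w :: complex assume w: "norm w = 1"
        show "norm (poly (Q * [:- a, 1:]) w) = norm (poly (smult c (\<Prod>x\<in>#add_mset a A. [:- x, 1:])) w)"
          unfolding n e Q(2)[OF w] ..
      next
        fix w :: complex assume w: "norm w \<le> 1"
        show "norm (poly (smult c (\<Prod>x\<in>#add_mset a A. [:- x, 1:])) w) \<le> norm (poly (Q * [:- a, 1:]) w)"
          unfolding n e by (rule mult_left_mono[OF Q(3)[OF w] norm_ge_zero])
      qed
    qed
  qed
  from this[of "lead_coeff P"] show thesis
    using that assms unfolding A[symmetric] by auto
qed

lemma integrable_circle_poly_powr:
  assumes "p > 0"
  shows "integrable circle_measure (\<lambda>z. norm (poly P (c * z)) powr p)"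
  using assms by (intro integrable_circle_continuous continuous_on_powr' continuous_intros) auto

text \<open>\<open>|P|\<^sup>p\<close> is dominated by \<open>|g|\<^sup>2\<close> for the holomorphic function \<open>g = Q powr (p/2)\<close>, where \<open>Q\<close> is the
  zero-free majorant; Parseval's formula then replaces the subharmonicity of \<open>|P|\<^sup>p\<close>.\<close>

lemma poly_powr_majorant:
  fixes P :: "complex poly"
  assumes p: "p > 0" and P: "P \<noteq> 0"
  obtains g :: "nat \<Rightarrow> complex"
  where "\<And>w. norm w < 1 \<Longrightarrow> summable (\<lambda>n. norm (g n * w ^ n))"
    and "\<And>w. norm w < 1 \<Longrightarrow> norm (poly P w) powr p \<le> (norm (\<Sum>n. g n * w ^ n))\<^sup>2"
    and "\<And>r. 0 \<le> r \<Longrightarrow> r < 1 \<Longrightarrow> (\<integral>z. (norm (\<Sum>n. g n * (of_real r * z) ^ n))\<^sup>2 \<partial>circle_measure)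
            \<le> (\<integral>z. norm (poly P z) powr p \<partial>circle_measure)"
proof -
  obtain Q where Q: "\<And>w. norm w < 1 \<Longrightarrow> poly Q w \<noteq> 0"
    "\<And>w. norm w = 1 \<Longrightarrow> norm (poly Q w) = norm (poly P w)"
    "\<And>w. norm w \<le> 1 \<Longrightarrow> norm (poly P w) \<le> norm (poly Q w)"
    using zero_free_majorant[OF P] by blast
  have "poly Q holomorphic_on ball 0 1" by (intro holomorphic_intros)
  then obtain l where l: "l holomorphic_on ball 0 1" "\<And>x. x \<in> ball 0 1 \<Longrightarrow> exp (l x) = poly Q x"
    using holomorphic_logarithm_exists[of "ball 0 1" "poly Q" 0] Q(1) by auto
  define h where "h w = exp (of_real (p/2) * l w)" for w
  have h: "h holomorphic_on ball 0 1"
    unfolding h_def by (intro holomorphic_intros l)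
  have nh: "(norm (h w))\<^sup>2 = norm (poly Q w) powr p" if "norm w < 1" for w
  proof -
    have "norm (poly Q w) = exp (Re (l w))"
      using l(2)[of w] that by (metis dist_0_norm mem_ball norm_exp_eq_Re)
    then show ?thesis
      by (simp add: h_def powr_def power2_eq_square flip: exp_add)
  qed
  define g where "g n = (deriv ^^ n) h 0 / fact n" for n
  have s: "(\<lambda>n. g n * w ^ n) sums h w" if "norm w < 1" for w
    using holomorphic_power_series[OF h, of w] that by (simp add: g_def)
  have sn: "summable (\<lambda>n. norm (g n * w ^ n))" if w: "norm w < 1" for w
  proof -
    obtain t where t: "norm w < t" "t < 1" using w dense by blast
    have "norm (complex_of_real t) < 1" "norm w < norm (complex_of_real t)"
      using t norm_ge_zero[of w] by (auto simp del: norm_ge_zero)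
    then show ?thesis
      using s[of "of_real t"] by (intro powser_insidea[of g "of_real t"]) (auto simp: sums_iff)
  qed
  have hs: "(\<Sum>n. g n * w ^ n) = h w" if "norm w < 1" for w
    using s[OF that] by (simp add: sums_iff)
  define I where "I r = (\<integral>z. norm (poly Q (of_real r * z)) powr p \<partial>circle_measure)" for r
  have I: "(\<integral>z. (norm (\<Sum>n. g n * (of_real r * z) ^ n))\<^sup>2 \<partial>circle_measure) = I r"
    if "0 \<le> r" "r < 1" for r
    unfolding I_def using that
    by (intro Bochner_Integration.integral_cong refl) (simp add: hs nh norm_mult)
  have sumI: "(\<lambda>n. (norm (g n * of_real r ^ n))\<^sup>2) sums I r" if r: "0 \<le> r" "r < 1" for r
  proof -
    have "summable (\<lambda>n. norm (g n * of_real r ^ n))" using r by (intro sn) auto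
    from parseval_circle[OF this] I[OF r] show ?thesis
      by (simp add: power_mult_distrib mult.assoc)
  qed
  \<comment> \<open>By Parseval the mean is a power series in \<open>r\<close> with nonnegative
    coefficients, so it increases term by term.\<close>
  have mono: "I r \<le> I r'" if "0 \<le> r" "r \<le> r'" "r' < 1" for r r'
    using sumI[of r] sumI[of r'] that
    by (intro sums_le[OF _ sumI sumI])
      (auto simp: norm_mult norm_power intro!: power_mono mult_left_mono)
  \<comment> \<open>\<open>Q\<close> may vanish on the circle, so the power \<open>h\<close> need
    not extend there. The limit towards radius 1 is therefore taken in |Q|^p, which is continuous on
    the closed disc and agrees with |P|^p on the circle.\<close>
  have lim: "(\<lambda>n. I (1 - 1 / real (Suc n))) \<longlonglongrightarrow> (\<integral>z. norm (poly P z) powr p \<partial>circle_measure)"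
  proof -
    have "compact (cball (0::complex) 1)" by simp
    moreover have "continuous_on (cball 0 1) (\<lambda>w. norm (poly Q w) powr p)"
      using p by (intro continuous_on_powr' continuous_intros) auto
    ultimately have "bounded ((\<lambda>w. norm (poly Q w) powr p) ` cball 0 1)"
      by (intro compact_imp_bounded compact_continuous_image)
    then obtain K where K: "\<forall>x\<in>(\<lambda>w. norm (poly Q w) powr p) ` cball 0 1. norm x \<le> K"
      unfolding bounded_iff ..
    have e: "(\<integral>z. norm (poly P z) powr p \<partial>circle_measure) = (\<integral>z. norm (poly Q z) powr p \<partial>circle_measure)"
      by (intro Bochner_Integration.integral_cong refl) (simp add: Q(2))
    show ?thesis
      unfolding e I_def
    proof (rule integral_dominated_convergence[where w="\<lambda>_. K"], goal_cases)
      case 1 show ?case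
        using borel_measurable_integrable[OF integrable_circle_poly_powr[OF p, of Q 1]] by simp
    next
      case (2 n) show ?case
        using integrable_circle_poly_powr[OF p] by (rule borel_measurable_integrable)
    next
      case 3 show ?case by simp
    next
      case 4
      have l: "(\<lambda>n. 1 - 1 / real (Suc n)) \<longlonglongrightarrow> 1 - 0"
        by (intro tendsto_diff tendsto_const LIMSEQ_Suc lim_1_over_n)
      have "(\<lambda>n. norm (poly Q (of_real (1 - 1 / real (Suc n)) * z)) powr p) \<longlonglongrightarrow> norm (poly Q (of_real (1 - 0) * z)) powr p" for z
      proof -
        have "continuous_on UNIV (\<lambda>w. norm (poly Q w) powr p)"
          using p by (intro continuous_on_powr' continuous_intros) auto
        then have "isCont (\<lambda>w. norm (poly Q w) powr p) x" for x
          by (simp add: continuous_on_eq_continuous_at)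
        then show ?thesis
          by (rule isCont_tendsto_compose) (intro tendsto_mult tendsto_of_real l tendsto_const)
      qed
      then show ?case by simp
    next
      case (5 n)
      show ?case
      proof (rule AE_I2)
        fix z assume "z \<in> space circle_measure"
        then have "of_real (1 - 1 / real (Suc n)) * z \<in> cball 0 1"
          by (simp add: norm_mult del: of_real_diff)
        then show "norm (norm (poly Q (of_real (1 - 1 / real (Suc n)) * z)) powr p) \<le> K"
          using K by blast
      qed
    qed
  qed
  have le: "I r \<le> (\<integral>z. norm (poly P z) powr p \<partial>circle_measure)" if r: "0 \<le> r" "r < 1" for r
  proof (rule LIMSEQ_le_const[OF lim])
    obtain N :: nat where N: "1 / (1 - r) < N" using reals_Archimedean2 by blast
    have "I r \<le> I (1 - 1 / real (Suc n))" if "n \<ge> N" for n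
    proof (rule mono)
      have "1 / (1 - r) < real (Suc n)" using N that by linarith
      then show "r \<le> 1 - 1 / real (Suc n)" using r by (simp add: field_simps)
    qed (use r in auto)
    then show "\<exists>N. \<forall>n\<ge>N. I r \<le> I (1 - 1 / real (Suc n))" by blast
  qed
  show thesis
  proof
    show "norm (poly P w) powr p \<le> (norm (\<Sum>n. g n * w ^ n))\<^sup>2" if "norm w < 1" for w
      using that p Q(3)[of w] by (simp add: hs nh powr_mono2)
  qed (auto simp: sn I le)
qed

text \<open>Both sides are compared through the majorant: |P|^p lies below |g|^2 at radius
  \<open>r\<close>, and the means of |g|^2 never exceed the mean of |P|^p on the unit circle. Every
  contraction property of dilations and shifts goes back to this inequality.\<close>

lemma integral_poly_powr_mono:
  fixes P :: "complex poly"
  assumes p: "p > 0" and r: "0 \<le> r" "r \<le> 1"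
  shows "(\<integral>z. norm (poly P (of_real r * z)) powr p \<partial>circle_measure)
       \<le> (\<integral>z. norm (poly P z) powr p \<partial>circle_measure)"
proof (cases "P = 0 \<or> r = 1")
  case True
  then show ?thesis using p by auto
next
  case False
  then have r1: "r < 1" and "P \<noteq> 0" using r by auto
  obtain g where g: "\<And>w. norm w < 1 \<Longrightarrow> summable (\<lambda>n. norm (g n * w ^ n))"
    "\<And>w. norm w < 1 \<Longrightarrow> norm (poly P w) powr p \<le> (norm (\<Sum>n. g n * w ^ n))\<^sup>2"
    "\<And>r. 0 \<le> r \<Longrightarrow> r < 1 \<Longrightarrow> (\<integral>z. (norm (\<Sum>n. g n * (of_real r * z) ^ n))\<^sup>2 \<partial>circle_measure)
            \<le> (\<integral>z. norm (poly P z) powr p \<partial>circle_measure)"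
    using poly_powr_majorant[OF p \<open>P \<noteq> 0\<close>] by blast
  have i: "integrable circle_measure (\<lambda>z. (norm (\<Sum>n. g n * (of_real r * z) ^ n))\<^sup>2)"
  proof (rule circle.integrable_const_bound)
    have s: "summable (\<lambda>n. norm (g n * of_real r ^ n))" using r r1 by (intro g) auto
    show "AE z in circle_measure. norm ((norm (\<Sum>n. g n * (of_real r * z) ^ n))\<^sup>2) \<le> (\<Sum>n. norm (g n * of_real r ^ n))\<^sup>2"
    proof (rule AE_I2)
      fix z assume z: "z \<in> space circle_measure"
      have e: "norm (g n * (of_real r * z) ^ n) = norm (g n * of_real r ^ n)" for n
        using z by (simp add: norm_mult norm_power)
      have "norm (\<Sum>n. g n * (of_real r * z) ^ n) \<le> (\<Sum>n. norm (g n * of_real r ^ n))"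
        using summable_norm[of "\<lambda>n. g n * (of_real r * z) ^ n"] s unfolding e by simp
      then show "norm ((norm (\<Sum>n. g n * (of_real r * z) ^ n))\<^sup>2) \<le> (\<Sum>n. norm (g n * of_real r ^ n))\<^sup>2"
        by (simp add: power_mono)
    qed
    have "(\<lambda>z. \<Sum>n. g n * (of_real r * z) ^ n) \<in> borel_measurable borel"
      by (rule borel_measurable_suminf) measurable
    from borel_measurable_circle_measure[OF this]
    show "(\<lambda>z. (norm (\<Sum>n. g n * (of_real r * z) ^ n))\<^sup>2) \<in> borel_measurable circle_measure"
      by measurable
  qed
  have "(\<integral>z. norm (poly P (of_real r * z)) powr p \<partial>circle_measure)
      \<le> (\<integral>z. (norm (\<Sum>n. g n * (of_real r * z) ^ n))\<^sup>2 \<partial>circle_measure)"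
    using r r1 by (intro integral_mono integrable_circle_poly_powr[OF p] i g(2)) (simp add: norm_mult)
  also have "\<dots> \<le> (\<integral>z. norm (poly P z) powr p \<partial>circle_measure)"
    using r r1 by (intro g(3)) auto
  finally show ?thesis .
qed

text \<open>With \<open>R = sqrt (norm w)\<close> the modulus of \<open>w\<close> splits as
  \<open>R * R\<close>. Parseval at radius \<open>R\<close> bounds each \<open>g n * R ^ n\<close>
  by the square root of the mean, and the second factor \<open>R ^ n\<close> leaves a geometric
  series. The constant depends on the modulus of \<open>w\<close> alone.\<close>

lemma poly_powr_le_integral:
  fixes P :: "complex poly"
  assumes p: "p > 0" and w: "norm w < 1"
  shows "norm (poly P w) powr p \<le>
    (\<integral>z. norm (poly P z) powr p \<partial>circle_measure) / (1 - sqrt (norm w))\<^sup>2"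
proof (cases "P = 0")
  case True
  then show ?thesis using p by simp
next
  case False
  obtain g where g: "\<And>w. norm w < 1 \<Longrightarrow> summable (\<lambda>n. norm (g n * w ^ n))"
    "\<And>w. norm w < 1 \<Longrightarrow> norm (poly P w) powr p \<le> (norm (\<Sum>n. g n * w ^ n))\<^sup>2"
    "\<And>r. 0 \<le> r \<Longrightarrow> r < 1 \<Longrightarrow> (\<integral>z. (norm (\<Sum>n. g n * (of_real r * z) ^ n))\<^sup>2 \<partial>circle_measure)
            \<le> (\<integral>z. norm (poly P z) powr p \<partial>circle_measure)"
    using poly_powr_majorant[OF p False] by blast
  define J where "J = (\<integral>z. norm (poly P z) powr p \<partial>circle_measure)"
  define R where "R = sqrt (norm w)"
  have R: "0 \<le> R" "R < 1" "norm w = R * R" using w by (auto simp: R_def)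
  have "summable (\<lambda>n. norm (g n * of_real R ^ n))" using R by (intro g) auto
  from parseval_circle[OF this]
  have sR: "(\<lambda>n. (norm (g n * of_real R ^ n))\<^sup>2) sums (\<integral>z. (norm (\<Sum>n. g n * (of_real R * z) ^ n))\<^sup>2 \<partial>circle_measure)"
    by (simp add: power_mult_distrib mult.assoc)
  have "(norm (g n * of_real R ^ n))\<^sup>2 \<le> J" for n
  proof -
    have "sum (\<lambda>n. (norm (g n * of_real R ^ n))\<^sup>2) {n} \<le> (\<Sum>n. (norm (g n * of_real R ^ n))\<^sup>2)"
      using sR by (intro sum_le_suminf) (auto simp: sums_iff)
    also have "\<dots> \<le> J" using sR g(3)[of R] R by (simp add: sums_iff J_def)
    finally show ?thesis by simp
  qed
  then have b: "norm (g n * of_real R ^ n) \<le> sqrt J" for n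
    by (metis real_le_rsqrt)
  have J0: "0 \<le> J" unfolding J_def by (simp add: integral_nonneg_AE)
  have "norm (\<Sum>n. g n * w ^ n) \<le> (\<Sum>n. norm (g n * w ^ n))"
    using g(1)[OF w] by (rule summable_norm)
  also have "\<dots> \<le> (\<Sum>n. sqrt J * R ^ n)"
  proof (intro suminf_le g(1)[OF w] summable_mult summable_geometric)
    fix n
    have "norm (g n * w ^ n) = norm (g n * of_real R ^ n) * R ^ n"
      using R by (simp add: norm_mult norm_power power_mult_distrib)
    also have "\<dots> \<le> sqrt J * R ^ n" using b R by (intro mult_right_mono) auto
    finally show "norm (g n * w ^ n) \<le> sqrt J * R ^ n" .
  qed (use R in simp)
  also have "\<dots> = sqrt J / (1 - R)"
    using R by (subst suminf_mult) (auto simp: suminf_geometric summable_geometric)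
  finally have "(norm (\<Sum>n. g n * w ^ n))\<^sup>2 \<le> (sqrt J / (1 - R))\<^sup>2"
    by (intro power_mono) auto
  also have "\<dots> = J / (1 - R)\<^sup>2" using J0 by (simp add: power_divide)
  finally show ?thesis using g(2)[OF w] by (simp add: J_def R_def)
qed

text \<open>For \<open>p < 1\<close> a coefficient cannot be estimated by integrating over the unit
  circle itself. Instead it is a Fourier coefficient on the circle of radius \<open>r\<close>, where
  the supremum is already controlled. The radius stays free: 1/4 gives convenient constants, and
  \<open>r\<close> close to 1 makes the growth in \<open>d\<close> arbitrarily slow. The outer power
  \<open>p\<close> of the denominator prepares for taking \<open>p\<close>-th roots.\<close>

lemma coeff_powr_le_integral:
  fixes P :: "complex poly"
  assumes p: "p > 0" and r: "0 < r" "r < 1"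
  shows "norm (coeff P d) powr p \<le>
    (\<integral>z. norm (poly P z) powr p \<partial>circle_measure) / (r ^ d * (1 - sqrt r) powr (2/p)) powr p"
proof -
  define J where "J = (\<integral>z. norm (poly P z) powr p \<partial>circle_measure)"
  have J0: "0 \<le> J" unfolding J_def by (simp add: integral_nonneg_AE)
  define B where "B = (J / (1 - sqrt r)\<^sup>2) powr (1/p)"
  have sr: "sqrt r < 1" using r by simp
  have le: "norm (poly P (of_real r * z)) \<le> B" if "norm z = 1" for z
  proof -
    have "norm (poly P (of_real r * z)) powr p \<le> J / (1 - sqrt r)\<^sup>2"
      using poly_powr_le_integral[OF p, of "of_real r * z" P] that r by (simp add: norm_mult J_def)
    then have "(norm (poly P (of_real r * z)) powr p) powr (1/p) \<le> B"
      unfolding B_def using p by (intro powr_mono2) auto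
    then show ?thesis using p by (simp add: powr_powr)
  qed
  have i: "integrable circle_measure (\<lambda>z. z ^ k * cnj z ^ d)" for k
    by (intro integrable_circle_continuous continuous_intros)
  have "(\<integral>z. poly P (of_real r * z) * cnj z ^ d \<partial>circle_measure)
      = (\<integral>z. (\<Sum>k\<le>degree P. (coeff P k * of_real r ^ k) * (z ^ k * cnj z ^ d)) \<partial>circle_measure)"
    by (intro Bochner_Integration.integral_cong refl)
      (simp add: poly_altdef sum_distrib_left sum_distrib_right power_mult_distrib mult_ac)
  also have "\<dots> = (\<Sum>k\<le>degree P. (\<integral>z. (coeff P k * of_real r ^ k) * (z ^ k * cnj z ^ d) \<partial>circle_measure))"
    by (intro Bochner_Integration.integral_sum integrable_mult_right i)
  also have "\<dots> = (\<Sum>k\<le>degree P. if k = d then coeff P k * of_real r ^ k else 0)"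
    by (intro sum.cong refl) (simp add: integral_circle_power_cnj)
  also have "\<dots> = coeff P d * of_real r ^ d"
    by (simp add: coeff_eq_0)
  finally have "norm (coeff P d * of_real r ^ d) = norm (\<integral>z. poly P (of_real r * z) * cnj z ^ d \<partial>circle_measure)"
    by simp
  also have "\<dots> \<le> (\<integral>z. B \<partial>circle_measure)"
    by (rule order.trans[OF integral_norm_bound], intro integral_mono integrable_circle_continuous continuous_intros)
      (simp add: norm_mult norm_power le)
  also have "\<dots> = B" using circle.prob_space by simp
  finally have "norm (coeff P d) * r ^ d \<le> B" using r by (simp add: norm_mult norm_power)
  then have "(norm (coeff P d) * r ^ d) powr p \<le> B powr p"
    using r p by (intro powr_mono2) auto
  also have "B powr p = J / (1 - sqrt r)\<^sup>2" using p J0 by (simp add: B_def powr_powr)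
  finally have "norm (coeff P d) powr p * (r ^ d) powr p \<le> J / (1 - sqrt r)\<^sup>2"
    using r by (simp add: powr_mult)
  moreover have "(r ^ d * (1 - sqrt r) powr (2/p)) powr p = (r ^ d) powr p * (1 - sqrt r)\<^sup>2"
    using r p sr by (simp add: powr_mult powr_powr)
  ultimately show ?thesis
    using r sr by (simp add: field_simps J_def)
qed

section \<open>Bohr lifts on the infinite torus\<close>

lemma infinite_primes_set: "infinite {p::nat. prime p}"
  using primes_infinite by simp

lemma prime_nth_prime [simp]: "prime (nth_prime j)"
  unfolding nth_prime_def using enumerate_in_set[OF infinite_primes_set] by auto

lemma nth_prime_pos [simp]: "nth_prime j > 0"
  by (simp add: prime_gt_0_nat)

lemma le_nth_prime: "j \<le> nth_prime j"
  unfolding nth_prime_def by (rule le_enumerate[OF infinite_primes_set])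

lemma nth_prime_less_iff [simp]: "nth_prime i < nth_prime j \<longleftrightarrow> i < j"
  unfolding nth_prime_def by (rule enumerate_mono_iff[OF infinite_primes_set])

lemma nth_prime_eq_iff [simp]: "nth_prime i = nth_prime j \<longleftrightarrow> i = j"
  by (metis nth_prime_less_iff less_irrefl linorder_neqE_nat)

lemma nth_prime_surj: "prime p \<Longrightarrow> \<exists>j. nth_prime j = p"
  unfolding nth_prime_def using enumerate_Ex[OF infinite_primes_set, of p] by auto

abbreviation expo :: "nat \<Rightarrow> nat \<Rightarrow> nat" where
  "expo j n \<equiv> multiplicity (nth_prime j) n"

lemma expo_mult: "0 < m \<Longrightarrow> 0 < n \<Longrightarrow> expo j (m * n) = expo j m + expo j n"
  by (rule prime_elem_multiplicity_mult_distrib) auto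

lemma expo_eq_0: "n < j \<Longrightarrow> expo j n = 0"
proof (cases "n = 0")
  case False
  assume "n < j"
  then have "n < nth_prime j" using le_nth_prime[of j] by simp
  then have "\<not> nth_prime j dvd n" using False by (auto dest: dvd_imp_le)
  then show ?thesis by (rule not_dvd_imp_multiplicity_0)
qed simp

lemma expo_nth_prime: "expo j (nth_prime i) = (if i = j then 1 else 0)"
proof (cases "i = j")
  case False
  then have "\<not> nth_prime j dvd nth_prime i"
    using primes_dvd_imp_eq[OF prime_nth_prime prime_nth_prime, of j i] by auto
  then show ?thesis using False by (simp add: not_dvd_imp_multiplicity_0)
qed simp

lemma eq_of_expo_eq:
  assumes "0 < m" "0 < n" "\<And>j. expo j m = expo j n"
  shows "m = n"
proof (rule multiplicity_eq_nat[OF assms(1,2)])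
  fix p :: nat assume "prime p"
  then obtain j where "nth_prime j = p" using nth_prime_surj by blast
  then show "multiplicity p m = multiplicity p n" using assms(3)[of j] by simp
qed

text \<open>A common index range for all \<open>n \<le> N\<close> allows monomials to be multiplied
  factor by factor.\<close>

lemma bohr_monom_altdef:
  assumes "0 < n" "n \<le> N"
  shows "bohr_monom n z = (\<Prod>j\<le>N. z j ^ expo j n)"
  unfolding bohr_monom_def
proof (rule prod.mono_neutral_left)
  show "{j. nth_prime j dvd n} \<subseteq> {..N}"
  proof
    fix j assume "j \<in> {j. nth_prime j dvd n}"
    then have "nth_prime j \<le> n" using assms by (auto dest: dvd_imp_le)
    then show "j \<in> {..N}" using le_nth_prime[of j] assms by simp
  qed
qed (auto simp: not_dvd_imp_multiplicity_0)

lemma bohr_monom_1 [simp]: "bohr_monom 1 z = 1" "bohr_monom (Suc 0) z = 1"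
  using bohr_monom_altdef[of 1 1 z] by simp_all

lemma bohr_monom_mult: "0 < m \<Longrightarrow> 0 < n \<Longrightarrow> bohr_monom (m * n) z = bohr_monom m z * bohr_monom n z"
  by (simp add: bohr_monom_altdef[of _ "m * n"] expo_mult power_add prod.distrib)

lemma bohr_monom_nth_prime: "bohr_monom (nth_prime i) z = z i"
proof -
  have "bohr_monom (nth_prime i) z = (\<Prod>j\<le>nth_prime i. z j ^ expo j (nth_prime i))"
    by (rule bohr_monom_altdef) simp_all
  also have "\<dots> = (\<Prod>j\<le>nth_prime i. if i = j then z j else 1)"
    by (intro prod.cong refl) (simp add: expo_nth_prime)
  also have "\<dots> = z i" using le_nth_prime[of i] by simp
  finally show ?thesis .
qed

lemma norm_bohr_monom: "0 < n \<Longrightarrow> (\<And>j. norm (z j) = 1) \<Longrightarrow> norm (bohr_monom n z) = 1"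
  by (simp add: bohr_monom_altdef[of n n] norm_power norm_mult flip: prod_norm)

text \<open>The degree of the monomial of \<open>n\<close> when \<open>z j\<close> has weight
  \<open>k j\<close>. Constant weight 1 counts prime factors with multiplicity, a unit vector reads
  off one exponent, and the indicator of a set of variables detects their presence. Stopping at
  \<open>n\<close> loses nothing because larger primes do not divide \<open>n\<close>.\<close>

definition wt :: "(nat \<Rightarrow> nat) \<Rightarrow> nat \<Rightarrow> nat" where
  "wt k n = (\<Sum>j\<le>n. k j * expo j n)"

lemma wt_altdef: "n \<le> N \<Longrightarrow> wt k n = (\<Sum>j\<le>N. k j * expo j n)"
  unfolding wt_def by (rule sum.mono_neutral_left) (auto simp: expo_eq_0)

lemma wt_mult: "0 < m \<Longrightarrow> 0 < n \<Longrightarrow> wt k (m * n) = wt k m + wt k n"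
  by (simp add: wt_altdef[of _ "m * n"] expo_mult algebra_simps sum.distrib)

lemma wt_1 [simp]: "wt k 1 = 0" "wt k (Suc 0) = 0"
  by (simp_all add: wt_def)

lemma wt_single: "wt (\<lambda>i. if i = j then 1 else 0) n = expo j n"
proof -
  have "wt (\<lambda>i. if i = j then 1 else 0) n = (\<Sum>i\<le>max j n. (if i = j then 1 else 0) * expo i n)"
    by (rule wt_altdef) simp
  also have "\<dots> = (\<Sum>i\<le>max j n. if i = j then expo i n else 0)"
    by (intro sum.cong refl) simp
  finally show ?thesis by simp
qed

lemma wt_eq_0_iff: "wt k n = 0 \<longleftrightarrow> (\<forall>j. k j = 0 \<or> expo j n = 0)"
proof -
  have "wt k n = 0 \<longleftrightarrow> (\<forall>j\<le>n. k j = 0 \<or> expo j n = 0)"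
    unfolding wt_def by (simp add: Ball_def)
  moreover have "k j = 0 \<or> expo j n = 0" if "\<forall>j\<le>n. k j = 0 \<or> expo j n = 0" for j
    using that expo_eq_0[of n j] by (cases "j \<le> n") simp_all
  ultimately show ?thesis by metis
qed

definition rot :: "(nat \<Rightarrow> nat) \<Rightarrow> complex \<Rightarrow> (nat \<Rightarrow> complex) \<Rightarrow> nat \<Rightarrow> complex" where
  "rot k w z = (\<lambda>j. w ^ k j * z j)"

lemma bohr_monom_rot: "0 < n \<Longrightarrow> bohr_monom n (rot k w z) = w ^ wt k n * bohr_monom n z"
  by (simp add: bohr_monom_altdef[of n n] wt_def rot_def power_mult_distrib prod.distrib power_sum flip: power_mult)

interpretation torus: prob_space torus_measure
  unfolding torus_measure_def by (intro prob_space_PiM prob_space_circle_measure)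

lemma norm_torus: "z \<in> space torus_measure \<Longrightarrow> norm (z j) = 1"
  by (auto simp: torus_measure_def space_PiM PiE_iff)

lemma measurable_torus_coord: "(\<lambda>z. z j) \<in> torus_measure \<rightarrow>\<^sub>M circle_measure"
  unfolding torus_measure_def by (rule measurable_component_singleton) simp

lemma measurable_torus_coord_borel [measurable]: "(\<lambda>z. z j) \<in> borel_measurable torus_measure"
  using measurable_compose[OF measurable_torus_coord measurable_circle_measure] .

lemma measurable_into_torus:
  assumes "\<And>j. (\<lambda>x. f x j) \<in> borel_measurable M" and "\<And>x j. x \<in> space M \<Longrightarrow> norm (f x j) = 1"
  shows "f \<in> M \<rightarrow>\<^sub>M torus_measure"
  unfolding torus_measure_def
  by (rule measurable_PiM_single') (auto intro!: measurable_into_circle_measure assms simp: assms)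

lemma indep_torus_coord: "torus.indep_vars (\<lambda>_. circle_measure) (\<lambda>j z. z j) UNIV"
proof -
  have "distr torus_measure (Pi\<^sub>M UNIV (\<lambda>_. circle_measure)) (\<lambda>z. \<lambda>j\<in>UNIV. z j)
      = distr torus_measure torus_measure (\<lambda>z. z)"
    unfolding torus_measure_def restrict_UNIV ..
  also have "\<dots> = torus_measure" by (rule distr_id)
  also have "\<dots> = Pi\<^sub>M UNIV (\<lambda>j. distr torus_measure circle_measure (\<lambda>z. z j))"
    unfolding torus_measure_def
    by (subst distr_PiM_component) (auto intro: prob_space_circle_measure)
  finally show ?thesis
    by (subst torus.indep_vars_iff_distr_eq_PiM') (auto intro: measurable_torus_coord)
qed

lemma distr_torus_coord: "distr torus_measure circle_measure (\<lambda>z. z j) = circle_measure"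
  unfolding torus_measure_def
  by (subst distr_PiM_component) (auto intro: prob_space_circle_measure)

lemma integral_torus_coord:
  fixes f :: "complex \<Rightarrow> 'a::{banach,second_countable_topology}"
  assumes "f \<in> borel_measurable circle_measure"
  shows "(\<integral>z. f (z j) \<partial>torus_measure) = (\<integral>w. f w \<partial>circle_measure)"
  using integral_distr[OF measurable_torus_coord[of j] assms] by (simp add: distr_torus_coord)

text \<open>The rotated coordinates are still independent and keep their distribution, and these two
  facts characterise the product measure.\<close>

lemma distr_torus_rot:
  assumes w: "norm w = 1"
  shows "distr torus_measure torus_measure (rot k w) = torus_measure"
proof -
  have m: "(\<lambda>z. w ^ k j * z) \<in> circle_measure \<rightarrow>\<^sub>M circle_measure" for j
    using w by (intro measurable_into_circle_measure)
      (auto intro!: borel_measurable_circle_measure simp: norm_mult norm_power)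
  have mj: "(\<lambda>z. w ^ k j * z j) \<in> torus_measure \<rightarrow>\<^sub>M circle_measure" for j
    by (rule measurable_compose[OF measurable_torus_coord m])
  have ind: "torus.indep_vars (\<lambda>_. circle_measure) (\<lambda>j z. w ^ k j * z j) UNIV"
    by (rule torus.indep_vars_compose2[OF indep_torus_coord m])
  have "distr torus_measure circle_measure (\<lambda>z. w ^ k j * z j) = circle_measure" for j
  proof -
    have "distr torus_measure circle_measure (\<lambda>z. w ^ k j * z j)
       = distr (distr torus_measure circle_measure (\<lambda>z. z j)) circle_measure (\<lambda>z. w ^ k j * z)"
      by (subst distr_distr[OF m measurable_torus_coord]) (simp add: comp_def)
    also have "\<dots> = circle_measure"
      unfolding distr_torus_coord using w by (intro distr_circle_rotate) (simp add: norm_power)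
    finally show ?thesis .
  qed
  moreover have "distr torus_measure (Pi\<^sub>M UNIV (\<lambda>_. circle_measure)) (\<lambda>z. \<lambda>j\<in>UNIV. w ^ k j * z j)
      = Pi\<^sub>M UNIV (\<lambda>j. distr torus_measure circle_measure (\<lambda>z. w ^ k j * z j))"
    using ind by (subst (asm) torus.indep_vars_iff_distr_eq_PiM') (auto intro: mj)
  moreover have "(\<lambda>z. \<lambda>j\<in>UNIV. w ^ k j * z j) = rot k w"
    by (simp add: rot_def fun_eq_iff)
  ultimately show ?thesis by (simp add: torus_measure_def)
qed

lemma measurable_bohr_monom [measurable]: "bohr_monom n \<in> borel_measurable torus_measure"
  unfolding bohr_monom_def by measurable

lemma measurable_bohr_lift [measurable]: "bohr_lift a \<in> borel_measurable torus_measure"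
  unfolding bohr_lift_def by measurable

lemma dirichlet_polysD: "a \<in> dirichlet_polys \<Longrightarrow> a 0 = 0" "a \<in> dirichlet_polys \<Longrightarrow> finite {n. a n \<noteq> 0}"
  by (auto simp: dirichlet_polys_def)

lemma dirichlet_polys_multiplier:
  assumes "a \<in> dirichlet_polys" shows "(\<lambda>n. m n * a n) \<in> dirichlet_polys"
proof -
  have "finite {n. m n * a n \<noteq> 0}"
    by (rule finite_subset[OF _ dirichlet_polysD(2)[OF assms]]) auto
  then show ?thesis using dirichlet_polysD(1)[OF assms] by (simp add: dirichlet_polys_def)
qed

lemma bohr_lift_altdef:
  assumes "finite A" "{n. a n \<noteq> 0} \<subseteq> A"
  shows "bohr_lift a z = (\<Sum>n\<in>A. a n * bohr_monom n z)"
  unfolding bohr_lift_def by (rule sum.mono_neutral_left) (use assms in auto)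

lemma norm_bohr_lift_le:
  assumes "a \<in> dirichlet_polys" "z \<in> space torus_measure"
  shows "norm (bohr_lift a z) \<le> (\<Sum>n | a n \<noteq> 0. norm (a n))"
  unfolding bohr_lift_def
proof (rule order.trans[OF norm_sum], rule sum_mono)
  fix n assume "n \<in> {n. a n \<noteq> 0}"
  then have "0 < n" using dirichlet_polysD(1)[OF assms(1)] by (cases n) auto
  then show "norm (a n * bohr_monom n z) \<le> norm (a n)"
    using norm_torus[OF assms(2)] by (simp add: norm_mult norm_bohr_monom)
qed

text \<open>The \<open>p\<close>-th power of the Hardy norm. Without the outer root, pointwise
  inequalities can be integrated directly, for \<open>p\<close> below 1 as well.\<close>

definition HP :: "real \<Rightarrow> (nat \<Rightarrow> complex) \<Rightarrow> real" where
  "HP p a = (\<integral>z. norm (bohr_lift a z) powr p \<partial>torus_measure)"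

lemma HP_nonneg: "0 \<le> HP p a"
  unfolding HP_def by (intro integral_nonneg_AE AE_I2) simp

lemma integrable_HP:
  assumes "a \<in> dirichlet_polys" "p > 0"
  shows "integrable torus_measure (\<lambda>z. norm (bohr_lift a z) powr p)"
proof (rule torus.integrable_const_bound)
  show "AE z in torus_measure. norm (norm (bohr_lift a z) powr p) \<le> (\<Sum>n | a n \<noteq> 0. norm (a n)) powr p"
  proof (rule AE_I2)
    fix z assume "z \<in> space torus_measure"
    from norm_bohr_lift_le[OF assms(1) this] assms(2)
    show "norm (norm (bohr_lift a z) powr p) \<le> (\<Sum>n | a n \<noteq> 0. norm (a n)) powr p"
      by (simp add: powr_mono2)
  qed
qed measurable

text \<open>The Bohr lift along the orbit of \<open>z\<close> under \<open>rot k\<close>, as a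
  polynomial in the rotation parameter. Its coefficients at \<open>z\<close> are the homogeneous
  parts for the weight \<open>k\<close>.\<close>

definition rot_poly :: "(nat \<Rightarrow> nat) \<Rightarrow> (nat \<Rightarrow> complex) \<Rightarrow> (nat \<Rightarrow> complex) \<Rightarrow> complex poly" where
  "rot_poly k a z = (\<Sum>n | a n \<noteq> 0. monom (a n * bohr_monom n z) (wt k n))"

text \<open>The radius \<open>r\<close> and the rotation \<open>w\<close> are kept apart:
  \<open>w\<close> moves the point on the torus, whereas \<open>r\<close>, which may be less than 1,
  can only act on the coefficients.\<close>

lemma poly_rot_poly:
  assumes "a \<in> dirichlet_polys"
  shows "poly (rot_poly k a z) (r * w) = bohr_lift (\<lambda>n. r ^ wt k n * a n) (rot k w z)"
proof -
  have "bohr_lift (\<lambda>n. r ^ wt k n * a n) (rot k w z)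
      = (\<Sum>n | a n \<noteq> 0. r ^ wt k n * a n * bohr_monom n (rot k w z))"
    by (rule bohr_lift_altdef) (use dirichlet_polysD[OF assms] in auto)
  also have "\<dots> = (\<Sum>n | a n \<noteq> 0. poly (monom (a n * bohr_monom n z) (wt k n)) (r * w))"
  proof (rule sum.cong)
    fix n assume "n \<in> {n. a n \<noteq> 0}"
    then have "0 < n" using dirichlet_polysD(1)[OF assms] by (cases n) auto
    then show "r ^ wt k n * a n * bohr_monom n (rot k w z) = poly (monom (a n * bohr_monom n z) (wt k n)) (r * w)"
      by (simp add: bohr_monom_rot poly_monom power_mult_distrib mult_ac)
  qed simp
  finally show ?thesis by (simp add: rot_poly_def poly_sum)
qed

lemma coeff_rot_poly:
  assumes "a \<in> dirichlet_polys"
  shows "coeff (rot_poly k a z) d = bohr_lift (\<lambda>n. of_bool (wt k n = d) * a n) z"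
proof -
  have "bohr_lift (\<lambda>n. of_bool (wt k n = d) * a n) z
      = (\<Sum>n | a n \<noteq> 0. of_bool (wt k n = d) * a n * bohr_monom n z)"
    by (rule bohr_lift_altdef) (use dirichlet_polysD[OF assms] in auto)
  then show ?thesis by (simp add: rot_poly_def coeff_sum coeff_monom) (auto intro!: sum.cong)
qed

text \<open>By rotation invariance and Fubini, the mean over the torus is the mean of the circle
  means over the orbits. Any one-variable inequality that holds on each orbit thus passes to
  infinitely many variables with the same constant.\<close>

lemma
  assumes a: "a \<in> dirichlet_polys" and p: "p > 0"
  shows HP_rot: "HP p a = (\<integral>z. (\<integral>w. norm (poly (rot_poly k a z) w) powr p \<partial>circle_measure) \<partial>torus_measure)"
    and integrable_HP_rot:
      "integrable torus_measure (\<lambda>z. \<integral>w. norm (poly (rot_poly k a z) w) powr p \<partial>circle_measure)"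
proof -
  interpret P: pair_prob_space circle_measure torus_measure ..
  interpret Q: pair_prob_space torus_measure circle_measure ..
  define G where "G z = norm (bohr_lift a z) powr p" for z
  have G[measurable]: "G \<in> borel_measurable torus_measure" unfolding G_def by measurable
  have mrot[measurable]: "(\<lambda>(z, w). rot k w z) \<in> torus_measure \<Otimes>\<^sub>M circle_measure \<rightarrow>\<^sub>M torus_measure"
  proof (rule measurable_into_torus)
    fix j show "(\<lambda>x. (case x of (z, w) \<Rightarrow> rot k w z) j) \<in> borel_measurable (torus_measure \<Otimes>\<^sub>M circle_measure)"
      unfolding rot_def split_beta by measurable
  qed (auto simp: rot_def norm_mult norm_power norm_torus space_pair_measure)
  have e: "norm (poly (rot_poly k a z) w) powr p = G (rot k w z)" for z w
    using poly_rot_poly[OF a, of k z 1 w] by (simp add: G_def)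
  have i: "integrable (torus_measure \<Otimes>\<^sub>M circle_measure) (\<lambda>(z, w). G (rot k w z))"
  proof (rule Q.P.integrable_const_bound)
    show "AE x in torus_measure \<Otimes>\<^sub>M circle_measure. norm (case x of (z, w) \<Rightarrow> G (rot k w z)) \<le> (\<Sum>n | a n \<noteq> 0. norm (a n)) powr p"
    proof (rule AE_I2)
      fix x assume "x \<in> space (torus_measure \<Otimes>\<^sub>M circle_measure)"
      then have "(case x of (z, w) \<Rightarrow> rot k w z) \<in> space torus_measure"
        by (rule measurable_space[OF mrot])
      then show "norm (case x of (z, w) \<Rightarrow> G (rot k w z)) \<le> (\<Sum>n | a n \<noteq> 0. norm (a n)) powr p"
        using norm_bohr_lift_le[OF a] p by (auto simp: G_def split_beta intro!: powr_mono2)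
    qed
    have "(\<lambda>x. G (case x of (z, w) \<Rightarrow> rot k w z)) \<in> borel_measurable (torus_measure \<Otimes>\<^sub>M circle_measure)"
      by measurable
    then show "(\<lambda>(z, w). G (rot k w z)) \<in> borel_measurable (torus_measure \<Otimes>\<^sub>M circle_measure)"
      by (simp add: split_beta)
  qed
  have "(\<integral>z. (\<integral>w. G (rot k w z) \<partial>circle_measure) \<partial>torus_measure)
      = (\<integral>w. (\<integral>z. G (rot k w z) \<partial>torus_measure) \<partial>circle_measure)"
    using Q.Fubini_integral[OF i] by simp
  also have "\<dots> = (\<integral>w. (\<integral>z. G z \<partial>torus_measure) \<partial>circle_measure)"
  proof (rule Bochner_Integration.integral_cong)
    fix w assume "w \<in> space circle_measure"
    then have w: "norm w = 1" by simp
    have "rot k w \<in> torus_measure \<rightarrow>\<^sub>M torus_measure"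
      by (rule measurable_into_torus) (auto simp: rot_def norm_mult norm_power norm_torus w)
    from integral_distr[OF this G] show "(\<integral>z. G (rot k w z) \<partial>torus_measure) = (\<integral>z. G z \<partial>torus_measure)"
      unfolding distr_torus_rot[OF w] by simp
  qed simp
  also have "\<dots> = HP p a"
    using circle.prob_space by (simp add: HP_def G_def)
  finally show "HP p a = (\<integral>z. (\<integral>w. norm (poly (rot_poly k a z) w) powr p \<partial>circle_measure) \<partial>torus_measure)"
    unfolding e by simp
  show "integrable torus_measure (\<lambda>z. \<integral>w. norm (poly (rot_poly k a z) w) powr p \<partial>circle_measure)"
    unfolding e using Q.integrable_fst[OF i] by simp
qed

text \<open>This is \<open>integral_poly_powr_mono\<close> on every orbit. The value
  \<open>r = 0\<close> is included on purpose: with \<open>0 ^ 0 = 1\<close> it is the projection to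
  weight 0, that is, setting all variables of positive weight to zero.\<close>

lemma HP_dilate_le:
  assumes a: "a \<in> dirichlet_polys" and p: "p > 0" and r: "0 \<le> r" "r \<le> 1"
  shows "HP p (\<lambda>n. of_real r ^ wt k n * a n) \<le> HP p a"
proof -
  define b where "b = (\<lambda>n. complex_of_real r ^ wt k n * a n)"
  have b: "b \<in> dirichlet_polys" unfolding b_def by (rule dirichlet_polys_multiplier[OF a])
  have e: "poly (rot_poly k b z) w = poly (rot_poly k a z) (of_real r * w)" for z w
    using poly_rot_poly[OF b, of k z 1 w] poly_rot_poly[OF a, of k z "of_real r" w] by (simp add: b_def)
  have "HP p b \<le> HP p a"
    unfolding HP_rot[OF b p, of k] HP_rot[OF a p, of k]
  proof (rule integral_mono[OF integrable_HP_rot[OF b p] integrable_HP_rot[OF a p]])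
    fix z
    show "(\<integral>w. norm (poly (rot_poly k b z) w) powr p \<partial>circle_measure)
        \<le> (\<integral>w. norm (poly (rot_poly k a z) w) powr p \<partial>circle_measure)"
      unfolding e by (rule integral_poly_powr_mono[OF p r])
  qed
  then show ?thesis by (simp add: b_def)
qed

lemma HP_coeff_le:
  assumes a: "a \<in> dirichlet_polys" and p: "p > 0" and r: "0 < r" "r < 1"
  shows "HP p (\<lambda>n. of_bool (wt k n = d) * a n) \<le> HP p a / (r ^ d * (1 - sqrt r) powr (2/p)) powr p"
proof -
  define C where "C = (r ^ d * (1 - sqrt r) powr (2/p)) powr p"
  define b where "b = (\<lambda>n. of_bool (wt k n = d) * a n)"
  have b: "b \<in> dirichlet_polys" unfolding b_def by (rule dirichlet_polys_multiplier[OF a])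
  have "HP p b \<le> (\<integral>z. (\<integral>w. norm (poly (rot_poly k a z) w) powr p \<partial>circle_measure) / C \<partial>torus_measure)"
    unfolding HP_def
  proof (rule integral_mono[OF integrable_HP[OF b p] integrable_divide[OF integrable_HP_rot[OF a p]]])
    fix z
    show "norm (bohr_lift b z) powr p \<le> (\<integral>w. norm (poly (rot_poly k a z) w) powr p \<partial>circle_measure) / C"
      unfolding b_def C_def coeff_rot_poly[OF a, symmetric] by (rule coeff_powr_le_integral[OF p r])
  qed
  also have "\<dots> = HP p a / C" by (simp add: HP_rot[OF a p, of k])
  finally show ?thesis by (simp add: b_def C_def)
qed

section \<open>The Bergman norm of Dirichlet polynomials\<close>

lemma nn_integral_powr_exp:
  fixes s b :: real
  assumes s: "s > 0" and b: "b > 0"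
  shows "(\<integral>\<^sup>+t. ennreal (indicator {0<..} t * (t powr (s - 1) * exp (- b * t))) \<partial>lborel)
    = ennreal (Gamma s / b powr s)"
proof -
  let ?f = "\<lambda>t. ennreal (indicator {0..} t * t powr (s - 1) / exp t)"
  have e: "?f (0 + b * t) = ennreal (b powr (s - 1)) * ennreal (indicator {0<..} t * (t powr (s - 1) * exp (- b * t)))" for t
  proof (cases "t > 0")
    case True
    then show ?thesis using b
      by (simp add: powr_mult exp_minus ennreal_mult'[symmetric] field_simps zero_le_mult_iff)
  next
    case False
    then show ?thesis using b by (auto simp: indicator_def zero_le_mult_iff)
  qed
  have "ennreal (Gamma s) = ennreal b * (\<integral>\<^sup>+t. ?f (0 + b * t) \<partial>lborel)"
    unfolding Gamma_conv_nn_integral_real[OF s] using b by (subst nn_integral_real_affine[of _ b 0]) auto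
  also have "\<dots> = ennreal b * (ennreal (b powr (s - 1)) *
      (\<integral>\<^sup>+t. ennreal (indicator {0<..} t * (t powr (s - 1) * exp (- b * t))) \<partial>lborel))"
    unfolding e by (subst nn_integral_cmult) auto
  also have "\<dots> = ennreal (b powr s) *
      (\<integral>\<^sup>+t. ennreal (indicator {0<..} t * (t powr (s - 1) * exp (- b * t))) \<partial>lborel)"
  proof -
    have "b * b powr (s - 1) = b powr s" using b by (simp add: powr_diff)
    then have "ennreal b * ennreal (b powr (s - 1)) = ennreal (b powr s)"
      using b by (simp flip: ennreal_mult')
    then show ?thesis by (simp add: mult.assoc[symmetric])
  qed
  finally have *: "ennreal (b powr s) *
      (\<integral>\<^sup>+t. ennreal (indicator {0<..} t * (t powr (s - 1) * exp (- b * t))) \<partial>lborel) = ennreal (Gamma s)" ..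
  have bs: "b powr s > 0" using b by simp
  let ?I = "(\<integral>\<^sup>+t. ennreal (indicator {0<..} t * (t powr (s - 1) * exp (- b * t))) \<partial>lborel)"
  have "?I = ennreal (1 / b powr s) * (ennreal (b powr s) * ?I)"
    using b bs by (simp add: mult.assoc[symmetric] ennreal_mult'[symmetric] del: powr_gt_zero)
  also have "\<dots> = ennreal (Gamma s / b powr s)"
    unfolding * using b bs by (simp add: ennreal_mult'[symmetric] del: powr_gt_zero)
  finally show ?thesis .
qed

definition mu_density :: "real \<Rightarrow> real \<Rightarrow> real" where
  "mu_density \<alpha> \<sigma> = indicator {0<..} \<sigma> * (2 powr (\<alpha>+1) / Gamma (\<alpha>+1) * \<sigma> powr \<alpha> * exp (-2*\<sigma>))"

lemma mu_measure_altdef: "mu_measure \<alpha> = density lborel (\<lambda>\<sigma>. ennreal (mu_density \<alpha> \<sigma>))"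
  by (simp add: mu_measure_def mu_density_def)

lemma measurable_mu_density [measurable]: "mu_density \<alpha> \<in> borel_measurable borel"
  unfolding mu_density_def by measurable

lemma sets_mu_measure [simp, measurable_cong]: "sets (mu_measure \<alpha>) = sets borel"
  and space_mu_measure [simp]: "space (mu_measure \<alpha>) = UNIV"
  by (simp_all add: mu_measure_def)

lemma mu_density_nonneg: "\<alpha> > -1 \<Longrightarrow> 0 \<le> mu_density \<alpha> \<sigma>"
  unfolding mu_density_def using Gamma_real_pos[of "\<alpha>+1"] by (intro mult_nonneg_nonneg divide_nonneg_nonneg) auto

lemma prob_space_mu_measure:
  assumes "\<alpha> > -1"
  shows "prob_space (mu_measure \<alpha>)"
proof
  have G: "Gamma (\<alpha>+1) > 0" using assms by (intro Gamma_real_pos) simp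
  have e: "ennreal (mu_density \<alpha> \<sigma>) = ennreal (2 powr (\<alpha>+1) / Gamma (\<alpha>+1)) *
      ennreal (indicator {0<..} \<sigma> * (\<sigma> powr (\<alpha> + 1 - 1) * exp (- 2 * \<sigma>)))" for \<sigma>
    using G by (subst ennreal_mult'[symmetric]) (auto simp: mu_density_def indicator_def)
  have "emeasure (mu_measure \<alpha>) (space (mu_measure \<alpha>)) = (\<integral>\<^sup>+\<sigma>. ennreal (mu_density \<alpha> \<sigma>) \<partial>lborel)"
    by (simp add: mu_measure_altdef emeasure_density)
  also have "\<dots> = ennreal (2 powr (\<alpha>+1) / Gamma (\<alpha>+1)) *
      (\<integral>\<^sup>+\<sigma>. ennreal (indicator {0<..} \<sigma> * (\<sigma> powr (\<alpha> + 1 - 1) * exp (- 2 * \<sigma>))) \<partial>lborel)"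
    unfolding e by (rule nn_integral_cmult) measurable
  also have "\<dots> = ennreal (2 powr (\<alpha>+1) / Gamma (\<alpha>+1)) * ennreal (Gamma (\<alpha>+1) / 2 powr (\<alpha>+1))"
    using assms by (subst nn_integral_powr_exp) simp_all
  also have "\<dots> = 1" using G by (subst ennreal_mult'[symmetric]) auto
  finally show "emeasure (mu_measure \<alpha>) (space (mu_measure \<alpha>)) = 1" .
qed

lemma AE_mu_measure: "AE \<sigma> in mu_measure \<alpha>. \<sigma> > 0"
  unfolding mu_measure_altdef by (subst AE_density) (auto simp: mu_density_def indicator_def)

text \<open>Near 0 the density is comparable to a constant times \<sigma>^\<alpha>, and \<alpha> + 1
  is the resulting exponent for a dyadic interval. Test polynomials are measured on such intervals,
  so this is where the difference of two weights becomes visible.\<close>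

lemma mu_measure_interval_ge:
  assumes "\<alpha> > -1"
  obtains c where "c > 0" and "\<And>\<delta>. 0 < \<delta> \<Longrightarrow> \<delta> \<le> 1 \<Longrightarrow> c * \<delta> powr (\<alpha> + 1) \<le> measure (mu_measure \<alpha>) {\<delta>/2<..\<delta>}"
proof
  have G: "Gamma (\<alpha>+1) > 0" using assms by (intro Gamma_real_pos) simp
  interpret prob_space "mu_measure \<alpha>" by (rule prob_space_mu_measure[OF assms])
  \<comment> \<open>The factors bound the parts of the density on the interval:
    \<open>exp (-2)\<close> since \<sigma> is at most 1, the power of 2 for replacing \<sigma> by
    \<delta> with either sign of \<alpha>, and 1/2 for the length.\<close>
  define c where "c = 2 powr (\<alpha>+1) / Gamma (\<alpha>+1) * exp (-2) * 2 powr (- \<bar>\<alpha>\<bar>) / 2"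
  show "c > 0" using G by (simp add: c_def)
  fix \<delta> :: real assume d: "0 < \<delta>" "\<delta> \<le> 1"
  have le: "c * 2 * \<delta> powr \<alpha> * indicator {\<delta>/2<..\<delta>} \<sigma> \<le> mu_density \<alpha> \<sigma> * indicator {\<delta>/2<..\<delta>} \<sigma>" for \<sigma>
  proof (cases "\<sigma> \<in> {\<delta>/2<..\<delta>}")
    case True
    then have s: "0 < \<sigma>" "\<sigma> \<le> 1" "\<delta>/2 \<le> \<sigma>" "\<sigma> \<le> \<delta>" using d by auto
    have "2 powr (- \<bar>\<alpha>\<bar>) * \<delta> powr \<alpha> \<le> \<sigma> powr \<alpha>"
    proof (cases "\<alpha> \<ge> 0")
      case True
      have "2 powr (- \<bar>\<alpha>\<bar>) * \<delta> powr \<alpha> = (\<delta>/2) powr \<alpha>"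
        using True d by (simp add: powr_divide powr_minus_divide)
      also have "\<dots> \<le> \<sigma> powr \<alpha>" using s d True by (intro powr_mono2) auto
      finally show ?thesis .
    next
      case False
      have "2 powr (- \<bar>\<alpha>\<bar>) * \<delta> powr \<alpha> \<le> 1 * \<delta> powr \<alpha>"
        by (intro mult_right_mono) (auto simp: powr_minus_divide ge_one_powr_ge_zero)
      also have "\<dots> \<le> \<sigma> powr \<alpha>" using s d False by (simp add: powr_mono2')
      finally show ?thesis .
    qed
    moreover have "exp (-2) \<le> exp (-2 * \<sigma>)" using s by simp
    ultimately have "2 powr (- \<bar>\<alpha>\<bar>) * \<delta> powr \<alpha> * exp (-2) \<le> \<sigma> powr \<alpha> * exp (-2 * \<sigma>)"
      by (intro mult_mono) auto
    then have "2 powr (\<alpha>+1) / Gamma (\<alpha>+1) * (2 powr (- \<bar>\<alpha>\<bar>) * \<delta> powr \<alpha> * exp (-2))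
        \<le> 2 powr (\<alpha>+1) / Gamma (\<alpha>+1) * (\<sigma> powr \<alpha> * exp (-2 * \<sigma>))"
      using G by (intro mult_left_mono) auto
    then show ?thesis using True s by (simp add: c_def mu_density_def mult_ac)
  next
    case False then show ?thesis by simp
  qed
  have c0: "0 \<le> c * 2 * \<delta> powr \<alpha>" using \<open>c > 0\<close> by simp
  have "ennreal (c * \<delta> powr (\<alpha> + 1)) = ennreal (c * 2 * \<delta> powr \<alpha>) * emeasure lborel {\<delta>/2<..\<delta>}"
    using d c0 by (simp add: ennreal_mult'[symmetric] powr_add)
  also have "\<dots> = (\<integral>\<^sup>+\<sigma>. ennreal (c * 2 * \<delta> powr \<alpha>) * indicator {\<delta>/2<..\<delta>} \<sigma> \<partial>lborel)"
    by (subst nn_integral_cmult_indicator) auto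
  also have "\<dots> \<le> (\<integral>\<^sup>+\<sigma>. ennreal (mu_density \<alpha> \<sigma>) * indicator {\<delta>/2<..\<delta>} \<sigma> \<partial>lborel)"
  proof (rule nn_integral_mono)
    fix \<sigma> show "ennreal (c * 2 * \<delta> powr \<alpha>) * indicator {\<delta>/2<..\<delta>} \<sigma> \<le> ennreal (mu_density \<alpha> \<sigma>) * indicator {\<delta>/2<..\<delta>} \<sigma>"
      using le[of \<sigma>] by (auto simp: indicator_def intro!: ennreal_leI)
  qed
  also have "\<dots> = emeasure (mu_measure \<alpha>) {\<delta>/2<..\<delta>}"
    by (simp add: mu_measure_altdef emeasure_density)
  finally show "c * \<delta> powr (\<alpha> + 1) \<le> measure (mu_measure \<alpha>) {\<delta>/2<..\<delta>}"
    by (simp add: emeasure_eq_measure measure_nonneg)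
qed

lemma dp_shift_altdef: "dp_shift \<sigma> a = (\<lambda>n. complex_of_real (real n powr (-\<sigma>)) * a n)"
  by (simp add: dp_shift_def mult.commute)

lemma dirichlet_polys_shift: "a \<in> dirichlet_polys \<Longrightarrow> dp_shift \<sigma> a \<in> dirichlet_polys"
  unfolding dp_shift_altdef by (rule dirichlet_polys_multiplier)

lemma dp_shift_multiplier: "dp_shift \<sigma> (\<lambda>n. m n * a n) = (\<lambda>n. m n * dp_shift \<sigma> a n)"
  by (simp add: dp_shift_def mult_ac)

lemma bohr_lift_shift:
  assumes "a \<in> dirichlet_polys"
  shows "bohr_lift (dp_shift \<sigma> a) z = (\<Sum>n | a n \<noteq> 0. a n * of_real (real n powr (-\<sigma>)) * bohr_monom n z)"
  by (subst bohr_lift_altdef[of "{n. a n \<noteq> 0}"])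
    (use dirichlet_polysD[OF assms] in \<open>auto simp: dp_shift_def\<close>)

lemma hardy_norm_powr: "p > 0 \<Longrightarrow> hardy_norm p a powr p = HP p a"
  using HP_nonneg[of p a] by (simp add: hardy_norm_def powr_powr flip: HP_def)

definition AP :: "real \<Rightarrow> real \<Rightarrow> (nat \<Rightarrow> complex) \<Rightarrow> real" where
  "AP p \<alpha> a = (\<integral>\<sigma>. HP p (dp_shift \<sigma> a) \<partial>mu_measure \<alpha>)"

lemma dp_norm_altdef: "p > 0 \<Longrightarrow> dp_norm p \<alpha> a = AP p \<alpha> a powr (1/p)"
  by (simp add: dp_norm_def AP_def hardy_norm_powr)

lemma AP_nonneg: "0 \<le> AP p \<alpha> a"
  unfolding AP_def by (intro integral_nonneg_AE AE_I2 HP_nonneg)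

lemma dp_norm_nonneg: "0 \<le> dp_norm p \<alpha> a"
  by (simp add: dp_norm_def)

lemma dp_norm_powr: "p > 0 \<Longrightarrow> dp_norm p \<alpha> a powr p = AP p \<alpha> a"
  using AP_nonneg[of p \<alpha> a] by (simp add: dp_norm_altdef powr_powr)

lemma HP_le:
  assumes "a \<in> dirichlet_polys" "p > 0"
  shows "HP p a \<le> (\<Sum>n | a n \<noteq> 0. norm (a n)) powr p"
proof -
  have "HP p a \<le> (\<integral>z. (\<Sum>n | a n \<noteq> 0. norm (a n)) powr p \<partial>torus_measure)"
    unfolding HP_def
  proof (rule integral_mono[OF integrable_HP[OF assms]])
    fix z assume "z \<in> space torus_measure"
    from norm_bohr_lift_le[OF assms(1) this] assms(2)
    show "norm (bohr_lift a z) powr p \<le> (\<Sum>n | a n \<noteq> 0. norm (a n)) powr p"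
      by (simp add: powr_mono2)
  qed simp
  then show ?thesis using torus.prob_space by simp
qed

lemma measurable_HP_shift [measurable]:
  assumes "a \<in> dirichlet_polys"
  shows "(\<lambda>\<sigma>. HP p (dp_shift \<sigma> a)) \<in> borel_measurable borel"
proof -
  have "(\<lambda>(\<sigma>, z). norm (\<Sum>n | a n \<noteq> 0. a n * of_real (real n powr (-\<sigma>)) * bohr_monom n z) powr p)
      \<in> borel_measurable (borel \<Otimes>\<^sub>M torus_measure)"
    by measurable
  then show ?thesis
    unfolding HP_def bohr_lift_shift[OF assms] by (rule torus.borel_measurable_lebesgue_integral)
qed

lemma sum_norm_dp_shift_le:
  assumes "a \<in> dirichlet_polys" "\<sigma> \<ge> 0"
  shows "(\<Sum>n | dp_shift \<sigma> a n \<noteq> 0. norm (dp_shift \<sigma> a n)) \<le> (\<Sum>n | a n \<noteq> 0. norm (a n))"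
proof (rule sum_le_included[where i="\<lambda>n. n"])
  show "finite {n. dp_shift \<sigma> a n \<noteq> 0}" "finite {n. a n \<noteq> 0}"
    by (intro dirichlet_polysD dirichlet_polys_shift assms)+
  show "\<forall>n\<in>{n. dp_shift \<sigma> a n \<noteq> 0}. \<exists>m\<in>{n. a n \<noteq> 0}. m = n \<and> norm (dp_shift \<sigma> a n) \<le> norm (a m)"
  proof (intro ballI)
    fix n assume "n \<in> {n. dp_shift \<sigma> a n \<noteq> 0}"
    then have n: "a n \<noteq> 0" by (simp add: dp_shift_def)
    then have "n \<noteq> 0" using dirichlet_polysD(1)[OF assms(1)] by metis
    then have "real n powr (-\<sigma>) \<le> real n powr 0" using assms by (intro powr_mono) auto
    then have "norm (dp_shift \<sigma> a n) \<le> norm (a n)"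
      using \<open>n \<noteq> 0\<close> by (simp add: dp_shift_def norm_mult mult_left_le)
    then show "\<exists>m\<in>{n. a n \<noteq> 0}. m = n \<and> norm (dp_shift \<sigma> a n) \<le> norm (a m)" using n by simp
  qed
qed auto

lemma HP_shift_le:
  assumes "a \<in> dirichlet_polys" "p > 0" "\<sigma> \<ge> 0"
  shows "HP p (dp_shift \<sigma> a) \<le> (\<Sum>n | a n \<noteq> 0. norm (a n)) powr p"
  using HP_le[OF dirichlet_polys_shift[OF assms(1)] assms(2), of \<sigma>] sum_norm_dp_shift_le[OF assms(1,3)] assms(2)
  by (meson order.trans powr_mono2 less_imp_le norm_ge_zero sum_nonneg)

lemma integrable_AP:
  assumes a: "a \<in> dirichlet_polys" and p: "p > 0" and \<alpha>: "\<alpha> > -1"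
  shows "integrable (mu_measure \<alpha>) (\<lambda>\<sigma>. HP p (dp_shift \<sigma> a))"
proof -
  interpret prob_space "mu_measure \<alpha>" by (rule prob_space_mu_measure[OF \<alpha>])
  show ?thesis
  proof (rule integrable_const_bound)
    show "AE \<sigma> in mu_measure \<alpha>. norm (HP p (dp_shift \<sigma> a)) \<le> (\<Sum>n | a n \<noteq> 0. norm (a n)) powr p"
      using AE_mu_measure[of \<alpha>]
      by (rule eventually_mono) (use HP_shift_le[OF a p] HP_nonneg in simp)
  qed (simp add: measurable_HP_shift[OF a] measurable_cong_sets[OF sets_mu_measure refl])
qed

lemma AP_mono:
  assumes "a \<in> dirichlet_polys" "b \<in> dirichlet_polys" "p > 0" "\<alpha> > -1"
    and "\<And>\<sigma>. \<sigma> > 0 \<Longrightarrow> HP p (dp_shift \<sigma> a) \<le> C * HP p (dp_shift \<sigma> b)"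
  shows "AP p \<alpha> a \<le> C * AP p \<alpha> b"
proof -
  have "AP p \<alpha> a \<le> (\<integral>\<sigma>. C * HP p (dp_shift \<sigma> b) \<partial>mu_measure \<alpha>)"
    unfolding AP_def
    by (rule integral_mono_AE[OF integrable_AP integrable_mult_right[OF integrable_AP]])
      (use assms AE_mu_measure[of \<alpha>] in \<open>auto elim: eventually_mono\<close>)
  then show ?thesis by (simp add: AP_def)
qed

lemma dp_norm_mono:
  assumes "a \<in> dirichlet_polys" "b \<in> dirichlet_polys" "p > 0" "\<alpha> > -1" "C \<ge> 0"
    and "\<And>\<sigma>. \<sigma> > 0 \<Longrightarrow> HP p (dp_shift \<sigma> a) \<le> C powr p * HP p (dp_shift \<sigma> b)"
  shows "dp_norm p \<alpha> a \<le> C * dp_norm p \<alpha> b"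
proof -
  have "dp_norm p \<alpha> a \<le> (C powr p * AP p \<alpha> b) powr (1/p)"
    unfolding dp_norm_altdef[OF assms(3)]
    using assms(3) by (intro powr_mono2 AP_nonneg AP_mono assms) auto
  also have "\<dots> = C * dp_norm p \<alpha> b"
    using assms(3,5) by (simp add: powr_mult powr_powr dp_norm_altdef AP_nonneg)
  finally show ?thesis .
qed

lemma dp_norm_dilate_le:
  assumes a: "a \<in> dirichlet_polys" and p: "p > 0" "\<alpha> > -1" and r: "0 \<le> r" "r \<le> 1"
  shows "dp_norm p \<alpha> (\<lambda>n. of_real r ^ wt k n * a n) \<le> dp_norm p \<alpha> a"
  using dp_norm_mono[OF dirichlet_polys_multiplier[OF a] a p, of 1 "\<lambda>n. of_real r ^ wt k n"]
    HP_dilate_le[OF dirichlet_polys_shift[OF a] p(1) r, of k]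
  by (simp add: dp_shift_multiplier)

lemma dp_norm_coeff_le:
  assumes a: "a \<in> dirichlet_polys" and p: "p > 0" "\<alpha> > -1" and r: "0 < r" "r < 1"
  shows "dp_norm p \<alpha> (\<lambda>n. of_bool (wt k n = d) * a n) \<le> 1 / (r ^ d * (1 - sqrt r) powr (2/p)) * dp_norm p \<alpha> a"
proof (rule dp_norm_mono[OF dirichlet_polys_multiplier[OF a] a p])
  show "0 \<le> 1 / (r ^ d * (1 - sqrt r) powr (2/p))" using r by simp
  show "HP p (dp_shift \<sigma> (\<lambda>n. of_bool (wt k n = d) * a n))
      \<le> (1 / (r ^ d * (1 - sqrt r) powr (2/p))) powr p * HP p (dp_shift \<sigma> a)" for \<sigma>
    using HP_coeff_le[OF dirichlet_polys_shift[OF a] p(1) r, of k d \<sigma>] r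
    by (simp add: dp_shift_multiplier powr_divide)
qed

lemma dp_norm_keep_le:
  assumes a: "a \<in> dirichlet_polys" and p: "p > 0" "\<alpha> > -1"
  shows "dp_norm p \<alpha> (\<lambda>n. of_bool (wt k n = 0) * a n) \<le> dp_norm p \<alpha> a"
proof -
  have "(\<lambda>n. of_real 0 ^ wt k n * a n) = (\<lambda>n. of_bool (wt k n = 0) * a n)"
    by (simp add: fun_eq_iff power_0_left)
  then show ?thesis using dp_norm_dilate_le[OF a p, of 0 k] by simp
qed

text \<open>Convexity of \<open>t powr p\<close> in the form that yields Minkowski's inequality after integration.\<close>

lemma powr_add_le_weighted:
  fixes x y A B p :: real
  assumes "p \<ge> 1" "A > 0" "B > 0" "x \<ge> 0" "y \<ge> 0"
  shows "(x + y) powr p \<le> (A + B) powr (p - 1) * (A powr (1 - p) * x powr p + B powr (1 - p) * y powr p)"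
proof -
  have one: "x powr p \<le> (A + B) powr (p - 1) * (A powr (1 - p) * x powr p)" if "A > 0" "B > 0" for x A B :: real
  proof -
    have "A powr (p - 1) \<le> (A + B) powr (p - 1)" using assms(1) that by (intro powr_mono2) auto
    then have "A powr (p - 1) * A powr (1 - p) \<le> (A + B) powr (p - 1) * A powr (1 - p)"
      by (intro mult_right_mono) auto
    then have "1 \<le> (A + B) powr (p - 1) * A powr (1 - p)"
      using that by (simp flip: powr_add)
    then have "1 * x powr p \<le> ((A + B) powr (p - 1) * A powr (1 - p)) * x powr p"
      by (intro mult_right_mono) auto
    then show ?thesis by (simp add: mult.assoc)
  qed
  consider "x = 0" | "y = 0" | "x > 0" "y > 0" using assms by linarith
  then show ?thesis
  proof cases
    case 1
    then show ?thesis using one[of B A y] assms by (simp add: add.commute)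
  next
    case 2
    then show ?thesis using one[of A B x] assms by simp
  next
    case 3
    define S where "S = A + B"
    have S: "S > 0" using assms by (simp add: S_def)
    have c: "convex_on {0<..} (\<lambda>x::real. x powr p)" by (rule powr_convex[OF assms(1)])
    have "((A / S) * (x / A) + (B / S) * (y / B)) powr p \<le> (A / S) * (x / A) powr p + (B / S) * (y / B) powr p"
      using convex_onD[OF c, of "B / S" "x / A" "y / B"] 3 assms S
      by (simp add: S_def field_simps)
    also have "(A / S) * (x / A) + (B / S) * (y / B) = (x + y) / S"
      using assms S by (simp add: field_simps)
    finally have "((x + y) / S) powr p * S powr p \<le> ((A / S) * (x / A) powr p + (B / S) * (y / B) powr p) * S powr p"
      by (intro mult_right_mono) auto
    moreover have "((x + y) / S) powr p * S powr p = (x + y) powr p"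
      using S 3 by (simp add: powr_divide)
    moreover have "((A / S) * (x / A) powr p + (B / S) * (y / B) powr p) * S powr p
        = S powr (p - 1) * (A powr (1 - p) * x powr p + B powr (1 - p) * y powr p)"
    proof -
      have "(A / S) * (x / A) powr p * S powr p = S powr (p - 1) * (A powr (1 - p) * x powr p)"
        if "A > 0" "x > 0" for A x :: real
        using that S by (simp add: powr_divide powr_diff field_simps)
      from this[of A x] this[of B y] 3 assms show ?thesis by (simp add: algebra_simps)
    qed
    ultimately show ?thesis by (simp add: S_def)
  qed
qed

text \<open>After division by \<open>x + y\<close> both summands lie in [0, 1], where raising to a
  power at most 1 does not decrease them.\<close>

lemma powr_add_le_subadd:
  fixes x y p :: real
  assumes "0 < p" "p \<le> 1" "x \<ge> 0" "y \<ge> 0"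
  shows "(x + y) powr p \<le> x powr p + y powr p"
proof (cases "x + y = 0")
  case False
  then have S: "x + y > 0" using assms by simp
  have "u / (x + y) \<le> (u / (x + y)) powr p" if "0 \<le> u" "u \<le> x + y" for u
  proof (cases "u = 0")
    case False
    have "(u / (x + y)) powr 1 \<le> (u / (x + y)) powr p"
      using that S False assms by (intro powr_mono') auto
    then show ?thesis using that S by simp
  qed simp
  from this[of x] this[of y] assms
  have "1 \<le> (x / (x + y)) powr p + (y / (x + y)) powr p"
    using S by (auto simp: add_divide_distrib[symmetric] intro: order.trans[rotated])
      (smt (verit) S add_divide_distrib divide_self)
  then have "(x + y) powr p * 1 \<le> (x + y) powr p * ((x / (x + y)) powr p + (y / (x + y)) powr p)"
    by (intro mult_left_mono) auto
  then show ?thesis using S assms by (simp add: powr_divide distrib_left)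
qed (use assms in simp)

section \<open>Linear structure and triangle inequalities\<close>

lemma dirichlet_polys_add:
  assumes "a \<in> dirichlet_polys" "b \<in> dirichlet_polys"
  shows "(\<lambda>n. a n + b n) \<in> dirichlet_polys"
proof -
  have "finite {n. a n + b n \<noteq> 0}"
    by (rule finite_subset[of _ "{n. a n \<noteq> 0} \<union> {n. b n \<noteq> 0}"]) (use assms dirichlet_polysD in auto)
  then show ?thesis using assms by (simp add: dirichlet_polys_def)
qed

lemma dirichlet_polys_diff:
  assumes "a \<in> dirichlet_polys" "b \<in> dirichlet_polys"
  shows "(\<lambda>n. a n - b n) \<in> dirichlet_polys"
  using dirichlet_polys_add[OF assms(1) dirichlet_polys_multiplier[OF assms(2), of "\<lambda>_. -1"]] by simp

lemma dirichlet_polys_0 [simp]: "(\<lambda>_. 0) \<in> dirichlet_polys"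
  by (simp add: dirichlet_polys_def)

lemma dirichlet_polys_sum:
  assumes "\<And>i. i \<in> I \<Longrightarrow> f i \<in> dirichlet_polys"
  shows "(\<lambda>n. \<Sum>i\<in>I. f i n) \<in> dirichlet_polys"
  using assms by (induction I rule: infinite_finite_induct) (auto intro: dirichlet_polys_add)

lemma bohr_lift_add:
  assumes "a \<in> dirichlet_polys" "b \<in> dirichlet_polys"
  shows "bohr_lift (\<lambda>n. a n + b n) z = bohr_lift a z + bohr_lift b z"
proof -
  have f: "finite ({n. a n \<noteq> 0} \<union> {n. b n \<noteq> 0})" using assms dirichlet_polysD by auto
  show ?thesis
    by (subst (1 2 3) bohr_lift_altdef[OF f]) (auto simp: sum.distrib distrib_right)
qed

lemma dp_shift_add: "dp_shift \<sigma> (\<lambda>n. a n + b n) = (\<lambda>n. dp_shift \<sigma> a n + dp_shift \<sigma> b n)"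
  by (simp add: dp_shift_def distrib_right)

text \<open>The scalar inequality is a parameter: subadditivity of the power serves exponents up to
  1, the weighted convexity inequality serves the others.\<close>

lemma HP_add_le:
  assumes a: "a \<in> dirichlet_polys" and b: "b \<in> dirichlet_polys" and p: "p > 0"
    and le: "\<And>x y::real. 0 \<le> x \<Longrightarrow> 0 \<le> y \<Longrightarrow> (x + y) powr p \<le> u * x powr p + v * y powr p"
  shows "HP p (\<lambda>n. a n + b n) \<le> u * HP p a + v * HP p b"
proof -
  have "HP p (\<lambda>n. a n + b n) \<le> (\<integral>z. u * norm (bohr_lift a z) powr p + v * norm (bohr_lift b z) powr p \<partial>torus_measure)"
    unfolding HP_def
  proof (rule integral_mono)
    show "integrable torus_measure (\<lambda>z. norm (bohr_lift (\<lambda>n. a n + b n) z) powr p)"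
      by (intro integrable_HP dirichlet_polys_add a b p)
    show "integrable torus_measure (\<lambda>z. u * norm (bohr_lift a z) powr p + v * norm (bohr_lift b z) powr p)"
      using integrable_HP[OF a p] integrable_HP[OF b p] by simp
    fix z
    have "norm (bohr_lift (\<lambda>n. a n + b n) z) powr p \<le> (norm (bohr_lift a z) + norm (bohr_lift b z)) powr p"
      unfolding bohr_lift_add[OF a b] using p by (intro powr_mono2 norm_triangle_ineq) auto
    also have "\<dots> \<le> u * norm (bohr_lift a z) powr p + v * norm (bohr_lift b z) powr p"
      by (rule le) auto
    finally show "norm (bohr_lift (\<lambda>n. a n + b n) z) powr p \<le> u * norm (bohr_lift a z) powr p + v * norm (bohr_lift b z) powr p" .
  qed
  also have "\<dots> = u * HP p a + v * HP p b"
    using integrable_HP[OF a p] integrable_HP[OF b p] by (simp add: HP_def)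
  finally show ?thesis .
qed

lemma AP_add_le:
  assumes a: "a \<in> dirichlet_polys" and b: "b \<in> dirichlet_polys" and p: "p > 0" "\<alpha> > -1"
    and le: "\<And>x y::real. 0 \<le> x \<Longrightarrow> 0 \<le> y \<Longrightarrow> (x + y) powr p \<le> u * x powr p + v * y powr p"
  shows "AP p \<alpha> (\<lambda>n. a n + b n) \<le> u * AP p \<alpha> a + v * AP p \<alpha> b"
proof -
  note i = integrable_AP[OF a p] integrable_AP[OF b p]
  have "AP p \<alpha> (\<lambda>n. a n + b n) \<le> (\<integral>\<sigma>. u * HP p (dp_shift \<sigma> a) + v * HP p (dp_shift \<sigma> b) \<partial>mu_measure \<alpha>)"
    unfolding AP_def
  proof (rule integral_mono)
    show "integrable (mu_measure \<alpha>) (\<lambda>\<sigma>. HP p (dp_shift \<sigma> (\<lambda>n. a n + b n)))"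
      by (intro integrable_AP dirichlet_polys_add a b p)
    show "integrable (mu_measure \<alpha>) (\<lambda>\<sigma>. u * HP p (dp_shift \<sigma> a) + v * HP p (dp_shift \<sigma> b))"
      using i by simp
    show "HP p (dp_shift \<sigma> (\<lambda>n. a n + b n)) \<le> u * HP p (dp_shift \<sigma> a) + v * HP p (dp_shift \<sigma> b)" for \<sigma>
      unfolding dp_shift_add by (intro HP_add_le dirichlet_polys_shift a b p le)
  qed
  also have "\<dots> = u * AP p \<alpha> a + v * AP p \<alpha> b" using i by (simp add: AP_def)
  finally show ?thesis .
qed

text \<open>The power that turns the quasi-norm into a functional with a genuine triangle inequality
  for every \<open>p > 0\<close>; for \<open>p \<ge> 1\<close> it is the norm itself. All
  approximation arguments are run with it.\<close>

definition tnorm :: "real \<Rightarrow> real \<Rightarrow> (nat \<Rightarrow> complex) \<Rightarrow> real" where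
  "tnorm p \<alpha> a = dp_norm p \<alpha> a powr min p 1"

lemma tnorm_nonneg: "0 \<le> tnorm p \<alpha> a"
  by (simp add: tnorm_def)

lemma tnorm_add_le:
  assumes a: "a \<in> dirichlet_polys" and b: "b \<in> dirichlet_polys" and p: "p > 0" "\<alpha> > -1"
  shows "tnorm p \<alpha> (\<lambda>n. a n + b n) \<le> tnorm p \<alpha> a + tnorm p \<alpha> b"
proof (cases "p \<le> 1")
  case True
  have "AP p \<alpha> (\<lambda>n. a n + b n) \<le> 1 * AP p \<alpha> a + 1 * AP p \<alpha> b"
    using powr_add_le_subadd[OF p(1) True] by (intro AP_add_le a b p) simp
  then show ?thesis using True p by (simp add: tnorm_def min_def dp_norm_powr)
next
  case False
  then have p1: "p \<ge> 1" by simp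
  have "dp_norm p \<alpha> (\<lambda>n. a n + b n) \<le> dp_norm p \<alpha> a + dp_norm p \<alpha> b"
  proof (rule field_le_epsilon)
    fix e :: real assume e: "e > 0"
    \<comment> \<open>The weights of \<open>powr_add_le_weighted\<close> should be the two norms;
      adding \<open>e / 2\<close> keeps them positive when a norm is 0.\<close>
    define A where "A = dp_norm p \<alpha> a + e / 2"
    define B where "B = dp_norm p \<alpha> b + e / 2"
    have AB: "A > 0" "B > 0" using e dp_norm_nonneg[of p \<alpha> a] dp_norm_nonneg[of p \<alpha> b] by (auto simp: A_def B_def)
    have "AP p \<alpha> a \<le> A powr p" "AP p \<alpha> b \<le> B powr p"
      using p e by (auto simp: A_def B_def dp_norm_nonneg simp flip: dp_norm_powr intro!: powr_mono2)
    then have "A powr (1 - p) * AP p \<alpha> a \<le> A powr (1 - p) * A powr p"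
      "B powr (1 - p) * AP p \<alpha> b \<le> B powr (1 - p) * B powr p"
      by (auto intro: mult_left_mono)
    then have le: "A powr (1 - p) * AP p \<alpha> a \<le> A" "B powr (1 - p) * AP p \<alpha> b \<le> B"
      using AB by (simp_all flip: powr_add)
    have "AP p \<alpha> (\<lambda>n. a n + b n) \<le> ((A + B) powr (p - 1) * A powr (1 - p)) * AP p \<alpha> a
        + ((A + B) powr (p - 1) * B powr (1 - p)) * AP p \<alpha> b"
    proof (intro AP_add_le a b p)
      fix x y :: real assume "0 \<le> x" "0 \<le> y"
      from powr_add_le_weighted[OF p1 AB this]
      show "(x + y) powr p \<le> (A + B) powr (p - 1) * A powr (1 - p) * x powr p + (A + B) powr (p - 1) * B powr (1 - p) * y powr p"
        by (simp add: distrib_left mult.assoc)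
    qed
    also have "\<dots> = (A + B) powr (p - 1) * (A powr (1 - p) * AP p \<alpha> a + B powr (1 - p) * AP p \<alpha> b)"
      by (simp add: algebra_simps)
    also have "\<dots> \<le> (A + B) powr (p - 1) * (A + B)"
      using le by (intro mult_left_mono add_mono) auto
    also have "\<dots> = (A + B) powr p" using AB by (simp add: powr_diff)
    finally have "(dp_norm p \<alpha> (\<lambda>n. a n + b n) powr p) powr (1/p) \<le> ((A + B) powr p) powr (1/p)"
      unfolding dp_norm_powr[OF p(1)] using p AB by - (rule powr_mono2, auto simp: AP_nonneg)
    then show "dp_norm p \<alpha> (\<lambda>n. a n + b n) \<le> dp_norm p \<alpha> a + dp_norm p \<alpha> b + e"
      using p AB by (simp add: powr_powr dp_norm_nonneg A_def B_def)
  qed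
  then show ?thesis using False by (simp add: tnorm_def min_def dp_norm_nonneg)
qed

section \<open>Bounds for coefficients and for values far to the right\<close>

lemma wt_nth_prime: "wt k (nth_prime j) = k j"
proof -
  have "wt k (nth_prime j) = (\<Sum>i\<le>nth_prime j. k i * expo i (nth_prime j))" by (rule wt_altdef) simp
  also have "\<dots> = (\<Sum>i\<le>nth_prime j. if i = j then k i else 0)"
    by (intro sum.cong refl) (simp add: expo_nth_prime)
  finally show ?thesis using le_nth_prime[of j] by simp
qed

lemma nth_prime_factor_induct [consumes 1, case_names one mult]:
  assumes "0 < n" and "P 1" and "\<And>j m. 0 < m \<Longrightarrow> P m \<Longrightarrow> P (nth_prime j * m)"
  shows "P n"
  using assms(1)
proof (induction n rule: less_induct)
  case (less n)
  show ?case
  proof (cases "n = 1")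
    case False
    then obtain q where q: "prime q" "q dvd n" using prime_factor_nat by blast
    then obtain j where j: "nth_prime j = q" using nth_prime_surj by blast
    from q obtain m where m: "n = nth_prime j * m" unfolding j by blast
    then have "0 < m" using less.prems by (cases m) auto
    moreover have "m < n" using m \<open>0 < m\<close> prime_gt_1_nat[OF prime_nth_prime[of j]] by simp
    ultimately show ?thesis unfolding m by (intro assms(3) less.IH) (simp_all add: m)
  qed (use assms(2) in simp)
qed

abbreviation Om :: "nat \<Rightarrow> nat" where
  "Om \<equiv> wt (\<lambda>_. 1)"

text \<open>Turns a cost that is exponential in the number of prime factors into a power of
  \<open>n\<close>.\<close>

lemma two_power_Om_le: "0 < n \<Longrightarrow> 2 ^ Om n \<le> n"
proof (induction n rule: nth_prime_factor_induct)
  case (mult j m)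
  have "2 * 2 ^ Om m \<le> nth_prime j * m"
    using mult prime_ge_2_nat[OF prime_nth_prime[of j]] by (intro mult_le_mono) auto
  then show ?case using mult by (simp add: wt_mult wt_nth_prime)
qed simp

text \<open>Its use is a finiteness statement: only finitely many \<open>n\<close> have a given
  number of prime factors, all of them among the first \<open>Suc J\<close> primes.\<close>

lemma smooth_le_power_Om:
  "0 < n \<Longrightarrow> wt (\<lambda>j. of_bool (j > J)) n = 0 \<Longrightarrow> n \<le> nth_prime J ^ Om n"
proof (induction n rule: nth_prime_factor_induct)
  case (mult j m)
  then have "j \<le> J" "m \<le> nth_prime J ^ Om m" by (auto simp: wt_mult wt_nth_prime)
  then have "nth_prime j \<le> nth_prime J"
    by (metis le_eq_less_or_eq nth_prime_less_iff)
  then have "nth_prime j * m \<le> nth_prime J * nth_prime J ^ Om m"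
    using \<open>m \<le> _\<close> by (intro mult_le_mono) auto
  then show ?case using mult(1) by (simp add: wt_mult wt_nth_prime)
qed simp

text \<open>The constant is arranged to be 1 for \<open>d = 0\<close>, so that slicing successively
  by many primes costs something only at those dividing \<open>n\<close>. The coefficient bound
  alone does not give this; the case \<open>d = 0\<close> uses the dilation with
  \<open>r = 0\<close>.\<close>

lemma HP_slice_le:
  assumes a: "a \<in> dirichlet_polys" and p: "p > 0"
  shows "HP p (\<lambda>n. of_bool (wt k n = d) * a n) \<le> (4 powr (p + 1)) ^ d * HP p a"
proof (cases "d = 0")
  case True
  have "(\<lambda>n. of_real 0 ^ wt k n * a n) = (\<lambda>n. of_bool (wt k n = 0) * a n)"
    by (simp add: fun_eq_iff power_0_left)
  then show ?thesis using HP_dilate_le[OF a p, of 0 k] True by simp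
next
  case False
  \<comment> \<open>The radius 1/4 has square root 1/2, so all factors become powers of 4.\<close>
  define D :: real where "D = ((1/4) ^ d * (1 - sqrt (1/4)) powr (2/p)) powr p"
  have sq: "sqrt (1/4) = (1/2::real)" by (rule real_sqrt_unique) (auto simp: power2_eq_square)
  have "D = (4 powr (- real d)) powr p * (1/2) powr 2"
  proof -
    have "(1/4::real) ^ d = 4 powr (- real d)"
      by (simp add: powr_minus powr_realpow power_one_over inverse_eq_divide)
    moreover have "((1 - 1/2) powr (2/p)) powr p = (1/2::real) powr 2"
      using p by (simp add: powr_powr)
    ultimately show ?thesis unfolding D_def sq by (simp only: powr_mult)
  qed
  also have "\<dots> = 4 powr (- (real d * p)) * 4 powr (- 1)"
    by (simp add: powr_powr powr_minus_divide powr_divide power2_eq_square)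
  also have "\<dots> = 4 powr (- (real d * p + 1))" unfolding powr_add[symmetric] by simp
  finally have D: "D = 4 powr (- (real d * p + 1))" .
  have "HP p (\<lambda>n. of_bool (wt k n = d) * a n) \<le> HP p a / D"
    unfolding D_def by (rule HP_coeff_le[OF a p]) auto
  also have "\<dots> = 4 powr (real d * p + 1) * HP p a"
    unfolding D powr_minus by (simp add: field_simps)
  also have "\<dots> \<le> (4 powr (p + 1)) ^ d * HP p a"
  proof (intro mult_right_mono HP_nonneg)
    have "real d * p + 1 \<le> (p + 1) * real d" using False by (simp add: algebra_simps)
    then have "4 powr (real d * p + 1) \<le> 4 powr ((p + 1) * real d)" by (intro powr_mono) auto
    then show "4 powr (real d * p + 1) \<le> (4 powr (p + 1)) ^ d"
      by (simp add: powr_powr flip: powr_realpow)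
  qed
  finally show ?thesis .
qed

lemma HP_match_le:
  assumes a: "a \<in> dirichlet_polys" and p: "p > 0"
  shows "HP p (\<lambda>i. of_bool (\<forall>j<m. expo j i = e j) * a i) \<le> (4 powr (p + 1)) ^ (\<Sum>j<m. e j) * HP p a"
proof (induction m)
  case (Suc m)
  define b where "b = (\<lambda>i. of_bool (\<forall>j<m. expo j i = e j) * a i)"
  have b: "b \<in> dirichlet_polys" unfolding b_def by (rule dirichlet_polys_multiplier[OF a])
  have "(\<lambda>i. of_bool (\<forall>j<Suc m. expo j i = e j) * a i)
      = (\<lambda>i. of_bool (wt (\<lambda>j. if j = m then 1 else 0) i = e m) * b i)"
    unfolding wt_single b_def by (auto simp: fun_eq_iff less_Suc_eq)
  then have "HP p (\<lambda>i. of_bool (\<forall>j<Suc m. expo j i = e j) * a i) \<le> (4 powr (p + 1)) ^ e m * HP p b"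
    using HP_slice_le[OF b p] by simp
  also have "\<dots> \<le> (4 powr (p + 1)) ^ e m * ((4 powr (p + 1)) ^ (\<Sum>j<m. e j) * HP p a)"
    using Suc by (intro mult_left_mono) (auto simp: b_def)
  finally show ?case by (simp add: power_add mult_ac)
qed simp

text \<open>Prescribing the exponents of the primes one after another isolates the term
  \<open>n\<close>. The total cost is a constant to the power \<open>Om n\<close>, hence polynomial
  in \<open>n\<close>; a cruder power only moves the half-plane of absolute convergence to the
  right.\<close>

lemma coeff_le_HP:
  assumes a: "a \<in> dirichlet_polys" and p: "p > 0" and n: "0 < n"
  shows "norm (a n) powr p \<le> real n powr (2 * p + 2) * HP p a"
proof -
  obtain N where N: "\<And>i. a i \<noteq> 0 \<Longrightarrow> i \<le> N" "n \<le> N"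
  proof -
    have "finite (insert n {i. a i \<noteq> 0})" using dirichlet_polysD(2)[OF a] by simp
    then obtain N where "\<And>i. i \<in> insert n {i. a i \<noteq> 0} \<Longrightarrow> i \<le> N"
      unfolding finite_nat_set_iff_bounded_le by blast
    then show ?thesis using that by auto
  qed
  \<comment> \<open>No prime of index above \<open>N\<close> divides \<open>n\<close> or an index in
    the support, so matching finitely many exponents singles out \<open>n\<close>.\<close>
  define b where "b = (\<lambda>i. of_bool (\<forall>j<Suc N. expo j i = expo j n) * a i)"
  have "b = (\<lambda>i. if i = n then a n else 0)"
  proof
    fix i
    show "b i = (if i = n then a n else 0)"
    proof (cases "a i = 0 \<or> i = n")
      case True then show ?thesis by (auto simp: b_def)
    next
      case False
      then have i: "a i \<noteq> 0" "i \<noteq> n" "i \<le> N" using N(1) by auto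
      have i0: "0 < i" using i(1) dirichlet_polysD(1)[OF a] by (cases i) auto
      have "\<not> (\<forall>j<Suc N. expo j i = expo j n)"
      proof
        assume *: "\<forall>j<Suc N. expo j i = expo j n"
        have "expo j i = expo j n" for j
        proof (cases "j < Suc N")
          case True then show ?thesis using * by simp
        next
          case False then show ?thesis using i N(2) by (simp add: expo_eq_0)
        qed
        then have "i = n" using eq_of_expo_eq[OF i0 n] by simp
        then show False using i by simp
      qed
      then show ?thesis using i by (simp add: b_def)
    qed
  qed
  then have bl: "bohr_lift b z = a n * bohr_monom n z" for z
    by (subst bohr_lift_altdef[of "{n}"]) auto
  have "HP p b = (\<integral>z. norm (a n) powr p \<partial>torus_measure)"
    unfolding HP_def bl
    by (intro Bochner_Integration.integral_cong refl) (simp add: norm_mult norm_bohr_monom[OF n] norm_torus)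
  also have "\<dots> = norm (a n) powr p" using torus.prob_space by simp
  finally have "norm (a n) powr p = HP p b" ..
  also have "\<dots> \<le> (4 powr (p + 1)) ^ (\<Sum>j<Suc N. expo j n) * HP p a"
    unfolding b_def by (rule HP_match_le[OF a p])
  also have "(\<Sum>j<Suc N. expo j n) = Om n"
    using N(2) by (simp add: wt_altdef[of n N] lessThan_Suc_atMost)
  also have "(4 powr (p + 1)) ^ Om n * HP p a \<le> real n powr (2 * p + 2) * HP p a"
  proof (intro mult_right_mono HP_nonneg)
    have "(4 powr (p + 1)) ^ Om n = (2 ^ Om n) powr (2 * p + 2)"
    proof -
      have "(4::real) = 2 powr 2" by simp
      then have "(4 powr (p + 1)) ^ Om n = 2 powr (2 * (p + 1) * real (Om n))"
        by (simp only: powr_powr powr_realpow[symmetric] powr_gt_zero)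
      also have "\<dots> = (2 ^ Om n) powr (2 * p + 2)"
        by (simp add: powr_powr mult_ac flip: powr_realpow)
      finally show ?thesis .
    qed
    also have "\<dots> \<le> real n powr (2 * p + 2)"
    proof (rule powr_mono2)
      show "(2::real) ^ Om n \<le> real n"
        using two_power_Om_le[OF n] by (metis of_nat_le_iff of_nat_numeral of_nat_power)
    qed (use p in auto)
    finally show "(4 powr (p + 1)) ^ Om n \<le> real n powr (2 * p + 2)" .
  qed
  finally show ?thesis .
qed

text \<open>Only \<sigma> in (1/2, 1] is used, where the shift costs at most a factor n^p in the
  \<open>p\<close>-th power. Together with the exponent \<open>2 * p + 2\<close> this gives
  \<open>3 * p + 2\<close>, and division by \<open>p\<close> the stated exponent.\<close>

lemma coeff_le_dp_norm:
  assumes p: "p > 0" "\<alpha> > -1"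
  obtains C where "C > 0"
    and "\<And>a n. a \<in> dirichlet_polys \<Longrightarrow> norm (a n) \<le> C * real n powr (3 + 2/p) * dp_norm p \<alpha> a"
proof -
  interpret prob_space "mu_measure \<alpha>" by (rule prob_space_mu_measure[OF p(2)])
  obtain c where c: "c > 0" "\<And>\<delta>. 0 < \<delta> \<Longrightarrow> \<delta> \<le> 1 \<Longrightarrow> c * \<delta> powr (\<alpha> + 1) \<le> prob {\<delta>/2<..\<delta>}"
    using mu_measure_interval_ge[OF p(2)] by blast
  have c1: "c \<le> prob {1/2<..1}" using c(2)[of 1] by simp
  define C where "C = (1 / c) powr (1/p)"
  show thesis
  proof
    show "C > 0" using c by (simp add: C_def)
    fix a n assume a: "a \<in> dirichlet_polys"
    show "norm (a n) \<le> C * real n powr (3 + 2/p) * dp_norm p \<alpha> a"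
    proof (cases "n = 0")
      case True
      then show ?thesis using dirichlet_polysD(1)[OF a] by simp
    next
      case False
      then have n: "0 < n" "1 \<le> real n" by auto
      have "norm (a n) powr p * real n powr (-p) * c \<le> norm (a n) powr p * real n powr (-p) * prob {1/2<..1}"
        using c1 by (intro mult_left_mono) auto
      also have "\<dots> = (\<integral>\<sigma>. norm (a n) powr p * real n powr (-p) * indicator {1/2<..1} \<sigma> \<partial>mu_measure \<alpha>)"
        by simp
      also have "\<dots> \<le> (\<integral>\<sigma>. real n powr (2 * p + 2) * HP p (dp_shift \<sigma> a) \<partial>mu_measure \<alpha>)"
      proof (rule integral_mono)
        show "integrable (mu_measure \<alpha>) (\<lambda>\<sigma>. norm (a n) powr p * real n powr (-p) * indicator {1/2<..1} \<sigma>)"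
          by (intro integrable_mult_right integrable_real_indicator) (auto simp: emeasure_eq_measure)
        show "integrable (mu_measure \<alpha>) (\<lambda>\<sigma>. real n powr (2 * p + 2) * HP p (dp_shift \<sigma> a))"
          using integrable_AP[OF a p] by simp
        fix \<sigma> :: real
        show "norm (a n) powr p * real n powr (-p) * indicator {1/2<..1} \<sigma> \<le> real n powr (2 * p + 2) * HP p (dp_shift \<sigma> a)"
        proof (cases "\<sigma> \<in> {1/2<..1}")
          case True
          have "norm (a n) powr p * real n powr (-p) \<le> norm (a n) powr p * real n powr (-\<sigma> * p)"
            using n True p by (intro mult_left_mono powr_mono) auto
          also have "\<dots> = norm (dp_shift \<sigma> a n) powr p"
            using n by (simp add: dp_shift_def norm_mult powr_mult powr_powr)
          also have "\<dots> \<le> real n powr (2 * p + 2) * HP p (dp_shift \<sigma> a)"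
            by (rule coeff_le_HP[OF dirichlet_polys_shift[OF a] p(1) n(1)])
          finally show ?thesis using True by simp
        next
          case False
          then show ?thesis by (simp add: HP_nonneg)
        qed
      qed
      also have "\<dots> = real n powr (2 * p + 2) * AP p \<alpha> a" by (simp add: AP_def)
      finally have "norm (a n) powr p * (real n powr (-p) * c) * (real n powr p / c)
          \<le> real n powr (2 * p + 2) * AP p \<alpha> a * (real n powr p / c)"
        using c by (intro mult_right_mono) (auto simp: mult.assoc)
      also have "norm (a n) powr p * (real n powr (-p) * c) * (real n powr p / c) = norm (a n) powr p"
        using n c by (simp add: powr_minus field_simps)
      also have "real n powr (2 * p + 2) * AP p \<alpha> a * (real n powr p / c) = 1 / c * real n powr (3 * p + 2) * AP p \<alpha> a"
        by (simp flip: powr_add)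
      finally have "(norm (a n) powr p) powr (1/p) \<le> (1 / c * real n powr (3 * p + 2) * AP p \<alpha> a) powr (1/p)"
        using p by (intro powr_mono2) auto
      also have "\<dots> = C * real n powr (3 + 2/p) * dp_norm p \<alpha> a"
      proof -
        have "(3 * p + 2) * (1/p) = 3 + 2/p" using p by (simp add: field_simps)
        then show ?thesis
          unfolding C_def dp_norm_altdef[OF p(1)] by (simp only: powr_mult powr_powr)
      qed
      finally show ?thesis using p by (simp add: powr_powr)
    qed
  qed
qed

lemma norm_nat_powr: "0 < n \<Longrightarrow> norm (of_nat n powr (s::complex)) = real n powr Re s"
  by (simp add: norm_powr_real_powr)

lemma dp_eval_altdef:
  assumes "finite A" "{n. a n \<noteq> 0} \<subseteq> A"
  shows "dp_eval a s = (\<Sum>n\<in>A. a n * of_nat n powr (-s))"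
  unfolding dp_eval_def by (rule sum.mono_neutral_left) (use assms in auto)

lemma dp_eval_add:
  assumes "a \<in> dirichlet_polys" "b \<in> dirichlet_polys"
  shows "dp_eval (\<lambda>n. a n + b n) s = dp_eval a s + dp_eval b s"
proof -
  have f: "finite ({n. a n \<noteq> 0} \<union> {n. b n \<noteq> 0})" using assms dirichlet_polysD by auto
  show ?thesis
    by (subst (1 2 3) dp_eval_altdef[OF f]) (auto simp: sum.distrib distrib_right)
qed

lemma dp_eval_diff:
  assumes "a \<in> dirichlet_polys" "b \<in> dirichlet_polys"
  shows "dp_eval (\<lambda>n. a n - b n) s = dp_eval a s - dp_eval b s"
proof -
  have f: "finite ({n. a n \<noteq> 0} \<union> {n. b n \<noteq> 0})" using assms dirichlet_polysD by auto
  show ?thesis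
    by (subst (1 2 3) dp_eval_altdef[OF f]) (auto simp: sum_subtractf left_diff_distrib)
qed

text \<open>The abscissa is the exponent of the coefficient bound plus 2, which leaves the
  convergent series of n^(-2).\<close>

lemma dp_eval_le_dp_norm:
  assumes p: "p > 0" "\<alpha> > -1"
  obtains C where "C > 0"
    and "\<And>a s. a \<in> dirichlet_polys \<Longrightarrow> Re s \<ge> 5 + 2/p \<Longrightarrow> norm (dp_eval a s) \<le> C * dp_norm p \<alpha> a"
proof -
  obtain C where C: "C > 0"
    "\<And>a n. a \<in> dirichlet_polys \<Longrightarrow> norm (a n) \<le> C * real n powr (3 + 2/p) * dp_norm p \<alpha> a"
    using coeff_le_dp_norm[OF p] by blast
  define M where "M = (\<Sum>n. real n powr (-2))"
  have sM: "summable (\<lambda>n. real n powr (-2))" by (simp add: summable_real_powr_iff)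
  show thesis
  proof
    show "C * (M + 1) > 0" using C(1) suminf_nonneg[OF sM] by (simp add: M_def add_nonneg_pos)
    fix a and s :: complex assume a: "a \<in> dirichlet_polys" and s: "Re s \<ge> 5 + 2/p"
    have "norm (dp_eval a s) \<le> (\<Sum>n | a n \<noteq> 0. C * dp_norm p \<alpha> a * real n powr (-2))"
      unfolding dp_eval_def
    proof (rule order.trans[OF norm_sum], rule sum_mono)
      fix n assume "n \<in> {n. a n \<noteq> 0}"
      then have n: "0 < n" using dirichlet_polysD(1)[OF a] by (cases n) auto
      have "norm (a n * of_nat n powr (-s)) = norm (a n) * real n powr (- Re s)"
        using n by (simp add: norm_mult norm_nat_powr)
      also have "\<dots> \<le> (C * real n powr (3 + 2/p) * dp_norm p \<alpha> a) * real n powr (- (5 + 2/p))"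
        using n s C(1) by (intro mult_mono C(2) a powr_mono) (auto simp: dp_norm_nonneg)
      also have "\<dots> = C * dp_norm p \<alpha> a * (real n powr (3 + 2/p) * real n powr (- (5 + 2/p)))"
        by simp
      also have "\<dots> = C * dp_norm p \<alpha> a * real n powr (-2)"
        unfolding powr_add[symmetric] by simp
      finally show "norm (a n * of_nat n powr (-s)) \<le> C * dp_norm p \<alpha> a * real n powr (-2)" .
    qed
    also have "\<dots> \<le> C * dp_norm p \<alpha> a * M"
      unfolding sum_distrib_left[symmetric] M_def
      using C(1) dirichlet_polysD(2)[OF a]
      by (intro mult_left_mono sum_le_suminf sM) (auto simp: dp_norm_nonneg)
    also have "\<dots> \<le> C * (M + 1) * dp_norm p \<alpha> a"
      using C(1) by (simp add: algebra_simps dp_norm_nonneg)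
    finally show "norm (dp_eval a s) \<le> C * (M + 1) * dp_norm p \<alpha> a" .
  qed
qed

lemma dp_norm_le_sum:
  assumes a: "a \<in> dirichlet_polys" and p: "p > 0" "\<alpha> > -1" and F: "finite F" "{n. a n \<noteq> 0} \<subseteq> F"
  shows "dp_norm p \<alpha> a \<le> (\<Sum>n\<in>F. norm (a n))"
proof -
  interpret prob_space "mu_measure \<alpha>" by (rule prob_space_mu_measure[OF p(2)])
  have e: "(\<Sum>n | a n \<noteq> 0. norm (a n)) = (\<Sum>n\<in>F. norm (a n))"
    by (rule sum.mono_neutral_left) (use F in auto)
  have "AP p \<alpha> a \<le> (\<integral>\<sigma>. (\<Sum>n\<in>F. norm (a n)) powr p \<partial>mu_measure \<alpha>)"
    unfolding AP_def
  proof (rule integral_mono_AE[OF integrable_AP[OF a p]])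
    show "AE \<sigma> in mu_measure \<alpha>. HP p (dp_shift \<sigma> a) \<le> (\<Sum>n\<in>F. norm (a n)) powr p"
      using AE_mu_measure[of \<alpha>] by (rule eventually_mono) (use HP_shift_le[OF a p(1)] e in simp)
  qed simp
  then have "AP p \<alpha> a \<le> (\<Sum>n\<in>F. norm (a n)) powr p" using prob_space by simp
  then have "AP p \<alpha> a powr (1/p) \<le> ((\<Sum>n\<in>F. norm (a n)) powr p) powr (1/p)"
    using p by (intro powr_mono2) (auto simp: AP_nonneg)
  then show ?thesis using p by (simp add: dp_norm_altdef powr_powr sum_nonneg)
qed

lemma dp_norm_cmult:
  assumes a: "a \<in> dirichlet_polys" and p: "p > 0"
  shows "dp_norm p \<alpha> (\<lambda>n. c * a n) = norm c * dp_norm p \<alpha> a"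
proof -
  have bl: "bohr_lift (\<lambda>n. c * b n) z = c * bohr_lift b z" if "b \<in> dirichlet_polys" for b z
    by (subst bohr_lift_altdef[of "{n. b n \<noteq> 0}"])
      (use dirichlet_polysD[OF that] in \<open>auto simp: bohr_lift_def sum_distrib_left mult.assoc\<close>)
  have "HP p (\<lambda>n. c * b n) = norm c powr p * HP p b" if "b \<in> dirichlet_polys" for b
    unfolding HP_def bl[OF that] by (simp add: norm_mult powr_mult)
  then have "AP p \<alpha> (\<lambda>n. c * a n) = norm c powr p * AP p \<alpha> a"
    unfolding AP_def dp_shift_multiplier using dirichlet_polys_shift[OF a] by simp
  then show ?thesis using p by (simp add: dp_norm_altdef powr_mult powr_powr AP_nonneg)
qed

lemma tnorm_diff_le:
  assumes a: "a \<in> dirichlet_polys" and b: "b \<in> dirichlet_polys" and p: "p > 0" "\<alpha> > -1"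
  shows "tnorm p \<alpha> (\<lambda>n. a n - b n) \<le> tnorm p \<alpha> a + tnorm p \<alpha> b"
  using tnorm_add_le[OF a dirichlet_polys_multiplier[OF b, of "\<lambda>_. -1"] p] dp_norm_cmult[OF b p(1), of \<alpha> "-1"]
  by (simp add: tnorm_def)

lemma tnorm_minus_commute:
  assumes a: "a \<in> dirichlet_polys" and b: "b \<in> dirichlet_polys" and p: "p > 0"
  shows "tnorm p \<alpha> (\<lambda>n. a n - b n) = tnorm p \<alpha> (\<lambda>n. b n - a n)"
  using dp_norm_cmult[OF dirichlet_polys_diff[OF a b] p, of \<alpha> "-1"] by (simp add: tnorm_def)

lemma tnorm_le_add_diff:
  assumes a: "a \<in> dirichlet_polys" and b: "b \<in> dirichlet_polys" and p: "p > 0" "\<alpha> > -1"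
  shows "\<bar>tnorm p \<alpha> a - tnorm p \<alpha> b\<bar> \<le> tnorm p \<alpha> (\<lambda>n. a n - b n)"
  using tnorm_add_le[OF dirichlet_polys_diff[OF a b] b p] tnorm_add_le[OF dirichlet_polys_diff[OF b a] a p]
    tnorm_minus_commute[OF a b p(1), of \<alpha>]
  by simp

lemma tnorm_sum_le:
  assumes "finite I" and "\<And>i. i \<in> I \<Longrightarrow> f i \<in> dirichlet_polys" and p: "p > 0" "\<alpha> > -1"
  shows "tnorm p \<alpha> (\<lambda>n. \<Sum>i\<in>I. f i n) \<le> (\<Sum>i\<in>I. tnorm p \<alpha> (f i))"
  using assms(1,2)
proof (induction I rule: finite_induct)
  case empty
  have "dp_norm p \<alpha> (\<lambda>n. 0) \<le> 0" using dp_norm_le_sum[OF dirichlet_polys_0 p, of "{}"] by simp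
  then have "dp_norm p \<alpha> (\<lambda>n. 0) = 0" using dp_norm_nonneg by (simp add: antisym)
  then show ?case by (simp add: tnorm_def)
next
  case (insert i I)
  have "tnorm p \<alpha> (\<lambda>n. f i n + (\<Sum>i\<in>I. f i n)) \<le> tnorm p \<alpha> (f i) + tnorm p \<alpha> (\<lambda>n. \<Sum>i\<in>I. f i n)"
    using insert.prems by (intro tnorm_add_le p dirichlet_polys_sum) auto
  also have "\<dots> \<le> tnorm p \<alpha> (f i) + (\<Sum>i\<in>I. tnorm p \<alpha> (f i))"
    using insert by simp
  finally show ?case using insert by simp
qed

lemma dp_norm_eq_tnorm: "p > 0 \<Longrightarrow> dp_norm p \<alpha> a = tnorm p \<alpha> a powr (1 / min p 1)"
  by (simp add: tnorm_def powr_powr dp_norm_nonneg)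

lemma dp_norm_tendsto_iff:
  assumes p: "p > 0" and c: "c \<ge> 0"
  shows "(\<lambda>k. tnorm p \<alpha> (X k)) \<longlonglongrightarrow> c powr min p 1 \<longleftrightarrow> (\<lambda>k. dp_norm p \<alpha> (X k)) \<longlonglongrightarrow> c"
proof
  assume "(\<lambda>k. tnorm p \<alpha> (X k)) \<longlonglongrightarrow> c powr min p 1"
  then have "(\<lambda>k. tnorm p \<alpha> (X k) powr (1 / min p 1)) \<longlonglongrightarrow> (c powr min p 1) powr (1 / min p 1)"
    by (rule tendsto_powr2) (use p in \<open>auto simp: tnorm_nonneg\<close>)
  then show "(\<lambda>k. dp_norm p \<alpha> (X k)) \<longlonglongrightarrow> c"
    using p c by (simp add: dp_norm_eq_tnorm powr_powr min_def split: if_splits)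
next
  assume "(\<lambda>k. dp_norm p \<alpha> (X k)) \<longlonglongrightarrow> c"
  then show "(\<lambda>k. tnorm p \<alpha> (X k)) \<longlonglongrightarrow> c powr min p 1"
    unfolding tnorm_def by (rule tendsto_powr2) (use p in \<open>auto simp: dp_norm_nonneg\<close>)
qed

section \<open>Cauchy sequences of Dirichlet polynomials\<close>

text \<open>The radius is not fixed: the growth rate in \<open>d\<close> can be brought as close to
  1 as desired at the expense of a constant that does not depend on \<open>d\<close>.\<close>

lemma tnorm_coeff_le:
  assumes a: "a \<in> dirichlet_polys" and p: "p > 0" "\<alpha> > -1" and r: "0 < r" "r < 1"
  shows "tnorm p \<alpha> (\<lambda>n. of_bool (wt k n = d) * a n)
    \<le> (1 / r powr min p 1) ^ d * (1 - sqrt r) powr (- (2/p) * min p 1) * tnorm p \<alpha> a"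
proof -
  have sr: "sqrt r < 1" using r by simp
  have "tnorm p \<alpha> (\<lambda>n. of_bool (wt k n = d) * a n)
      \<le> (1 / (r ^ d * (1 - sqrt r) powr (2/p)) * dp_norm p \<alpha> a) powr min p 1"
    unfolding tnorm_def using dp_norm_coeff_le[OF a p r] p by (intro powr_mono2) (auto simp: dp_norm_nonneg)
  also have "\<dots> = (1 / (r ^ d * (1 - sqrt r) powr (2/p))) powr min p 1 * tnorm p \<alpha> a"
    by (simp only: powr_mult tnorm_def)
  also have "1 / (r ^ d * (1 - sqrt r) powr (2/p)) = (1 / r) ^ d * (1 - sqrt r) powr (- (2/p))"
    using r by (simp add: powr_minus power_one_over field_simps)
  also have "\<dots> powr min p 1 = ((1 / r) ^ d) powr min p 1 * (1 - sqrt r) powr (- (2/p) * min p 1)"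
    by (simp only: powr_mult powr_powr)
  also have "((1 / r) ^ d) powr min p 1 = (1 / r powr min p 1) ^ d"
  proof -
    have "((1 / r) ^ d) powr min p 1 = (1 / r) powr (real d * min p 1)"
      using r by (simp add: powr_powr flip: powr_realpow)
    also have "\<dots> = ((1 / r) powr min p 1) powr real d"
      by (simp add: powr_powr mult.commute)
    also have "\<dots> = ((1 / r) powr min p 1) ^ d"
      using r by (intro powr_realpow) simp
    also have "(1 / r) powr min p 1 = 1 / r powr min p 1"
      using r by (simp add: powr_divide)
    finally show ?thesis .
  qed
  finally show ?thesis .
qed

lemma tnorm_tendsto_0_of_finite:
  assumes "\<And>k. X k \<in> dirichlet_polys" and p: "p > 0" "\<alpha> > -1" and "finite F"
    and "\<And>k. {n. X k n \<noteq> 0} \<subseteq> F" and "\<And>n. n \<in> F \<Longrightarrow> (\<lambda>k. X k n) \<longlonglongrightarrow> 0"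
  shows "(\<lambda>k. tnorm p \<alpha> (X k)) \<longlonglongrightarrow> 0"
proof -
  have "(\<lambda>k. \<Sum>n\<in>F. norm (X k n)) \<longlonglongrightarrow> (\<Sum>n\<in>F. 0)"
    using assms(6) by (intro tendsto_sum tendsto_norm_zero)
  then have *: "(\<lambda>k. \<Sum>n\<in>F. norm (X k n)) \<longlonglongrightarrow> 0" by simp
  have "(\<lambda>k. dp_norm p \<alpha> (X k)) \<longlonglongrightarrow> 0"
    by (rule tendsto_sandwich[OF _ _ tendsto_const *])
      (intro always_eventually allI dp_norm_nonneg dp_norm_le_sum assms)+
  then show ?thesis
    using dp_norm_tendsto_iff[OF p(1), of 0] p by simp
qed

text \<open>A Fatou lemma for coefficientwise convergence, which implies no pointwise convergence on
  the torus. The variables absent from \<open>b\<close> are set to zero and everything is dilated by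
  \<rho> < 1. Then the slices of the difference to \<open>b\<close> live on finite sets of indices,
  so each tends to 0, and the factor \<rho>^d makes their sum converge uniformly. At the end \<rho>
  tends to 1. Both operations are contractions, which is why no constant appears.\<close>

lemma dp_norm_le_of_coeff_limit:
  assumes Y: "\<And>k. Y k \<in> dirichlet_polys" and b: "b \<in> dirichlet_polys"
    and p: "p > 0" "\<alpha> > -1"
    and bound: "\<And>k. dp_norm p \<alpha> (Y k) \<le> K" and lim: "\<And>n. (\<lambda>k. Y k n) \<longlonglongrightarrow> b n"
  shows "dp_norm p \<alpha> b \<le> K"
proof -
  define t where "t = min p 1"
  have t: "t > 0" using p by (simp add: t_def)
  have K: "K \<ge> 0" using bound[of 0] dp_norm_nonneg[of p \<alpha> "Y 0"] by linarith
  obtain J where J: "\<And>i. b i \<noteq> 0 \<Longrightarrow> i \<le> J"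
    using dirichlet_polysD(2)[OF b] unfolding finite_nat_set_iff_bounded_le by blast
  \<comment> \<open>Variables of index above \<open>J\<close> do not occur in \<open>b\<close>; the
    projection \<open>E\<close> removes them from \<open>Y k\<close> and leaves finitely many
    variables.\<close>
  define kk :: "nat \<Rightarrow> nat" where "kk = (\<lambda>j. of_bool (j > J))"
  define E where "E a n = of_bool (wt kk n = 0) * a n" for a :: "nat \<Rightarrow> complex" and n
  have E: "E a \<in> dirichlet_polys" if "a \<in> dirichlet_polys" for a
    unfolding E_def by (rule dirichlet_polys_multiplier[OF that])
  have Ele: "tnorm p \<alpha> (E a) \<le> tnorm p \<alpha> a" if "a \<in> dirichlet_polys" for a
    unfolding E_def tnorm_def using p dp_norm_keep_le[OF that p] by (intro powr_mono2) (auto simp: dp_norm_nonneg)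
  have Eb: "E b = b"
  proof
    fix n show "E b n = b n"
    proof (cases "b n = 0")
      case False
      then have "n \<le> J" by (rule J)
      then have "wt kk n = 0" unfolding wt_eq_0_iff kk_def by (auto intro: expo_eq_0)
      then show ?thesis by (simp add: E_def)
    qed (simp add: E_def)
  qed
  define Z where "Z k = (\<lambda>n. E (Y k) n - b n)" for k
  have Z: "Z k \<in> dirichlet_polys" for k
    unfolding Z_def by (intro dirichlet_polys_diff E Y b)
  define K1 where "K1 = K powr t + tnorm p \<alpha> b"
  have tY: "tnorm p \<alpha> (Y k) \<le> K powr t" for k
    unfolding tnorm_def t_def using p by (intro powr_mono2 bound) (auto simp: dp_norm_nonneg)
  have ZK: "tnorm p \<alpha> (Z k) \<le> K1" for k
    unfolding Z_def K1_def
    using tnorm_diff_le[OF E[OF Y] b p, of k] Ele[OF Y, of k] tY[of k] by linarith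
  have Zlim: "(\<lambda>k. Z k n) \<longlonglongrightarrow> 0" for n
  proof -
    have "(\<lambda>k. of_bool (wt kk n = 0) * Y k n - b n) \<longlonglongrightarrow> of_bool (wt kk n = 0) * b n - b n"
      by (intro tendsto_diff tendsto_mult tendsto_const lim)
    moreover have "of_bool (wt kk n = 0) * b n - b n = 0" using fun_cong[OF Eb, of n] by (simp add: E_def)
    ultimately show ?thesis by (simp add: Z_def E_def)
  qed
  have supp: "wt kk n = 0 \<and> 0 < n" if "Z k n \<noteq> 0" for k n
  proof -
    have "n \<noteq> 0" using that dirichlet_polysD(1)[OF Z[of k]] by metis
    moreover have "wt kk n = 0"
    proof (rule ccontr)
      assume "wt kk n \<noteq> 0"
      then have "E (Y k) n = 0" "E b n = 0" by (auto simp: E_def)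
      then show False using that Eb by (simp add: Z_def)
    qed
    ultimately show ?thesis by simp
  qed
  define S where "S d a n = of_bool (Om n = d) * a n" for d and a :: "nat \<Rightarrow> complex" and n
  have S: "S d a \<in> dirichlet_polys" if "a \<in> dirichlet_polys" for a d
    unfolding S_def by (rule dirichlet_polys_multiplier[OF that])
  have S0: "(\<lambda>k. tnorm p \<alpha> (S d (Z k))) \<longlonglongrightarrow> 0" for d
  proof (rule tnorm_tendsto_0_of_finite[OF S[OF Z] p])
    show "finite {..nth_prime J ^ d}" by simp
    show "{n. S d (Z k) n \<noteq> 0} \<subseteq> {..nth_prime J ^ d}" for k
    proof
      fix n assume "n \<in> {n. S d (Z k) n \<noteq> 0}"
      then have "Om n = d" "Z k n \<noteq> 0" by (auto simp: S_def)
      then show "n \<in> {..nth_prime J ^ d}"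
        using smooth_le_power_Om[of n J] supp[of k n] by (simp add: kk_def)
    qed
    show "(\<lambda>k. S d (Z k) n) \<longlonglongrightarrow> 0" for n
      unfolding S_def using Zlim[of n] by (rule tendsto_mult_right_zero)
  qed
  define T where "T \<rho> a n = complex_of_real \<rho> ^ Om n * a n" for \<rho> and a :: "nat \<Rightarrow> complex" and n
  have T: "T \<rho> a \<in> dirichlet_polys" if "a \<in> dirichlet_polys" for a \<rho>
    unfolding T_def by (rule dirichlet_polys_multiplier[OF that])
  have Tle: "tnorm p \<alpha> (T \<rho> a) \<le> tnorm p \<alpha> a" if "a \<in> dirichlet_polys" "0 \<le> \<rho>" "\<rho> \<le> 1" for a \<rho>
    unfolding tnorm_def T_def using dp_norm_dilate_le[OF that(1) p that(2,3), of "\<lambda>_. 1"] p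
    by (intro powr_mono2) (auto simp: dp_norm_nonneg)
  have main: "tnorm p \<alpha> (T \<rho> b) \<le> K powr t" if \<rho>: "0 < \<rho>" "\<rho> < 1" for \<rho>
  proof -
    \<comment> \<open>Any radius strictly between \<rho> and 1 works: the slices grow at most like
      r^(-d t), and the dilation contributes \<rho>^(d t), so the ratio \<open>q\<close> is below
      1.\<close>
    define r where "r = (\<rho> + 1) / 2"
    have r: "0 < r" "r < 1" "\<rho> < r" using \<rho> by (auto simp: r_def)
    define c where "c = (1 - sqrt r) powr (- (2/p) * t)"
    define q where "q = \<rho> powr t * (1 / r powr t)"
    have q: "0 \<le> q" "q < 1"
    proof -
      have "\<rho> powr t < r powr t" using r \<rho> t by (intro powr_less_mono2) auto
      then show "0 \<le> q" "q < 1" using r by (auto simp: q_def)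
    qed
    have Sle: "tnorm p \<alpha> (S d (Z k)) \<le> (1 / r powr t) ^ d * c * K1" for d k
    proof -
      have "tnorm p \<alpha> (S d (Z k)) \<le> (1 / r powr t) ^ d * c * tnorm p \<alpha> (Z k)"
        unfolding S_def c_def t_def by (rule tnorm_coeff_le[OF Z p r(1,2)])
      also have "\<dots> \<le> (1 / r powr t) ^ d * c * K1"
        using r by (intro mult_left_mono ZK) (auto simp: c_def)
      finally show ?thesis .
    qed
    define g where "g d k = (\<rho> powr t) ^ d * tnorm p \<alpha> (S d (Z k))" for d k
    have gle: "norm (g d k) \<le> c * K1 * q ^ d" for d k
    proof -
      have "norm (g d k) = (\<rho> powr t) ^ d * tnorm p \<alpha> (S d (Z k))"
        by (simp add: g_def tnorm_nonneg abs_mult)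
      also have "\<dots> \<le> (\<rho> powr t) ^ d * ((1 / r powr t) ^ d * c * K1)"
        by (intro mult_left_mono Sle) auto
      also have "\<dots> = c * K1 * q ^ d" by (simp add: q_def power_mult_distrib power_divide)
      finally show ?thesis .
    qed
    have sq: "summable (\<lambda>d. c * K1 * q ^ d)" using q by (intro summable_mult summable_geometric) simp
    have gs: "summable (\<lambda>d. g d k)" for k
      by (rule summable_comparison_test[OF _ sq]) (intro exI[of _ 0] allI impI gle)
    have "(\<lambda>k. \<Sum>d. g d k) \<longlonglongrightarrow> (\<Sum>d. 0)"
    proof (rule conjunct2[OF conjunct2[OF tannerys_theorem[OF _ _ sq]]])
      show "(\<lambda>k. g d k) \<longlonglongrightarrow> 0" for d
        unfolding g_def by (rule tendsto_mult_right_zero[OF S0])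
      show "\<forall>\<^sub>F (d, k) in at_top \<times>\<^sub>F sequentially. norm (g d k) \<le> c * K1 * q ^ d"
        by (rule always_eventually) (simp only: split_beta gle simp_thms)
    qed simp
    then have "(\<lambda>k. \<Sum>d. g d k) \<longlonglongrightarrow> 0" by simp
    then have glim: "(\<lambda>k. K powr t + (\<Sum>d. g d k)) \<longlonglongrightarrow> K powr t + 0"
      by (intro tendsto_add tendsto_const)
    have le: "tnorm p \<alpha> (T \<rho> b) \<le> K powr t + (\<Sum>d. g d k)" for k
    proof -
      obtain D where D: "\<And>n. Z k n \<noteq> 0 \<Longrightarrow> Om n \<le> D"
      proof -
        have "finite (Om ` {n. Z k n \<noteq> 0})" using dirichlet_polysD(2)[OF Z] by simp
        then obtain D where "\<forall>x\<in>Om ` {n. Z k n \<noteq> 0}. x \<le> D"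
          unfolding finite_nat_set_iff_bounded_le ..
        then show ?thesis using that[of D] by simp
      qed
      have TZ: "T \<rho> (Z k) = (\<lambda>n. \<Sum>d\<le>D. of_real \<rho> ^ d * S d (Z k) n)"
      proof
        fix n
        have "(\<Sum>d\<le>D. of_real \<rho> ^ d * S d (Z k) n) = (\<Sum>d\<le>D. if d = Om n then of_real \<rho> ^ d * Z k n else 0)"
          by (intro sum.cong refl) (simp add: S_def)
        also have "\<dots> = T \<rho> (Z k) n" using D[of n] by (auto simp: T_def)
        finally show "T \<rho> (Z k) n = (\<Sum>d\<le>D. of_real \<rho> ^ d * S d (Z k) n)" ..
      qed
      have "tnorm p \<alpha> (T \<rho> (Z k)) \<le> (\<Sum>d\<le>D. tnorm p \<alpha> (\<lambda>n. of_real \<rho> ^ d * S d (Z k) n))"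
        unfolding TZ by (rule tnorm_sum_le[OF _ dirichlet_polys_multiplier[OF S[OF Z]] p]) simp
      also have "\<dots> = (\<Sum>d\<le>D. g d k)"
      proof (rule sum.cong)
        fix d
        have "tnorm p \<alpha> (\<lambda>n. of_real \<rho> ^ d * S d (Z k) n) = (\<rho> ^ d * dp_norm p \<alpha> (S d (Z k))) powr t"
          unfolding tnorm_def t_def dp_norm_cmult[OF S[OF Z] p(1)] using \<rho> by (simp add: norm_power)
        also have "\<dots> = (\<rho> ^ d) powr t * tnorm p \<alpha> (S d (Z k))"
          by (simp only: powr_mult tnorm_def t_def)
        also have "(\<rho> ^ d) powr t = (\<rho> powr t) ^ d"
          using \<rho> by (simp add: powr_realpow[symmetric] powr_powr mult.commute)
        finally show "tnorm p \<alpha> (\<lambda>n. of_real \<rho> ^ d * S d (Z k) n) = g d k" by (simp add: g_def)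
      qed simp
      also have "\<dots> \<le> (\<Sum>d. g d k)"
        by (intro sum_le_suminf gs) (auto simp: g_def tnorm_nonneg)
      finally have 1: "tnorm p \<alpha> (T \<rho> (Z k)) \<le> (\<Sum>d. g d k)" .
      have "T \<rho> b = (\<lambda>n. T \<rho> (E (Y k)) n - T \<rho> (Z k) n)"
        by (simp add: T_def Z_def fun_eq_iff algebra_simps)
      then have "tnorm p \<alpha> (T \<rho> b) \<le> tnorm p \<alpha> (T \<rho> (E (Y k))) + tnorm p \<alpha> (T \<rho> (Z k))"
        using tnorm_diff_le[OF T[OF E[OF Y]] T[OF Z] p] by simp
      also have "\<dots> \<le> K powr t + (\<Sum>d. g d k)"
        using 1 Tle[OF E[OF Y], of \<rho> k] Ele[OF Y, of k] tY[of k] \<rho> by linarith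
      finally show ?thesis .
    qed
    have "tnorm p \<alpha> (T \<rho> b) \<le> K powr t + 0"
      by (rule LIMSEQ_le_const[OF glim]) (intro exI[of _ 0] allI impI le)
    then show ?thesis by simp
  qed
  define \<rho> where "\<rho> k = 1 - 1 / real (Suc (Suc k))" for k
  have \<rho>: "0 < \<rho> k" "\<rho> k < 1" for k by (auto simp: \<rho>_def)
  have \<rho>lim: "\<rho> \<longlonglongrightarrow> 1"
  proof -
    have "\<rho> \<longlonglongrightarrow> 1 - 0"
      unfolding \<rho>_def by (intro tendsto_diff tendsto_const LIMSEQ_Suc lim_1_over_n)
    then show ?thesis by simp
  qed
  \<comment> \<open>Here \<open>b\<close> is fixed and has finite support, so undoing the dilation
    is a matter of finitely many coefficients.\<close>
  have D0: "(\<lambda>k. tnorm p \<alpha> (\<lambda>n. b n - T (\<rho> k) b n)) \<longlonglongrightarrow> 0"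
  proof (rule tnorm_tendsto_0_of_finite[OF dirichlet_polys_diff[OF b T[OF b]] p dirichlet_polysD(2)[OF b]])
    show "{n. b n - T (\<rho> k) b n \<noteq> 0} \<subseteq> {n. b n \<noteq> 0}" for k by (auto simp: T_def)
    show "(\<lambda>k. b n - T (\<rho> k) b n) \<longlonglongrightarrow> 0" for n
    proof -
      have "(\<lambda>k. b n - T (\<rho> k) b n) \<longlonglongrightarrow> b n - complex_of_real 1 ^ Om n * b n"
        unfolding T_def by (intro tendsto_diff tendsto_mult tendsto_power tendsto_of_real tendsto_const \<rho>lim)
      then show ?thesis by simp
    qed
  qed
  have "tnorm p \<alpha> b \<le> K powr t + tnorm p \<alpha> (\<lambda>n. b n - T (\<rho> k) b n)" for k
    using tnorm_le_add_diff[OF b T[OF b] p, of "\<rho> k"] main[OF \<rho>, of k] by linarith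
  then have "tnorm p \<alpha> b \<le> K powr t + 0"
    by (intro LIMSEQ_le_const[OF tendsto_add[OF tendsto_const D0]]) (rule exI[of _ 0], simp)
  then have "tnorm p \<alpha> b powr (1/t) \<le> (K powr t) powr (1/t)"
    using t by (intro powr_mono2) (auto simp: tnorm_nonneg)
  then show ?thesis
    using t K by (simp add: dp_norm_eq_tnorm[OF p(1)] t_def[symmetric] powr_powr)
qed

lemma dp_CauchyD:
  assumes "dp_Cauchy p \<alpha> X" shows "X k \<in> dirichlet_polys"
    and "e > 0 \<Longrightarrow> \<exists>M. \<forall>k\<ge>M. \<forall>l\<ge>M. dp_norm p \<alpha> (\<lambda>n. X k n - X l n) < e"
  using assms by (simp_all add: dp_Cauchy_def)

lemma dp_Cauchy_coeff_convergent:
  assumes X: "dp_Cauchy p \<alpha> X" and p: "p > 0" "\<alpha> > -1"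
  shows "convergent (\<lambda>k. X k n)"
proof -
  obtain C where C: "C > 0"
    "\<And>a n. a \<in> dirichlet_polys \<Longrightarrow> norm (a n) \<le> C * real n powr (3 + 2/p) * dp_norm p \<alpha> a"
    using coeff_le_dp_norm[OF p] by blast
  \<comment> \<open>The summand 1 keeps \<open>B\<close> positive for \<open>n = 0\<close>, where
    the power is 0.\<close>
  define B where "B = C * real n powr (3 + 2/p) + 1"
  have B: "B > 0" using C(1) by (simp add: B_def add_nonneg_pos)
  have "Cauchy (\<lambda>k. X k n)"
  proof (rule metric_CauchyI)
    fix e :: real assume "e > 0"
    then obtain M where M: "\<forall>k\<ge>M. \<forall>l\<ge>M. dp_norm p \<alpha> (\<lambda>n. X k n - X l n) < e / B"
      using dp_CauchyD(2)[OF X, of "e / B"] B by auto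
    have "dist (X k n) (X l n) < e" if "k \<ge> M" "l \<ge> M" for k l
    proof -
      have "dist (X k n) (X l n) \<le> C * real n powr (3 + 2/p) * dp_norm p \<alpha> (\<lambda>n. X k n - X l n)"
        using C(2)[OF dirichlet_polys_diff[OF dp_CauchyD(1)[OF X] dp_CauchyD(1)[OF X]]]
        by (simp add: dist_norm)
      also have "\<dots> \<le> B * dp_norm p \<alpha> (\<lambda>n. X k n - X l n)"
        by (intro mult_right_mono) (auto simp: B_def dp_norm_nonneg)
      also have "\<dots> < B * (e / B)" using M that B by (intro mult_strict_left_mono) auto
      finally show ?thesis using B by simp
    qed
    then show "\<exists>M. \<forall>m\<ge>M. \<forall>n'\<ge>M. dist (X m n) (X n' n) < e" by (intro exI[of _ M]) simp
  qed
  then show ?thesis by (rule Cauchy_convergent)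
qed

text \<open>For fixed \<open>k\<close> the differences \<open>X k - X l\<close> tend coefficientwise
  to \<open>X k\<close> as \<open>l\<close> grows, so the Fatou property bounds the norm of
  \<open>X k\<close> by the Cauchy bound.\<close>

lemma dp_Cauchy_tendsto_0:
  assumes X: "dp_Cauchy p \<alpha> X" and p: "p > 0" "\<alpha> > -1" and lim: "\<And>n. (\<lambda>k. X k n) \<longlonglongrightarrow> 0"
  shows "(\<lambda>k. dp_norm p \<alpha> (X k)) \<longlonglongrightarrow> 0"
proof (rule LIMSEQ_I)
  fix e :: real assume e: "e > 0"
  then obtain M where M: "\<forall>k\<ge>M. \<forall>l\<ge>M. dp_norm p \<alpha> (\<lambda>n. X k n - X l n) < e / 2"
    using dp_CauchyD(2)[OF X, of "e / 2"] by auto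
  have "dp_norm p \<alpha> (X k) \<le> e / 2" if k: "k \<ge> M" for k
  proof (rule dp_norm_le_of_coeff_limit[of "\<lambda>l n. X k n - X (l + M) n"])
    show "(\<lambda>l. X k n - X (l + M) n) \<longlonglongrightarrow> X k n" for n
      using tendsto_diff[OF tendsto_const LIMSEQ_ignore_initial_segment[OF lim]] by simp
    show "dp_norm p \<alpha> (\<lambda>n. X k n - X (l + M) n) \<le> e / 2" for l
      using M k by (simp add: less_imp_le)
  qed (intro p dirichlet_polys_diff dp_CauchyD(1)[OF X])+
  then have "\<forall>k\<ge>M. norm (dp_norm p \<alpha> (X k) - 0) < e"
    using e by (fastforce simp: dp_norm_nonneg)
  then show "\<exists>no. \<forall>k\<ge>no. norm (dp_norm p \<alpha> (X k) - 0) < e" by blast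
qed

lemma dp_norm_convergent:
  assumes X: "dp_Cauchy p \<alpha> X" and p: "p > 0" "\<alpha> > -1"
  obtains L where "L \<ge> 0" "(\<lambda>k. dp_norm p \<alpha> (X k)) \<longlonglongrightarrow> L"
proof -
  define t where "t = min p 1"
  have t: "t > 0" using p by (simp add: t_def)
  have "Cauchy (\<lambda>k. tnorm p \<alpha> (X k))"
  proof (rule metric_CauchyI)
    fix e :: real assume e: "e > 0"
    then obtain M where M: "\<forall>k\<ge>M. \<forall>l\<ge>M. dp_norm p \<alpha> (\<lambda>n. X k n - X l n) < e powr (1/t)"
      using dp_CauchyD(2)[OF X, of "e powr (1/t)"] by auto
    have "dist (tnorm p \<alpha> (X k)) (tnorm p \<alpha> (X l)) < e" if "k \<ge> M" "l \<ge> M" for k l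
    proof -
      have "dist (tnorm p \<alpha> (X k)) (tnorm p \<alpha> (X l)) \<le> tnorm p \<alpha> (\<lambda>n. X k n - X l n)"
        unfolding dist_real_def by (intro tnorm_le_add_diff dp_CauchyD(1)[OF X] p)
      also have "\<dots> < (e powr (1/t)) powr t"
        unfolding tnorm_def t_def[symmetric] using M that t by (intro powr_less_mono2) (auto simp: dp_norm_nonneg)
      finally show ?thesis using t e by (simp add: powr_powr)
    qed
    then show "\<exists>M. \<forall>m\<ge>M. \<forall>n\<ge>M. dist (tnorm p \<alpha> (X m)) (tnorm p \<alpha> (X n)) < e" by (intro exI[of _ M]) simp
  qed
  then obtain l where l: "(\<lambda>k. tnorm p \<alpha> (X k)) \<longlonglongrightarrow> l"
    using Cauchy_convergent convergent_def by blast
  have l0: "l \<ge> 0" by (rule LIMSEQ_le_const[OF l]) (auto simp: tnorm_nonneg)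
  have "(l powr (1/t)) powr min p 1 = l" using t l0 by (simp add: powr_powr t_def[symmetric])
  then have "(\<lambda>k. dp_norm p \<alpha> (X k)) \<longlonglongrightarrow> l powr (1/t)"
    using dp_norm_tendsto_iff[OF p(1), of "l powr (1/t)" \<alpha> X] l by simp
  then show thesis using that[of "l powr (1/t)"] by simp
qed

lemma dp_norm_bounded:
  assumes X: "dp_Cauchy p \<alpha> X" and p: "p > 0" "\<alpha> > -1"
  obtains K where "K > 0" "\<And>k. dp_norm p \<alpha> (X k) \<le> K"
proof -
  obtain L where "(\<lambda>k. dp_norm p \<alpha> (X k)) \<longlonglongrightarrow> L"
    using dp_norm_convergent[OF X p] by blast
  then have "Bseq (\<lambda>k. dp_norm p \<alpha> (X k))"
    by (intro convergent_imp_Bseq convergentI)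
  then obtain K where K: "K > 0" "\<forall>k. norm (dp_norm p \<alpha> (X k)) \<le> K" unfolding Bseq_def by blast
  have "dp_norm p \<alpha> (X k) \<le> K" for k using spec[OF K(2), of k] by simp
  then show thesis using that[of K] K(1) by blast
qed

text \<open>The leading coefficient of a Dirichlet series is recovered from its values far to the right.\<close>

lemma coeff_limit_eq_0:
  assumes D: "\<And>k. D k \<in> dirichlet_polys" and bound: "\<And>k n. norm (D k n) \<le> C * real n powr A"
    and lim: "\<And>n. (\<lambda>k. D k n) \<longlonglongrightarrow> c n"
    and ev: "\<And>s::real. s \<ge> s1 \<Longrightarrow> (\<lambda>k. dp_eval (D k) (of_real s)) \<longlonglongrightarrow> 0"
  shows "c n = 0"
proof -
  \<comment> \<open>Beyond \<open>A + 2\<close> all terms are dominated by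
    \<open>C * real n powr (-2)\<close> uniformly in \<open>k\<close>, so limit and sum may be
    exchanged.\<close>
  define s2 where "s2 = max s1 (A + 2)"
  have cb: "norm (c n) \<le> C * real n powr A" for n
    by (rule LIMSEQ_le_const2[OF tendsto_norm[OF lim]]) (intro exI[of _ 0] allI impI bound)
  have C0: "C \<ge> 0" using order.trans[OF norm_ge_zero bound[of 0 1]] by simp
  have c0: "c 0 = 0"
    using lim[of 0] dirichlet_polysD(1)[OF D] by (simp add: LIMSEQ_const_iff)
  have sM: "summable (\<lambda>n. C * real n powr (-2))"
    by (rule summable_mult) (simp add: summable_real_powr_iff)
  have tbound: "norm (x * of_nat n powr (- complex_of_real s)) \<le> C * real n powr (-2)"
    if "norm x \<le> C * real n powr A" "n = 0 \<longrightarrow> x = 0" "s \<ge> s2" for x n s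
  proof (cases "n = 0")
    case False
    then have n: "0 < n" by simp
    have "norm (x * of_nat n powr (- complex_of_real s)) = norm x * real n powr (- s)"
      using n by (simp add: norm_mult norm_nat_powr)
    also have "\<dots> \<le> (C * real n powr A) * real n powr (- (A + 2))"
      using that n C0 by (intro mult_mono powr_mono) (auto simp: s2_def)
    also have "\<dots> = C * (real n powr A * real n powr (- (A + 2)))" by (simp only: mult.assoc)
    also have "\<dots> = C * real n powr (-2)" unfolding powr_add[symmetric] by simp
    finally show ?thesis .
  qed (use that in simp)
  have sum0: "(\<Sum>n. c n * of_nat n powr (- complex_of_real s)) = 0" if s: "s \<ge> s2" for s
  proof -
    have e: "(\<Sum>n. D k n * of_nat n powr (- complex_of_real s)) = dp_eval (D k) (of_real s)" for k
      unfolding dp_eval_def by (rule suminf_finite) (auto simp: dirichlet_polysD(2)[OF D])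
    have Db: "norm (D k n * of_nat n powr (- complex_of_real s)) \<le> C * real n powr (-2)" for n k
      by (rule tbound[OF bound _ s]) (use dirichlet_polysD(1)[OF D] in simp)
    have "(\<lambda>k. \<Sum>n. D k n * of_nat n powr (- complex_of_real s)) \<longlonglongrightarrow> (\<Sum>n. c n * of_nat n powr (- complex_of_real s))"
    proof (rule conjunct2[OF conjunct2[OF tannerys_theorem[OF _ _ sM]]])
      show "(\<lambda>k. D k n * of_nat n powr (- complex_of_real s)) \<longlonglongrightarrow> c n * of_nat n powr (- complex_of_real s)" for n
        by (intro tendsto_mult lim tendsto_const)
      show "\<forall>\<^sub>F (n, k) in at_top \<times>\<^sub>F sequentially. norm (D k n * of_nat n powr (- complex_of_real s)) \<le> C * real n powr (-2)"
        by (rule always_eventually) (simp only: split_beta Db simp_thms)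
    qed simp
    moreover have "(\<lambda>k. \<Sum>n. D k n * of_nat n powr (- complex_of_real s)) \<longlonglongrightarrow> 0"
      unfolding e using s by (intro ev) (simp add: s2_def)
    ultimately show ?thesis by (rule LIMSEQ_unique)
  qed
  show ?thesis
  proof (induction n rule: less_induct)
    case (less N)
    show ?case
    proof (cases "N = 0")
      case False
      \<comment> \<open>The ratio by which the first index after \<open>N\<close> loses against
        \<open>N\<close> each time the real part grows by 1.\<close>
      define q where "q = real N / real (Suc N)"
      have q: "0 \<le> q" "q < 1" by (auto simp: q_def)
      define M where "M = (\<Sum>n. C * real n powr (-2)) * real N powr s2"
      have le: "norm (c N) \<le> q ^ u * M" for u
      proof -
        define s where "s = s2 + real u"
        have s: "s \<ge> s2" by (simp add: s_def)
        define f where "f n = c n * of_nat n powr (- complex_of_real s)" for n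
        have nf: "norm (f n) \<le> C * real n powr (-2)" for n
          unfolding f_def by (rule tbound[OF cb _ s]) (simp add: c0)
        have sf: "summable f" by (rule summable_comparison_test[OF _ sM]) (intro exI[of _ 0] allI impI nf)
        have fN: "f N = - (\<Sum>n. f (n + Suc N))"
        proof -
          have "(\<Sum>i<Suc N. f i) = f N"
            using less by (simp add: f_def)
          moreover have "suminf f = 0"
            using sum0[OF s] by (simp add: f_def[abs_def])
          ultimately have "(\<Sum>n. f (n + Suc N)) + f N = 0"
            using suminf_split_initial_segment[OF sf, of "Suc N"] by (simp only:)
          then show ?thesis by (simp only: add_eq_0_iff)
        qed
        \<comment> \<open>Equal to (N+1)^(-u), split so that multiplication by N^s cancels the
          second factor and leaves the decay \<open>q ^ u\<close>.\<close>
        define w where "w = q ^ u * real N powr (- real u)"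
        have w: "w \<ge> 0" using q by (simp add: w_def)
        have b: "norm (f (n + Suc N)) \<le> w * (C * real (n + Suc N) powr (-2))" for n
        proof -
          define m where "m = n + Suc N"
          have m: "real m \<ge> real (Suc N)" "0 < m" by (auto simp: m_def)
          have "complex_of_nat m powr (- complex_of_real s)
              = of_nat m powr (- complex_of_real s2) * of_nat m powr (- complex_of_real u)"
            using m by (simp add: s_def powr_add[symmetric])
          then have "f m = c m * of_nat m powr (- complex_of_real s2) * of_nat m powr (- complex_of_real u)"
            by (simp add: f_def)
          then have "norm (f m) = norm (c m * of_nat m powr (- complex_of_real s2)) * real m powr (- real u)"
            using norm_nat_powr[OF m(2), of "- complex_of_real u"] by (simp add: norm_mult)
          also have "\<dots> \<le> (C * real m powr (-2)) * real (Suc N) powr (- real u)"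
          proof (rule mult_mono)
            show "norm (c m * of_nat m powr (- complex_of_real s2)) \<le> C * real m powr (-2)"
              by (rule tbound[OF cb]) (use m in auto)
            show "real m powr (- real u) \<le> real (Suc N) powr (- real u)"
              using m by (intro powr_mono2') auto
          qed (use C0 in auto)
          also have "real (Suc N) powr (- real u) = w"
            using False by (simp add: w_def q_def powr_minus powr_realpow power_divide field_simps)
          finally show ?thesis by (simp add: m_def mult_ac)
        qed
        have s1: "summable (\<lambda>n. C * real (n + Suc N) powr (-2))"
          using sM by (rule summable_ignore_initial_segment)
        have sm: "summable (\<lambda>n. w * (C * real (n + Suc N) powr (-2)))"
          by (rule summable_mult[OF s1])
        have sn: "summable (\<lambda>n. norm (f (n + Suc N)))"
          by (rule summable_comparison_test[OF _ sm]) (intro exI[of _ 0] allI impI, simp only: real_norm_def abs_norm_cancel b)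
        have "norm (f N) = norm (\<Sum>n. f (n + Suc N))" by (simp add: fN)
        also have "\<dots> \<le> (\<Sum>n. norm (f (n + Suc N)))"
          by (rule summable_norm[OF sn])
        also have "\<dots> \<le> (\<Sum>n. w * (C * real (n + Suc N) powr (-2)))"
          by (rule suminf_le[OF b sn sm])
        also have "\<dots> = w * (\<Sum>n. C * real (n + Suc N) powr (-2))"
          by (rule suminf_mult[OF s1])
        also have "\<dots> \<le> w * (\<Sum>n. C * real n powr (-2))"
        proof (rule mult_left_mono[OF _ w])
          have "(\<Sum>i<Suc N. C * real i powr (-2)) \<ge> 0" using C0 by (intro sum_nonneg) simp
          then show "(\<Sum>n. C * real (n + Suc N) powr (-2)) \<le> (\<Sum>n. C * real n powr (-2))"
            using suminf_split_initial_segment[OF sM, of "Suc N"] by linarith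
        qed
        finally have "norm (f N) * real N powr s \<le> w * (\<Sum>n. C * real n powr (-2)) * real N powr s"
          by (intro mult_right_mono) auto
        moreover have "norm (f N) * real N powr s = norm (c N)"
        proof -
          have "norm (f N) = norm (c N) * real N powr (- s)"
            using False norm_nat_powr[of N "- complex_of_real s"] by (simp add: f_def norm_mult)
          moreover have "real N powr (- s) * real N powr s = 1"
            using False by (simp flip: powr_add)
          ultimately show ?thesis by simp
        qed
        moreover have "real N powr (- real u) * real N powr s = real N powr s2"
          by (simp add: s_def flip: powr_add)
        moreover have "w * (\<Sum>n. C * real n powr (-2)) * real N powr s
            = q ^ u * ((\<Sum>n. C * real n powr (-2)) * (real N powr (- real u) * real N powr s))"
          by (simp only: w_def mult_ac)
        ultimately show ?thesis by (simp only: M_def)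
      qed
      have "(\<lambda>u. q ^ u * M) \<longlonglongrightarrow> 0 * M"
        using q by (intro tendsto_mult tendsto_const LIMSEQ_realpow_zero) auto
      then have "norm (c N) \<le> 0 * M" by (rule LIMSEQ_le_const) (intro exI[of _ 0] allI impI le)
      then show ?thesis by simp
    qed (use c0 in simp)
  qed
qed

section \<open>The norm of the completion is well defined\<close>

lemma bergman_repD:
  assumes "bergman_rep p \<alpha> X f"
  shows "dp_Cauchy p \<alpha> X" "Re s > 1/2 \<Longrightarrow> (\<lambda>k. dp_eval (X k) s) \<longlonglongrightarrow> f s"
  using assms by (auto simp: bergman_rep_def C_half_def)

lemma bergman_rep_diff:
  assumes X: "bergman_rep p \<alpha> X f" and Y: "bergman_rep p \<alpha> Y g" and p: "p > 0" "\<alpha> > -1"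
  shows "bergman_rep p \<alpha> (\<lambda>k n. X k n - Y k n) (\<lambda>s\<in>C_half. f s - g s)"
proof -
  define t where "t = min p 1"
  have t: "t > 0" using p by (simp add: t_def)
  note XD = dp_CauchyD(1)[OF bergman_repD(1)[OF X]]
  note YD = dp_CauchyD(1)[OF bergman_repD(1)[OF Y]]
  have 1: "\<exists>M. \<forall>k\<ge>M. \<forall>l\<ge>M. dp_norm p \<alpha> (\<lambda>n. (X k n - Y k n) - (X l n - Y l n)) < e" if e: "e > 0" for e
  proof -
    define d where "d = (e powr t / 2) powr (1/t)"
    have d: "d > 0" using e by (simp add: d_def)
    obtain M1 where M1: "\<forall>k\<ge>M1. \<forall>l\<ge>M1. dp_norm p \<alpha> (\<lambda>n. X k n - X l n) < d"
      using dp_CauchyD(2)[OF bergman_repD(1)[OF X] d] by blast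
    obtain M2 where M2: "\<forall>k\<ge>M2. \<forall>l\<ge>M2. dp_norm p \<alpha> (\<lambda>n. Y k n - Y l n) < d"
      using dp_CauchyD(2)[OF bergman_repD(1)[OF Y] d] by blast
    have small: "tnorm p \<alpha> a < e powr t / 2" if "dp_norm p \<alpha> a < d" for a
    proof -
      have "tnorm p \<alpha> a < d powr t"
        unfolding tnorm_def t_def[symmetric] using that t by (intro powr_less_mono2) (auto simp: dp_norm_nonneg)
      then show ?thesis using t e by (simp add: d_def powr_powr)
    qed
    have "dp_norm p \<alpha> (\<lambda>n. (X k n - Y k n) - (X l n - Y l n)) < e" if kl: "k \<ge> max M1 M2" "l \<ge> max M1 M2" for k l
    proof -
      have "(\<lambda>n. (X k n - Y k n) - (X l n - Y l n)) = (\<lambda>n. (X k n - X l n) - (Y k n - Y l n))"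
        by (simp add: fun_eq_iff)
      then have "tnorm p \<alpha> (\<lambda>n. (X k n - Y k n) - (X l n - Y l n))
          \<le> tnorm p \<alpha> (\<lambda>n. X k n - X l n) + tnorm p \<alpha> (\<lambda>n. Y k n - Y l n)"
        using tnorm_diff_le[OF dirichlet_polys_diff[OF XD XD] dirichlet_polys_diff[OF YD YD] p] by simp
      also have "\<dots> < e powr t / 2 + e powr t / 2"
        using M1 M2 kl by (intro add_strict_mono small) auto
      finally have "tnorm p \<alpha> (\<lambda>n. (X k n - Y k n) - (X l n - Y l n)) powr (1/t) < (e powr t) powr (1/t)"
        using t by (intro powr_less_mono2) (auto simp: tnorm_nonneg)
      then show ?thesis using t e by (simp add: dp_norm_eq_tnorm[OF p(1)] t_def[symmetric] powr_powr)
    qed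
    then show ?thesis by (intro exI[of _ "max M1 M2"]) simp
  qed
  have 2: "(\<lambda>k. dp_eval (\<lambda>n. X k n - Y k n) s) \<longlonglongrightarrow> f s - g s" if "Re s > 1/2" for s
    unfolding dp_eval_diff[OF XD YD] using that
    by (intro tendsto_diff bergman_repD(2)[OF X] bergman_repD(2)[OF Y])
  show ?thesis
    unfolding bergman_rep_def dp_Cauchy_def
    using 1 2 dirichlet_polys_diff[OF XD YD] by (auto simp: C_half_def)
qed

text \<open>Injectivity of evaluation on the completion: vanishing values force the limits of the
  coefficients to vanish, and a Cauchy sequence with null coefficients is null.\<close>

lemma bergman_rep_0_tendsto_0:
  assumes X: "bergman_rep p \<alpha> X f" and p: "p > 0" "\<alpha> > -1" and f: "\<And>s. Re s > 1/2 \<Longrightarrow> f s = 0"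
  shows "(\<lambda>k. dp_norm p \<alpha> (X k)) \<longlonglongrightarrow> 0"
proof (rule dp_Cauchy_tendsto_0[OF bergman_repD(1)[OF X] p])
  fix n
  note C = bergman_repD(1)[OF X]
  obtain C where C0: "C > 0"
    "\<And>a n. a \<in> dirichlet_polys \<Longrightarrow> norm (a n) \<le> C * real n powr (3 + 2/p) * dp_norm p \<alpha> a"
    using coeff_le_dp_norm[OF p] by blast
  obtain K where K: "K > 0" "\<And>k. dp_norm p \<alpha> (X k) \<le> K"
    using dp_norm_bounded[OF C p] by blast
  obtain c where c: "\<And>n. (\<lambda>k. X k n) \<longlonglongrightarrow> c n"
    using dp_Cauchy_coeff_convergent[OF C p] unfolding convergent_def by metis
  have "c n = 0"
  proof (rule coeff_limit_eq_0[OF dp_CauchyD(1)[OF C] _ c])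
    fix k n
    have "norm (X k n) \<le> C * real n powr (3 + 2/p) * dp_norm p \<alpha> (X k)"
      by (rule C0(2)[OF dp_CauchyD(1)[OF C]])
    also have "\<dots> \<le> C * real n powr (3 + 2/p) * K"
      using C0(1) by (intro mult_left_mono K) auto
    finally show "norm (X k n) \<le> (C * K) * real n powr (3 + 2/p)" by (simp add: mult_ac)
  next
    fix s :: real assume "s \<ge> 1"
    then show "(\<lambda>k. dp_eval (X k) (complex_of_real s)) \<longlonglongrightarrow> 0"
      using bergman_repD(2)[OF X, of "of_real s"] f[of "of_real s"] by simp
  qed
  then show "(\<lambda>k. X k n) \<longlonglongrightarrow> 0" using c[of n] by simp
qed

text \<open>The difference of two representing sequences represents 0, hence is null, and the limits
  of their norms agree. This settles the definite description in \<open>bergman_norm\<close>, which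
  is not unfolded again.\<close>

lemma dp_norm_tendsto_bergman_norm:
  assumes X: "bergman_rep p \<alpha> X f" and p: "p > 0" "\<alpha> > -1"
  shows "(\<lambda>k. dp_norm p \<alpha> (X k)) \<longlonglongrightarrow> bergman_norm p \<alpha> f"
proof -
  obtain L where L: "L \<ge> 0" "(\<lambda>k. dp_norm p \<alpha> (X k)) \<longlonglongrightarrow> L"
    using dp_norm_convergent[OF bergman_repD(1)[OF X] p] by blast
  have "bergman_norm p \<alpha> f = L"
    unfolding bergman_norm_def
  proof (rule the_equality)
    show "\<exists>X. bergman_rep p \<alpha> X f \<and> (\<lambda>k. dp_norm p \<alpha> (X k)) \<longlonglongrightarrow> L" using X L by blast
    fix r assume "\<exists>Y. bergman_rep p \<alpha> Y f \<and> (\<lambda>k. dp_norm p \<alpha> (Y k)) \<longlonglongrightarrow> r"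
    then obtain Y where Y: "bergman_rep p \<alpha> Y f" and r: "(\<lambda>k. dp_norm p \<alpha> (Y k)) \<longlonglongrightarrow> r" by blast
    have r0: "r \<ge> 0" by (rule LIMSEQ_le_const[OF r]) (auto simp: dp_norm_nonneg)
    have "(\<lambda>k. dp_norm p \<alpha> (\<lambda>n. Y k n - X k n)) \<longlonglongrightarrow> 0"
      by (rule bergman_rep_0_tendsto_0[OF bergman_rep_diff[OF Y X p] p]) (simp add: C_half_def)
    then have 0: "(\<lambda>k. tnorm p \<alpha> (\<lambda>n. Y k n - X k n)) \<longlonglongrightarrow> 0"
      using dp_norm_tendsto_iff[OF p(1), of 0] p by simp
    have "(\<lambda>k. tnorm p \<alpha> (Y k) - tnorm p \<alpha> (X k)) \<longlonglongrightarrow> 0"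
    proof (rule Lim_null_comparison[OF _ 0], intro always_eventually allI)
      fix k show "norm (tnorm p \<alpha> (Y k) - tnorm p \<alpha> (X k)) \<le> tnorm p \<alpha> (\<lambda>n. Y k n - X k n)"
        unfolding real_norm_def
        by (intro tnorm_le_add_diff p dp_CauchyD(1)[OF bergman_repD(1)[OF X]]
          dp_CauchyD(1)[OF bergman_repD(1)[OF Y]])
    qed
    moreover have "(\<lambda>k. tnorm p \<alpha> (Y k) - tnorm p \<alpha> (X k)) \<longlonglongrightarrow> r powr min p 1 - L powr min p 1"
      using r L(2) unfolding dp_norm_tendsto_iff[OF p(1) r0, symmetric] dp_norm_tendsto_iff[OF p(1) L(1), symmetric]
      by (rule tendsto_diff)
    ultimately have "r powr min p 1 - L powr min p 1 = 0" using LIMSEQ_unique by blast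
    then have "(r powr min p 1) powr (1 / min p 1) = (L powr min p 1) powr (1 / min p 1)" by simp
    then show "r = L" using r0 L(1) p by (simp add: powr_powr min_def split: if_splits)
  qed
  then show ?thesis using L by simp
qed

section \<open>Products of Dirichlet polynomials\<close>

text \<open>Dirichlet convolution, summed over the two supports instead of over divisors, which
  makes it a finite double sum that can be reordered freely.\<close>

definition dconv :: "(nat \<Rightarrow> complex) \<Rightarrow> (nat \<Rightarrow> complex) \<Rightarrow> nat \<Rightarrow> complex" where
  "dconv a b = (\<lambda>n. \<Sum>i | a i \<noteq> 0. \<Sum>j | b j \<noteq> 0. if i * j = n then a i * b j else 0)"

definition dunit :: "nat \<Rightarrow> complex" where
  "dunit = (\<lambda>n. of_bool (n = 1))"

primrec dpow :: "(nat \<Rightarrow> complex) \<Rightarrow> nat \<Rightarrow> nat \<Rightarrow> complex" where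
  "dpow a 0 = dunit"
| "dpow a (Suc k) = dconv a (dpow a k)"

text \<open>A power series with coefficients \<open>c\<close>, cut off before degree
  \<open>K\<close> and evaluated at \<open>a\<close> in the convolution algebra.\<close>

definition dcomb :: "(nat \<Rightarrow> complex) \<Rightarrow> nat \<Rightarrow> (nat \<Rightarrow> complex) \<Rightarrow> nat \<Rightarrow> complex" where
  "dcomb c K a = (\<lambda>n. \<Sum>i<K. c i * dpow a i n)"

text \<open>Common form of \<open>bohr_lift\<close> and \<open>dp_eval\<close>: both evaluate at a
  completely multiplicative function of \<open>n\<close>, so multiplicativity need be proved only
  once.\<close>

definition eval_char :: "(nat \<Rightarrow> 'a) \<Rightarrow> (nat \<Rightarrow> 'a) \<Rightarrow> 'a::comm_ring_1" where
  "eval_char \<theta> a = (\<Sum>n | a n \<noteq> 0. a n * \<theta> n)"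

lemma eval_char_altdef:
  assumes "finite A" "{n. a n \<noteq> 0} \<subseteq> A"
  shows "eval_char \<theta> a = (\<Sum>n\<in>A. a n * \<theta> n)"
  unfolding eval_char_def by (rule sum.mono_neutral_left) (use assms in auto)

lemma bohr_lift_eval_char: "bohr_lift a z = eval_char (\<lambda>n. bohr_monom n z) a"
  by (simp add: bohr_lift_def eval_char_def)

lemma dp_eval_eval_char: "dp_eval a s = eval_char (\<lambda>n. of_nat n powr (-s)) a"
  by (simp add: dp_eval_def eval_char_def)

lemma dirichlet_polys_pos: "a \<in> dirichlet_polys \<Longrightarrow> a n \<noteq> 0 \<Longrightarrow> 0 < n"
  using dirichlet_polysD(1) by (cases n) auto

lemma dconv_altdef:
  assumes A: "finite A" "{n. a n \<noteq> 0} \<subseteq> A" and B: "finite B" "{n. b n \<noteq> 0} \<subseteq> B"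
  shows "dconv a b n = (\<Sum>i\<in>A. \<Sum>j\<in>B. if i * j = n then a i * b j else 0)"
proof -
  have "(\<Sum>j | b j \<noteq> 0. if i * j = n then a i * b j else 0) = (\<Sum>j\<in>B. if i * j = n then a i * b j else 0)" for i
    by (rule sum.mono_neutral_left) (use B in auto)
  then have "dconv a b n = (\<Sum>i | a i \<noteq> 0. \<Sum>j\<in>B. if i * j = n then a i * b j else 0)"
    by (simp add: dconv_def)
  also have "\<dots> = (\<Sum>i\<in>A. \<Sum>j\<in>B. if i * j = n then a i * b j else 0)"
    by (rule sum.mono_neutral_left) (use A in \<open>auto intro!: sum.neutral split: if_splits\<close>)
  finally show ?thesis .
qed

lemma dconv_nonzeroE:
  assumes "dconv a b n \<noteq> 0"
  obtains i j where "a i \<noteq> 0" "b j \<noteq> 0" "n = i * j"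
proof -
  obtain i where i: "a i \<noteq> 0" "(\<Sum>j | b j \<noteq> 0. if i * j = n then a i * b j else 0) \<noteq> 0"
    using assms sum.not_neutral_contains_not_neutral unfolding dconv_def by blast
  then obtain j where "b j \<noteq> 0" "(if i * j = n then a i * b j else 0) \<noteq> 0"
    using sum.not_neutral_contains_not_neutral by blast
  then show thesis using that[of i j] i(1) by (simp split: if_splits)
qed

lemma dconv_support: "{n. dconv a b n \<noteq> 0} \<subseteq> (\<lambda>(i, j). i * j) ` ({n. a n \<noteq> 0} \<times> {n. b n \<noteq> 0})"
  by (rule subsetI) (auto elim!: dconv_nonzeroE)

lemma dirichlet_polys_dconv:
  assumes "a \<in> dirichlet_polys" "b \<in> dirichlet_polys"
  shows "dconv a b \<in> dirichlet_polys"
proof -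
  have "finite {n. dconv a b n \<noteq> 0}"
    by (rule finite_subset[OF dconv_support]) (use assms dirichlet_polysD in auto)
  moreover have "dconv a b 0 = 0"
  proof (rule ccontr)
    assume "dconv a b 0 \<noteq> 0"
    then obtain i j where "a i \<noteq> 0" "b j \<noteq> 0" "0 = i * j" by (rule dconv_nonzeroE)
    then show False using dirichlet_polys_pos[OF assms(1), of i] dirichlet_polys_pos[OF assms(2), of j] by simp
  qed
  ultimately show ?thesis by (simp add: dirichlet_polys_def)
qed

lemma dirichlet_polys_dunit: "dunit \<in> dirichlet_polys"
proof -
  have "{n. dunit n \<noteq> 0} = {1}" by (auto simp: dunit_def)
  then show ?thesis by (simp add: dirichlet_polys_def dunit_def)
qed

lemma dirichlet_polys_dpow: "a \<in> dirichlet_polys \<Longrightarrow> dpow a k \<in> dirichlet_polys"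
  by (induction k) (simp_all add: dirichlet_polys_dunit dirichlet_polys_dconv)

lemma dirichlet_polys_dcomb: "a \<in> dirichlet_polys \<Longrightarrow> dcomb c K a \<in> dirichlet_polys"
  unfolding dcomb_def by (intro dirichlet_polys_sum dirichlet_polys_multiplier dirichlet_polys_dpow)

lemma eval_char_dconv:
  assumes a: "a \<in> dirichlet_polys" and b: "b \<in> dirichlet_polys"
    and \<theta>: "\<And>i j. 0 < i \<Longrightarrow> 0 < j \<Longrightarrow> \<theta> (i * j) = \<theta> i * \<theta> j"
  shows "eval_char \<theta> (dconv a b) = eval_char \<theta> a * eval_char \<theta> b"
proof -
  let ?A = "{n. a n \<noteq> 0}" and ?B = "{n. b n \<noteq> 0}"
  let ?F = "(\<lambda>(i, j). i * j) ` (?A \<times> ?B)"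
  have F: "finite ?F" using dirichlet_polysD(2)[OF a] dirichlet_polysD(2)[OF b] by simp
  have "eval_char \<theta> (dconv a b) = (\<Sum>n\<in>?F. dconv a b n * \<theta> n)"
    by (rule eval_char_altdef[OF F dconv_support])
  also have "\<dots> = (\<Sum>n\<in>?F. \<Sum>i\<in>?A. \<Sum>j\<in>?B. if i * j = n then a i * b j * \<theta> n else 0)"
    unfolding dconv_def sum_distrib_right by (intro sum.cong refl) simp
  also have "\<dots> = (\<Sum>i\<in>?A. \<Sum>n\<in>?F. \<Sum>j\<in>?B. if i * j = n then a i * b j * \<theta> n else 0)"
    by (rule sum.swap)
  also have "\<dots> = (\<Sum>i\<in>?A. \<Sum>j\<in>?B. \<Sum>n\<in>?F. if i * j = n then a i * b j * \<theta> n else 0)"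
    by (intro sum.cong refl sum.swap)
  also have "\<dots> = (\<Sum>i\<in>?A. \<Sum>j\<in>?B. (a i * \<theta> i) * (b j * \<theta> j))"
  proof (intro sum.cong refl)
    fix i j assume ij: "i \<in> ?A" "j \<in> ?B"
    then have "i * j \<in> ?F" by (intro image_eqI[of _ _ "(i, j)"]) auto
    then have "(\<Sum>n\<in>?F. if i * j = n then a i * b j * \<theta> n else 0) = a i * b j * \<theta> (i * j)"
      using F by (simp add: sum.delta')
    then show "(\<Sum>n\<in>?F. if i * j = n then a i * b j * \<theta> n else 0) = (a i * \<theta> i) * (b j * \<theta> j)"
      using \<theta>[OF dirichlet_polys_pos[OF a] dirichlet_polys_pos[OF b], of i j] ij by (simp add: mult_ac)
  qed
  also have "\<dots> = eval_char \<theta> a * eval_char \<theta> b"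
    by (simp add: eval_char_def sum_product)
  finally show ?thesis .
qed

lemma eval_char_dunit: "eval_char \<theta> dunit = \<theta> 1"
  by (subst eval_char_altdef[of "{1}"]) (auto simp: dunit_def)

lemma eval_char_dpow:
  assumes a: "a \<in> dirichlet_polys"
    and \<theta>: "\<And>i j. 0 < i \<Longrightarrow> 0 < j \<Longrightarrow> \<theta> (i * j) = \<theta> i * \<theta> j" "\<theta> 1 = 1"
  shows "eval_char \<theta> (dpow a k) = eval_char \<theta> a ^ k"
  by (induction k) (simp_all add: eval_char_dunit \<theta>(2)[simplified] eval_char_dconv[OF a dirichlet_polys_dpow[OF a] \<theta>(1)])

lemma eval_char_dcomb:
  assumes a: "a \<in> dirichlet_polys"
    and \<theta>: "\<And>i j. 0 < i \<Longrightarrow> 0 < j \<Longrightarrow> \<theta> (i * j) = \<theta> i * \<theta> j" "\<theta> 1 = 1"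
  shows "eval_char \<theta> (dcomb c K a) = (\<Sum>i<K. c i * eval_char \<theta> a ^ i)"
proof -
  let ?F = "(\<Union>i<K. {n. dpow a i n \<noteq> 0})"
  have F: "finite ?F" using dirichlet_polysD(2)[OF dirichlet_polys_dpow[OF a]] by simp
  have s: "{n. dcomb c K a n \<noteq> 0} \<subseteq> ?F"
  proof
    fix n assume "n \<in> {n. dcomb c K a n \<noteq> 0}"
    then have "(\<Sum>i<K. c i * dpow a i n) \<noteq> 0" by (simp add: dcomb_def)
    then obtain i where "i \<in> {..<K}" "c i * dpow a i n \<noteq> 0"
      by (rule sum.not_neutral_contains_not_neutral)
    then show "n \<in> ?F" by auto
  qed
  have "eval_char \<theta> (dcomb c K a) = (\<Sum>n\<in>?F. \<Sum>i<K. c i * (dpow a i n * \<theta> n))"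
    unfolding eval_char_altdef[OF F s] by (simp add: dcomb_def sum_distrib_right mult.assoc)
  also have "\<dots> = (\<Sum>i<K. c i * (\<Sum>n\<in>?F. dpow a i n * \<theta> n))"
    by (subst sum.swap) (simp add: sum_distrib_left)
  also have "\<dots> = (\<Sum>i<K. c i * eval_char \<theta> (dpow a i))"
    by (intro sum.cong refl arg_cong2[where f="(*)"] eval_char_altdef[symmetric] F) auto
  finally show ?thesis by (simp add: eval_char_dpow[OF a \<theta>])
qed

lemma of_nat_powr_mult:
  "0 < i \<Longrightarrow> 0 < j \<Longrightarrow> complex_of_nat (i * j) powr s = of_nat i powr s * of_nat j powr s"
  unfolding of_nat_mult by (rule powr_times_real) simp_all

lemma bohr_lift_dpow: "a \<in> dirichlet_polys \<Longrightarrow> bohr_lift (dpow a k) z = bohr_lift a z ^ k"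
  unfolding bohr_lift_eval_char by (rule eval_char_dpow) (simp_all add: bohr_monom_mult)

lemma dp_eval_dcomb:
  "a \<in> dirichlet_polys \<Longrightarrow> dp_eval (dcomb c K a) s = (\<Sum>i<K. c i * dp_eval a s ^ i)"
  unfolding dp_eval_eval_char by (rule eval_char_dcomb) (simp_all add: of_nat_powr_mult del: of_nat_mult)

text \<open>Multiplication by a completely multiplicative function is a homomorphism of the
  convolution algebra. The instances are the shifts, with n^(-\<sigma>), and the removal of
  variables, with the indicator of weight 0.\<close>

lemma dconv_multiplier:
  assumes a: "a \<in> dirichlet_polys" and b: "b \<in> dirichlet_polys"
    and \<psi>: "\<And>i j. 0 < i \<Longrightarrow> 0 < j \<Longrightarrow> \<psi> (i * j) = \<psi> i * \<psi> j"
  shows "dconv (\<lambda>n. \<psi> n * a n) (\<lambda>n. \<psi> n * b n) n = \<psi> n * dconv a b n"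
proof -
  let ?A = "{n. a n \<noteq> 0}" and ?B = "{n. b n \<noteq> 0}"
  have "dconv (\<lambda>n. \<psi> n * a n) (\<lambda>n. \<psi> n * b n) n
      = (\<Sum>i\<in>?A. \<Sum>j\<in>?B. if i * j = n then \<psi> i * a i * (\<psi> j * b j) else 0)"
    by (rule dconv_altdef) (use dirichlet_polysD(2)[OF a] dirichlet_polysD(2)[OF b] in auto)
  also have "\<dots> = (\<Sum>i\<in>?A. \<Sum>j\<in>?B. \<psi> n * (if i * j = n then a i * b j else 0))"
  proof (intro sum.cong refl)
    fix i j assume ij: "i \<in> ?A" "j \<in> ?B"
    show "(if i * j = n then \<psi> i * a i * (\<psi> j * b j) else 0) = \<psi> n * (if i * j = n then a i * b j else 0)"
      using \<psi>[OF dirichlet_polys_pos[OF a] dirichlet_polys_pos[OF b], of i j] ij by auto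
  qed
  also have "\<dots> = \<psi> n * dconv a b n" by (simp add: dconv_def sum_distrib_left)
  finally show ?thesis .
qed

lemma dpow_multiplier:
  assumes a: "a \<in> dirichlet_polys"
    and \<psi>: "\<And>i j. 0 < i \<Longrightarrow> 0 < j \<Longrightarrow> \<psi> (i * j) = \<psi> i * \<psi> j" "\<psi> 1 = 1"
  shows "dpow (\<lambda>n. \<psi> n * a n) k = (\<lambda>n. \<psi> n * dpow a k n)"
proof (induction k)
  case 0
  then show ?case using \<psi>(2) by (auto simp: dunit_def fun_eq_iff)
next
  case (Suc k)
  then show ?case
    by (intro ext) (simp add: dconv_multiplier[OF a dirichlet_polys_dpow[OF a] \<psi>(1)])
qed

lemma dcomb_multiplier:
  assumes a: "a \<in> dirichlet_polys"
    and \<psi>: "\<And>i j. 0 < i \<Longrightarrow> 0 < j \<Longrightarrow> \<psi> (i * j) = \<psi> i * \<psi> j" "\<psi> 1 = 1"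
  shows "dcomb c K (\<lambda>n. \<psi> n * a n) = (\<lambda>n. \<psi> n * dcomb c K a n)"
proof -
  have "dpow (\<lambda>n. \<psi> n * a n) i = (\<lambda>n. \<psi> n * dpow a i n)" for i
    by (rule dpow_multiplier[OF a \<psi>])
  then show ?thesis by (simp add: dcomb_def sum_distrib_left mult_ac)
qed

lemma
  assumes a: "a \<in> dirichlet_polys"
  shows dp_shift_dpow: "dp_shift \<sigma> (dpow a k) = dpow (dp_shift \<sigma> a) k"
    and dp_shift_dcomb: "dp_shift \<sigma> (dcomb c K a) = dcomb c K (dp_shift \<sigma> a)"
  unfolding dp_shift_altdef
  by (rule dpow_multiplier[symmetric, OF a] dcomb_multiplier[symmetric, OF a]; simp add: powr_mult)+

text \<open>Applied to the exponent of a marking prime with \<open>d = 1\<close>: that exponent then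
  tells which power of \<open>a\<close> a term comes from.\<close>

lemma dpow_support_wt:
  assumes a: "a \<in> dirichlet_polys" and wt: "\<And>n. a n \<noteq> 0 \<Longrightarrow> wt k n = d"
  shows "dpow a m n \<noteq> 0 \<Longrightarrow> wt k n = m * d"
proof (induction m arbitrary: n)
  case 0
  then show ?case by (simp add: dunit_def split: if_splits)
next
  case (Suc m)
  from Suc.prems have "dconv a (dpow a m) n \<noteq> 0" by simp
  then obtain i j where ij: "a i \<noteq> 0" "dpow a m j \<noteq> 0" "n = i * j" by (rule dconv_nonzeroE)
  then have "wt k n = wt k i + wt k j"
    using dirichlet_polys_pos[OF a] dirichlet_polys_pos[OF dirichlet_polys_dpow[OF a]] by (simp add: wt_mult)
  then show ?case using Suc.IH[OF ij(2)] wt[OF ij(1)] by simp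
qed

text \<open>The sum of absolute values at the real point \<open>s\<close>. It is submultiplicative
  and dominates the values on the half-plane to the right of \<open>s\<close>; at 1/2 it controls
  convergence on all of \<open>C_half\<close>.\<close>

definition l1 :: "real \<Rightarrow> (nat \<Rightarrow> complex) \<Rightarrow> real" where
  "l1 s a = (\<Sum>n | a n \<noteq> 0. norm (a n) * real n powr (-s))"

lemma l1_altdef:
  assumes "finite A" "{n. a n \<noteq> 0} \<subseteq> A"
  shows "l1 s a = (\<Sum>n\<in>A. norm (a n) * real n powr (-s))"
  unfolding l1_def by (rule sum.mono_neutral_left) (use assms in auto)

lemma l1_nonneg: "0 \<le> l1 s a"
  unfolding l1_def by (intro sum_nonneg) simp

lemma l1_dconv_le:
  assumes a: "a \<in> dirichlet_polys" and b: "b \<in> dirichlet_polys"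
  shows "l1 s (dconv a b) \<le> l1 s a * l1 s b"
proof -
  let ?A = "{n. a n \<noteq> 0}" and ?B = "{n. b n \<noteq> 0}"
  let ?F = "(\<lambda>(i, j). i * j) ` (?A \<times> ?B)"
  have F: "finite ?F" using dirichlet_polysD(2)[OF a] dirichlet_polysD(2)[OF b] by simp
  have "l1 s (dconv a b) = (\<Sum>n\<in>?F. norm (dconv a b n) * real n powr (-s))"
    by (rule l1_altdef[OF F dconv_support])
  also have "\<dots> \<le> (\<Sum>n\<in>?F. \<Sum>i\<in>?A. \<Sum>j\<in>?B. if i * j = n then norm (a i) * norm (b j) * real n powr (-s) else 0)"
  proof (rule sum_mono)
    fix n
    have "norm (dconv a b n) \<le> (\<Sum>i\<in>?A. \<Sum>j\<in>?B. if i * j = n then norm (a i) * norm (b j) else 0)"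
      unfolding dconv_def
      by (intro order.trans[OF norm_sum] sum_mono) (simp add: norm_mult)
    then have "norm (dconv a b n) * real n powr (-s)
        \<le> (\<Sum>i\<in>?A. \<Sum>j\<in>?B. if i * j = n then norm (a i) * norm (b j) else 0) * real n powr (-s)"
      by (intro mult_right_mono) auto
    also have "\<dots> = (\<Sum>i\<in>?A. \<Sum>j\<in>?B. if i * j = n then norm (a i) * norm (b j) * real n powr (-s) else 0)"
      unfolding sum_distrib_right by (intro sum.cong refl) simp
    finally show "norm (dconv a b n) * real n powr (-s)
        \<le> (\<Sum>i\<in>?A. \<Sum>j\<in>?B. if i * j = n then norm (a i) * norm (b j) * real n powr (-s) else 0)" .
  qed
  also have "\<dots> = (\<Sum>i\<in>?A. \<Sum>n\<in>?F. \<Sum>j\<in>?B. if i * j = n then norm (a i) * norm (b j) * real n powr (-s) else 0)"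
    by (rule sum.swap)
  also have "\<dots> = (\<Sum>i\<in>?A. \<Sum>j\<in>?B. \<Sum>n\<in>?F. if i * j = n then norm (a i) * norm (b j) * real n powr (-s) else 0)"
    by (intro sum.cong refl sum.swap)
  also have "\<dots> = (\<Sum>i\<in>?A. \<Sum>j\<in>?B. (norm (a i) * real i powr (-s)) * (norm (b j) * real j powr (-s)))"
  proof (intro sum.cong refl)
    fix i j assume ij: "i \<in> ?A" "j \<in> ?B"
    then have "i * j \<in> ?F" by (intro image_eqI[of _ _ "(i, j)"]) auto
    then have "(\<Sum>n\<in>?F. if i * j = n then norm (a i) * norm (b j) * real n powr (-s) else 0)
        = norm (a i) * norm (b j) * real (i * j) powr (-s)"
      using F by (simp add: sum.delta')
    then show "(\<Sum>n\<in>?F. if i * j = n then norm (a i) * norm (b j) * real n powr (-s) else 0)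
        = (norm (a i) * real i powr (-s)) * (norm (b j) * real j powr (-s))"
      by (simp add: powr_mult mult_ac)
  qed
  also have "\<dots> = l1 s a * l1 s b" by (simp add: l1_def sum_product)
  finally show ?thesis .
qed

lemma l1_dpow_le: "a \<in> dirichlet_polys \<Longrightarrow> l1 s (dpow a k) \<le> l1 s a ^ k"
proof (induction k)
  case 0
  have "l1 s dunit = (\<Sum>n\<in>{1}. norm (dunit n) * real n powr (-s))"
    by (rule l1_altdef) (auto simp: dunit_def)
  then show ?case by (simp add: dunit_def)
next
  case (Suc k)
  have "l1 s (dconv a (dpow a k)) \<le> l1 s a * l1 s (dpow a k)"
    by (rule l1_dconv_le[OF Suc.prems dirichlet_polys_dpow[OF Suc.prems]])
  also have "\<dots> \<le> l1 s a * l1 s a ^ k"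
    using Suc by (intro mult_left_mono l1_nonneg) auto
  finally show ?case by simp
qed

lemma coeff_le_l1:
  assumes "a \<in> dirichlet_polys"
  shows "norm (a n) \<le> real n powr s * l1 s a"
proof (cases "a n = 0")
  case False
  then have n: "0 < n" by (rule dirichlet_polys_pos[OF assms])
  have "(\<Sum>i\<in>{n}. norm (a i) * real i powr (-s)) \<le> l1 s a"
    unfolding l1_def by (rule sum_mono2) (use dirichlet_polysD(2)[OF assms] False in auto)
  then have "real n powr s * (norm (a n) * real n powr (-s)) \<le> real n powr s * l1 s a"
    by (intro mult_left_mono) auto
  moreover have "real n powr s * real n powr (-s) = 1" using n by (simp flip: powr_add)
  ultimately show ?thesis by (simp add: mult.left_commute)
qed (simp add: l1_nonneg)

lemma norm_dp_eval_le_l1: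
  assumes a: "a \<in> dirichlet_polys" and "s \<le> Re w"
  shows "norm (dp_eval a w) \<le> l1 s a"
  unfolding dp_eval_def l1_def
proof (rule order.trans[OF norm_sum], rule sum_mono)
  fix n assume "n \<in> {n. a n \<noteq> 0}"
  then have n: "0 < n" using dirichlet_polys_pos[OF a] by simp
  have "norm (a n * of_nat n powr (-w)) = norm (a n) * real n powr (- Re w)"
    using n norm_nat_powr[of n "-w"] by (simp add: norm_mult)
  also have "\<dots> \<le> norm (a n) * real n powr (-s)"
    using n assms(2) by (intro mult_left_mono powr_mono) auto
  finally show "norm (a n * of_nat n powr (-w)) \<le> norm (a n) * real n powr (-s)" .
qed

section \<open>Embeddings and powers\<close>

lemma bohr_monom_powr: "0 < n \<Longrightarrow> bohr_monom n (\<lambda>j. of_real (real (nth_prime j) powr u)) = of_real (real n powr u)"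
  by (induction n rule: nth_prime_factor_induct) (simp_all add: bohr_monom_mult bohr_monom_nth_prime powr_mult)

lemma HP_dilate_all_le:
  assumes a: "a \<in> dirichlet_polys" and p: "p > 0" and \<rho>: "\<And>j. 0 \<le> \<rho> j" "\<And>j. \<rho> j \<le> (1::real)"
  shows "HP p (\<lambda>n. (\<Prod>j<m. of_real (\<rho> j) ^ expo j n) * a n) \<le> HP p a"
proof (induction m)
  case (Suc m)
  define b where "b = (\<lambda>n. (\<Prod>j<m. of_real (\<rho> j) ^ expo j n) * a n)"
  have b: "b \<in> dirichlet_polys" unfolding b_def by (rule dirichlet_polys_multiplier[OF a])
  have "(\<lambda>n. (\<Prod>j<Suc m. of_real (\<rho> j) ^ expo j n) * a n)
      = (\<lambda>n. of_real (\<rho> m) ^ wt (\<lambda>i. if i = m then 1 else 0) n * b n)"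
    by (simp add: wt_single b_def mult_ac fun_eq_iff)
  then have "HP p (\<lambda>n. (\<Prod>j<Suc m. of_real (\<rho> j) ^ expo j n) * a n) \<le> HP p b"
    using HP_dilate_le[OF b p \<rho>] by simp
  then show ?case using Suc by (simp add: b_def)
qed simp

text \<open>Shifting by \<open>u\<close> multiplies each \<open>z j\<close> by the power -u of its
  prime, a number in [0, 1]. The shift is therefore a composition of dilations in single variables,
  finitely many of which act on a given polynomial.\<close>

lemma HP_shift_antimono:
  assumes a: "a \<in> dirichlet_polys" and p: "p > 0" and "\<tau> \<le> \<sigma>"
  shows "HP p (dp_shift \<sigma> a) \<le> HP p (dp_shift \<tau> a)"
proof -
  define u where "u = \<sigma> - \<tau>"
  have u: "u \<ge> 0" using assms(3) by (simp add: u_def)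
  define b where "b = dp_shift \<tau> a"
  have b: "b \<in> dirichlet_polys" unfolding b_def by (rule dirichlet_polys_shift[OF a])
  obtain N where N: "\<And>i. b i \<noteq> 0 \<Longrightarrow> i \<le> N"
    using dirichlet_polysD(2)[OF b] unfolding finite_nat_set_iff_bounded_le by blast
  define \<rho> where "\<rho> j = real (nth_prime j) powr (-u)" for j
  have \<rho>: "0 \<le> \<rho> j" "\<rho> j \<le> 1" for j
  proof -
    have "real (nth_prime j) powr (-u) \<le> real (nth_prime j) powr 0"
      using u prime_ge_1_nat[OF prime_nth_prime[of j]] by (intro powr_mono) auto
    then show "0 \<le> \<rho> j" "\<rho> j \<le> 1" by (simp_all add: \<rho>_def split: if_splits)
  qed
  have "dp_shift \<sigma> a = (\<lambda>n. (\<Prod>j<Suc N. of_real (\<rho> j) ^ expo j n) * b n)"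
  proof
    fix n
    show "dp_shift \<sigma> a n = (\<Prod>j<Suc N. of_real (\<rho> j) ^ expo j n) * b n"
    proof (cases "b n = 0")
      case True
      then have "n = 0 \<or> a n = 0" by (auto simp: b_def dp_shift_def)
      then have "a n = 0" using dirichlet_polysD(1)[OF a] by metis
      then show ?thesis using True by (simp add: dp_shift_def)
    next
      case False
      then have n: "0 < n" "n \<le> N" using dirichlet_polys_pos[OF b] N by auto
      have "(\<Prod>j<Suc N. of_real (\<rho> j) ^ expo j n) = bohr_monom n (\<lambda>j. of_real (\<rho> j))"
        using bohr_monom_altdef[OF n] by (simp only: lessThan_Suc_atMost)
      also have "\<dots> = of_real (real n powr (-u))"
        unfolding \<rho>_def by (rule bohr_monom_powr[OF n(1)])
      finally show ?thesis
        by (simp add: b_def dp_shift_def u_def mult.left_commute powr_diff powr_minus flip: of_real_mult)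
          (simp add: powr_add[symmetric] powr_minus[symmetric] field_simps)
    qed
  qed
  then show ?thesis using HP_dilate_all_le[OF b p, of \<rho> "Suc N"] \<rho> by (simp add: b_def)
qed

lemma ennreal_AP:
  assumes a: "a \<in> dirichlet_polys" and p: "p > 0" "\<alpha> > -1"
  shows "ennreal (AP p \<alpha> a) = (\<integral>\<^sup>+\<sigma>. ennreal (mu_density \<alpha> \<sigma> * HP p (dp_shift \<sigma> a)) \<partial>lborel)"
proof -
  have [measurable]: "(\<lambda>\<sigma>. HP p (dp_shift \<sigma> a)) \<in> borel_measurable borel"
    by (rule measurable_HP_shift[OF a])
  have "ennreal (AP p \<alpha> a) = (\<integral>\<^sup>+\<sigma>. ennreal (HP p (dp_shift \<sigma> a)) \<partial>mu_measure \<alpha>)"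
    unfolding AP_def by (intro nn_integral_eq_integral[symmetric] integrable_AP a p AE_I2 HP_nonneg)
  also have "\<dots> = (\<integral>\<^sup>+\<sigma>. ennreal (mu_density \<alpha> \<sigma>) * ennreal (HP p (dp_shift \<sigma> a)) \<partial>lborel)"
    unfolding mu_measure_altdef by (rule nn_integral_density) measurable
  also have "\<dots> = (\<integral>\<^sup>+\<sigma>. ennreal (mu_density \<alpha> \<sigma> * HP p (dp_shift \<sigma> a)) \<partial>lborel)"
    by (intro nn_integral_cong) (simp add: ennreal_mult' mu_density_nonneg[OF p(2)])
  finally show ?thesis .
qed

lemma young_powr:
  fixes x y t :: real
  assumes "0 < t" "t < 1" "0 \<le> x" "0 \<le> y"
  shows "x powr t * y powr (1 - t) \<le> t * x + (1 - t) * y"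
proof (cases "x = 0 \<or> y = 0")
  case False
  then show ?thesis using assms by (intro Youngs_inequality_0) auto
next
  case True
  then show ?thesis using assms by auto
qed

text \<open>Weighted means with a free parameter \<open>h\<close>. Letting \<open>h\<close> depend
  on \<sigma> and on the norm replaces Hoelder's inequality in both integrations.\<close>

lemma young_scaled:
  fixes x y t h :: real
  assumes t: "0 < t" "t < 1" and "0 \<le> x" "0 \<le> y" "0 < h"
  shows "x powr t * y powr (1 - t) \<le> t * h * x + (1 - t) * h powr (- t / (1 - t)) * y"
proof -
  have "x powr t * y powr (1 - t) = (h * x) powr t * (h powr (- t / (1 - t)) * y) powr (1 - t)"
  proof -
    have "h powr t * (h powr (- t / (1 - t))) powr (1 - t) = 1"
      using assms by (simp add: powr_powr flip: powr_add)
    then show ?thesis by (simp add: powr_mult mult_ac)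
  qed
  also have "\<dots> \<le> t * (h * x) + (1 - t) * (h powr (- t / (1 - t)) * y)"
    using assms by (intro young_powr) auto
  finally show ?thesis by (simp add: mult.assoc)
qed

text \<open>Young's inequality is used with
  \<open>h = s * \<sigma> powr (\<alpha> - \<beta>)\<close>. Multiplied by \<sigma>^\<beta>, its
  first term carries the weight \<sigma>^\<alpha> of the source, and the second is the explicit
  power \<sigma>^\<gamma>, independent of \<open>a\<close>.\<close>

lemma AP_embed_less:
  assumes r: "0 < r" "r < p" and \<alpha>: "\<alpha> > -1" and \<beta>: "\<beta> > -1" and c: "r * (\<alpha> + 1) < p * (\<beta> + 1)"
  obtains C where "C > 0" "\<And>a. a \<in> dirichlet_polys \<Longrightarrow> AP r \<beta> a \<le> C * AP p \<alpha> a powr (r/p)"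
proof -
  define t where "t = r / p"
  have p: "p > 0" using r by simp
  have t: "0 < t" "t < 1" using r by (auto simp: t_def)
  define k\<alpha> where "k\<alpha> = 2 powr (\<alpha>+1) / Gamma (\<alpha>+1)"
  define k\<beta> where "k\<beta> = 2 powr (\<beta>+1) / Gamma (\<beta>+1)"
  have k: "k\<alpha> > 0" "k\<beta> > 0"
    using Gamma_real_pos[of "\<alpha>+1"] Gamma_real_pos[of "\<beta>+1"] \<alpha> \<beta> by (auto simp: k\<alpha>_def k\<beta>_def)
  \<comment> \<open>The exponent \<gamma> exceeds -1, so that the second term is integrable at 0,
    exactly under the hypothesis \<open>r * (\<alpha> + 1) < p * (\<beta> + 1)\<close>.\<close>
  define \<gamma> where "\<gamma> = (\<beta> - \<alpha> * t) / (1 - t)"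
  have \<gamma>: "\<gamma> + 1 > 0"
  proof -
    have "t * (\<alpha> + 1) < \<beta> + 1" using c p by (simp add: t_def field_simps)
    then have "0 < (\<beta> - \<alpha> * t) + (1 - t)" by (simp add: algebra_simps)
    moreover have "\<gamma> + 1 = ((\<beta> - \<alpha> * t) + (1 - t)) / (1 - t)" using t by (simp add: \<gamma>_def add_divide_distrib)
    ultimately show ?thesis using t by simp
  qed
  define G where "G = Gamma (\<gamma> + 1) / 2 powr (\<gamma> + 1)"
  have G: "G > 0" using Gamma_real_pos[of "\<gamma>+1"] \<gamma> by (auto simp: G_def)
  define C where "C = t * k\<beta> / k\<alpha> + (1 - t) * k\<beta> * G"
  have C: "C > 0" using t k G by (simp add: C_def add_pos_pos)
  show thesis
  proof
    show "C > 0" by (rule C)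
    fix a assume a: "a \<in> dirichlet_polys"
    have HPr: "HP r b \<le> t * h * HP p b + (1 - t) * h powr (- t / (1 - t))" if b: "b \<in> dirichlet_polys" and h: "h > 0" for b h
    proof -
      have "HP r b \<le> (\<integral>z. t * h * norm (bohr_lift b z) powr p + (1 - t) * h powr (- t / (1 - t)) \<partial>torus_measure)"
        unfolding HP_def
      proof (rule integral_mono)
        show "integrable torus_measure (\<lambda>z. norm (bohr_lift b z) powr r)" by (rule integrable_HP[OF b r(1)])
        show "integrable torus_measure (\<lambda>z. t * h * norm (bohr_lift b z) powr p + (1 - t) * h powr (- t / (1 - t)))"
          using integrable_HP[OF b p] by simp
        fix z
        show "norm (bohr_lift b z) powr r \<le> t * h * norm (bohr_lift b z) powr p + (1 - t) * h powr (- t / (1 - t))"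
          using young_scaled[OF t, of "norm (bohr_lift b z) powr p" 1 h] h p by (simp add: powr_powr t_def)
      qed
      also have "\<dots> = t * h * HP p b + (1 - t) * h powr (- t / (1 - t))"
        using integrable_HP[OF b p] torus.prob_space by (simp add: HP_def)
      finally show ?thesis .
    qed
    have main: "AP r \<beta> a \<le> C * A powr t" if A: "A > 0" "AP p \<alpha> a \<le> A" for A
    proof -
      \<comment> \<open>This choice balances the two terms: both become multiples of
        \<open>A powr t\<close>.\<close>
      define s where "s = A powr (t - 1)"
      have s: "s > 0" using A by (simp add: s_def)
      define c1 where "c1 = t * s * k\<beta> / k\<alpha>"
      define c2 where "c2 = (1 - t) * s powr (- t / (1 - t)) * k\<beta>"
      have c12: "c1 \<ge> 0" "c2 \<ge> 0" using t s k by (auto simp: c1_def c2_def)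
      have pw: "mu_density \<beta> \<sigma> * HP r (dp_shift \<sigma> a)
          \<le> c1 * (mu_density \<alpha> \<sigma> * HP p (dp_shift \<sigma> a)) + c2 * (indicator {0<..} \<sigma> * (\<sigma> powr (\<gamma> + 1 - 1) * exp (- 2 * \<sigma>)))" for \<sigma>
      proof (cases "\<sigma> > 0")
        case True
        define H where "H = HP p (dp_shift \<sigma> a)"
        have "HP r (dp_shift \<sigma> a) \<le> t * (s * \<sigma> powr (\<alpha> - \<beta>)) * H + (1 - t) * (s * \<sigma> powr (\<alpha> - \<beta>)) powr (- t / (1 - t))"
          unfolding H_def by (rule HPr[OF dirichlet_polys_shift[OF a]]) (use s True in simp)
        then have "k\<beta> * \<sigma> powr \<beta> * exp (-2 * \<sigma>) * HP r (dp_shift \<sigma> a)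
            \<le> k\<beta> * \<sigma> powr \<beta> * exp (-2 * \<sigma>) * (t * (s * \<sigma> powr (\<alpha> - \<beta>)) * H + (1 - t) * (s * \<sigma> powr (\<alpha> - \<beta>)) powr (- t / (1 - t)))"
          using k by (intro mult_left_mono) auto
        also have "\<dots> = t * s * k\<beta> * exp (-2 * \<sigma>) * (\<sigma> powr \<beta> * \<sigma> powr (\<alpha> - \<beta>)) * H
            + (1 - t) * s powr (- t / (1 - t)) * k\<beta> * exp (-2 * \<sigma>) * (\<sigma> powr \<beta> * (\<sigma> powr (\<alpha> - \<beta>)) powr (- t / (1 - t)))"
          by (simp add: powr_mult algebra_simps)
        also have "\<sigma> powr \<beta> * \<sigma> powr (\<alpha> - \<beta>) = \<sigma> powr \<alpha>" by (simp flip: powr_add)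
        also have "\<sigma> powr \<beta> * (\<sigma> powr (\<alpha> - \<beta>)) powr (- t / (1 - t)) = \<sigma> powr \<gamma>"
        proof -
          have "\<beta> + (\<alpha> - \<beta>) * (- t / (1 - t)) = \<gamma>" using t by (simp add: \<gamma>_def field_simps)
          then show ?thesis by (simp add: powr_powr flip: powr_add)
        qed
        finally show ?thesis
          using True k by (simp add: mu_density_def c1_def c2_def H_def mult_ac flip: k\<alpha>_def k\<beta>_def)
      next
        case False
        then show ?thesis by (simp add: mu_density_def)
      qed
      have [measurable]: "(\<lambda>\<sigma>. HP p (dp_shift \<sigma> a)) \<in> borel_measurable borel"
        by (rule measurable_HP_shift[OF a])
      have "ennreal (AP r \<beta> a) \<le> (\<integral>\<^sup>+\<sigma>. ennreal c1 * ennreal (mu_density \<alpha> \<sigma> * HP p (dp_shift \<sigma> a))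
          + ennreal c2 * ennreal (indicator {0<..} \<sigma> * (\<sigma> powr (\<gamma> + 1 - 1) * exp (- 2 * \<sigma>))) \<partial>lborel)"
        unfolding ennreal_AP[OF a r(1) \<beta>]
      proof (rule nn_integral_mono)
        fix \<sigma>
        have "ennreal (mu_density \<beta> \<sigma> * HP r (dp_shift \<sigma> a)) \<le> ennreal (c1 * (mu_density \<alpha> \<sigma> * HP p (dp_shift \<sigma> a))
            + c2 * (indicator {0<..} \<sigma> * (\<sigma> powr (\<gamma> + 1 - 1) * exp (- 2 * \<sigma>))))"
          by (intro ennreal_leI pw)
        also have "\<dots> = ennreal c1 * ennreal (mu_density \<alpha> \<sigma> * HP p (dp_shift \<sigma> a))
            + ennreal c2 * ennreal (indicator {0<..} \<sigma> * (\<sigma> powr (\<gamma> + 1 - 1) * exp (- 2 * \<sigma>)))"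
          using c12 mu_density_nonneg[OF \<alpha>] HP_nonneg by (simp add: ennreal_plus ennreal_mult' del: ennreal_plus[symmetric])
        finally show "ennreal (mu_density \<beta> \<sigma> * HP r (dp_shift \<sigma> a)) \<le> ennreal c1 * ennreal (mu_density \<alpha> \<sigma> * HP p (dp_shift \<sigma> a))
            + ennreal c2 * ennreal (indicator {0<..} \<sigma> * (\<sigma> powr (\<gamma> + 1 - 1) * exp (- 2 * \<sigma>)))" .
      qed
      also have "\<dots> = ennreal c1 * ennreal (AP p \<alpha> a) + ennreal c2 * ennreal G"
        unfolding ennreal_AP[OF a p \<alpha>] G_def nn_integral_powr_exp[OF \<gamma> zero_less_numeral, symmetric]
        by (subst nn_integral_add) (simp_all add: nn_integral_cmult)
      also have "\<dots> = ennreal (c1 * AP p \<alpha> a + c2 * G)"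
      proof -
        have "ennreal (c1 * AP p \<alpha> a + c2 * G) = ennreal (c1 * AP p \<alpha> a) + ennreal (c2 * G)"
          using c12 G by (intro ennreal_plus) (auto simp: AP_nonneg)
        also have "ennreal (c1 * AP p \<alpha> a) = ennreal c1 * ennreal (AP p \<alpha> a)"
          using c12 by (intro ennreal_mult) (auto simp: AP_nonneg)
        also have "ennreal (c2 * G) = ennreal c2 * ennreal G"
          using c12 G by (intro ennreal_mult) auto
        finally show ?thesis ..
      qed
      finally have "AP r \<beta> a \<le> c1 * AP p \<alpha> a + c2 * G"
        using c12 G by (subst (asm) ennreal_le_iff) (auto simp: AP_nonneg)
      also have "\<dots> \<le> c1 * A + c2 * G"
        using c12 A by (intro add_right_mono mult_left_mono) auto
      also have "\<dots> = C * A powr t"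
      proof -
        have "s * A = A powr t" using A by (simp add: s_def powr_diff)
        moreover have "s powr (- t / (1 - t)) = A powr t"
        proof -
          have "(t - 1) * (- t / (1 - t)) = t" using t by (simp add: field_simps)
          then show ?thesis by (simp add: s_def powr_powr)
        qed
        moreover have "c1 * A = t * k\<beta> / k\<alpha> * (s * A)" by (simp add: c1_def)
        moreover have "C * A powr t = t * k\<beta> / k\<alpha> * A powr t + (1 - t) * A powr t * k\<beta> * G"
          by (simp add: C_def distrib_right)
        ultimately show ?thesis by (simp only: c2_def)
      qed
      finally show ?thesis .
    qed
    \<comment> \<open>A negative power of \<open>A\<close> occurs above, so \<open>A\<close> must be
      positive although the norm may vanish; the bound is obtained in the limit.\<close>
    have lim: "(\<lambda>n. C * (AP p \<alpha> a + 1 / real (Suc n)) powr t) \<longlonglongrightarrow> C * (AP p \<alpha> a + 0) powr t"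
      by (intro tendsto_mult tendsto_const tendsto_powr2 tendsto_add LIMSEQ_Suc lim_1_over_n)
        (use t AP_nonneg[of p \<alpha> a] in \<open>auto intro!: always_eventually\<close>)
    have "AP r \<beta> a \<le> C * (AP p \<alpha> a + 0) powr t"
    proof (rule LIMSEQ_le_const[OF lim], intro exI[of _ 0] allI impI main)
      show "0 < AP p \<alpha> a + 1 / real (Suc n)" "AP p \<alpha> a \<le> AP p \<alpha> a + 1 / real (Suc n)" for n
        using AP_nonneg[of p \<alpha> a] by (auto intro: add_nonneg_pos)
    qed
    then show "AP r \<beta> a \<le> C * AP p \<alpha> a powr (r/p)" by (simp add: t_def)
  qed
qed

text \<open>For \<sigma> up to 1 the weights compare directly. For larger \<sigma> the moment is at
  most its value at 1, which in turn is at most a multiple of its average over (1/2, 1].\<close>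

lemma AP_embed_eq:
  assumes p: "p > 0" and \<alpha>: "\<alpha> > -1" and \<beta>: "\<alpha> \<le> \<beta>"
  obtains C where "C > 0" "\<And>a. a \<in> dirichlet_polys \<Longrightarrow> AP p \<beta> a \<le> C * AP p \<alpha> a"
proof -
  have \<beta>1: "\<beta> > -1" using \<alpha> \<beta> by simp
  interpret A: prob_space "mu_measure \<alpha>" by (rule prob_space_mu_measure[OF \<alpha>])
  interpret B: prob_space "mu_measure \<beta>" by (rule prob_space_mu_measure[OF \<beta>1])
  define k\<alpha> where "k\<alpha> = 2 powr (\<alpha>+1) / Gamma (\<alpha>+1)"
  define k\<beta> where "k\<beta> = 2 powr (\<beta>+1) / Gamma (\<beta>+1)"
  have k: "k\<alpha> > 0" "k\<beta> > 0"
    using Gamma_real_pos[of "\<alpha>+1"] Gamma_real_pos[of "\<beta>+1"] \<alpha> \<beta>1 by (auto simp: k\<alpha>_def k\<beta>_def)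
  obtain c where c: "c > 0" "\<And>\<delta>. 0 < \<delta> \<Longrightarrow> \<delta> \<le> 1 \<Longrightarrow> c * \<delta> powr (\<alpha> + 1) \<le> A.prob {\<delta>/2<..\<delta>}"
    using mu_measure_interval_ge[OF \<alpha>] by blast
  define C where "C = k\<beta> / k\<alpha> + 1 / c"
  show thesis
  proof
    show "C > 0" using k c by (simp add: C_def add_pos_pos)
    fix a assume a: "a \<in> dirichlet_polys"
    define H where "H \<sigma> = HP p (dp_shift \<sigma> a)" for \<sigma>
    have H0: "H \<sigma> \<ge> 0" for \<sigma> by (simp add: H_def HP_nonneg)
    have [measurable]: "H \<in> borel_measurable borel"
      unfolding H_def by (rule measurable_HP_shift[OF a])
    have pw: "mu_density \<beta> \<sigma> * H \<sigma> \<le> k\<beta> / k\<alpha> * (mu_density \<alpha> \<sigma> * H \<sigma>) + H 1 * mu_density \<beta> \<sigma>" for \<sigma>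
    proof (cases "0 < \<sigma> \<and> \<sigma> \<le> 1")
      case True
      have "\<sigma> powr \<beta> \<le> \<sigma> powr \<alpha>" using True \<beta> by (intro powr_mono') auto
      then have "k\<beta> * exp (-2 * \<sigma>) * H \<sigma> * \<sigma> powr \<beta> \<le> k\<beta> * exp (-2 * \<sigma>) * H \<sigma> * \<sigma> powr \<alpha>"
        using k H0 by (intro mult_left_mono) auto
      then have "mu_density \<beta> \<sigma> * H \<sigma> \<le> k\<beta> / k\<alpha> * (mu_density \<alpha> \<sigma> * H \<sigma>)"
        using True k by (simp add: mu_density_def mult_ac flip: k\<alpha>_def k\<beta>_def)
      moreover have "0 \<le> H 1 * mu_density \<beta> \<sigma>" by (intro mult_nonneg_nonneg H0 mu_density_nonneg \<beta>1)
      ultimately show ?thesis by linarith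
    next
      case False
      show ?thesis
      proof (cases "\<sigma> > 0")
        case True
        then have "H \<sigma> \<le> H 1" unfolding H_def using False by (intro HP_shift_antimono a p) auto
        then have "mu_density \<beta> \<sigma> * H \<sigma> \<le> mu_density \<beta> \<sigma> * H 1"
          by (intro mult_left_mono mu_density_nonneg \<beta>1)
        moreover have "0 \<le> k\<beta> / k\<alpha> * (mu_density \<alpha> \<sigma> * H \<sigma>)"
          using k by (intro mult_nonneg_nonneg H0 mu_density_nonneg \<alpha>) auto
        ultimately show ?thesis by (simp add: mult.commute)
      qed (simp add: mu_density_def)
    qed
    have "ennreal (AP p \<beta> a) \<le> (\<integral>\<^sup>+\<sigma>. ennreal (k\<beta> / k\<alpha>) * ennreal (mu_density \<alpha> \<sigma> * H \<sigma>) + ennreal (H 1) * ennreal (mu_density \<beta> \<sigma>) \<partial>lborel)"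
      unfolding ennreal_AP[OF a p \<beta>1]
    proof (rule nn_integral_mono)
      fix \<sigma>
      have "ennreal (mu_density \<beta> \<sigma> * H \<sigma>) \<le> ennreal (k\<beta> / k\<alpha> * (mu_density \<alpha> \<sigma> * H \<sigma>) + H 1 * mu_density \<beta> \<sigma>)"
        by (intro ennreal_leI pw)
      also have "\<dots> = ennreal (k\<beta> / k\<alpha> * (mu_density \<alpha> \<sigma> * H \<sigma>)) + ennreal (H 1 * mu_density \<beta> \<sigma>)"
        using k by (intro ennreal_plus mult_nonneg_nonneg H0 mu_density_nonneg \<alpha> \<beta>1) auto
      also have "\<dots> = ennreal (k\<beta> / k\<alpha>) * ennreal (mu_density \<alpha> \<sigma> * H \<sigma>) + ennreal (H 1) * ennreal (mu_density \<beta> \<sigma>)"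
        using k by (intro arg_cong2[where f="(+)"] ennreal_mult mult_nonneg_nonneg H0 mu_density_nonneg \<alpha> \<beta>1) auto
      finally show "ennreal (mu_density \<beta> \<sigma> * HP p (dp_shift \<sigma> a))
          \<le> ennreal (k\<beta> / k\<alpha>) * ennreal (mu_density \<alpha> \<sigma> * H \<sigma>) + ennreal (H 1) * ennreal (mu_density \<beta> \<sigma>)"
        by (simp add: H_def)
    qed
    also have "\<dots> = ennreal (k\<beta> / k\<alpha>) * (\<integral>\<^sup>+\<sigma>. ennreal (mu_density \<alpha> \<sigma> * H \<sigma>) \<partial>lborel)
        + ennreal (H 1) * (\<integral>\<^sup>+\<sigma>. ennreal (mu_density \<beta> \<sigma>) \<partial>lborel)"
      by (subst nn_integral_add) (simp_all add: nn_integral_cmult)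
    also have "(\<integral>\<^sup>+\<sigma>. ennreal (mu_density \<alpha> \<sigma> * H \<sigma>) \<partial>lborel) = ennreal (AP p \<alpha> a)"
      unfolding H_def by (rule ennreal_AP[OF a p \<alpha>, symmetric])
    also have "(\<integral>\<^sup>+\<sigma>. ennreal (mu_density \<beta> \<sigma>) \<partial>lborel) = 1"
      using B.emeasure_space_1 by (simp add: mu_measure_altdef emeasure_density)
    also have "ennreal (k\<beta> / k\<alpha>) * ennreal (AP p \<alpha> a) + ennreal (H 1) * 1 = ennreal (k\<beta> / k\<alpha> * AP p \<alpha> a + H 1)"
      using k H0[of 1] AP_nonneg[of p \<alpha> a] by (simp add: ennreal_mult'[symmetric] flip: ennreal_plus)
    finally have 1: "AP p \<beta> a \<le> k\<beta> / k\<alpha> * AP p \<alpha> a + H 1"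
      using k H0[of 1] AP_nonneg[of p \<alpha> a] by (subst (asm) ennreal_le_iff) auto
    have "H 1 * c \<le> (\<integral>\<sigma>. H 1 * indicator {1/2<..1} \<sigma> \<partial>mu_measure \<alpha>)"
      using c(2)[of 1] H0[of 1] by (simp add: mult_left_mono)
    also have "\<dots> \<le> AP p \<alpha> a"
      unfolding AP_def
    proof (rule integral_mono[OF _ integrable_AP[OF a p \<alpha>]])
      show "integrable (mu_measure \<alpha>) (\<lambda>\<sigma>. H 1 * indicator {1/2<..1} \<sigma>)"
        by (intro integrable_mult_right integrable_real_indicator) (auto simp: A.emeasure_eq_measure)
      show "H 1 * indicator {1/2<..1} \<sigma> \<le> HP p (dp_shift \<sigma> a)" for \<sigma>
        using HP_shift_antimono[OF a p, of \<sigma> 1] HP_nonneg[of p "dp_shift \<sigma> a"] by (auto simp: H_def indicator_def)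
    qed
    finally have "H 1 \<le> AP p \<alpha> a / c" using c(1) by (simp add: pos_le_divide_eq)
    with 1 show "AP p \<beta> a \<le> C * AP p \<alpha> a" by (simp add: C_def distrib_right)
  qed
qed

text \<open>If \<open>r\<close> is not below \<open>p\<close>, the second condition excludes
  \<alpha> > \<beta>, and the first then forces \<open>r = p\<close>.\<close>

lemma AP_embed:
  assumes r: "0 < r" and p: "p > 0" and \<alpha>: "\<alpha> > -1" and \<beta>: "\<beta> > -1"
    and c1: "\<alpha> \<le> \<beta> \<Longrightarrow> r \<le> p" and c2: "\<alpha> > \<beta> \<Longrightarrow> r * (\<alpha> + 1) < p * (\<beta> + 1)"
  obtains C where "C > 0" "\<And>a. a \<in> dirichlet_polys \<Longrightarrow> AP r \<beta> a \<le> C * AP p \<alpha> a powr (r/p)"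
proof (cases "r < p")
  case True
  have "r * (\<alpha> + 1) < p * (\<beta> + 1)"
  proof (cases "\<alpha> \<le> \<beta>")
    case le: True
    have "r * (\<alpha> + 1) < p * (\<alpha> + 1)" using True \<alpha> by simp
    also have "\<dots> \<le> p * (\<beta> + 1)" using le p by simp
    finally show ?thesis .
  qed (use c2 in simp)
  from AP_embed_less[OF r True \<alpha> \<beta> this] show thesis using that by blast
next
  case False
  have le: "\<alpha> \<le> \<beta>"
  proof (rule ccontr)
    assume "\<not> \<alpha> \<le> \<beta>"
    then have "r * (\<alpha> + 1) < p * (\<beta> + 1)" "p * (\<beta> + 1) \<le> r * (\<alpha> + 1)"
      using c2 False \<beta> p r mult_mono[of p r "\<beta> + 1" "\<alpha> + 1"] by auto
    then show False by simp
  qed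
  then have "r = p" using c1 False by simp
  from AP_embed_eq[OF p \<alpha> le] obtain C where "C > 0" "\<And>a. a \<in> dirichlet_polys \<Longrightarrow> AP p \<beta> a \<le> C * AP p \<alpha> a"
    by blast
  then show thesis using that[of C] \<open>r = p\<close> p by (simp add: AP_nonneg)
qed

section \<open>Powers and polynomials are uniformly continuous on bounded sets\<close>

lemma bohr_lift_diff:
  assumes "a \<in> dirichlet_polys" "b \<in> dirichlet_polys"
  shows "bohr_lift (\<lambda>n. a n - b n) z = bohr_lift a z - bohr_lift b z"
proof -
  have f: "finite ({n. a n \<noteq> 0} \<union> {n. b n \<noteq> 0})" using assms dirichlet_polysD by auto
  show ?thesis
    by (subst (1 2 3) bohr_lift_altdef[OF f]) (auto simp: sum_subtractf left_diff_distrib)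
qed

lemma dp_shift_diff: "dp_shift \<sigma> (\<lambda>n. a n - b n) = (\<lambda>n. dp_shift \<sigma> a n - dp_shift \<sigma> b n)"
  by (simp add: dp_shift_def left_diff_distrib)

lemma AP_le_pointwise:
  assumes c: "c \<in> dirichlet_polys" and a: "a \<in> dirichlet_polys" and b1: "b1 \<in> dirichlet_polys" and b2: "b2 \<in> dirichlet_polys"
    and q: "q > 0" and r: "r > 0" and \<beta>: "\<beta> > -1"
    and le: "\<And>\<sigma> z. norm (bohr_lift (dp_shift \<sigma> c) z) powr q \<le> A * norm (bohr_lift (dp_shift \<sigma> a) z) powr r
      + B * (norm (bohr_lift (dp_shift \<sigma> b1) z) powr r + norm (bohr_lift (dp_shift \<sigma> b2) z) powr r)"
  shows "AP q \<beta> c \<le> A * AP r \<beta> a + B * (AP r \<beta> b1 + AP r \<beta> b2)"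
proof -
  note i = integrable_AP[OF a r \<beta>] integrable_AP[OF b1 r \<beta>] integrable_AP[OF b2 r \<beta>]
  have HPle: "HP q (dp_shift \<sigma> c) \<le> A * HP r (dp_shift \<sigma> a) + B * (HP r (dp_shift \<sigma> b1) + HP r (dp_shift \<sigma> b2))" for \<sigma>
  proof -
    note j = integrable_HP[OF dirichlet_polys_shift[OF a] r, of \<sigma>]
      integrable_HP[OF dirichlet_polys_shift[OF b1] r, of \<sigma>] integrable_HP[OF dirichlet_polys_shift[OF b2] r, of \<sigma>]
    have "HP q (dp_shift \<sigma> c) \<le> (\<integral>z. A * norm (bohr_lift (dp_shift \<sigma> a) z) powr r
      + B * (norm (bohr_lift (dp_shift \<sigma> b1) z) powr r + norm (bohr_lift (dp_shift \<sigma> b2) z) powr r) \<partial>torus_measure)"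
      unfolding HP_def
      by (rule integral_mono[OF integrable_HP[OF dirichlet_polys_shift[OF c] q] _ le]) (use j in simp)
    also have "\<dots> = A * HP r (dp_shift \<sigma> a) + B * (HP r (dp_shift \<sigma> b1) + HP r (dp_shift \<sigma> b2))"
      using j by (simp add: HP_def)
    finally show ?thesis .
  qed
  have "AP q \<beta> c \<le> (\<integral>\<sigma>. A * HP r (dp_shift \<sigma> a) + B * (HP r (dp_shift \<sigma> b1) + HP r (dp_shift \<sigma> b2)) \<partial>mu_measure \<beta>)"
    unfolding AP_def by (rule integral_mono[OF integrable_AP[OF c q \<beta>] _ HPle]) (use i in simp)
  also have "\<dots> = A * AP r \<beta> a + B * (AP r \<beta> b1 + AP r \<beta> b2)" using i by (simp add: AP_def)
  finally show ?thesis .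
qed

lemma norm_power_diff_le:
  fixes u v :: complex
  shows "norm (u ^ j - v ^ j) \<le> real j * norm (u - v) * (norm u + norm v) ^ (j - 1)"
proof (induction j)
  case (Suc j)
  have e: "u ^ Suc j - v ^ Suc j = u * (u ^ j - v ^ j) + (u - v) * v ^ j"
    by (simp add: algebra_simps)
  have "norm (u ^ Suc j - v ^ Suc j) \<le> norm u * norm (u ^ j - v ^ j) + norm (u - v) * norm v ^ j"
    unfolding e by (rule order.trans[OF norm_triangle_ineq]) (simp add: norm_mult norm_power)
  also have "\<dots> \<le> norm u * (real j * norm (u - v) * (norm u + norm v) ^ (j - 1)) + norm (u - v) * (norm u + norm v) ^ j"
    using Suc by (intro add_mono mult_left_mono power_mono) auto
  also have "norm u * (real j * norm (u - v) * (norm u + norm v) ^ (j - 1)) \<le> real j * norm (u - v) * (norm u + norm v) ^ j"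
  proof (cases j)
    case (Suc i)
    have "real j * norm (u - v) * (norm u + norm v) ^ i * norm u \<le> real j * norm (u - v) * (norm u + norm v) ^ i * (norm u + norm v)"
      by (intro mult_left_mono) auto
    then show ?thesis using Suc by (simp add: mult_ac)
  qed simp
  finally show ?case by (simp add: algebra_simps)
qed simp

lemma powr_add_le_two:
  fixes x y r :: real
  assumes "x \<ge> 0" "y \<ge> 0" "r > 0"
  shows "(x + y) powr r \<le> 2 powr r * (x powr r + y powr r)"
proof -
  have "(x + y) powr r \<le> (2 * max x y) powr r" using assms by (intro powr_mono2) auto
  also have "\<dots> = 2 powr r * max x y powr r" by (simp add: powr_mult)
  also have "\<dots> \<le> 2 powr r * (x powr r + y powr r)"
    by (intro mult_left_mono) (auto simp: max_def)
  finally show ?thesis .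
qed

lemma AP_dpow:
  assumes a: "a \<in> dirichlet_polys" and j: "j > 0"
  shows "AP q \<beta> (dpow a j) = AP (q * real j) \<beta> a"
proof -
  have "norm (x ^ j) powr q = norm x powr (q * real j)" for x :: complex
  proof (cases "x = 0")
    case False
    then have "norm x ^ j = norm x powr real j" by (simp add: powr_realpow)
    then show ?thesis by (simp add: norm_power powr_powr mult.commute)
  qed (use j in simp)
  then show ?thesis
    unfolding AP_def HP_def dp_shift_dpow[OF a] bohr_lift_dpow[OF dirichlet_polys_shift[OF a]] by simp
qed

text \<open>The degree condition of the theorem with denominators cleared; \<open>q * real j\<close>
  is the exponent \<open>r\<close> of the embedding that controls the \<open>j\<close>-th
  power.\<close>

definition admissible :: "real \<Rightarrow> real \<Rightarrow> real \<Rightarrow> real \<Rightarrow> nat \<Rightarrow> bool" where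
  "admissible p \<alpha> q \<beta> j \<longleftrightarrow> (\<alpha> \<le> \<beta> \<longrightarrow> q * real j \<le> p) \<and> (\<alpha> > \<beta> \<longrightarrow> q * real j * (\<alpha> + 1) < p * (\<beta> + 1))"

lemma AP_dpow_le:
  assumes p: "p > 0" "\<alpha> > -1" and q: "q > 0" "\<beta> > -1" and adm: "admissible p \<alpha> q \<beta> j" and j: "j > 0"
  obtains C where "C > 0" "\<And>a. a \<in> dirichlet_polys \<Longrightarrow> AP (q * real j) \<beta> a \<le> C * dp_norm p \<alpha> a powr (q * real j)"
proof -
  obtain C where C: "C > 0" "\<And>a. a \<in> dirichlet_polys \<Longrightarrow> AP (q * real j) \<beta> a \<le> C * AP p \<alpha> a powr (q * real j / p)"
    using AP_embed[of "q * real j" p \<alpha> \<beta>] p q adm j unfolding admissible_def by auto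
  have "AP p \<alpha> a powr (q * real j / p) = dp_norm p \<alpha> a powr (q * real j)" for a
    using p by (simp add: dp_norm_altdef powr_powr)
  then show thesis using that C by simp
qed

text \<open>The difference of powers is |u - v| times a factor of degree \<open>j - 1\<close>, and
  Young's inequality separates the two. First the weight \<open>D\<close> of the merely bounded part
  is made small, whatever the size of \<open>A\<close>; then \<delta> is chosen depending on
  \<open>A\<close>. For \<open>j = 1\<close> the second factor is trivial and the exponent
  \<open>t\<close> would be 1, so this case is separate, as is \<open>j = 0\<close>.\<close>

lemma dpow_diff_small:
  assumes p: "p > 0" "\<alpha> > -1" and q: "q > 0" "\<beta> > -1" and adm: "admissible p \<alpha> q \<beta> j" and e: "e > 0"
  obtains \<delta> where "\<delta> > 0" "\<And>X Y. X \<in> dirichlet_polys \<Longrightarrow> Y \<in> dirichlet_polys \<Longrightarrow> dp_norm p \<alpha> X \<le> B \<Longrightarrow> dp_norm p \<alpha> Y \<le> B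
    \<Longrightarrow> dp_norm p \<alpha> (\<lambda>n. X n - Y n) < \<delta> \<Longrightarrow> AP q \<beta> (\<lambda>n. dpow X j n - dpow Y j n) < e"
proof (cases "j = 0")
  case True
  have "AP q \<beta> (\<lambda>n. 0) = 0"
    using dp_norm_le_sum[OF dirichlet_polys_0 q, of "{}"] dp_norm_nonneg[of q \<beta> "\<lambda>_. 0"] AP_nonneg[of q \<beta> "\<lambda>_. 0"] q
    by (simp add: dp_norm_altdef)
  then show thesis using that[of 1] e True by simp
next
  case j: False
  define r where "r = q * real j"
  have r: "r > 0" using q j by (simp add: r_def)
  obtain C where C: "C > 0" "\<And>a. a \<in> dirichlet_polys \<Longrightarrow> AP r \<beta> a \<le> C * dp_norm p \<alpha> a powr r"
    using AP_dpow_le[OF p q adm] j unfolding r_def by auto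
  obtain A D where AD: "A \<ge> 0" "D \<ge> 0" "4 * D * C * (\<bar>B\<bar> powr r) < e"
    and pw: "\<And>u v :: complex. norm (u ^ j - v ^ j) powr q \<le> A * norm (u - v) powr r + D * (norm u powr r + norm v powr r)"
  proof (cases "j = 1")
    case True
    show thesis by (rule that[of 1 0]) (use e True in \<open>auto simp: r_def\<close>)
  next
    case False
    then have j2: "j \<ge> 2" using j by simp
    define t where "t = 1 / real j"
    have t: "0 < t" "t < 1" using j2 by (auto simp: t_def)
    define k where "k = real j powr q"
    have k: "k > 0" using j by (simp add: k_def)
    \<comment> \<open>Makes \<open>4 * D * C * \<bar>B\<bar> powr r\<close> at most
      \<open>e / 2\<close>; adding 1 to the power of \<open>B\<close> avoids a zero denominator. The
      next parameter \<open>h\<close> is then determined by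
      \<open>h powr (- t / (1 - t)) = \<eta>\<close>.\<close>
    define \<eta> where "\<eta> = e / (8 * k * 2 powr r * C * (\<bar>B\<bar> powr r + 1))"
    have \<eta>: "\<eta> > 0" using e k C by (simp add: \<eta>_def add_nonneg_pos)
    define h where "h = \<eta> powr (- (1 - t) / t)"
    have h: "h > 0" using \<eta> by (simp add: h_def)
    have "(- (1 - t) / t) * (- t / (1 - t)) = 1" using t by (simp add: field_simps)
    then have h\<eta>: "h powr (- t / (1 - t)) = \<eta>" using \<eta> by (simp add: h_def powr_powr)
    define A where "A = k * t * h"
    define D where "D = k * \<eta> * 2 powr r"
    show thesis
    proof (rule that[of A D])
      show "A \<ge> 0" "D \<ge> 0" using k t h \<eta> by (auto simp: A_def D_def)
      have "4 * D * C * \<bar>B\<bar> powr r \<le> 4 * D * C * (\<bar>B\<bar> powr r + 1)"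
        using k \<eta> C by (intro mult_left_mono) (auto simp: D_def)
      also have "\<dots> = \<eta> * (4 * k * 2 powr r * C * (\<bar>B\<bar> powr r + 1))" by (simp add: D_def mult_ac)
      also have "\<dots> = e / 2"
      proof -
        define w where "w = k * 2 powr r * C * (\<bar>B\<bar> powr r + 1)"
        have w: "w > 0" using k C by (simp add: w_def add_nonneg_pos)
        have "\<eta> = e / (8 * w)" by (simp add: \<eta>_def w_def mult_ac)
        moreover have "\<eta> * (4 * k * 2 powr r * C * (\<bar>B\<bar> powr r + 1)) = \<eta> * (4 * w)" by (simp add: w_def mult_ac)
        ultimately show ?thesis using w by simp
      qed
      finally show "4 * D * C * \<bar>B\<bar> powr r < e" using e by simp
      fix u v :: complex
      define S where "S = norm u + norm v"
      have S: "S \<ge> 0" by (simp add: S_def)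
      have x: "(norm (u - v) powr r) powr t = norm (u - v) powr q"
        using j by (simp add: powr_powr r_def t_def)
      have y: "(S powr r) powr (1 - t) = (S ^ (j - 1)) powr q"
      proof (cases "S = 0")
        case True then show ?thesis using j2 by simp
      next
        case False
        then have "S ^ (j - 1) = S powr real (j - 1)" using S by (simp add: powr_realpow)
        moreover have "r * (1 - t) = real (j - 1) * q" using j by (simp add: r_def t_def field_simps of_nat_diff)
        ultimately show ?thesis by (simp add: powr_powr)
      qed
      have "norm (u ^ j - v ^ j) powr q \<le> (real j * norm (u - v) * S ^ (j - 1)) powr q"
        unfolding S_def using norm_power_diff_le[of u j v] q by (intro powr_mono2) auto
      also have "\<dots> = k * ((norm (u - v) powr r) powr t * (S powr r) powr (1 - t))"
        unfolding x y k_def by (simp only: powr_mult mult.assoc)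
      also have "\<dots> \<le> k * (t * h * norm (u - v) powr r + (1 - t) * h powr (- t / (1 - t)) * S powr r)"
        using k t h by (intro mult_left_mono young_scaled) auto
      also have "\<dots> \<le> k * (t * h * norm (u - v) powr r + 1 * \<eta> * (2 powr r * (norm u powr r + norm v powr r)))"
      proof -
        have "S powr r \<le> 2 powr r * (norm u powr r + norm v powr r)"
          unfolding S_def by (rule powr_add_le_two) (use r in auto)
        then have "(1 - t) * \<eta> * S powr r \<le> 1 * \<eta> * (2 powr r * (norm u powr r + norm v powr r))"
          using t \<eta> by (intro mult_mono) auto
        then show ?thesis unfolding h\<eta> using k by (intro mult_left_mono add_left_mono) auto
      qed
      also have "\<dots> = A * norm (u - v) powr r + D * (norm u powr r + norm v powr r)"
        by (simp add: A_def D_def algebra_simps)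
      finally show "norm (u ^ j - v ^ j) powr q \<le> A * norm (u - v) powr r + D * (norm u powr r + norm v powr r)" .
    qed
  qed
  \<comment> \<open>Chosen so that \<open>A * C * \<delta> powr r\<close> is at most
    \<open>e / 2\<close>; the summand 1 covers \<open>A = 0\<close>.\<close>
  define \<delta> where "\<delta> = (e / (2 * (A * C + 1))) powr (1/r)"
  have AC: "A * C \<ge> 0" using AD C by simp
  show thesis
  proof (rule that[of \<delta>])
    show "\<delta> > 0" using e AC by (simp add: \<delta>_def)
    fix X Y assume X: "X \<in> dirichlet_polys" and Y: "Y \<in> dirichlet_polys"
      and XB: "dp_norm p \<alpha> X \<le> B" and YB: "dp_norm p \<alpha> Y \<le> B" and d: "dp_norm p \<alpha> (\<lambda>n. X n - Y n) < \<delta>"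
    note XY = dirichlet_polys_diff[OF X Y]
    have "AP q \<beta> (\<lambda>n. dpow X j n - dpow Y j n) \<le> A * AP r \<beta> (\<lambda>n. X n - Y n) + D * (AP r \<beta> X + AP r \<beta> Y)"
    proof (rule AP_le_pointwise[OF dirichlet_polys_diff[OF dirichlet_polys_dpow[OF X] dirichlet_polys_dpow[OF Y]] XY X Y q(1) r q(2)])
      fix \<sigma> z
      show "norm (bohr_lift (dp_shift \<sigma> (\<lambda>n. dpow X j n - dpow Y j n)) z) powr q
          \<le> A * norm (bohr_lift (dp_shift \<sigma> (\<lambda>n. X n - Y n)) z) powr r
          + D * (norm (bohr_lift (dp_shift \<sigma> X) z) powr r + norm (bohr_lift (dp_shift \<sigma> Y) z) powr r)"
        unfolding dp_shift_diff dp_shift_dpow[OF X] dp_shift_dpow[OF Y]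
          bohr_lift_diff[OF dirichlet_polys_dpow[OF dirichlet_polys_shift[OF X]] dirichlet_polys_dpow[OF dirichlet_polys_shift[OF Y]]]
          bohr_lift_diff[OF dirichlet_polys_shift[OF X] dirichlet_polys_shift[OF Y]]
          bohr_lift_dpow[OF dirichlet_polys_shift[OF X]] bohr_lift_dpow[OF dirichlet_polys_shift[OF Y]]
        by (rule pw)
    qed
    also have "\<dots> \<le> A * (C * \<delta> powr r) + D * (C * \<bar>B\<bar> powr r + C * \<bar>B\<bar> powr r)"
    proof (intro add_mono mult_left_mono)
      have mono: "AP r \<beta> a \<le> C * w powr r" if "a \<in> dirichlet_polys" "dp_norm p \<alpha> a \<le> w" for a w
      proof -
        have "dp_norm p \<alpha> a powr r \<le> w powr r" using that r by (intro powr_mono2) (auto simp: dp_norm_nonneg)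
        then have "C * dp_norm p \<alpha> a powr r \<le> C * w powr r" using C by (intro mult_left_mono) auto
        then show ?thesis using C(2)[OF that(1)] by linarith
      qed
      show "AP r \<beta> (\<lambda>n. X n - Y n) \<le> C * \<delta> powr r" by (rule mono[OF XY]) (use d in simp)
      show "AP r \<beta> X \<le> C * \<bar>B\<bar> powr r" by (rule mono[OF X]) (use XB in simp)
      show "AP r \<beta> Y \<le> C * \<bar>B\<bar> powr r" by (rule mono[OF Y]) (use YB in simp)
    qed (use AD in auto)
    also have "\<dots> = (A * C) * (e / (2 * (A * C + 1))) + 2 * D * C * \<bar>B\<bar> powr r"
      using r e AC by (simp add: \<delta>_def powr_powr mult_ac)
    also have "\<dots> < e / 2 + e / 2"
    proof (rule add_le_less_mono)
      have "A * C * e \<le> (A * C + 1) * e" using e by (intro mult_right_mono) auto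
      then show "(A * C) * (e / (2 * (A * C + 1))) \<le> e / 2" using AC by (simp add: field_simps)
      show "2 * D * C * \<bar>B\<bar> powr r < e / 2" using AD(3) by simp
    qed
    finally show "AP q \<beta> (\<lambda>n. dpow X j n - dpow Y j n) < e" by simp
  qed
qed

lemma admissible_le:
  assumes "admissible p \<alpha> q \<beta> j" "i \<le> j" "q > 0" "\<alpha> > -1"
  shows "admissible p \<alpha> q \<beta> i"
proof -
  have 1: "q * real i \<le> q * real j" using assms by simp
  then have "q * real i * (\<alpha> + 1) \<le> q * real j * (\<alpha> + 1)" using assms by (intro mult_right_mono) auto
  with 1 show ?thesis using assms(1) unfolding admissible_def by linarith
qed

lemma dcomb_diff_small:
  assumes p: "p > 0" "\<alpha> > -1" and q: "q > 0" "\<beta> > -1" and adm: "\<And>i. i < K \<Longrightarrow> admissible p \<alpha> q \<beta> i" and e: "e > 0"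
  obtains \<delta> where "\<delta> > 0" "\<And>X Y. X \<in> dirichlet_polys \<Longrightarrow> Y \<in> dirichlet_polys \<Longrightarrow> dp_norm p \<alpha> X \<le> B \<Longrightarrow> dp_norm p \<alpha> Y \<le> B
    \<Longrightarrow> dp_norm p \<alpha> (\<lambda>n. X n - Y n) < \<delta> \<Longrightarrow> dp_norm q \<beta> (\<lambda>n. dcomb c K X n - dcomb c K Y n) < e"
proof -
  define t where "t = min q 1"
  have t: "t > 0" using q by (simp add: t_def)
  \<comment> \<open>An equal share of \<open>e powr t\<close> for each term; \<open>K + 1\<close> in
    place of \<open>K\<close> yields strict inequality, and \<open>norm (c i) + 1\<close> allows for
    vanishing coefficients.\<close>
  define w where "w i = e powr t / (real K + 1) / ((norm (c i) + 1) powr t)" for i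
  have cpos: "(norm (c i) + 1) powr t > 0" for i
  proof -
    have "norm (c i) + 1 \<noteq> 0" using norm_ge_zero[of "c i"] by linarith
    then show ?thesis by simp
  qed
  have w: "w i > 0" for i unfolding w_def using e cpos by (intro divide_pos_pos) auto
  have "\<forall>i\<in>{..<K}. \<exists>\<delta>>0. \<forall>X Y. X \<in> dirichlet_polys \<longrightarrow> Y \<in> dirichlet_polys \<longrightarrow> dp_norm p \<alpha> X \<le> B \<longrightarrow> dp_norm p \<alpha> Y \<le> B
    \<longrightarrow> dp_norm p \<alpha> (\<lambda>n. X n - Y n) < \<delta> \<longrightarrow> AP q \<beta> (\<lambda>n. dpow X i n - dpow Y i n) < w i powr (q / t)"
  proof
    fix i assume "i \<in> {..<K}"
    then have "admissible p \<alpha> q \<beta> i" using adm by simp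
    moreover have "w i powr (q / t) > 0" using w[of i] by simp
    ultimately show "\<exists>\<delta>>0. \<forall>X Y. X \<in> dirichlet_polys \<longrightarrow> Y \<in> dirichlet_polys \<longrightarrow> dp_norm p \<alpha> X \<le> B \<longrightarrow> dp_norm p \<alpha> Y \<le> B
      \<longrightarrow> dp_norm p \<alpha> (\<lambda>n. X n - Y n) < \<delta> \<longrightarrow> AP q \<beta> (\<lambda>n. dpow X i n - dpow Y i n) < w i powr (q / t)"
    proof (rule dpow_diff_small[OF p q, of i "w i powr (q / t)" B], goal_cases)
      case (1 \<delta>)
      then show ?case by (intro exI[of _ \<delta>]) simp
    qed
  qed
  then obtain d where "\<forall>i\<in>{..<K}. d i > 0 \<and> (\<forall>X Y. X \<in> dirichlet_polys \<longrightarrow> Y \<in> dirichlet_polys \<longrightarrow> dp_norm p \<alpha> X \<le> B \<longrightarrow> dp_norm p \<alpha> Y \<le> B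
      \<longrightarrow> dp_norm p \<alpha> (\<lambda>n. X n - Y n) < d i \<longrightarrow> AP q \<beta> (\<lambda>n. dpow X i n - dpow Y i n) < w i powr (q / t))"
    by (rule exE[OF bchoice])
  then have d: "\<And>i. i < K \<Longrightarrow> d i > 0"
    "\<And>i X Y. i < K \<Longrightarrow> X \<in> dirichlet_polys \<Longrightarrow> Y \<in> dirichlet_polys \<Longrightarrow> dp_norm p \<alpha> X \<le> B \<Longrightarrow> dp_norm p \<alpha> Y \<le> B
    \<Longrightarrow> dp_norm p \<alpha> (\<lambda>n. X n - Y n) < d i \<Longrightarrow> AP q \<beta> (\<lambda>n. dpow X i n - dpow Y i n) < w i powr (q / t)"
    by simp_all
  define \<delta> where "\<delta> = Min (insert 1 (d ` {..<K}))"
  show thesis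
  proof (rule that[of \<delta>])
    show "\<delta> > 0" unfolding \<delta>_def using d(1) by (subst Min_gr_iff) auto
    fix X Y assume X: "X \<in> dirichlet_polys" and Y: "Y \<in> dirichlet_polys"
      and B: "dp_norm p \<alpha> X \<le> B" "dp_norm p \<alpha> Y \<le> B" and l: "dp_norm p \<alpha> (\<lambda>n. X n - Y n) < \<delta>"
    define V where "V i = (\<lambda>n. dpow X i n - dpow Y i n)" for i
    have V: "V i \<in> dirichlet_polys" for i
      unfolding V_def by (intro dirichlet_polys_diff dirichlet_polys_dpow X Y)
    have Vw: "tnorm q \<beta> (\<lambda>n. c i * V i n) \<le> e powr t / (real K + 1)" if i: "i < K" for i
    proof -
      have "\<delta> \<le> d i" unfolding \<delta>_def using i by (intro Min_le) auto
      then have "AP q \<beta> (V i) < w i powr (q / t)"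
        unfolding V_def using l by (intro d(2) i X Y B) simp
      then have "AP q \<beta> (V i) powr (t / q) \<le> (w i powr (q / t)) powr (t / q)"
        using t q by (intro powr_mono2) (auto simp: AP_nonneg)
      also have "\<dots> = w i" using t q w[of i] by (simp add: powr_powr)
      finally have "tnorm q \<beta> (V i) \<le> w i"
        using q by (simp add: tnorm_def dp_norm_altdef powr_powr t_def)
      have "tnorm q \<beta> (\<lambda>n. c i * V i n) = norm (c i) powr t * tnorm q \<beta> (V i)"
        unfolding tnorm_def dp_norm_cmult[OF V q(1)] by (simp only: powr_mult t_def)
      also have "\<dots> \<le> (norm (c i) + 1) powr t * w i"
        using t \<open>tnorm q \<beta> (V i) \<le> w i\<close> by (intro mult_mono powr_mono2) (auto simp: tnorm_nonneg)
      also have "\<dots> = e powr t / (real K + 1)"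
      proof -
        have "y * (x / y) = x" if "y > 0" for x y :: real using that by simp
        from this[OF cpos[of i]] show ?thesis by (simp only: w_def)
      qed
      finally show ?thesis .
    qed
    have "(\<lambda>n. dcomb c K X n - dcomb c K Y n) = (\<lambda>n. \<Sum>i<K. c i * V i n)"
      by (simp add: dcomb_def V_def sum_subtractf right_diff_distrib fun_eq_iff)
    moreover have "tnorm q \<beta> (\<lambda>n. \<Sum>i<K. c i * V i n) \<le> (\<Sum>i<K. tnorm q \<beta> (\<lambda>n. c i * V i n))"
      by (rule tnorm_sum_le[OF finite_lessThan dirichlet_polys_multiplier[OF V] q])
    ultimately have "tnorm q \<beta> (\<lambda>n. dcomb c K X n - dcomb c K Y n) \<le> (\<Sum>i<K. tnorm q \<beta> (\<lambda>n. c i * V i n))"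
      by simp
    also have "\<dots> \<le> (\<Sum>i<K. e powr t / (real K + 1))" by (intro sum_mono Vw) simp
    also have "\<dots> = e powr t * (real K / (real K + 1))" by simp
    also have "\<dots> < e powr t * 1" using e by (intro mult_strict_left_mono) auto
    finally have "tnorm q \<beta> (\<lambda>n. dcomb c K X n - dcomb c K Y n) powr (1/t) < (e powr t * 1) powr (1/t)"
      using t by (intro powr_less_mono2) (auto simp: tnorm_nonneg)
    then show "dp_norm q \<beta> (\<lambda>n. dcomb c K X n - dcomb c K Y n) < e"
      using t e by (simp add: dp_norm_eq_tnorm[OF q(1)] t_def[symmetric] powr_powr)
  qed
qed

lemma dcomb_bounded:
  assumes p: "p > 0" "\<alpha> > -1" and q: "q > 0" "\<beta> > -1" and adm: "\<And>i. i < K \<Longrightarrow> admissible p \<alpha> q \<beta> i"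
  obtains M where "\<And>X. X \<in> dirichlet_polys \<Longrightarrow> dp_norm p \<alpha> X \<le> B \<Longrightarrow> dp_norm q \<beta> (dcomb c K X) \<le> M"
proof -
  define t where "t = min q 1"
  have t: "t > 0" using q by (simp add: t_def)
  have "\<forall>i\<in>{..<K}. \<exists>M. \<forall>X. X \<in> dirichlet_polys \<longrightarrow> dp_norm p \<alpha> X \<le> B \<longrightarrow> tnorm q \<beta> (\<lambda>n. c i * dpow X i n) \<le> M"
  proof
    fix i assume "i \<in> {..<K}"
    then have a: "admissible p \<alpha> q \<beta> i" using adm by simp
    show "\<exists>M. \<forall>X. X \<in> dirichlet_polys \<longrightarrow> dp_norm p \<alpha> X \<le> B \<longrightarrow> tnorm q \<beta> (\<lambda>n. c i * dpow X i n) \<le> M"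
    proof (cases "i = 0")
      case True
      then show ?thesis by (intro exI[of _ "tnorm q \<beta> (\<lambda>n. c 0 * dunit n)"]) simp
    next
      case False
      define r where "r = q * real i"
      have r: "r > 0" using q False by (simp add: r_def)
      obtain C where C: "C > 0" "\<And>a. a \<in> dirichlet_polys \<Longrightarrow> AP r \<beta> a \<le> C * dp_norm p \<alpha> a powr r"
        using AP_dpow_le[OF p q a] False unfolding r_def by auto
      have "tnorm q \<beta> (\<lambda>n. c i * dpow X i n) \<le> norm (c i) powr t * (C * \<bar>B\<bar> powr r) powr (t / q)"
        if X: "X \<in> dirichlet_polys" "dp_norm p \<alpha> X \<le> B" for X
      proof -
        have "dp_norm p \<alpha> X powr r \<le> \<bar>B\<bar> powr r" using X r by (intro powr_mono2) (auto simp: dp_norm_nonneg)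
        then have "C * dp_norm p \<alpha> X powr r \<le> C * \<bar>B\<bar> powr r" using C by (intro mult_left_mono) auto
        then have "AP q \<beta> (dpow X i) \<le> C * \<bar>B\<bar> powr r"
          using C(2)[OF X(1)] AP_dpow[OF X(1), of i q \<beta>] False by (simp add: r_def)
        then have "AP q \<beta> (dpow X i) powr (t / q) \<le> (C * \<bar>B\<bar> powr r) powr (t / q)"
          using t q by (intro powr_mono2) (auto simp: AP_nonneg)
        then have "tnorm q \<beta> (dpow X i) \<le> (C * \<bar>B\<bar> powr r) powr (t / q)"
          using q by (simp add: tnorm_def dp_norm_altdef powr_powr t_def)
        moreover have "tnorm q \<beta> (\<lambda>n. c i * dpow X i n) = norm (c i) powr t * tnorm q \<beta> (dpow X i)"
          unfolding tnorm_def dp_norm_cmult[OF dirichlet_polys_dpow[OF X(1)] q(1)] by (simp only: powr_mult t_def)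
        ultimately show ?thesis by (simp add: mult_left_mono)
      qed
      then show ?thesis by blast
    qed
  qed
  then obtain M where "\<forall>i\<in>{..<K}. \<forall>X. X \<in> dirichlet_polys \<longrightarrow> dp_norm p \<alpha> X \<le> B \<longrightarrow> tnorm q \<beta> (\<lambda>n. c i * dpow X i n) \<le> M i"
    by (rule exE[OF bchoice])
  then have M: "\<And>i X. i < K \<Longrightarrow> X \<in> dirichlet_polys \<Longrightarrow> dp_norm p \<alpha> X \<le> B \<Longrightarrow> tnorm q \<beta> (\<lambda>n. c i * dpow X i n) \<le> M i"
    by simp
  show thesis
  proof (rule that[of "(\<Sum>i<K. M i) powr (1/t)"])
    fix X assume X: "X \<in> dirichlet_polys" "dp_norm p \<alpha> X \<le> B"
    have "tnorm q \<beta> (dcomb c K X) \<le> (\<Sum>i<K. tnorm q \<beta> (\<lambda>n. c i * dpow X i n))"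
      unfolding dcomb_def
      by (rule tnorm_sum_le[OF finite_lessThan dirichlet_polys_multiplier[OF dirichlet_polys_dpow[OF X(1)]] q])
    also have "\<dots> \<le> (\<Sum>i<K. M i)" by (intro sum_mono M X) simp
    finally have "tnorm q \<beta> (dcomb c K X) powr (1/t) \<le> (\<Sum>i<K. M i) powr (1/t)"
      using t by (intro powr_mono2) (auto simp: tnorm_nonneg)
    then show "dp_norm q \<beta> (dcomb c K X) \<le> (\<Sum>i<K. M i) powr (1/t)"
      by (simp add: dp_norm_eq_tnorm[OF q(1)] t_def)
  qed
qed

section \<open>Superposition operators\<close>

lemma bergman_spaceE:
  assumes "f \<in> bergman_space p \<alpha>"
  obtains X where "bergman_rep p \<alpha> X f"
  using assms by (auto simp: bergman_space_def)

lemma bergman_spaceI: "bergman_rep p \<alpha> X f \<Longrightarrow> f \<in> extensional C_half \<Longrightarrow> f \<in> bergman_space p \<alpha>"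
  by (auto simp: bergman_space_def)

lemma bergman_dist_tendsto:
  assumes "bergman_rep p \<alpha> Y g" "bergman_rep p \<alpha> X f" and p: "p > 0" "\<alpha> > -1"
  shows "(\<lambda>k. dp_norm p \<alpha> (\<lambda>n. Y k n - X k n)) \<longlonglongrightarrow> bergman_dist p \<alpha> g f"
  unfolding bergman_dist_def by (rule dp_norm_tendsto_bergman_norm[OF bergman_rep_diff[OF assms] p])

context
  fixes p q \<alpha> \<beta> :: real and P :: "complex poly"
  assumes p: "p > 0" "\<alpha> > -1" and q: "q > 0" "\<beta> > -1" and adm: "admissible p \<alpha> q \<beta> (degree P)"
begin

abbreviation (input) lift_poly :: "(nat \<Rightarrow> complex) \<Rightarrow> nat \<Rightarrow> complex" where
  "lift_poly \<equiv> dcomb (coeff P) (Suc (degree P))"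

lemma admissible_lt: "i < Suc (degree P) \<Longrightarrow> admissible p \<alpha> q \<beta> i"
  by (rule admissible_le[OF adm]) (use p q in auto)

text \<open>A Cauchy sequence is bounded, so uniform continuity on bounded sets makes the sequence
  of images Cauchy; on values it acts by \<open>poly P\<close>, which is continuous.\<close>

lemma bergman_rep_superposition:
  assumes X: "bergman_rep p \<alpha> X f"
  shows "bergman_rep q \<beta> (\<lambda>k. lift_poly (X k)) (superposition (poly P) f)"
proof -
  note D = dp_CauchyD(1)[OF bergman_repD(1)[OF X]]
  obtain B where B: "B > 0" "\<And>k. dp_norm p \<alpha> (X k) \<le> B"
    using dp_norm_bounded[OF bergman_repD(1)[OF X] p] by blast
  have "\<exists>M. \<forall>k\<ge>M. \<forall>l\<ge>M. dp_norm q \<beta> (\<lambda>n. lift_poly (X k) n - lift_poly (X l) n) < e" if e: "e > 0" for e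
  proof -
    obtain \<delta> where \<delta>: "\<delta> > 0" "\<And>X Y. X \<in> dirichlet_polys \<Longrightarrow> Y \<in> dirichlet_polys \<Longrightarrow> dp_norm p \<alpha> X \<le> B \<Longrightarrow> dp_norm p \<alpha> Y \<le> B
      \<Longrightarrow> dp_norm p \<alpha> (\<lambda>n. X n - Y n) < \<delta> \<Longrightarrow> dp_norm q \<beta> (\<lambda>n. lift_poly X n - lift_poly Y n) < e"
      proof (rule dcomb_diff_small[OF p q admissible_lt e, of "Suc (degree P)" B "coeff P"], goal_cases)
      case (2 d)
      show thesis by (rule 2(1), rule 2(2), rule 2(3))
    qed simp
    obtain M where M: "\<forall>k\<ge>M. \<forall>l\<ge>M. dp_norm p \<alpha> (\<lambda>n. X k n - X l n) < \<delta>"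
      using dp_CauchyD(2)[OF bergman_repD(1)[OF X] \<delta>(1)] by blast
    show ?thesis
      by (intro exI[of _ M] allI impI \<delta>(2) D B) (use M in simp)
  qed
  moreover have "(\<lambda>k. dp_eval (lift_poly (X k)) s) \<longlonglongrightarrow> poly P (f s)" if "Re s > 1/2" for s
  proof -
    have "dp_eval (lift_poly (X k)) s = poly P (dp_eval (X k) s)" for k
      unfolding dp_eval_dcomb[OF D] by (simp only: poly_altdef lessThan_Suc_atMost)
    then show ?thesis
      using isCont_tendsto_compose[OF poly_isCont bergman_repD(2)[OF X that], of P] by simp
  qed
  ultimately show ?thesis
    unfolding bergman_rep_def dp_Cauchy_def using dirichlet_polys_dcomb[OF D]
    by (auto simp: superposition_def compose_def C_half_def)
qed

lemma superposition_extensional: "superposition \<phi> f \<in> extensional C_half"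
  by (simp add: superposition_def)

lemma superposition_poly_maps: "superposition (poly P) \<in> bergman_space p \<alpha> \<rightarrow> bergman_space q \<beta>"
proof
  fix f assume "f \<in> bergman_space p \<alpha>"
  then obtain X where "bergman_rep p \<alpha> X f" by (rule bergman_spaceE)
  then show "superposition (poly P) f \<in> bergman_space q \<beta>"
    by (rule bergman_spaceI[OF bergman_rep_superposition superposition_extensional])
qed

lemma superposition_poly_bounded: "bergman_bounded_op p \<alpha> q \<beta> (superposition (poly P))"
  unfolding bergman_bounded_op_def
proof (intro allI impI)
  fix S assume S: "bergman_bounded_set p \<alpha> S"
  then obtain C where C: "S \<subseteq> bergman_space p \<alpha>" "\<And>f. f \<in> S \<Longrightarrow> bergman_norm p \<alpha> f \<le> C"
    by (auto simp: bergman_bounded_set_def)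
  \<comment> \<open>The bound \<open>C\<close> concerns the limit of the norms of a representing
    sequence; its members satisfy \<open>C + 1\<close> from some index on.\<close>
  obtain M where M: "\<And>X. X \<in> dirichlet_polys \<Longrightarrow> dp_norm p \<alpha> X \<le> C + 1 \<Longrightarrow> dp_norm q \<beta> (lift_poly X) \<le> M"
    proof (rule dcomb_bounded[OF p q admissible_lt, of "Suc (degree P)" "C + 1" "coeff P"], goal_cases)
    case (2 M)
    show thesis by (rule 2(1), rule 2(2))
  qed simp
  have "bergman_norm q \<beta> (superposition (poly P) f) \<le> M" if f: "f \<in> S" for f
  proof -
    obtain X where X: "bergman_rep p \<alpha> X f" using C(1) f by (auto elim: bergman_spaceE)
    note D = dp_CauchyD(1)[OF bergman_repD(1)[OF X]]
    have "bergman_norm p \<alpha> f < C + 1" using C(2)[OF f] by simp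
    from order_tendstoD(2)[OF dp_norm_tendsto_bergman_norm[OF X p] this]
    have "\<forall>\<^sub>F k in sequentially. dp_norm q \<beta> (lift_poly (X k)) \<le> M"
      by eventually_elim (intro M D less_imp_le)
    from tendsto_upperbound[OF dp_norm_tendsto_bergman_norm[OF bergman_rep_superposition[OF X] q] this]
    show ?thesis by simp
  qed
  then show "bergman_bounded_set q \<beta> (superposition (poly P) ` S)"
    using superposition_poly_maps C(1) unfolding bergman_bounded_set_def by blast
qed

lemma superposition_poly_continuous: "bergman_continuous_op p \<alpha> q \<beta> (superposition (poly P))"
  unfolding bergman_continuous_op_def
proof (intro ballI allI impI)
  fix f and e :: real assume f: "f \<in> bergman_space p \<alpha>" and e: "e > 0"
  obtain X where X: "bergman_rep p \<alpha> X f" using f by (rule bergman_spaceE)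
  note XD = dp_CauchyD(1)[OF bergman_repD(1)[OF X]]
  obtain K where K: "K > 0" "\<And>k. dp_norm p \<alpha> (X k) \<le> K"
    using dp_norm_bounded[OF bergman_repD(1)[OF X] p] by blast
  define t where "t = min p 1"
  have t: "t > 0" using p by (simp add: t_def)
  \<comment> \<open>Bounds both the approximants of \<open>f\<close> and, by the triangle inequality
    for \<open>tnorm\<close>, those of any \<open>g\<close> at distance less than 1 from
    \<open>f\<close>.\<close>
  define B where "B = max K ((K powr t + 1) powr (1/t))"
  have e2: "e / 2 > 0" using e by simp
  obtain \<delta> where \<delta>: "\<delta> > 0" "\<And>X Y. X \<in> dirichlet_polys \<Longrightarrow> Y \<in> dirichlet_polys \<Longrightarrow> dp_norm p \<alpha> X \<le> B \<Longrightarrow> dp_norm p \<alpha> Y \<le> B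
    \<Longrightarrow> dp_norm p \<alpha> (\<lambda>n. X n - Y n) < \<delta> \<Longrightarrow> dp_norm q \<beta> (\<lambda>n. lift_poly X n - lift_poly Y n) < e / 2"
    proof (rule dcomb_diff_small[OF p q admissible_lt e2, of "Suc (degree P)" B "coeff P"], goal_cases)
    case (2 d)
    show thesis by (rule 2(1), rule 2(2), rule 2(3))
  qed simp
  show "\<exists>d>0. \<forall>g\<in>bergman_space p \<alpha>. bergman_dist p \<alpha> g f < d \<longrightarrow>
      bergman_dist q \<beta> (superposition (poly P) g) (superposition (poly P) f) < e"
  proof (intro exI[of _ "min \<delta> 1"] conjI ballI impI)
    show "min \<delta> 1 > 0" using \<delta>(1) by simp
    fix g assume "g \<in> bergman_space p \<alpha>" and d: "bergman_dist p \<alpha> g f < min \<delta> 1"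
    then obtain Y where Y: "bergman_rep p \<alpha> Y g" by (auto elim: bergman_spaceE)
    note YD = dp_CauchyD(1)[OF bergman_repD(1)[OF Y]]
    from order_tendstoD(2)[OF bergman_dist_tendsto[OF Y X p] d]
    have ev: "\<forall>\<^sub>F k in sequentially. dp_norm q \<beta> (\<lambda>n. lift_poly (Y k) n - lift_poly (X k) n) \<le> e / 2"
    proof eventually_elim
      case (elim k)
      have "tnorm p \<alpha> (\<lambda>n. Y k n - X k n) \<le> 1 powr t"
        unfolding tnorm_def t_def using elim p by (intro powr_mono2) (auto simp: dp_norm_nonneg)
      moreover have "tnorm p \<alpha> (X k) \<le> K powr t"
        unfolding tnorm_def t_def using K p by (intro powr_mono2) (auto simp: dp_norm_nonneg)
      moreover have "tnorm p \<alpha> (Y k) \<le> tnorm p \<alpha> (\<lambda>n. Y k n - X k n) + tnorm p \<alpha> (X k)"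
        using tnorm_le_add_diff[OF YD XD p, of k k] by linarith
      ultimately have "tnorm p \<alpha> (Y k) \<le> K powr t + 1" by simp
      then have "tnorm p \<alpha> (Y k) powr (1/t) \<le> (K powr t + 1) powr (1/t)"
        using t by (intro powr_mono2) (auto simp: tnorm_nonneg)
      then have "dp_norm p \<alpha> (Y k) \<le> B"
        by (simp add: dp_norm_eq_tnorm[OF p(1)] t_def[symmetric] B_def)
      moreover have "dp_norm p \<alpha> (X k) \<le> B" using K(2)[of k] by (simp add: B_def)
      ultimately show ?case using \<delta>(2)[OF YD XD] elim by (simp add: less_imp_le)
    qed
    from tendsto_upperbound[OF bergman_dist_tendsto[OF bergman_rep_superposition[OF Y] bergman_rep_superposition[OF X] q] ev]
    show "bergman_dist q \<beta> (superposition (poly P) g) (superposition (poly P) f) < e"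
      using e by simp
  qed
qed

end

section \<open>Holomorphy of elements of the target space and of \<phi>\<close>

lemma dp_eval_holomorphic:
  assumes a: "a \<in> dirichlet_polys"
  shows "dp_eval a holomorphic_on S"
proof -
  have "(\<lambda>s. \<Sum>n | a n \<noteq> 0. a n * exp (- s * of_real (ln (real n)))) holomorphic_on S"
    by (intro holomorphic_intros)
  moreover have "(\<Sum>n | a n \<noteq> 0. a n * exp (- s * of_real (ln (real n)))) = dp_eval a s" for s
    unfolding dp_eval_def
  proof (intro sum.cong refl)
    fix n assume "n \<in> {n. a n \<noteq> 0}"
    then have "0 < n" using dirichlet_polys_pos[OF a] by simp
    then show "a n * exp (- s * of_real (ln (real n))) = a n * of_nat n powr (-s)"
      using Ln_of_nat[of n] by (simp add: powr_def)
  qed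
  ultimately show ?thesis by (simp add: fun_eq_iff holomorphic_on_def)
qed

lemma bergman_rep_uniform_limit:
  assumes Y: "bergman_rep q \<beta> Y g" and q: "q > 0" "\<beta> > -1"
  shows "uniform_limit {s. Re s > 5 + 2/q} (\<lambda>k. dp_eval (Y k)) g sequentially"
  unfolding uniform_limit_sequentially_iff
proof (intro allI impI)
  fix e :: real assume e: "e > 0"
  note D = dp_CauchyD(1)[OF bergman_repD(1)[OF Y]]
  obtain C where C: "C > 0" "\<And>a s. a \<in> dirichlet_polys \<Longrightarrow> Re s \<ge> 5 + 2/q \<Longrightarrow> norm (dp_eval a s) \<le> C * dp_norm q \<beta> a"
    using dp_eval_le_dp_norm[OF q] by blast
  have "e / (2 * C) > 0" using e C by simp
  then obtain M where M: "\<forall>k\<ge>M. \<forall>l\<ge>M. dp_norm q \<beta> (\<lambda>n. Y k n - Y l n) < e / (2 * C)"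
    using dp_CauchyD(2)[OF bergman_repD(1)[OF Y]] by blast
  show "\<exists>N. \<forall>n\<ge>N. \<forall>s\<in>{s. Re s > 5 + 2/q}. dist (dp_eval (Y n) s) (g s) < e"
  proof (intro exI[of _ M] allI impI ballI)
    fix k s assume k: "k \<ge> M" and "s \<in> {s. Re s > 5 + 2/q}"
    then have s0: "Re s > 5 + 2/q" by simp
    have "2 / q > 0" using q by simp
    with s0 have s: "Re s \<ge> 5 + 2/q" "Re s > 1/2" by linarith+
    have "(\<lambda>l. dist (dp_eval (Y k) s) (dp_eval (Y l) s)) \<longlonglongrightarrow> dist (dp_eval (Y k) s) (g s)"
      by (intro tendsto_dist tendsto_const bergman_repD(2)[OF Y s(2)])
    moreover have "\<forall>\<^sub>F l in sequentially. dist (dp_eval (Y k) s) (dp_eval (Y l) s) \<le> e / 2"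
      using eventually_ge_at_top[of M]
    proof eventually_elim
      case (elim l)
      have "dist (dp_eval (Y k) s) (dp_eval (Y l) s) \<le> C * dp_norm q \<beta> (\<lambda>n. Y k n - Y l n)"
        unfolding dist_norm dp_eval_diff[OF D D, symmetric] by (intro C(2) dirichlet_polys_diff D s)
      also have "\<dots> \<le> C * (e / (2 * C))" using M k elim C(1) by (intro mult_left_mono) (auto intro: less_imp_le)
      finally show ?case using C(1) by simp
    qed
    ultimately have "dist (dp_eval (Y k) s) (g s) \<le> e / 2" by (rule tendsto_upperbound) simp
    then show "dist (dp_eval (Y k) s) (g s) < e" using e by simp
  qed
qed

lemma bergman_holomorphic:
  assumes Y: "bergman_rep q \<beta> Y g" and q: "q > 0" "\<beta> > -1"
  shows "g holomorphic_on {s. Re s > 5 + 2/q}"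
proof (rule holomorphic_uniform_sequence)
  show op: "open {s. Re s > 5 + 2/q}" by (rule open_halfspace_Re_gt)
  show "dp_eval (Y n) holomorphic_on {s. Re s > 5 + 2/q}" for n
    by (rule dp_eval_holomorphic[OF dp_CauchyD(1)[OF bergman_repD(1)[OF Y]]])
  fix x assume "x \<in> {s. Re s > 5 + 2/q}"
  then obtain d where d: "d > 0" "cball x d \<subseteq> {s. Re s > 5 + 2/q}"
    using op open_contains_cball by blast
  then show "\<exists>d. 0 < d \<and> cball x d \<subseteq> {s. Re s > 5 + 2/q} \<and> uniform_limit (cball x d) (\<lambda>n. dp_eval (Y n)) g sequentially"
    using uniform_limit_on_subset[OF bergman_rep_uniform_limit[OF Y q]] by blast
qed

text \<open>Composing \<open>\<phi>\<close> with \<open>d + R / 2^s\<close> and inverting this function shows that \<open>\<phi>\<close> is holomorphic near every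
  point different from \<open>d\<close>; the half-plane on which elements of the target space are known to be
  holomorphic does not depend on \<open>R\<close>.\<close>

lemma superposition_maps_entire:
  assumes maps: "superposition \<phi> \<in> bergman_space p \<alpha> \<rightarrow> bergman_space q \<beta>"
    and p: "p > 0" "\<alpha> > -1" and q: "q > 0" "\<beta> > -1"
  shows "\<phi> holomorphic_on UNIV"
proof -
  have "\<phi> holomorphic_on ball w0 1" for w0
  proof -
    define s1 where "s1 = 5 + 2/q"
    have "2 / q > 0" using q by simp
    then have s1: "s1 > 1/2" unfolding s1_def by linarith
    \<comment> \<open>As |w - d| < 2 on the ball, this power of 2 sends the ball under \<tau> into
      real parts above \<open>s1 + 1\<close>.\<close>
    define R :: real where "R = 2 powr (s1 + 2)"
    have R: "R > 0" by (simp add: R_def)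
    \<comment> \<open>Then \<open>w - d\<close> runs through the unit disc around 1, where the
      principal logarithm is holomorphic.\<close>
    define d where "d = w0 - 1"
    define a :: "nat \<Rightarrow> complex" where "a n = (if n = 1 then d else if n = 2 then of_real R else 0)" for n
    have supp: "{n. a n \<noteq> 0} \<subseteq> {1, 2}" by (auto simp: a_def)
    then have a: "a \<in> dirichlet_polys"
      unfolding dirichlet_polys_def by (auto simp: a_def intro: finite_subset)
    have ev: "dp_eval a s = d + of_real R * 2 powr (-s)" for s
      by (subst dp_eval_altdef[OF _ supp]) (simp_all add: a_def)
    define f where "f = (\<lambda>s\<in>C_half. d + of_real R * 2 powr (-s))"
    have "dp_norm p \<alpha> (\<lambda>n. 0) = 0"
      using dp_norm_le_sum[OF dirichlet_polys_0 p, of "{}"] dp_norm_nonneg[of p \<alpha> "\<lambda>_. 0"] by simp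
    then have "bergman_rep p \<alpha> (\<lambda>_. a) f"
      unfolding bergman_rep_def dp_Cauchy_def using a by (simp add: ev f_def)
    then have "f \<in> bergman_space p \<alpha>" by (rule bergman_spaceI) (simp add: f_def)
    then have "superposition \<phi> f \<in> bergman_space q \<beta>" using maps by blast
    then obtain Y where Y: "bergman_rep q \<beta> Y (superposition \<phi> f)" by (rule bergman_spaceE)
    have g: "superposition \<phi> f holomorphic_on {s. Re s > s1}"
      unfolding s1_def by (rule bergman_holomorphic[OF Y q])
    define \<tau> where "\<tau> w = - Ln ((w - d) / of_real R) / of_real (ln 2)" for w
    have Re: "Re ((w - d) / of_real R) > 0" and nw: "norm (w - d) < 2" if "w \<in> ball w0 1" for w
    proof -
      have n: "norm (w - w0) < 1" using that by (simp add: dist_norm norm_minus_commute)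
      have e: "w - d = 1 + (w - w0)" by (simp add: d_def)
      have "Re (w - d) = 1 + Re (w - w0)" unfolding e by simp
      moreover have "\<bar>Re (w - w0)\<bar> \<le> norm (w - w0)" by (rule abs_Re_le_cmod)
      moreover have "norm (w - d) \<le> 1 + norm (w - w0)"
        unfolding e using norm_triangle_ineq[of 1 "w - w0"] by simp
      ultimately have "Re (w - d) > 0" "norm (w - d) < 2" using n by linarith+
      then show "Re ((w - d) / of_real R) > 0" "norm (w - d) < 2" using R by simp_all
    qed
    have nz: "(w - d) / of_real R \<notin> \<real>\<^sub>\<le>\<^sub>0" "w - d \<noteq> 0" if "w \<in> ball w0 1" for w
    proof -
      show "(w - d) / of_real R \<notin> \<real>\<^sub>\<le>\<^sub>0" using Re[OF that] by (auto simp: complex_nonpos_Reals_iff)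
      show "w - d \<noteq> 0" using Re[OF that] by auto
    qed
    have hol: "\<tau> holomorphic_on ball w0 1"
      unfolding \<tau>_def using R nz(1) by (intro holomorphic_intros) auto
    have img: "Re (\<tau> w) > s1" if w: "w \<in> ball w0 1" for w
    proof -
      have "Re (\<tau> w) = - ln (norm ((w - d) / of_real R)) / ln 2"
        unfolding \<tau>_def using nz(2)[OF w] R by (simp add: Re_divide_of_real)
      also have "\<dots> = (ln R - ln (norm (w - d))) / ln 2"
        using nz(2)[OF w] R by (simp add: norm_divide ln_div)
      also have "\<dots> > (ln R - ln 2) / ln 2"
        using nz(2)[OF w] nw[OF w] by (intro divide_strict_right_mono) auto
      also have "(ln R - ln 2) / ln 2 = s1 + 1"
        by (simp add: R_def ln_powr diff_divide_distrib)
      finally show ?thesis by simp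
    qed
    have "(superposition \<phi> f \<circ> \<tau>) holomorphic_on ball w0 1"
      by (rule holomorphic_on_compose_gen[OF hol g]) (use img in auto)
    moreover have "(superposition \<phi> f \<circ> \<tau>) w = \<phi> w" if w: "w \<in> ball w0 1" for w
    proof -
      have "2 powr (- \<tau> w) = (w - d) / of_real R"
      proof -
        have "2 powr (- \<tau> w) = exp (- \<tau> w * of_real (ln 2))"
          using Ln_of_real[of 2] by (simp add: powr_def)
        also have "- \<tau> w * of_real (ln 2) = Ln ((w - d) / of_real R)" by (simp add: \<tau>_def)
        finally show ?thesis using nz(2)[OF w] R by simp
      qed
      then have "d + of_real R * 2 powr (- \<tau> w) = w" using R by simp
      moreover have "\<tau> w \<in> C_half" using img[OF w] s1 by (simp add: C_half_def)
      ultimately show ?thesis by (simp add: superposition_def compose_def f_def)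
    qed
    ultimately show ?thesis by (rule holomorphic_transform)
  qed
  then have "\<phi> field_differentiable at w" for w
    using holomorphic_on_imp_differentiable_at[of \<phi> "ball w 1" w] by simp
  then show ?thesis by (simp add: holomorphic_on_def)
qed

section \<open>Vanishing of Taylor coefficients\<close>

lemma l1_add_le:
  assumes "a \<in> dirichlet_polys" "b \<in> dirichlet_polys"
  shows "l1 s (\<lambda>n. a n + b n) \<le> l1 s a + l1 s b"
proof -
  let ?F = "{n. a n \<noteq> 0} \<union> {n. b n \<noteq> 0}"
  have f: "finite ?F" using assms dirichlet_polysD by auto
  have "l1 s (\<lambda>n. a n + b n) = (\<Sum>n\<in>?F. norm (a n + b n) * real n powr (-s))"
    by (rule l1_altdef[OF f]) auto
  also have "\<dots> \<le> (\<Sum>n\<in>?F. norm (a n) * real n powr (-s) + norm (b n) * real n powr (-s))"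
    unfolding distrib_right[symmetric] by (intro sum_mono mult_right_mono norm_triangle_ineq) simp
  also have "\<dots> = l1 s a + l1 s b"
    unfolding sum.distrib by (intro arg_cong2[where f="(+)"] l1_altdef[OF f, symmetric]) auto
  finally show ?thesis .
qed

lemma l1_sum_le:
  assumes "finite I" "\<And>i. i \<in> I \<Longrightarrow> f i \<in> dirichlet_polys"
  shows "l1 s (\<lambda>n. \<Sum>i\<in>I. f i n) \<le> (\<Sum>i\<in>I. l1 s (f i))"
  using assms
proof (induction I rule: finite_induct)
  case (insert i I)
  have "l1 s (\<lambda>n. f i n + (\<Sum>i\<in>I. f i n)) \<le> l1 s (f i) + l1 s (\<lambda>n. \<Sum>i\<in>I. f i n)"
    using insert.prems by (intro l1_add_le dirichlet_polys_sum) auto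
  also have "\<dots> \<le> l1 s (f i) + (\<Sum>i\<in>I. l1 s (f i))" using insert by simp
  finally show ?case using insert by simp
qed (simp add: l1_def)

text \<open>For \<open>n > 0\<close> only divisors of \<open>n\<close> contribute. The lemma serves
  to show that the coefficients of the approximants of \<phi> composed with \<open>f\<close> become
  stationary.\<close>

lemma dconv_cong_le:
  assumes DP: "a \<in> dirichlet_polys" "b \<in> dirichlet_polys" "a' \<in> dirichlet_polys" "b' \<in> dirichlet_polys"
    and eq: "\<And>m. m \<le> n \<Longrightarrow> a m = a' m" "\<And>m. m \<le> n \<Longrightarrow> b m = b' m"
  shows "dconv a b n = dconv a' b' n"
proof (cases "n = 0")
  case True
  then show ?thesis using DP by (simp add: dirichlet_polysD(1)[OF dirichlet_polys_dconv])
next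
  case False
  let ?A = "{n. a n \<noteq> 0} \<union> {n. a' n \<noteq> 0}" and ?B = "{n. b n \<noteq> 0} \<union> {n. b' n \<noteq> 0}"
  have f: "finite ?A" "finite ?B" using DP dirichlet_polysD by auto
  have "dconv a b n = (\<Sum>i\<in>?A. \<Sum>j\<in>?B. if i * j = n then a i * b j else 0)"
    by (rule dconv_altdef[OF f(1) _ f(2)]) auto
  also have "\<dots> = (\<Sum>i\<in>?A. \<Sum>j\<in>?B. if i * j = n then a' i * b' j else 0)"
  proof (intro sum.cong refl)
    fix i j
    show "(if i * j = n then a i * b j else 0) = (if i * j = n then a' i * b' j else 0)"
    proof (cases "i * j = n")
      case True
      then have "i dvd n" "j dvd n" by auto
      then have "i \<le> n" "j \<le> n" using False by (auto intro: dvd_imp_le)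
      then show ?thesis using eq by simp
    qed simp
  qed
  also have "\<dots> = dconv a' b' n"
    by (rule dconv_altdef[OF f(1) _ f(2), symmetric]) auto
  finally show ?thesis .
qed

lemma dpow_cong_le:
  assumes a: "a \<in> dirichlet_polys" "a' \<in> dirichlet_polys" and eq: "\<And>m. m \<le> n \<Longrightarrow> a m = a' m"
  shows "m \<le> n \<Longrightarrow> dpow a i m = dpow a' i m"
proof (induction i arbitrary: m)
  case (Suc i)
  show ?case unfolding dpow.simps
    by (rule dconv_cong_le[OF a(1) dirichlet_polys_dpow[OF a(1)] a(2) dirichlet_polys_dpow[OF a(2)]])
      (use Suc eq in auto)
qed simp

text \<open>Without constant term each factor brings at least one prime, so only finitely many
  powers contribute to a given coefficient.\<close>

lemma dpow_nonzero_le_Om: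
  assumes a: "a \<in> dirichlet_polys" "a 1 = 0"
  shows "dpow a i n \<noteq> 0 \<Longrightarrow> i \<le> Om n"
proof (induction i arbitrary: n)
  case (Suc i)
  from Suc.prems have "dconv a (dpow a i) n \<noteq> 0" by simp
  then obtain u v where uv: "a u \<noteq> 0" "dpow a i v \<noteq> 0" "n = u * v" by (rule dconv_nonzeroE)
  have u: "0 < u" "u \<noteq> 1" using dirichlet_polys_pos[OF a(1) uv(1)] uv(1) a(2) by auto
  have "Om u \<noteq> 0"
  proof
    assume "Om u = 0"
    then have "expo j u = expo j 1" for j unfolding wt_eq_0_iff by simp
    then have "u = 1" using eq_of_expo_eq[of u 1] u by simp
    then show False using u by simp
  qed
  then show ?case
    using Suc.IH[OF uv(2)] uv u dirichlet_polys_pos[OF dirichlet_polys_dpow[OF a(1)] uv(2)] by (simp add: wt_mult)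
qed simp

definition has_test_polys :: "real \<Rightarrow> real \<Rightarrow> real \<Rightarrow> real \<Rightarrow> nat \<Rightarrow> bool" where
  "has_test_polys p \<alpha> q \<beta> N \<longleftrightarrow> (\<forall>J \<eta> K. \<eta> > 0 \<longrightarrow> (\<exists>h j. h \<in> dirichlet_polys \<and> J \<le> j \<and>
     (\<forall>n. h n \<noteq> 0 \<longrightarrow> (\<forall>i<J. expo i n = 0) \<and> expo j n = 1) \<and>
     dp_norm p \<alpha> h \<le> \<eta> \<and> l1 (1/2) h \<le> \<eta> \<and> K \<le> dp_norm q \<beta> (dpow h N)))"

text \<open>A gliding hump: test polynomials in disjoint blocks of primes are summed up to an element \<open>f\<close> of the
  source space. In each block one prime marks the degree, so that the \<open>N\<close>-th Taylor coefficient of \<open>\<phi>\<close> is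
  isolated in \<open>\<phi> \<circ> f\<close> by coefficient projections that are bounded independently of the block.\<close>

lemma taylor_coeff_eq_0_of_test_polys:
  assumes maps: "superposition \<phi> \<in> bergman_space p \<alpha> \<rightarrow> bergman_space q \<beta>"
    and p: "p > 0" "\<alpha> > -1" and q: "q > 0" "\<beta> > -1"
    and \<phi>: "\<And>w. (\<lambda>n. c n * w ^ n) sums \<phi> w"
    and test: "has_test_polys p \<alpha> q \<beta> N"
  shows "c N = 0"
proof (rule ccontr)
  assume cN: "c N \<noteq> 0"
  define t where "t = min p 1"
  have t: "0 < t" "t \<le> 1" using p by (simp_all add: t_def)
  \<comment> \<open>The exponent 1/t makes \<open>tnorm\<close> of the \<open>k\<close>-th block at
    most (1/2)^k, and as \<open>t \<le> 1\<close> the \<open>l1\<close> norms are summable by the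
    same series.\<close>
  define \<eta> where "\<eta> k = ((1/2::real) ^ k) powr (1/t)" for k :: nat
  have \<eta>: "\<eta> k > 0" for k by (simp add: \<eta>_def)
  have \<eta>le: "\<eta> k \<le> (1/2) ^ k" for k
  proof -
    have "\<eta> k \<le> ((1/2::real) ^ k) powr 1"
      unfolding \<eta>_def using t by (intro powr_mono') (auto simp: power_le_one)
    then show ?thesis by simp
  qed
  define Q where "Q J k h j \<longleftrightarrow> h \<in> dirichlet_polys \<and> J \<le> j \<and>
     (\<forall>n. h n \<noteq> 0 \<longrightarrow> (\<forall>i<J. expo i n = 0) \<and> expo j n = 1) \<and>
     dp_norm p \<alpha> h \<le> \<eta> k \<and> l1 (1/2) h \<le> \<eta> k \<and> real k \<le> dp_norm q \<beta> (dpow h N)" for J k h j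
  have "\<forall>x. \<exists>y. Q (fst x) (snd x) (fst y) (snd y)"
    using test \<eta> unfolding has_test_polys_def Q_def by simp
  then obtain G where G: "\<And>x. Q (fst x) (snd x) (fst (G x)) (snd (G x))"
    by (rule exE[OF choice]) blast
  \<comment> \<open>The next block starts beyond every index \<open>n\<close> in the support of the
    present one, hence beyond the index of every prime dividing such an \<open>n\<close>.\<close>
  define Js where "Js = rec_nat 0 (\<lambda>k J. Suc (Max (insert J {n. fst (G (J, k)) n \<noteq> 0})))"
  define h where "h k = fst (G (Js k, k))" for k
  define j0 where "j0 k = snd (G (Js k, k))" for k
  have Q: "Q (Js k) k (h k) (j0 k)" for k
    using G[of "(Js k, k)"] by (simp add: h_def j0_def)
  have h: "h k \<in> dirichlet_polys" and hp: "dp_norm p \<alpha> (h k) \<le> \<eta> k" and hl: "l1 (1/2) (h k) \<le> \<eta> k"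
    and hq: "real k \<le> dp_norm q \<beta> (dpow (h k) N)" and j0: "Js k \<le> j0 k" for k
    using Q[of k] by (auto simp: Q_def)
  have hs: "i < Js k \<Longrightarrow> expo i n = 0" "expo (j0 k) n = 1" if "h k n \<noteq> 0" for k n i
    using Q[of k] that by (auto simp: Q_def)
  have JsSuc: "Js (Suc k) = Suc (Max (insert (Js k) {n. h k n \<noteq> 0}))" for k
    by (simp add: Js_def h_def)
  have fin: "finite (insert (Js k) {n. h k n \<noteq> 0})" for k using dirichlet_polysD(2)[OF h] by simp
  have Jmono: "Js k < Js (Suc k)" for k unfolding JsSuc using fin[of k] by (simp add: less_Suc_eq_le)
  have Jmono': "Js k \<le> Js l" if "k \<le> l" for k l
    by (rule lift_Suc_mono_le[of Js, OF less_imp_le[OF Jmono] that])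
  have kJ: "k \<le> Js k" for k
  proof (induction k)
    case (Suc k) then show ?case using Jmono[of k] by simp
  qed simp
  have supp_less: "n < Js (Suc k)" if "h k n \<noteq> 0" for k n
    unfolding JsSuc using Max_ge[OF fin, of n k] that by simp
  have supp_ge: "k \<le> n" if "h k n \<noteq> 0" for k n
  proof -
    have "j0 k \<le> n"
    proof (rule ccontr)
      assume "\<not> j0 k \<le> n"
      then have "expo (j0 k) n = 0" by (intro expo_eq_0) simp
      then show False using hs(2)[OF that] by simp
    qed
    then show ?thesis using j0[of k] kJ[of k] by linarith
  qed
  have j0_less: "j0 k < Js (Suc k)" if "h k n \<noteq> 0" for k n
  proof -
    have "j0 k \<le> n"
    proof (rule ccontr)
      assume "\<not> j0 k \<le> n"
      then have "expo (j0 k) n = 0" by (intro expo_eq_0) simp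
      then show False using hs(2)[OF that] by simp
    qed
    then show ?thesis using supp_less[OF that] by simp
  qed
  \<comment> \<open>Weight 1 outside block \<open>i\<close>: weight 0 of \<open>n\<close> means that
    all primes of \<open>n\<close> belong to the block.\<close>
  define blk where "blk i j = (of_bool (\<not> (Js i \<le> j \<and> j < Js (Suc i))) :: nat)" for i j
  have blk1: "wt (blk i) n = 0" if "h i n \<noteq> 0" for i n
    unfolding wt_eq_0_iff
  proof
    fix j show "blk i j = 0 \<or> expo j n = 0"
    proof (cases "expo j n = 0")
      case False
      then have "Js i \<le> j" using hs(1)[OF that, of j] by (metis not_le)
      moreover have "j \<le> n" using False expo_eq_0[of n j] by (metis not_le)
      ultimately show ?thesis using supp_less[OF that] by (simp add: blk_def)
    qed simp
  qed
  have blk2: "wt (blk i) n \<noteq> 0" if "h k n \<noteq> 0" "k \<noteq> i" for i k n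
  proof
    assume "wt (blk i) n = 0"
    then have "blk i (j0 k) = 0" using hs(2)[OF that(1)] unfolding wt_eq_0_iff by (metis zero_neq_one)
    then have b: "Js i \<le> j0 k" "j0 k < Js (Suc i)" by (auto simp: blk_def split: if_splits)
    show False
    proof (cases "k < i")
      case True
      then have "Js (Suc k) \<le> Js i" by (intro Jmono') simp
      then show False using b j0_less[OF that(1)] by simp
    next
      case False
      then have "Js (Suc i) \<le> Js k" using that(2) by (intro Jmono') simp
      then show False using b j0[of k] by simp
    qed
  qed
  define F where "F k = (\<lambda>n. \<Sum>i<k. h i n)" for k
  have F: "F k \<in> dirichlet_polys" for k unfolding F_def by (intro dirichlet_polys_sum h)
  have geo: "(\<Sum>i<k. (1/2::real) ^ i) \<le> 2" for k
  proof -
    have "(\<Sum>i<k. (1/2::real) ^ i) \<le> (\<Sum>i. (1/2::real) ^ i)"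
      by (intro sum_le_suminf summable_geometric) auto
    then show ?thesis by (simp add: suminf_geometric)
  qed
  have th: "tnorm p \<alpha> (h k) \<le> (1/2) ^ k" for k
  proof -
    have "tnorm p \<alpha> (h k) \<le> \<eta> k powr t"
      unfolding tnorm_def t_def using p by (intro powr_mono2 hp) (auto simp: dp_norm_nonneg)
    then show ?thesis using t by (simp add: \<eta>_def powr_powr)
  qed
  have Fdiff: "tnorm p \<alpha> (\<lambda>n. F k n - F l n) \<le> 2 * (1/2) ^ l" if "l \<le> k" for k l
  proof -
    have e: "(\<lambda>n. F k n - F l n) = (\<lambda>n. \<Sum>i\<in>{l..<k}. h i n)"
      unfolding F_def lessThan_atLeast0 using that by (simp add: sum_diff_nat_ivl fun_eq_iff)
    have "tnorm p \<alpha> (\<lambda>n. F k n - F l n) \<le> (\<Sum>i\<in>{l..<k}. tnorm p \<alpha> (h i))"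
      unfolding e by (rule tnorm_sum_le[OF _ h p]) simp
    also have "\<dots> \<le> (\<Sum>i\<in>{l..<k}. (1/2) ^ i)" by (intro sum_mono th)
    also have "\<dots> = (\<Sum>i<k - l. (1/2) ^ l * (1/2::real) ^ i)"
      using that by (subst sum.atLeastLessThan_shift_0) (simp add: lessThan_atLeast0 power_add)
    also have "\<dots> = (1/2) ^ l * (\<Sum>i<k - l. (1/2::real) ^ i)" by (simp add: sum_distrib_left)
    also have "\<dots> \<le> (1/2) ^ l * 2" by (intro mult_left_mono geo) simp
    finally show ?thesis by (simp add: mult.commute)
  qed
  have FC: "dp_Cauchy p \<alpha> F"
    unfolding dp_Cauchy_def
  proof (intro conjI allI impI F)
    fix e :: real assume e: "e > 0"
    obtain M where M: "(1/2::real) ^ M < e powr t / 2"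
      using real_arch_pow_inv[of "e powr t / 2" "1/2"] e by auto
    have small: "dp_norm p \<alpha> (\<lambda>n. F k n - F l n) < e" if "M \<le> l" "l \<le> k" for k l
    proof -
      have "(1/2::real) ^ l \<le> (1/2) ^ M" using that by (intro power_decreasing) auto
      then have "tnorm p \<alpha> (\<lambda>n. F k n - F l n) < e powr t"
        using Fdiff[OF that(2)] M by linarith
      then have "tnorm p \<alpha> (\<lambda>n. F k n - F l n) powr (1/t) < (e powr t) powr (1/t)"
        using t by (intro powr_less_mono2) (auto simp: tnorm_nonneg)
      then show ?thesis using t e by (simp add: dp_norm_eq_tnorm[OF p(1)] t_def[symmetric] powr_powr)
    qed
    have "dp_norm p \<alpha> (\<lambda>n. F k n - F l n) < e" if "M \<le> k" "M \<le> l" for k l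
    proof (cases "l \<le> k")
      case True then show ?thesis using small that by simp
    next
      case False
      then have "dp_norm p \<alpha> (\<lambda>n. F l n - F k n) < e" using small that by simp
      then show ?thesis
        using tnorm_minus_commute[OF F F p(1), of \<alpha> l k] by (simp add: dp_norm_eq_tnorm[OF p(1)])
    qed
    then show "\<exists>M. \<forall>k\<ge>M. \<forall>l\<ge>M. dp_norm p \<alpha> (\<lambda>n. F k n - F l n) < e" by (intro exI[of _ M]) simp
  qed
  have hl': "l1 (1/2) (h i) \<le> (1/2) ^ i" for i using hl[of i] \<eta>le[of i] by linarith
  have evF: "dp_eval (F k) s = (\<Sum>i<k. dp_eval (h i) s)" for k s
  proof (induction k)
    case 0 then show ?case by (simp add: F_def dp_eval_def)
  next
    case (Suc k)
    have "F (Suc k) = (\<lambda>n. F k n + h k n)" by (simp add: F_def)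
    then show ?case using dp_eval_add[OF F h] Suc by simp
  qed
  have sumh: "summable (\<lambda>i. dp_eval (h i) s)" if "Re s \<ge> 1/2" for s
  proof (rule summable_comparison_test)
    show "\<exists>N. \<forall>i\<ge>N. norm (dp_eval (h i) s) \<le> (1/2) ^ i"
      using order.trans[OF norm_dp_eval_le_l1[OF h that] hl'] by blast
  qed (simp add: summable_geometric)
  define f where "f = (\<lambda>s\<in>C_half. \<Sum>i. dp_eval (h i) s)"
  have fF: "bergman_rep p \<alpha> F f"
    unfolding bergman_rep_def
  proof (intro conjI FC ballI)
    fix s assume s: "s \<in> C_half"
    then show "(\<lambda>k. dp_eval (F k) s) \<longlonglongrightarrow> f s"
      unfolding evF f_def using summable_LIMSEQ[OF sumh[of s]] by (simp add: C_half_def)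
  qed
  then have "f \<in> bergman_space p \<alpha>" by (rule bergman_spaceI) (simp add: f_def)
  then have "superposition \<phi> f \<in> bergman_space q \<beta>" using maps by blast
  then obtain Y where Y: "bergman_rep q \<beta> Y (superposition \<phi> f)" by (rule bergman_spaceE)
  note YD = dp_CauchyD(1)[OF bergman_repD(1)[OF Y]]
  obtain B where B: "B > 0" "\<And>k. dp_norm q \<beta> (Y k) \<le> B"
    using dp_norm_bounded[OF bergman_repD(1)[OF Y] q] by blast
  obtain C where C: "C > 0" "\<And>a n. a \<in> dirichlet_polys \<Longrightarrow> norm (a n) \<le> C * real n powr (3 + 2/q) * dp_norm q \<beta> a"
    using coeff_le_dp_norm[OF q] by blast
  \<comment> \<open>Radius 2 suffices because the \<open>l1\<close> norms of all partial sums
    \<open>F k\<close> are at most 2; convergence at 3 gives absolute convergence there.\<close>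
  have sc: "summable (\<lambda>i. norm (c i) * 2 ^ i)"
  proof -
    have "summable (\<lambda>i. c i * 3 ^ i)" using \<phi>[of 3] by (simp add: sums_iff)
    from powser_insidea[OF this, of 2] show ?thesis by (simp add: norm_mult norm_power)
  qed
  define M where "M = (\<Sum>i. norm (c i) * 2 ^ i)"
  have M0: "M \<ge> 0" unfolding M_def by (intro suminf_nonneg sc) auto
  \<comment> \<open>Both the number of blocks and the number of Taylor terms are cut at
    \<open>k\<close>. Every coefficient of \<open>W k\<close> is then eventually constant.\<close>
  define W where "W k = dcomb c k (F k)" for k
  have W: "W k \<in> dirichlet_polys" for k unfolding W_def by (rule dirichlet_polys_dcomb[OF F])
  have lF: "l1 (1/2) (F k) \<le> 2" for k
  proof -
    have "l1 (1/2) (F k) \<le> (\<Sum>i<k. l1 (1/2) (h i))" unfolding F_def by (intro l1_sum_le h) simp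
    also have "\<dots> \<le> (\<Sum>i<k. (1/2) ^ i)" by (intro sum_mono hl')
    finally show ?thesis using geo[of k] by linarith
  qed
  have Wb: "norm (W k n) \<le> M * real n powr (1/2)" for k n
  proof -
    have "norm (W k n) \<le> (\<Sum>i<k. norm (c i) * (real n powr (1/2) * 2 ^ i))"
      unfolding W_def dcomb_def
    proof (rule order.trans[OF norm_sum], rule sum_mono)
      fix i
      have "norm (dpow (F k) i n) \<le> real n powr (1/2) * l1 (1/2) (dpow (F k) i)"
        by (rule coeff_le_l1[OF dirichlet_polys_dpow[OF F]])
      also have "\<dots> \<le> real n powr (1/2) * 2 ^ i"
        by (intro mult_left_mono order.trans[OF l1_dpow_le[OF F] power_mono[OF lF]] l1_nonneg) auto
      finally show "norm (c i * dpow (F k) i n) \<le> norm (c i) * (real n powr (1/2) * 2 ^ i)"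
        by (simp add: norm_mult mult_left_mono)
    qed
    also have "\<dots> = real n powr (1/2) * (\<Sum>i<k. norm (c i) * 2 ^ i)" by (simp add: sum_distrib_left mult_ac)
    also have "\<dots> \<le> real n powr (1/2) * M"
      unfolding M_def by (intro mult_left_mono sum_le_suminf sc) auto
    finally show ?thesis by (simp add: mult.commute)
  qed
  \<comment> \<open>No norm estimate for \<open>W k\<close> is at hand, so \<open>Y k\<close> and
    \<open>W k\<close> are compared by coefficients: both converge pointwise to \<phi> composed with
    \<open>f\<close>, and polynomial growth of the coefficients allows
    \<open>coeff_limit_eq_0\<close> to be applied.\<close>
  define D where "D k = (\<lambda>n. Y k n - W k n)" for k
  have D: "D k \<in> dirichlet_polys" for k unfolding D_def by (rule dirichlet_polys_diff[OF YD W])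
  have Db: "norm (D k n) \<le> (C * B + M) * real n powr (3 + 2/q)" for k n
  proof (cases "n = 0")
    case True
    then show ?thesis using dirichlet_polysD(1)[OF D[of k]] by simp
  next
    case False
    have "0 < 2 / q" using q by simp
    then have "1/2 \<le> 3 + 2/q" by linarith
    then have 1: "real n powr (1/2) \<le> real n powr (3 + 2/q)" using False by (intro powr_mono) auto
    have "norm (D k n) \<le> norm (Y k n) + norm (W k n)" unfolding D_def by (rule norm_triangle_ineq4)
    also have "\<dots> \<le> C * real n powr (3 + 2/q) * B + M * real n powr (3 + 2/q)"
    proof (rule add_mono)
      show "norm (Y k n) \<le> C * real n powr (3 + 2/q) * B"
        using C(1) by (intro order.trans[OF C(2)[OF YD]] mult_left_mono B) auto
      show "norm (W k n) \<le> M * real n powr (3 + 2/q)"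
        using 1 M0 by (intro order.trans[OF Wb] mult_left_mono)
    qed
    finally show ?thesis by (simp add: algebra_simps)
  qed
  have Wconst: "W k n = W (Suc n) n" if k: "k \<ge> Suc n" for k n
  proof -
    have F1: "F k 1 = 0" for k
    proof -
      have "h i 1 = 0" for i using hs(2)[of i 1] by auto
      then show ?thesis by (simp add: F_def)
    qed
    have Feq: "F k m = F (Suc n) m" if "m \<le> n" for m
      unfolding F_def
    proof (rule sum.mono_neutral_right)
      show "\<forall>i\<in>{..<k} - {..<Suc n}. h i m = 0"
      proof (intro ballI, rule ccontr)
        fix i assume i: "i \<in> {..<k} - {..<Suc n}" and "h i m \<noteq> 0"
        then have "i \<le> m" by (intro supp_ge)
        then show False using i that by simp
      qed
    qed (use k in auto)
    have 0: "dpow (F k) i n = 0" if "i \<ge> Suc n" for i k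
    proof (rule ccontr)
      assume a: "dpow (F k) i n \<noteq> 0"
      then have "i \<le> Om n" by (rule dpow_nonzero_le_Om[OF F F1])
      moreover have "2 ^ Om n \<le> n" by (rule two_power_Om_le[OF dirichlet_polys_pos[OF dirichlet_polys_dpow[OF F] a]])
      moreover have "Om n < 2 ^ Om n" by (rule less_exp)
      ultimately show False using that by linarith
    qed
    have "W k n = (\<Sum>i<Suc n. c i * dpow (F k) i n)"
      unfolding W_def dcomb_def by (rule sum.mono_neutral_right) (use k 0 in auto)
    also have "\<dots> = W (Suc n) n"
      unfolding W_def dcomb_def using dpow_cong_le[OF F F Feq, of n] by simp
    finally show ?thesis .
  qed
  have Wlim: "(\<lambda>k. W k n) \<longlonglongrightarrow> W (Suc n) n" for n
    by (rule tendsto_eventually, rule eventually_mono[OF eventually_ge_at_top[of "Suc n"] Wconst])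
  have evW: "(\<lambda>k. dp_eval (W k) s) \<longlonglongrightarrow> \<phi> (f s)" if s: "Re s > 1/2" for s
  proof -
    define w where "w k = dp_eval (F k) s" for k
    have wl: "w \<longlonglongrightarrow> f s" unfolding w_def by (rule bergman_repD(2)[OF fF s])
    have wb: "norm (w k) \<le> 2" for k
      unfolding w_def using s by (intro order.trans[OF norm_dp_eval_le_l1[OF F] lF]) simp
    define A where "A i k = (if i < k then c i * w k ^ i else 0)" for i k
    have Ab: "norm (A i k) \<le> norm (c i) * 2 ^ i" for i k
      unfolding A_def by (auto simp: norm_mult norm_power intro!: mult_left_mono power_mono wb)
    have "(\<lambda>k. \<Sum>i. A i k) \<longlonglongrightarrow> (\<Sum>i. c i * f s ^ i)"
    proof (rule conjunct2[OF conjunct2[OF tannerys_theorem[OF _ _ sc]]])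
      fix i
      have "\<forall>\<^sub>F k in sequentially. c i * w k ^ i = A i k"
        using eventually_gt_at_top[of i] by eventually_elim (simp add: A_def)
      moreover have "(\<lambda>k. c i * w k ^ i) \<longlonglongrightarrow> c i * f s ^ i"
        by (intro tendsto_mult tendsto_const tendsto_power wl)
      ultimately show "(\<lambda>k. A i k) \<longlonglongrightarrow> c i * f s ^ i" by (rule Lim_transform_eventually[rotated])
      show "\<forall>\<^sub>F (i, k) in at_top \<times>\<^sub>F sequentially. norm (A i k) \<le> norm (c i) * 2 ^ i"
        by (rule always_eventually) (simp only: split_beta Ab simp_thms)
    qed simp
    moreover have "(\<Sum>i. A i k) = dp_eval (W k) s" for k
    proof -
      have "(\<Sum>i. A i k) = (\<Sum>i<k. A i k)" by (rule suminf_finite) (auto simp: A_def)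
      also have "\<dots> = dp_eval (W k) s" unfolding W_def dp_eval_dcomb[OF F] by (simp add: A_def w_def)
      finally show ?thesis .
    qed
    moreover have "(\<Sum>i. c i * f s ^ i) = \<phi> (f s)" using \<phi>[of "f s"] by (simp add: sums_iff)
    ultimately show ?thesis by simp
  qed
  obtain y where y: "\<And>n. (\<lambda>k. Y k n) \<longlonglongrightarrow> y n"
    using dp_Cauchy_coeff_convergent[OF bergman_repD(1)[OF Y] q] unfolding convergent_def by metis
  have Dlim: "(\<lambda>k. D k n) \<longlonglongrightarrow> y n - W (Suc n) n" for n
    unfolding D_def by (intro tendsto_diff y Wlim)
  have "y n - W (Suc n) n = 0" for n
  proof (rule coeff_limit_eq_0[OF D Db Dlim])
    fix s :: real assume "s \<ge> 1"
    then have s: "Re (of_real s) > 1/2" by simp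
    have "(\<lambda>k. dp_eval (Y k) (of_real s) - dp_eval (W k) (of_real s)) \<longlonglongrightarrow> superposition \<phi> f (of_real s) - \<phi> (f (of_real s))"
      by (intro tendsto_diff bergman_repD(2)[OF Y s] evW[OF s])
    moreover have "superposition \<phi> f (of_real s) = \<phi> (f (of_real s))"
      using s by (simp add: superposition_def compose_def C_half_def)
    ultimately show "(\<lambda>k. dp_eval (D k) (of_real s)) \<longlonglongrightarrow> 0"
      unfolding D_def dp_eval_diff[OF YD W] by simp
  qed
  then have D0: "(\<lambda>k. D k n) \<longlonglongrightarrow> 0" for n using Dlim[of n] by simp
  \<comment> \<open>The norm bound of the slice of degree \<open>N\<close> at radius 1/4, times
    \<open>B\<close>. The block projection is a contraction, so \<open>L\<close> does not depend on
    the block.\<close>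
  define L where "L = 1 / ((1/4) ^ N * (1 - sqrt (1/4)) powr (2/q)) * B"
  have bound: "norm (c N) * real i \<le> L" for i
  proof -
    \<comment> \<open>\<open>E\<close> retains block \<open>i\<close> and is multiplicative, hence
      maps the truncated series of \<open>F k\<close> to that of \<open>h i\<close>;
      \<open>S\<close> then retains the terms in which the marking prime has exponent
      \<open>N\<close>.\<close>
    define E where "E a n = of_bool (wt (blk i) n = 0) * a n" for a :: "nat \<Rightarrow> complex" and n
    define S where "S a n = of_bool (wt (\<lambda>j. if j = j0 i then 1 else 0) n = N) * E a n" for a :: "nat \<Rightarrow> complex" and n
    have E: "E a \<in> dirichlet_polys" if "a \<in> dirichlet_polys" for a
      unfolding E_def by (rule dirichlet_polys_multiplier[OF that])
    have S: "S a \<in> dirichlet_polys" if "a \<in> dirichlet_polys" for a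
      unfolding S_def by (rule dirichlet_polys_multiplier[OF E[OF that]])
    \<comment> \<open>From this index on both block \<open>i\<close> and the Taylor term
      \<open>N\<close> are present in \<open>W k\<close>.\<close>
    define m0 where "m0 = Suc (max i N)"
    have SW: "S (W k) n = c N * dpow (h i) N n" if k: "k \<ge> m0" for k n
    proof -
      have EF: "(\<lambda>n. of_bool (wt (blk i) n = 0) * F k n) = h i"
      proof
        fix n
        have "of_bool (wt (blk i) n = 0) * F k n = (\<Sum>m<k. of_bool (wt (blk i) n = 0) * h m n)"
          by (simp add: F_def sum_distrib_left)
        also have "\<dots> = (\<Sum>m<k. if m = i then h i n else 0)"
        proof (intro sum.cong refl)
          fix m
          show "of_bool (wt (blk i) n = 0) * h m n = (if m = i then h i n else 0)"
            using blk1[of i n] blk2[of m n i] by (cases "h m n = 0") auto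
        qed
        also have "\<dots> = h i n" using k by (simp add: m0_def)
        finally show "of_bool (wt (blk i) n = 0) * F k n = h i n" .
      qed
      have "E (W k) = dcomb c k (\<lambda>n. of_bool (wt (blk i) n = 0) * F k n)"
        unfolding E_def[abs_def] W_def
        by (rule dcomb_multiplier[OF F, symmetric]) (simp_all add: wt_mult)
      then have "E (W k) n = (\<Sum>m<k. c m * dpow (h i) m n)" unfolding EF by (simp add: dcomb_def)
      then have "S (W k) n = (\<Sum>m<k. of_bool (expo (j0 i) n = N) * (c m * dpow (h i) m n))"
        by (simp add: S_def wt_single sum_distrib_left)
      also have "\<dots> = (\<Sum>m<k. if m = N then c N * dpow (h i) N n else 0)"
      proof (intro sum.cong refl)
        fix m
        have "expo (j0 i) n = m" if "dpow (h i) m n \<noteq> 0" for m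
          using dpow_support_wt[OF h, of i "\<lambda>j. if j = j0 i then 1 else 0" 1 m n] hs(2)[of i] that
          by (simp add: wt_single)
        then show "of_bool (expo (j0 i) n = N) * (c m * dpow (h i) m n) = (if m = N then c N * dpow (h i) N n else 0)"
          by (cases "dpow (h i) m n = 0") auto
      qed
      also have "\<dots> = c N * dpow (h i) N n" using k by (simp add: m0_def)
      finally show ?thesis .
    qed
    \<comment> \<open>The projected \<open>Y k\<close> converge only coefficientwise to this
      polynomial, so the bound is transferred by the Fatou property.\<close>
    have "dp_norm q \<beta> (\<lambda>n. c N * dpow (h i) N n) \<le> L"
    proof (rule dp_norm_le_of_coeff_limit[of "\<lambda>k. S (Y (k + m0))"])
      show "S (Y (k + m0)) \<in> dirichlet_polys" for k by (rule S[OF YD])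
      show "(\<lambda>n. c N * dpow (h i) N n) \<in> dirichlet_polys"
        by (rule dirichlet_polys_multiplier[OF dirichlet_polys_dpow[OF h]])
      show "dp_norm q \<beta> (S (Y (k + m0))) \<le> L" for k
      proof -
        have "dp_norm q \<beta> (S (Y (k + m0))) \<le> 1 / ((1/4) ^ N * (1 - sqrt (1/4)) powr (2/q)) * dp_norm q \<beta> (E (Y (k + m0)))"
          unfolding S_def by (rule dp_norm_coeff_le[OF E[OF YD] q]) auto
        also have "\<dots> \<le> L"
          unfolding L_def
        proof (rule mult_left_mono)
          show "dp_norm q \<beta> (E (Y (k + m0))) \<le> B"
            unfolding E_def by (rule order.trans[OF dp_norm_keep_le[OF YD q] B(2)])
        qed simp
        finally show ?thesis .
      qed
      fix n
      have "(\<lambda>k. of_bool (wt (\<lambda>j. if j = j0 i then 1 else 0) n = N) * (of_bool (wt (blk i) n = 0) * D (k + m0) n) + c N * dpow (h i) N n)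
          \<longlonglongrightarrow> of_bool (wt (\<lambda>j. if j = j0 i then 1 else 0) n = N) * (of_bool (wt (blk i) n = 0) * 0) + c N * dpow (h i) N n"
        by (intro tendsto_add tendsto_mult tendsto_const LIMSEQ_ignore_initial_segment D0)
      moreover have "of_bool (wt (\<lambda>j. if j = j0 i then 1 else 0) n = N) * (of_bool (wt (blk i) n = 0) * D (k + m0) n) + c N * dpow (h i) N n
          = S (Y (k + m0)) n" for k
        using SW[of "k + m0" n] by (simp add: S_def E_def D_def right_diff_distrib)
      ultimately show "(\<lambda>k. S (Y (k + m0)) n) \<longlonglongrightarrow> c N * dpow (h i) N n" by simp
    qed (use q in auto)
    then have "norm (c N) * dp_norm q \<beta> (dpow (h i) N) \<le> L"
      using dp_norm_cmult[OF dirichlet_polys_dpow[OF h] q(1)] by simp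
    moreover have "norm (c N) * real i \<le> norm (c N) * dp_norm q \<beta> (dpow (h i) N)"
      by (intro mult_left_mono hq) simp
    ultimately show ?thesis by linarith
  qed
  obtain i :: nat where "L / norm (c N) < real i" using reals_Archimedean2 by blast
  then have "L < norm (c N) * real i" using cN by (simp add: field_simps)
  then show False using bound[of i] by simp
qed

section \<open>Product test polynomials\<close>

text \<open>Erdos's argument: every \<open>n \<le> 4^k\<close> is a squarefree number times the square of a number \<open>\<le> 2^k\<close>.\<close>

lemma card_primes_le_four_power: "k \<le> card {p::nat. prime p \<and> p \<le> 4 ^ k}"
proof -
  let ?P = "{p::nat. prime p \<and> p \<le> 4 ^ k}"
  have fP: "finite ?P" by (rule finite_subset[of _ "{..4 ^ k}"]) auto
  define g :: "nat set \<times> nat \<Rightarrow> nat" where "g = (\<lambda>(S, t). (\<Prod>p\<in>S. p) * t ^ 2)"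
  have "{1..4 ^ k} \<subseteq> g ` (Pow ?P \<times> {1..2 ^ k})"
  proof
    fix n :: nat assume n: "n \<in> {1..4 ^ k}"
    define s where "s = squarefree_part n"
    define u where "u = square_part n"
    have dec: "n = s * u ^ 2" unfolding s_def u_def by (rule squarefree_decompose)
    have s0: "s \<noteq> 0" by (simp add: s_def)
    have u0: "u \<noteq> 0" using n dec by (metis atLeastAtMost_iff mult_0_right not_one_le_zero zero_power2)
    have "s = (\<Prod>p\<in>prime_factors s. p ^ multiplicity p s)"
      using prod_prime_factors[OF s0] by simp
    also have "\<dots> = (\<Prod>p\<in>prime_factors s. p)"
    proof (rule prod.cong)
      fix p assume p: "p \<in> prime_factors s"
      then have "prime p" "p dvd s" by (auto dest: in_prime_factors_imp_prime)
      then have "multiplicity p s \<noteq> 0" using s0 by (simp add: prime_multiplicity_gt_zero_iff prime_imp_prime_elem)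
      moreover have "multiplicity p s \<le> Suc 0"
        unfolding s_def by (rule prime_multiplicity_squarefree_part_le_Suc_0[OF \<open>prime p\<close>])
      ultimately have "multiplicity p s = 1" by linarith
      then show "p ^ multiplicity p s = p" by simp
    qed simp
    finally have "n = g (prime_factors s, u)" using dec by (simp add: g_def)
    moreover have "prime_factors s \<in> Pow ?P"
    proof -
      have "p \<le> 4 ^ k" if "p \<in> prime_factors s" for p
      proof -
        have "p dvd s" using that by auto
        then have "p \<le> s" using s0 by (auto intro: dvd_imp_le)
        also have "s \<le> n" using dec u0 by (cases u) auto
        finally show ?thesis using n by simp
      qed
      then show ?thesis by (auto dest: in_prime_factors_imp_prime)
    qed
    moreover have "u \<in> {1..2 ^ k}"
    proof -
      have "u ^ 2 \<le> n" using dec s0 by (cases s) auto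
      also have "n \<le> (2 ^ k) ^ 2"
      proof -
        have "(4::nat) ^ k = (2 ^ k) ^ 2" by (simp add: power2_eq_square flip: power_mult_distrib)
        then show ?thesis using n by simp
      qed
      finally have "u \<le> 2 ^ k" by (simp add: power2_nat_le_eq_le)
      then show ?thesis using u0 by simp
    qed
    ultimately show "n \<in> g ` (Pow ?P \<times> {1..2 ^ k})" by blast
  qed
  then have "card {1..4 ^ k :: nat} \<le> card (g ` (Pow ?P \<times> {1..2 ^ k}))"
    using fP by (intro card_mono) auto
  also have "\<dots> \<le> card (Pow ?P \<times> {1..2 ^ k :: nat})" using fP by (intro card_image_le) auto
  also have "\<dots> = 2 ^ card ?P * 2 ^ k" using fP by (simp add: card_cartesian_product card_Pow)
  finally have "2 ^ k * 2 ^ k \<le> 2 ^ card ?P * (2::nat) ^ k"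
    by (simp flip: power_mult_distrib)
  then have "2 ^ k \<le> (2::nat) ^ card ?P" by simp
  then show ?thesis by (simp add: power_le_imp_le_exp)
qed

text \<open>Otherwise all primes up to 4^(m+1) would be among the first \<open>m\<close>, against
  the count of at least \<open>m + 1\<close>. What matters later is that the logarithm of the prime
  grows at most linearly with its index.\<close>

lemma nth_prime_le: "nth_prime m \<le> 4 ^ Suc m"
proof (rule ccontr)
  assume "\<not> nth_prime m \<le> 4 ^ Suc m"
  then have gt: "4 ^ Suc m < nth_prime m" by simp
  have "{p::nat. prime p \<and> p \<le> 4 ^ Suc m} \<subseteq> nth_prime ` {..<m}"
  proof
    fix p :: nat assume "p \<in> {p. prime p \<and> p \<le> 4 ^ Suc m}"
    then obtain j where j: "nth_prime j = p" "p \<le> 4 ^ Suc m" using nth_prime_surj by blast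
    then have "nth_prime j < nth_prime m" using gt by simp
    then show "p \<in> nth_prime ` {..<m}" using j by auto
  qed
  then have "card {p::nat. prime p \<and> p \<le> 4 ^ Suc m} \<le> card (nth_prime ` {..<m})"
    by (intro card_mono) auto
  also have "\<dots> \<le> m" using card_image_le[of "{..<m}" nth_prime] by simp
  finally show False using card_primes_le_four_power[of "Suc m"] by simp
qed

text \<open>The strict tangent inequality at 1. If the tangent value \<open>a\<close> is positive,
  logarithms are compared by using ln x \<le> x - 1 at \<open>1 / y\<close> and, strictly, at
  \<open>a / y\<close>; the right sides combine because \<open>a + (s - 1) = s * y\<close>.\<close>

lemma bernoulli_powr_strict:
  fixes y s :: real
  assumes "s > 1" "y > 0" "y \<noteq> 1"
  shows "1 + s * (y - 1) < y powr s"
proof (cases "1 + s * (y - 1) > 0")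
  case False
  then show ?thesis using assms powr_gt_zero[of y s] by linarith
next
  case True
  define a where "a = 1 + s * (y - 1)"
  have a: "a > 0" using True by (simp add: a_def)
  have "a \<noteq> y"
  proof
    assume "a = y"
    then have "(s - 1) * (y - 1) = 0" by (simp add: a_def algebra_simps)
    then show False using assms by simp
  qed
  then have "a / y \<noteq> 1" using assms by simp
  then have "ln (a / y) \<noteq> a / y - 1" using ln_eq_minus_one[of "a / y"] a assms by auto
  then have "ln (a / y) < a / y - 1" using ln_le_minus_one[of "a / y"] a assms by simp
  then have 1: "ln a < ln y + a / y - 1" using a assms by (simp add: ln_div)
  have 2: "- ln y \<le> 1 / y - 1" using ln_le_minus_one[of "1 / y"] assms by (simp add: ln_div)
  have "ln a + (s - 1) * (- ln y) < (ln y + a / y - 1) + (s - 1) * (1 / y - 1)"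
    using 1 2 assms by (intro add_less_le_mono mult_left_mono) auto
  also have "\<dots> = ln y + (a + (s - 1)) / y - s" using assms by (simp add: field_simps)
  also have "a + (s - 1) = s * y" by (simp add: a_def algebra_simps)
  also have "s * y / y = s" using assms by simp
  finally have "ln a < s * ln y" by (simp add: algebra_simps)
  then have "exp (ln a) < exp (s * ln y)" by simp
  then have "a < exp (s * ln y)" using a by (simp only: exp_ln)
  then show ?thesis using assms(2) by (simp add: a_def powr_def)
qed

text \<open>The moment of one factor of the product test polynomials. The coefficient 1/2 keeps the
  factor away from zero on the circle.\<close>

definition circle_mean :: "real \<Rightarrow> real" where
  "circle_mean p = (\<integral>w. norm (1 + w / 2) powr p \<partial>circle_measure)"

lemma norm_one_plus_half: "norm w = 1 \<Longrightarrow> norm (1 + w / 2 :: complex) > 0"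
proof -
  assume "norm w = 1"
  then have "norm (w / 2) = 1 / 2" by (simp add: norm_divide)
  then have "1 + w / 2 \<noteq> 0" by (metis add_eq_0_iff norm_minus_cancel norm_one one_neq_zero divide_eq_1_iff numeral_eq_one_iff semiring_norm(85) zero_neq_numeral)
  then show ?thesis by simp
qed

lemma integrable_circle_mean: "p > 0 \<Longrightarrow> integrable circle_measure (\<lambda>w. norm (1 + w / 2) powr p)"
  by (intro integrable_circle_continuous continuous_on_powr' continuous_intros) auto

text \<open>Monotonicity in the radius, compared with the value 1 at the centre.\<close>

lemma circle_mean_ge_1: assumes "p > 0" shows "circle_mean p \<ge> 1"
proof -
  have "(\<integral>z. norm (poly [:1, 1/2:] (of_real 0 * z)) powr p \<partial>circle_measure)
       \<le> (\<integral>z. norm (poly [:1, 1/2:] z) powr p \<partial>circle_measure)"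
    by (rule integral_poly_powr_mono[OF assms]) auto
  then show ?thesis using circle.prob_space by (simp add: circle_mean_def)
qed

text \<open>Strictness comes from the second and fourth moments \<open>5/4\<close> and \<open>33/16\<close>, which show that
  \<open>|1 + w/2|\<close> is not constant almost everywhere.\<close>

lemma circle_mean_strict:
  assumes p: "0 < p" and r: "p < r"
  shows "circle_mean p powr (1/p) < circle_mean r powr (1/r)"
proof -
  define s where "s = r / p"
  have s: "s > 1" using p r by (simp add: s_def)
  define m where "m = circle_mean p"
  have m: "m \<ge> 1" unfolding m_def by (rule circle_mean_ge_1[OF p])
  define X where "X w = norm (1 + w / 2 :: complex) powr p" for w
  have iX: "integrable circle_measure X" unfolding X_def by (rule integrable_circle_mean[OF p])
  have Xs: "X w powr s = norm (1 + w / 2) powr r" for w using p by (simp add: X_def powr_powr s_def)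
  have iXs: "integrable circle_measure (\<lambda>w. X w powr s)"
    unfolding Xs using p r by (intro integrable_circle_mean) simp
  \<comment> \<open>The gap in the tangent inequality at \<open>X w / m\<close>, scaled by
    \<open>m powr s\<close>. It is nonnegative, and since \<open>m\<close> is the mean of
    \<open>X\<close>, it integrates to \<open>circle_mean r - m powr s\<close>.\<close>
  define d where "d w = X w powr s - m powr s * (1 + s * (X w / m - 1))" for w
  have id: "integrable circle_measure d" unfolding d_def using iX iXs by simp
  have d0: "d w \<ge> 0" "d w = 0 \<Longrightarrow> X w = m" if "norm w = 1" for w
  proof -
    have "X w > 0" using norm_one_plus_half[OF that] by (simp add: X_def)
    then have y: "X w / m > 0" using m by simp
    have e: "X w powr s = m powr s * (X w / m) powr s"
      using m \<open>X w > 0\<close> by (simp add: powr_divide)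
    have mp: "m powr s > 0" using m by simp
    have "d w > 0" if "X w / m \<noteq> 1"
      unfolding d_def e using bernoulli_powr_strict[OF s y that] mp by simp
    moreover have "d w = 0" if "X w / m = 1" using that unfolding d_def e by simp
    ultimately show "d w \<ge> 0" "d w = 0 \<Longrightarrow> X w = m"
      using m by (cases "X w / m = 1"; force)+
  qed
  have "m powr s < circle_mean r"
  proof (rule ccontr)
    assume "\<not> m powr s < circle_mean r"
    then have le: "circle_mean r \<le> m powr s" by simp
    have IX: "(\<integral>w. X w \<partial>circle_measure) = m" by (simp add: X_def m_def circle_mean_def)
    have "(\<integral>w. d w \<partial>circle_measure) = (\<integral>w. X w powr s \<partial>circle_measure) - m powr s * (1 + s * ((\<integral>w. X w \<partial>circle_measure) / m - 1))"
      unfolding d_def using iX iXs circle.prob_space by simp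
    then have "(\<integral>w. d w \<partial>circle_measure) = circle_mean r - m powr s * (1 + s * (m / m - 1))"
      unfolding IX Xs circle_mean_def .
    then have "(\<integral>w. d w \<partial>circle_measure) \<le> 0" using le m by simp
    moreover have nn: "AE w in circle_measure. 0 \<le> d w" by (intro AE_I2 d0) simp
    ultimately have "(\<integral>w. d w \<partial>circle_measure) = 0" using integral_nonneg_AE[OF nn] by simp
    then have "AE w in circle_measure. d w = 0" using integral_nonneg_eq_0_iff_AE[OF id nn] by simp
    then have AE: "AE w in circle_measure. norm (1 + w / 2) = m powr (1/p)"
      using AE_space
    proof eventually_elim
      case (elim w)
      then have "norm w = 1" by simp
      then have "X w = m" using d0(2) elim by simp
      then have "X w powr (1/p) = m powr (1/p)" by simp
      then show ?case using p by (simp add: X_def powr_powr)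
    qed
    define k where "k = m powr (1/p)"
    have two: "(\<integral>w. (norm (1 + w / 2 :: complex))\<^sup>2 \<partial>circle_measure) = 5/4"
      using parseval_circle_finite[of "\<lambda>i. if i = 0 then 1 else 1/2" 2]
      by (simp add: numeral_2_eq_2 power2_eq_square norm_divide)
    have four: "(\<integral>w. (norm ((1 + w / 2 :: complex)\<^sup>2))\<^sup>2 \<partial>circle_measure) = 33/16"
    proof -
      have "(1 + w / 2)\<^sup>2 = (\<Sum>i<3. (if i = 0 then 1 else if i = 1 then 1 else 1/4) * w ^ i)" for w :: complex
        by (simp add: numeral_3_eq_3 power2_eq_square field_simps)
      then show ?thesis
        using parseval_circle_finite[of "\<lambda>i. if i = 0 then 1 else if i = 1 then 1 else 1/4" 3]
        by (simp add: numeral_3_eq_3 power2_eq_square norm_divide)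
    qed
    have "(\<integral>w. (norm (1 + w / 2 :: complex))\<^sup>2 \<partial>circle_measure) = (\<integral>w. k\<^sup>2 \<partial>circle_measure)"
    proof (rule integral_cong_AE)
      show "AE w in circle_measure. (norm (1 + w / 2))\<^sup>2 = k\<^sup>2" using AE by eventually_elim (simp add: k_def)
    qed (auto intro!: borel_measurable_circle_measure)
    then have k2: "k\<^sup>2 = 5/4" using two circle.prob_space by simp
    have "(\<integral>w. (norm ((1 + w / 2 :: complex)\<^sup>2))\<^sup>2 \<partial>circle_measure) = (\<integral>w. (k\<^sup>2)\<^sup>2 \<partial>circle_measure)"
    proof (rule integral_cong_AE)
      show "AE w in circle_measure. (norm ((1 + w / 2)\<^sup>2))\<^sup>2 = (k\<^sup>2)\<^sup>2" using AE by eventually_elim (simp add: k_def norm_power)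
    qed (auto intro!: borel_measurable_circle_measure)
    then have "(k\<^sup>2)\<^sup>2 = 33/16" using four circle.prob_space by simp
    then show False unfolding k2 by (simp add: power2_eq_square)
  qed
  then have "(m powr s) powr (1/r) < circle_mean r powr (1/r)"
    using p r by (intro powr_less_mono2) auto
  then show ?thesis using p r by (simp add: powr_powr s_def m_def)
qed

lemma integral_torus_prod:
  assumes "finite A" "p > 0"
  shows "(\<integral>z. (\<Prod>j\<in>A. norm (1 + z j / 2) powr p) \<partial>torus_measure) = circle_mean p ^ card A"
proof -
  have m: "(\<lambda>w. norm (1 + w / 2 :: complex) powr p) \<in> borel_measurable circle_measure"
    by (intro borel_measurable_circle_measure) measurable
  have "torus.indep_vars (\<lambda>_. borel) (\<lambda>j z. norm (1 + z j / 2) powr p) A"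
    by (rule torus.indep_vars_compose2[OF torus.indep_vars_subset[OF indep_torus_coord subset_UNIV] m])
  moreover have "integrable torus_measure (\<lambda>z. norm (1 + z j / 2) powr p)" for j
    using integrable_distr[OF measurable_torus_coord[of j], of "\<lambda>w. norm (1 + w / 2 :: complex) powr p"]
      integrable_circle_mean[OF assms(2)] by (simp add: distr_torus_coord)
  ultimately have "(\<integral>z. (\<Prod>j\<in>A. norm (1 + z j / 2) powr p) \<partial>torus_measure)
      = (\<Prod>j\<in>A. \<integral>z. norm (1 + z j / 2) powr p \<partial>torus_measure)"
    using assms(1) by (intro torus.indep_vars_lebesgue_integral) auto
  also have "\<dots> = circle_mean p ^ card A"
    unfolding circle_mean_def using integral_torus_coord[OF m] by simp
  finally show ?thesis .
qed

section \<open>Lower bounds for norms of test polynomials\<close>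

lemma nth_prime_neq_0 [simp]: "nth_prime j \<noteq> 0"
  using nth_prime_pos[of j] by linarith

text \<open>Comparison with a step function. The product test polynomials use a single interval, the
  lacunary ones one interval for each prime.\<close>

lemma AP_ge_disjoint:
  assumes a: "a \<in> dirichlet_polys" and r: "r > 0" and \<beta>: "\<beta> > -1" and I: "finite I" and S: "\<And>i. S i \<in> sets borel"
    and disj: "\<And>i j \<sigma>. i \<in> I \<Longrightarrow> j \<in> I \<Longrightarrow> \<sigma> \<in> S i \<Longrightarrow> \<sigma> \<in> S j \<Longrightarrow> i = j"
    and le: "\<And>i \<sigma>. i \<in> I \<Longrightarrow> \<sigma> \<in> S i \<Longrightarrow> b i \<le> HP r (dp_shift \<sigma> a)"
  shows "(\<Sum>i\<in>I. b i * measure (mu_measure \<beta>) (S i)) \<le> AP r \<beta> a"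
proof -
  interpret prob_space "mu_measure \<beta>" by (rule prob_space_mu_measure[OF \<beta>])
  have i: "integrable (mu_measure \<beta>) (\<lambda>\<sigma>. b i * indicator (S i) \<sigma>)" for i
    by (intro integrable_mult_right integrable_real_indicator) (simp_all add: emeasure_eq_measure S)
  have "(\<Sum>i\<in>I. b i * prob (S i)) = (\<Sum>i\<in>I. \<integral>\<sigma>. b i * indicator (S i) \<sigma> \<partial>mu_measure \<beta>)"
    by simp
  also have "\<dots> = (\<integral>\<sigma>. (\<Sum>i\<in>I. b i * indicator (S i) \<sigma>) \<partial>mu_measure \<beta>)"
    by (rule Bochner_Integration.integral_sum[OF i, symmetric])
  also have "\<dots> \<le> AP r \<beta> a"
    unfolding AP_def
  proof (rule integral_mono[OF Bochner_Integration.integrable_sum[OF i] integrable_AP[OF a r \<beta>]])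
    fix \<sigma> :: real
    show "(\<Sum>i\<in>I. b i * indicator (S i) \<sigma>) \<le> HP r (dp_shift \<sigma> a)"
    proof (cases "\<exists>i\<in>I. \<sigma> \<in> S i")
      case True
      then obtain i where i: "i \<in> I" "\<sigma> \<in> S i" by (rule bexE)
      have "(\<Sum>j\<in>I. b j * indicator (S j) \<sigma>) = (\<Sum>j\<in>I. if j = i then b i else 0)"
      proof (intro sum.cong refl)
        fix j assume j: "j \<in> I"
        show "b j * indicator (S j) \<sigma> = (if j = i then b i else 0)"
          using disj[OF i(1) j i(2)] i(2) by (cases "\<sigma> \<in> S j") auto
      qed
      also have "\<dots> = b i" using I i(1) by simp
      finally show ?thesis using le[OF i] by simp
    next
      case False
      then have "(\<Sum>i\<in>I. b i * indicator (S i) \<sigma>) = 0" by (intro sum.neutral) auto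
      then show ?thesis by (simp add: HP_nonneg)
    qed
  qed
  finally show ?thesis .
qed

text \<open>The norm of the power is the \<open>N\<close>-th power of the norm with exponent
  \<open>q * real N\<close>, which does not fall below its base once the base is at least 1; hence
  the maximum with 1.\<close>

lemma dp_norm_dpow_ge:
  assumes a: "a \<in> dirichlet_polys" and q: "q > 0" and N: "N > 0" and K: "max 1 K \<le> dp_norm (q * real N) \<beta> a"
  shows "K \<le> dp_norm q \<beta> (dpow a N)"
proof -
  have "dp_norm q \<beta> (dpow a N) = (dp_norm (q * real N) \<beta> a powr (q * real N)) powr (1/q)"
    using q N by (simp add: dp_norm_altdef[OF q] AP_dpow[OF a N] dp_norm_powr)
  also have "\<dots> = dp_norm (q * real N) \<beta> a powr real N"
    using q by (simp add: powr_powr)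
  also have "\<dots> \<ge> dp_norm (q * real N) \<beta> a powr 1"
    using K N by (intro powr_mono) auto
  finally show ?thesis using K by (simp add: dp_norm_nonneg)
qed

lemma dp_shift_0:
  assumes "a \<in> dirichlet_polys" shows "dp_shift 0 a = a"
proof
  fix n show "dp_shift 0 a n = a n"
    using dirichlet_polysD(1)[OF assms] by (cases "n = 0") (simp_all add: dp_shift_def)
qed

lemma AP_le_HP:
  assumes a: "a \<in> dirichlet_polys" and p: "p > 0" "\<alpha> > -1"
  shows "AP p \<alpha> a \<le> HP p a"
proof -
  interpret prob_space "mu_measure \<alpha>" by (rule prob_space_mu_measure[OF p(2)])
  have "AP p \<alpha> a \<le> (\<integral>\<sigma>. HP p a \<partial>mu_measure \<alpha>)"
    unfolding AP_def
  proof (rule integral_mono_AE[OF integrable_AP[OF a p]])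
    show "AE \<sigma> in mu_measure \<alpha>. HP p (dp_shift \<sigma> a) \<le> HP p a"
      using AE_mu_measure[of \<alpha>]
    proof eventually_elim
      case (elim \<sigma>)
      then show ?case using HP_shift_antimono[OF a p(1), of 0 \<sigma>] dp_shift_0[OF a] by simp
    qed
  qed simp
  then show ?thesis using prob_space by simp
qed

text \<open>The exponential gain from \<open>M\<close> factors outweighs the small mass of the
  interval on which the shift is harmless, whose length decays only quadratically in
  \<open>M\<close>.\<close>

lemma exp_beats_powr:
  fixes a e J :: real
  assumes "a > 0" "e > 0" "J \<ge> 0"
  shows "filterlim (\<lambda>M::nat. exp (a * real M) * (2 * (J + real M + 1)^2) powr (-e)) at_top sequentially"
  using assms by real_asymp

definition half_factor :: "nat \<Rightarrow> nat \<Rightarrow> complex" where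
  "half_factor j = (\<lambda>n. if n = 1 then 1 else if n = nth_prime j then 1/2 else 0)"

text \<open>The polynomial z_J times the product of 1 + z_j / 2 over J < j \<le> J + M. The leading
  variable marks the degree and has modulus 1 on the torus, so it does not affect the Hardy
  norms.\<close>

primrec half_prod :: "nat \<Rightarrow> nat \<Rightarrow> nat \<Rightarrow> complex" where
  "half_prod J 0 = (\<lambda>n. of_bool (n = nth_prime J))"
| "half_prod J (Suc M) = dconv (half_factor (J + Suc M)) (half_prod J M)"

lemma nth_prime_neq_1: "nth_prime j \<noteq> 1"
  using prime_gt_1_nat[OF prime_nth_prime[of j]] by simp

lemma half_factor_support: "{n. half_factor j n \<noteq> 0} \<subseteq> {1, nth_prime j}"
  by (auto simp: half_factor_def)

lemma dirichlet_polys_half_factor: "half_factor j \<in> dirichlet_polys"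
  using finite_subset[OF half_factor_support[of j]] nth_prime_pos[of j]
  by (auto simp: dirichlet_polys_def half_factor_def)

lemma dirichlet_polys_half_prod: "half_prod J M \<in> dirichlet_polys"
proof (induction M)
  case 0
  have "{n. half_prod J 0 n \<noteq> 0} \<subseteq> {nth_prime J}" by auto
  then show ?case using nth_prime_pos[of J] finite_subset by (auto simp: dirichlet_polys_def)
qed (simp add: dirichlet_polys_dconv dirichlet_polys_half_factor)

lemma half_prod_support:
  "half_prod J M n \<noteq> 0 \<Longrightarrow> (\<forall>i<J. expo i n = 0) \<and> expo J n = 1"
proof (induction M arbitrary: n)
  case 0
  then have "n = nth_prime J" by (simp split: if_splits)
  then show ?case by (simp add: expo_nth_prime)
next
  case (Suc M)
  from Suc.prems have "dconv (half_factor (J + Suc M)) (half_prod J M) n \<noteq> 0" by simp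
  then obtain i j where ij: "half_factor (J + Suc M) i \<noteq> 0" "half_prod J M j \<noteq> 0" "n = i * j"
    by (rule dconv_nonzeroE)
  have "i \<in> {1, nth_prime (J + Suc M)}" using ij(1) half_factor_support by blast
  then have z: "expo l i = 0" if "l \<le> J" for l using that by (auto simp: expo_nth_prime)
  have "0 < i" "0 < j"
    using dirichlet_polys_pos[OF dirichlet_polys_half_factor ij(1)] dirichlet_polys_pos[OF dirichlet_polys_half_prod ij(2)] by auto
  then show ?case using Suc.IH[OF ij(2)] z ij(3) by (simp add: expo_mult)
qed

lemma eval_char_half_prod:
  assumes \<theta>: "\<And>i j. 0 < i \<Longrightarrow> 0 < j \<Longrightarrow> \<theta> (i * j) = \<theta> i * \<theta> j" "\<theta> 1 = 1"
  shows "eval_char \<theta> (half_prod J M) = \<theta> (nth_prime J) * (\<Prod>j\<in>{J<..J+M}. 1 + \<theta> (nth_prime j) / 2)"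
proof (induction M)
  case 0
  show ?case by (subst eval_char_altdef[of "{nth_prime J}"]) auto
next
  case (Suc M)
  have "eval_char \<theta> (half_factor (J + Suc M)) = (\<Sum>n\<in>{1, nth_prime (J + Suc M)}. half_factor (J + Suc M) n * \<theta> n)"
    by (rule eval_char_altdef[OF _ half_factor_support]) simp
  also have "\<dots> = 1 + \<theta> (nth_prime (J + Suc M)) / 2"
    using nth_prime_neq_1[of "J + Suc M"] \<theta>(2) by (simp add: half_factor_def)
  finally have 1: "eval_char \<theta> (half_factor (J + Suc M)) = 1 + \<theta> (nth_prime (J + Suc M)) / 2" .
  have "{J<..J + Suc M} = insert (J + Suc M) {J<..J + M}" by auto
  then have 2: "(\<Prod>j\<in>{J<..J+Suc M}. 1 + \<theta> (nth_prime j) / 2)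
      = (1 + \<theta> (nth_prime (J + Suc M)) / 2) * (\<Prod>j\<in>{J<..J+M}. 1 + \<theta> (nth_prime j) / 2)" by simp
  have "eval_char \<theta> (half_prod J (Suc M)) = eval_char \<theta> (half_factor (J + Suc M)) * eval_char \<theta> (half_prod J M)"
    unfolding half_prod.simps
    by (rule eval_char_dconv[OF dirichlet_polys_half_factor dirichlet_polys_half_prod \<theta>(1)])
  then show ?case unfolding 1 2 Suc by (simp add: mult_ac)
qed

lemma bohr_lift_shift_half_prod:
  "bohr_lift (dp_shift \<sigma> (half_prod J M)) z = of_real (real (nth_prime J) powr (-\<sigma>)) * z J *
     (\<Prod>j\<in>{J<..J+M}. 1 + of_real (real (nth_prime j) powr (-\<sigma>)) * z j / 2)"
proof -
  have "bohr_lift (dp_shift \<sigma> (half_prod J M)) z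
      = eval_char (\<lambda>n. of_real (real n powr (-\<sigma>)) * bohr_monom n z) (half_prod J M)"
    unfolding bohr_lift_shift[OF dirichlet_polys_half_prod] eval_char_def by (simp add: mult.assoc)
  also have "\<dots> = (of_real (real (nth_prime J) powr (-\<sigma>)) * bohr_monom (nth_prime J) z) *
      (\<Prod>j\<in>{J<..J+M}. 1 + (of_real (real (nth_prime j) powr (-\<sigma>)) * bohr_monom (nth_prime j) z) / 2)"
    by (rule eval_char_half_prod) (simp_all add: bohr_monom_mult powr_mult)
  finally show ?thesis by (simp add: bohr_monom_nth_prime)
qed

lemma HP_half_prod:
  assumes p: "p > 0"
  shows "HP p (half_prod J M) = circle_mean p ^ M"
proof -
  have "HP p (half_prod J M) = (\<integral>z. (\<Prod>j\<in>{J<..J+M}. norm (1 + z j / 2) powr p) \<partial>torus_measure)"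
    unfolding HP_def
  proof (rule Bochner_Integration.integral_cong)
    fix z assume z: "z \<in> space torus_measure"
    have "bohr_lift (half_prod J M) z = z J * (\<Prod>j\<in>{J<..J+M}. 1 + z j / 2)"
      using bohr_lift_shift_half_prod[of 0 J M z] by (simp add: dp_shift_0[OF dirichlet_polys_half_prod])
    then show "norm (bohr_lift (half_prod J M) z) powr p = (\<Prod>j\<in>{J<..J+M}. norm (1 + z j / 2) powr p)"
      using norm_torus[OF z] by (simp add: norm_mult prod_norm[symmetric] prod_powr_distrib)
  qed simp
  also have "\<dots> = circle_mean p ^ M" by (subst integral_torus_prod) (use p in simp_all)
  finally show ?thesis .
qed

text \<open>The squares of the two sides differ by (1 - \<rho>) (1 + \<rho> + \<rho> Re w), which is
  nonnegative. Thus damping a variable by \<rho> costs at most a factor \<rho>.\<close>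

lemma norm_one_plus_scaled_ge:
  fixes w :: complex
  assumes "norm w = 1" "0 \<le> \<rho>" "\<rho> \<le> 1"
  shows "\<rho> * norm (1 + w / 2) \<le> norm (1 + of_real \<rho> * w / 2)"
proof -
  have "(norm (of_real \<rho> * (1 + w / 2)))\<^sup>2 \<le> (norm (1 + of_real \<rho> * w / 2))\<^sup>2"
  proof -
    have "\<bar>Re w\<bar> \<le> 1" using abs_Re_le_cmod[of w] assms by simp
    have "(norm (1 + of_real \<rho> * w / 2))\<^sup>2 - (norm (of_real \<rho> * (1 + w / 2)))\<^sup>2
        = 1 + \<rho> * Re w - \<rho>\<^sup>2 - \<rho>\<^sup>2 * Re w"
      unfolding cmod_power2 by (simp add: power2_eq_square field_simps)
    also have "\<dots> = (1 - \<rho>) * ((1 + \<rho>) + \<rho> * Re w)"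
      by (simp add: power2_eq_square algebra_simps)
    finally have "(norm (1 + of_real \<rho> * w / 2))\<^sup>2 - (norm (of_real \<rho> * (1 + w / 2)))\<^sup>2
        = (1 - \<rho>) * ((1 + \<rho>) + \<rho> * Re w)" .
    moreover have "0 \<le> (1 - \<rho>) * ((1 + \<rho>) + \<rho> * Re w)"
    proof (rule mult_nonneg_nonneg)
      have "- \<rho> \<le> \<rho> * Re w" using mult_left_mono[of "-1" "Re w" \<rho>] \<open>\<bar>Re w\<bar> \<le> 1\<close> assms by simp
      then show "0 \<le> (1 + \<rho>) + \<rho> * Re w" using assms by simp
    qed (use assms in simp)
    ultimately show ?thesis by linarith
  qed
  then have "norm (of_real \<rho> * (1 + w / 2)) \<le> norm (1 + of_real \<rho> * w / 2)"
    by (rule power2_le_imp_le) simp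
  then show ?thesis using assms by (simp add: norm_mult)
qed

text \<open>With L = J + M + 1, the primes involved have logarithm at most 2 L, so each of the M + 1
  factors loses at most exp(-2 \<sigma> L). The restriction on \<sigma> bounds the total loss by
  exp(-1), independently of \<open>M\<close>.\<close>

lemma HP_shift_half_prod_ge:
  assumes r: "r > 0" and \<sigma>: "0 \<le> \<sigma>" "\<sigma> \<le> 1 / (2 * (real J + real M + 1)^2)"
  shows "exp (- r) * circle_mean r ^ M \<le> HP r (dp_shift \<sigma> (half_prod J M))"
proof -
  define L where "L = real J + real M + 1"
  have L: "L \<ge> 1" by (simp add: L_def)
  define \<rho> where "\<rho> = exp (- (\<sigma> * 2 * L))"
  have \<rho>: "0 < \<rho>" "\<rho> \<le> 1" using \<sigma> L by (auto simp: \<rho>_def)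
  have pj: "\<rho> \<le> real (nth_prime j) powr (-\<sigma>)" "real (nth_prime j) powr (-\<sigma>) \<le> 1" if "j \<le> J + M" for j
  proof -
    have p1: "1 \<le> real (nth_prime j)" using prime_ge_1_nat[OF prime_nth_prime[of j]] by simp
    have "real (nth_prime j) \<le> real (4 ^ Suc j)" using nth_prime_le[of j] by (simp only: of_nat_le_iff)
    then have "ln (real (nth_prime j)) \<le> ln (real (4 ^ Suc j))" using p1 by (subst ln_le_cancel_iff) auto
    also have "\<dots> = real (Suc j) * ln 4" by (simp only: of_nat_power of_nat_numeral ln_realpow zero_less_numeral)
    also have "\<dots> \<le> L * 2"
    proof (rule mult_mono)
      have "ln (4::real) = 2 * ln 2" using ln_realpow[of 2 2] by simp
      then show "ln (4::real) \<le> 2" using ln_2_less_1 by simp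
    qed (use that in \<open>auto simp: L_def\<close>)
    finally have "\<sigma> * ln (real (nth_prime j)) \<le> \<sigma> * (L * 2)" using \<sigma> by (intro mult_left_mono) auto
    then show "\<rho> \<le> real (nth_prime j) powr (-\<sigma>)" using p1 by (simp add: \<rho>_def powr_def mult_ac)
    have "real (nth_prime j) powr (-\<sigma>) \<le> real (nth_prime j) powr 0" using p1 \<sigma> by (intro powr_mono) auto
    then show "real (nth_prime j) powr (-\<sigma>) \<le> 1" using p1 by simp
  qed
  have "\<rho> ^ Suc M = exp (- (real (Suc M) * (\<sigma> * 2 * L)))"
    unfolding \<rho>_def exp_of_nat_mult[symmetric] by simp
  moreover have "real (Suc M) * (\<sigma> * 2 * L) \<le> 1"
  proof -
    have "real (Suc M) * (\<sigma> * 2 * L) \<le> L * (\<sigma> * 2 * L)"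
      using \<sigma> L by (intro mult_right_mono) (auto simp: L_def)
    also have "\<dots> = \<sigma> * (2 * L^2)" by (simp add: power2_eq_square)
    also have "\<dots> \<le> 1 / (2 * L^2) * (2 * L^2)" using \<sigma> unfolding L_def[symmetric] by (intro mult_right_mono) auto
    also have "\<dots> = 1" using L by simp
    finally show ?thesis .
  qed
  ultimately have \<rho>M: "exp (-1) \<le> \<rho> ^ Suc M" by simp
  have "exp (- r) * circle_mean r ^ M = exp (- r) * (\<integral>z. (\<Prod>j\<in>{J<..J+M}. norm (1 + z j / 2) powr r) \<partial>torus_measure)"
    by (subst integral_torus_prod) (use r in simp_all)
  also have "\<dots> = (\<integral>z. exp (- r) * norm (bohr_lift (half_prod J M) z) powr r \<partial>torus_measure)"
  proof -
    have "(\<integral>z. (\<Prod>j\<in>{J<..J+M}. norm (1 + z j / 2) powr r) \<partial>torus_measure) = HP r (half_prod J M)"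
      unfolding HP_half_prod[OF r] by (subst integral_torus_prod) (use r in simp_all)
    then show ?thesis by (simp add: HP_def)
  qed
  also have "\<dots> \<le> HP r (dp_shift \<sigma> (half_prod J M))"
    unfolding HP_def
  proof (rule integral_mono)
    show "integrable torus_measure (\<lambda>z. exp (- r) * norm (bohr_lift (half_prod J M) z) powr r)"
      using integrable_HP[OF dirichlet_polys_half_prod r] by simp
    show "integrable torus_measure (\<lambda>z. norm (bohr_lift (dp_shift \<sigma> (half_prod J M)) z) powr r)"
      by (rule integrable_HP[OF dirichlet_polys_shift[OF dirichlet_polys_half_prod] r])
    fix z assume z: "z \<in> space torus_measure"
    define R where "R = (\<Prod>j\<in>{J<..J+M}. norm (1 + z j / 2))"
    have R0: "R \<ge> 0" unfolding R_def by (intro prod_nonneg) simp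
    have 0: "norm (bohr_lift (half_prod J M) z) = R"
      using bohr_lift_shift_half_prod[of 0 J M z] norm_torus[OF z]
      by (simp add: dp_shift_0[OF dirichlet_polys_half_prod] norm_mult prod_norm[symmetric] R_def)
    have "exp (-1) * R \<le> \<rho> ^ Suc M * R" by (rule mult_right_mono[OF \<rho>M R0])
    also have "\<dots> = \<rho> * (\<Prod>j\<in>{J<..J+M}. \<rho> * norm (1 + z j / 2))"
      by (simp add: R_def prod.distrib)
    also have "\<dots> \<le> real (nth_prime J) powr (-\<sigma>) *
        (\<Prod>j\<in>{J<..J+M}. norm (1 + of_real (real (nth_prime j) powr (-\<sigma>)) * z j / 2))"
    proof (intro mult_mono prod_mono conjI)
      fix j assume j: "j \<in> {J<..J+M}"
      have "\<rho> * norm (1 + z j / 2) \<le> real (nth_prime j) powr (-\<sigma>) * norm (1 + z j / 2)"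
        using j by (intro mult_right_mono pj) auto
      also have "\<dots> \<le> norm (1 + of_real (real (nth_prime j) powr (-\<sigma>)) * z j / 2)"
        using j by (intro norm_one_plus_scaled_ge norm_torus[OF z] pj) auto
      finally show "\<rho> * norm (1 + z j / 2) \<le> norm (1 + of_real (real (nth_prime j) powr (-\<sigma>)) * z j / 2)" .
      show "0 \<le> \<rho> * norm (1 + z j / 2)" using \<rho> by simp
    next
      show "\<rho> \<le> real (nth_prime J) powr (-\<sigma>)" by (rule pj) simp
    qed (use \<rho> in \<open>auto intro!: prod_nonneg\<close>)
    also have "\<dots> = norm (bohr_lift (dp_shift \<sigma> (half_prod J M)) z)"
      unfolding bohr_lift_shift_half_prod using norm_torus[OF z] by (simp add: norm_mult prod_norm[symmetric])
    finally have "(exp (-1) * R) powr r \<le> norm (bohr_lift (dp_shift \<sigma> (half_prod J M)) z) powr r"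
      using r R0 by (intro powr_mono2) auto
    then show "exp (- r) * norm (bohr_lift (half_prod J M) z) powr r \<le> norm (bohr_lift (dp_shift \<sigma> (half_prod J M)) z) powr r"
      unfolding 0 by (simp add: powr_mult exp_powr_real)
  qed
  finally show ?thesis .
qed

text \<open>Follows from submultiplicativity. For large \<open>J\<close> each factor is as close to
  1 as desired, so any \<omega> > 1 is eventually allowed.\<close>

lemma l1_half_prod_le:
  assumes "\<And>j. j > J \<Longrightarrow> 1 + real (nth_prime j) powr (-1/2) / 2 \<le> \<omega>"
  shows "l1 (1/2) (half_prod J M) \<le> \<omega> ^ M"
proof -
  have \<omega>: "\<omega> \<ge> 0" using assms[of "Suc J"] by (smt (verit) divide_nonneg_pos powr_ge_zero lessI)
  show ?thesis
  proof (induction M)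
    case 0
    have "l1 (1/2) (half_prod J 0) = (\<Sum>n\<in>{nth_prime J}. norm (half_prod J 0 n) * real n powr (-(1/2)))"
      by (rule l1_altdef) auto
    also have "\<dots> = real (nth_prime J) powr (-(1/2))" by simp
    also have "\<dots> \<le> real (nth_prime J) powr 0"
      using prime_ge_1_nat[OF prime_nth_prime[of J]] by (intro powr_mono) auto
    finally show ?case by simp
  next
    case (Suc M)
    have "l1 (1/2) (half_factor (J + Suc M)) = (\<Sum>n\<in>{1, nth_prime (J + Suc M)}. norm (half_factor (J + Suc M) n) * real n powr (-(1/2)))"
      by (rule l1_altdef[OF _ half_factor_support]) simp
    also have "\<dots> = 1 + real (nth_prime (J + Suc M)) powr (-1/2) / 2"
      using nth_prime_neq_1[of "J + Suc M"] by (simp add: half_factor_def norm_divide)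
    also have "\<dots> \<le> \<omega>" by (rule assms) simp
    finally have 1: "l1 (1/2) (half_factor (J + Suc M)) \<le> \<omega>" .
    have "l1 (1/2) (half_prod J (Suc M)) \<le> l1 (1/2) (half_factor (J + Suc M)) * l1 (1/2) (half_prod J M)"
      unfolding half_prod.simps by (rule l1_dconv_le[OF dirichlet_polys_half_factor dirichlet_polys_half_prod])
    also have "\<dots> \<le> \<omega> * \<omega> ^ M" using \<omega> by (intro mult_mono 1 Suc l1_nonneg)
    finally show ?case by simp
  qed
qed

lemma l1_cmult:
  assumes "a \<in> dirichlet_polys" shows "l1 s (\<lambda>n. c * a n) = norm c * l1 s a"
  by (subst l1_altdef[of "{n. a n \<noteq> 0}"])
    (use dirichlet_polysD(2)[OF assms] in \<open>auto simp: l1_def norm_mult sum_distrib_left mult.assoc\<close>)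

lemma has_test_polys_gt:
  assumes p: "p > 0" "\<alpha> > -1" and q: "q > 0" "\<beta> > -1" and gt: "p < q * real N"
  shows "has_test_polys p \<alpha> q \<beta> N"
  unfolding has_test_polys_def
proof (intro allI impI)
  fix J0 and \<eta> K :: real assume \<eta>: "\<eta> > 0"
  define r where "r = q * real N"
  have r: "p < r" "0 < r" using gt p by (auto simp: r_def)
  have N: "N > 0" using r q by (cases N) (auto simp: r_def)
  \<comment> \<open>Division by \<omega>^M keeps the source norm and, for large \<open>J\<close>,
    the \<open>l1\<close> norm bounded, while in the exponent \<open>r\<close> a factor greater than
    1 survives for each prime.\<close>
  obtain \<omega> where \<omega>: "circle_mean p powr (1/p) < \<omega>" "\<omega> < circle_mean r powr (1/r)"
    using dense[OF circle_mean_strict[OF p(1) r(1)]] by blast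
  have "1 \<le> circle_mean p powr (1/p)" using circle_mean_ge_1[OF p(1)] p by (intro ge_one_powr_ge_zero) auto
  then have \<omega>1: "\<omega> > 1" using \<omega> by simp
  obtain J1 :: nat where J1: "(2 * (\<omega> - 1)) powr (-2) < real J1" using reals_Archimedean2 by blast
  define J where "J = max J0 J1"
  have J1J: "real J1 \<le> real J" by (simp add: J_def)
  have small: "1 + real (nth_prime j) powr (-1/2) / 2 \<le> \<omega>" if "j > J" for j
  proof -
    have "(2 * (\<omega> - 1)) powr (-2) \<le> real (nth_prime j)"
      using J1 J1J that le_nth_prime[of j] by linarith
    then have "real (nth_prime j) powr (-1/2) \<le> ((2 * (\<omega> - 1)) powr (-2)) powr (-1/2)"
      using \<omega>1 by (intro powr_mono2') auto
    also have "\<dots> = 2 * (\<omega> - 1)" using \<omega>1 by (simp add: powr_powr)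
    finally show ?thesis by simp
  qed
  obtain \<kappa> where \<kappa>: "\<kappa> > 0" "\<And>\<delta>. 0 < \<delta> \<Longrightarrow> \<delta> \<le> 1 \<Longrightarrow> \<kappa> * \<delta> powr (\<beta> + 1) \<le> measure (mu_measure \<beta>) {\<delta>/2<..\<delta>}"
    using mu_measure_interval_ge[OF q(2)] by blast
  define x where "x = ln (circle_mean r powr (1/r) / \<omega>)"
  have x: "x > 0" unfolding x_def using \<omega> \<omega>1 by (intro ln_gt_zero) (simp add: pos_less_divide_eq)
  define e where "e = (\<beta> + 1) / r"
  have e: "e > 0" using q r by (simp add: e_def)
  define c0 where "c0 = \<eta> * exp (-1) * \<kappa> powr (1/r)"
  have c0: "c0 > 0" using \<eta> \<kappa> by (simp add: c0_def)
  have "filterlim (\<lambda>M::nat. exp (x * real M) * (2 * (real J + real M + 1)^2) powr (-e)) at_top sequentially"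
    by (rule exp_beats_powr) (use x e in auto)
  \<comment> \<open>The number of factors is chosen last: \<open>J\<close>, fixed above by the
    \<open>l1\<close> bound, enters the length of the interval.\<close>
  then have "\<forall>\<^sub>F M::nat in sequentially. max 1 K / c0 \<le> exp (x * real M) * (2 * (real J + real M + 1)^2) powr (-e)"
    unfolding filterlim_at_top by blast
  then obtain M :: nat where M: "max 1 K / c0 \<le> exp (x * real M) * (2 * (real J + real M + 1)^2) powr (-e)"
    using eventually_happens'[OF sequentially_bot] by blast
  define c where "c = \<eta> * (1 / \<omega>) ^ M"
  have c: "c > 0" using \<eta> \<omega>1 by (simp add: c_def)
  define a where "a = half_prod J M"
  have a: "a \<in> dirichlet_polys" unfolding a_def by (rule dirichlet_polys_half_prod)
  have c\<omega>: "c * \<omega> ^ M = \<eta>" using \<omega>1 by (simp add: c_def power_one_over)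
  define \<delta> where "\<delta> = 1 / (2 * (real J + real M + 1)^2)"
  have "1 \<le> (real J + real M + 1)^2" by (simp add: one_le_power)
  then have "1 \<le> 2 * (real J + real M + 1)^2" by linarith
  moreover have "0 < 1 / V \<and> 1 / V \<le> 1" if "1 \<le> V" for V :: real using that by simp
  ultimately have \<delta>: "0 < \<delta>" "\<delta> \<le> 1" unfolding \<delta>_def by blast+
  have low: "max 1 K \<le> dp_norm r \<beta> (\<lambda>n. of_real c * a n)"
  proof -
    have "(\<Sum>i\<in>{()}. exp (- r) * circle_mean r ^ M * measure (mu_measure \<beta>) {\<delta>/2<..\<delta>}) \<le> AP r \<beta> a"
      unfolding a_def
    proof (rule AP_ge_disjoint[OF dirichlet_polys_half_prod r(2) q(2)])
      fix i \<sigma> assume "\<sigma> \<in> {\<delta>/2<..\<delta>}"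
      then show "exp (- r) * circle_mean r ^ M \<le> HP r (dp_shift \<sigma> (half_prod J M))"
        using \<delta> by (intro HP_shift_half_prod_ge r) (auto simp: \<delta>_def)
    qed auto
    then have "exp (- r) * circle_mean r ^ M * measure (mu_measure \<beta>) {\<delta>/2<..\<delta>} \<le> AP r \<beta> a" by simp
    moreover have "exp (- r) * circle_mean r ^ M * (\<kappa> * \<delta> powr (\<beta> + 1)) \<le> exp (- r) * circle_mean r ^ M * measure (mu_measure \<beta>) {\<delta>/2<..\<delta>}"
      using \<kappa>(2)[OF \<delta>] circle_mean_ge_1[OF r(2)] by (intro mult_left_mono) auto
    ultimately have "exp (- r) * circle_mean r ^ M * (\<kappa> * \<delta> powr (\<beta> + 1)) \<le> AP r \<beta> a" by linarith
    then have "(exp (- r) * circle_mean r ^ M * (\<kappa> * \<delta> powr (\<beta> + 1))) powr (1/r) \<le> dp_norm r \<beta> a"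
      unfolding dp_norm_altdef[OF r(2)] using r \<kappa> circle_mean_ge_1[OF r(2)] by (intro powr_mono2) auto
    moreover have "(exp (- r) * circle_mean r ^ M * (\<kappa> * \<delta> powr (\<beta> + 1))) powr (1/r)
        = exp (-1) * (circle_mean r powr (1/r)) ^ M * (\<kappa> powr (1/r) * \<delta> powr e)"
    proof -
      have "exp (- r) powr (1/r) = exp (-1)" using r by (simp add: exp_powr_real)
      moreover have "(circle_mean r ^ M) powr (1/r) = (circle_mean r powr (1/r)) ^ M"
        using circle_mean_ge_1[OF r(2)] by (simp add: powr_realpow[symmetric] powr_powr mult.commute)
      moreover have "(\<delta> powr (\<beta> + 1)) powr (1/r) = \<delta> powr e" by (simp add: powr_powr e_def)
      ultimately show ?thesis by (simp only: powr_mult)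
    qed
    ultimately have "exp (-1) * (circle_mean r powr (1/r)) ^ M * (\<kappa> powr (1/r) * \<delta> powr e) \<le> dp_norm r \<beta> a" by simp
    then have "c * (exp (-1) * (circle_mean r powr (1/r)) ^ M * (\<kappa> powr (1/r) * \<delta> powr e)) \<le> c * dp_norm r \<beta> a"
      using c by (intro mult_left_mono) auto
    also have "c * dp_norm r \<beta> a = dp_norm r \<beta> (\<lambda>n. of_real c * a n)"
      using dp_norm_cmult[OF a r(2), of \<beta> "of_real c"] c by simp
    also have "c * (exp (-1) * (circle_mean r powr (1/r)) ^ M * (\<kappa> powr (1/r) * \<delta> powr e))
        = c0 * (exp (x * real M) * (2 * (real J + real M + 1)^2) powr (-e))"
    proof -
      have "exp (x * real M) = (circle_mean r powr (1/r) / \<omega>) ^ M"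
      proof -
        have "0 < circle_mean r powr (1/r) / \<omega>" using \<omega> \<omega>1 by (intro divide_pos_pos) linarith+
        then have "exp x = circle_mean r powr (1/r) / \<omega>" unfolding x_def by (rule exp_ln)
        then show ?thesis by (simp only: exp_of_nat2_mult)
      qed
      moreover have "\<delta> powr e = (2 * (real J + real M + 1)^2) powr (-e)"
        by (simp add: \<delta>_def powr_minus_divide powr_divide)
      ultimately show ?thesis by (simp add: c_def c0_def power_divide)
    qed
    finally show ?thesis using M c0 by (simp add: pos_divide_le_eq mult.commute)
  qed
  show "\<exists>h j. h \<in> dirichlet_polys \<and> J0 \<le> j \<and>
     (\<forall>n. h n \<noteq> 0 \<longrightarrow> (\<forall>i<J0. expo i n = 0) \<and> expo j n = 1) \<and>
     dp_norm p \<alpha> h \<le> \<eta> \<and> l1 (1/2) h \<le> \<eta> \<and> K \<le> dp_norm q \<beta> (dpow h N)"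
  proof (intro exI conjI)
    show h: "(\<lambda>n. of_real c * a n) \<in> dirichlet_polys" by (rule dirichlet_polys_multiplier[OF a])
    show "J0 \<le> J" by (simp add: J_def)
    show "\<forall>n. of_real c * a n \<noteq> 0 \<longrightarrow> (\<forall>i<J0. expo i n = 0) \<and> expo J n = 1"
    proof (intro allI impI)
      fix n assume "of_real c * a n \<noteq> 0"
      then have "half_prod J M n \<noteq> 0" by (simp add: a_def)
      then show "(\<forall>i<J0. expo i n = 0) \<and> expo J n = 1"
        using half_prod_support[of J M n] by (simp add: J_def)
    qed
    show "dp_norm p \<alpha> (\<lambda>n. of_real c * a n) \<le> \<eta>"
    proof -
      have "dp_norm p \<alpha> a \<le> (circle_mean p ^ M) powr (1/p)"
        unfolding dp_norm_altdef[OF p(1)] a_def HP_half_prod[OF p(1), symmetric, of M J] using p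
        by (intro powr_mono2 AP_le_HP dirichlet_polys_half_prod AP_nonneg) auto
      also have "\<dots> = (circle_mean p powr (1/p)) ^ M"
        using circle_mean_ge_1[OF p(1)] by (simp add: powr_realpow[symmetric] powr_powr mult.commute)
      also have "\<dots> \<le> \<omega> ^ M" using \<omega>(1) by (intro power_mono) auto
      finally have "c * dp_norm p \<alpha> a \<le> c * \<omega> ^ M" using c by (intro mult_left_mono) auto
      then show ?thesis using dp_norm_cmult[OF a p(1), of \<alpha> "of_real c"] c c\<omega> by simp
    qed
    show "l1 (1/2) (\<lambda>n. of_real c * a n) \<le> \<eta>"
    proof -
      have "c * l1 (1/2) a \<le> c * \<omega> ^ M"
        unfolding a_def using c by (intro mult_left_mono l1_half_prod_le small) auto
      then show ?thesis using l1_cmult[OF a, of "1/2" "of_real c"] c c\<omega> by simp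
    qed
    show "K \<le> dp_norm q \<beta> (dpow (\<lambda>n. of_real c * a n) N)"
      by (rule dp_norm_dpow_ge[OF h q(1) N]) (use low in \<open>simp add: r_def\<close>)
  qed
qed

section \<open>Lacunary test polynomials\<close>

text \<open>The right side is the value at the maximum \<open>x = s\<close>.\<close>

lemma powr_exp_le:
  fixes s x :: real
  assumes "s > 0" "x > 0"
  shows "x powr s * exp (- x) \<le> exp (s * ln s - s)"
proof -
  have "ln (x / s) \<le> x / s - 1" using assms by (intro ln_le_minus_one) simp
  then have "s * (ln x - ln s) \<le> s * (x / s - 1)" using assms by (intro mult_left_mono) (simp_all add: ln_div)
  then have "s * ln x - x \<le> s * ln s - s" using assms by (simp add: right_diff_distrib)
  then have "exp (s * ln x - x) \<le> exp (s * ln s - s)" by simp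
  then show ?thesis using assms by (simp add: powr_def exp_diff exp_minus field_simps)
qed

text \<open>The summand is dominated by the increment over a doubling of the bounded function
  \<open>x powr \<tau> / (1 + x powr \<tau>)\<close>, so the sum telescopes.\<close>

lemma lacunary_sum_le:
  fixes \<tau> :: real
  assumes \<tau>: "\<tau> > 0"
  obtains D where "D > 0"
    and "\<And>L R \<sigma>. (\<And>i. L i > 0) \<Longrightarrow> (\<And>i. 2 * L i \<le> L (Suc i)) \<Longrightarrow> \<sigma> > 0 \<Longrightarrow>
           (\<Sum>i<R. (L i * \<sigma>) powr \<tau> * exp (- (L i * \<sigma>))) \<le> D"
proof -
  define b where "b = 2 powr \<tau>"
  have b: "b > 1" using \<tau> by (simp add: b_def)
  \<comment> \<open>\<open>E\<close> bounds x^(2 \<tau>) exp(-x), so that (1 + u^2) exp(-x) \<le> 1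
    + E for u = x^\<tau>. As doubling \<open>x\<close> multiplies \<open>u\<close> by
    \<open>b\<close>, this is what the comparison with the increment of \<Psi> requires, and it
    determines \<open>D\<close>.\<close>
  define E where "E = exp (2 * \<tau> * ln (2 * \<tau>) - 2 * \<tau>)"
  define D where "D = 2 * b * (1 + E) / (b - 1)"
  have D: "D > 0" using b by (simp add: D_def E_def add_pos_pos)
  define \<Psi> where "\<Psi> x = x powr \<tau> / (1 + x powr \<tau>)" for x
  have \<Psi>0: "0 \<le> \<Psi> x" "\<Psi> x \<le> 1" for x
  proof -
    have "0 \<le> x powr \<tau>" by simp
    then have "0 < 1 + x powr \<tau>" by linarith
    then show "0 \<le> \<Psi> x" "\<Psi> x \<le> 1" by (simp_all add: \<Psi>_def divide_le_eq_1)
  qed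
  have \<Psi>mono: "\<Psi> x \<le> \<Psi> y" if "0 < x" "x \<le> y" for x y
  proof -
    have le: "x powr \<tau> \<le> y powr \<tau>" using that \<tau> by (intro powr_mono2) auto
    have e: "\<Psi> z = 1 - 1 / (1 + z powr \<tau>)" for z
    proof -
      have "1 + z powr \<tau> \<noteq> 0" using powr_ge_zero[of z \<tau>] by linarith
      then show ?thesis by (simp add: \<Psi>_def field_simps)
    qed
    have "1 / (1 + y powr \<tau>) \<le> 1 / (1 + x powr \<tau>)"
      using le powr_ge_zero[of x \<tau>] by (intro divide_left_mono mult_pos_pos) linarith+
    then show ?thesis unfolding e by linarith
  qed
  have step: "x powr \<tau> * exp (- x) \<le> D * (\<Psi> (2 * x) - \<Psi> x)" if x: "x > 0" for x
  proof -
    define u where "u = x powr \<tau>"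
    have u: "u > 0" using x by (simp add: u_def)
    have "exp (- x) \<le> 1" using x by simp
    moreover have "u\<^sup>2 * exp (- x) \<le> E"
    proof -
      have "u\<^sup>2 = x powr (2 * \<tau>)" using x by (simp add: u_def power2_eq_square flip: powr_add)
      then show ?thesis using powr_exp_le[of "2 * \<tau>" x] x \<tau> by (simp add: E_def)
    qed
    moreover have "(1 + u\<^sup>2) * exp (- x) = exp (- x) + u\<^sup>2 * exp (- x)" by (simp add: distrib_right)
    ultimately have e1: "(1 + u\<^sup>2) * exp (- x) \<le> 1 + E" by linarith
    have "(1 + b * u) * (1 + u) \<le> (b + b * u) * (1 + u)"
      using b u by (intro mult_right_mono) auto
    also have "\<dots> = b * (1 + u)\<^sup>2" by (simp add: power2_eq_square algebra_simps)
    also have "\<dots> \<le> b * (2 * (1 + u\<^sup>2))"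
    proof (rule mult_left_mono)
      have "0 \<le> (1 - u)\<^sup>2" by simp
      then show "(1 + u)\<^sup>2 \<le> 2 * (1 + u\<^sup>2)" by (simp add: power2_eq_square algebra_simps)
    qed (use b in simp)
    finally have "(1 + b * u) * (1 + u) * exp (- x) \<le> b * (2 * (1 + u\<^sup>2)) * exp (- x)"
      by (intro mult_right_mono) auto
    also have "\<dots> = 2 * b * ((1 + u\<^sup>2) * exp (- x))" by simp
    also have "\<dots> \<le> 2 * b * (1 + E)" using e1 b by (intro mult_left_mono) auto
    also have "\<dots> = D * (b - 1)" using b by (simp add: D_def)
    finally have 1: "(1 + b * u) * (1 + u) * exp (- x) \<le> D * (b - 1)" .
    have "(2 * x) powr \<tau> = b * u" using x by (simp add: powr_mult b_def u_def)
    then have "\<Psi> (2 * x) - \<Psi> x = b * u / (1 + b * u) - u / (1 + u)" by (simp add: \<Psi>_def u_def)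
    also have "\<dots> = (b - 1) * u / ((1 + b * u) * (1 + u))"
    proof -
      have "1 + b * u > 0" "1 + u > 0" using b u by (simp_all add: add_pos_pos)
      then show ?thesis by (simp add: divide_simps) (simp add: algebra_simps)
    qed
    finally have 2: "\<Psi> (2 * x) - \<Psi> x = (b - 1) * u / ((1 + b * u) * (1 + u))" .
    define w where "w = (1 + b * u) * (1 + u)"
    have w: "w > 0" using b u by (simp add: w_def add_pos_pos)
    have "u * (w * exp (- x)) \<le> u * (D * (b - 1))" using 1 u unfolding w_def[symmetric] by (intro mult_left_mono) auto
    then have "u * exp (- x) \<le> D * ((b - 1) * u / w)" using w by (simp add: pos_le_divide_eq mult_ac)
    then show ?thesis unfolding 2 w_def u_def .
  qed
  show thesis
  proof (rule that[OF D])
    fix L :: "nat \<Rightarrow> real" and R and \<sigma> :: real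
    assume L: "\<And>i. L i > 0" "\<And>i. 2 * L i \<le> L (Suc i)" and \<sigma>: "\<sigma> > 0"
    have "(\<Sum>i<R. (L i * \<sigma>) powr \<tau> * exp (- (L i * \<sigma>))) \<le> D * \<Psi> (L R * \<sigma>)"
    proof (induction R)
      case 0
      then show ?case using D \<Psi>0 by simp
    next
      case (Suc R)
      have pos: "L R * \<sigma> > 0" using L(1) \<sigma> by simp
      have "(\<Sum>i<Suc R. (L i * \<sigma>) powr \<tau> * exp (- (L i * \<sigma>))) \<le> D * \<Psi> (L R * \<sigma>) + D * (\<Psi> (2 * (L R * \<sigma>)) - \<Psi> (L R * \<sigma>))"
        using Suc step[OF pos] by simp
      also have "\<dots> = D * \<Psi> (2 * (L R * \<sigma>))" by (simp add: algebra_simps)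
      also have "\<dots> \<le> D * \<Psi> (L (Suc R) * \<sigma>)"
      proof (intro mult_left_mono \<Psi>mono)
        have "2 * L R * \<sigma> \<le> L (Suc R) * \<sigma>" using L(2)[of R] \<sigma> by (intro mult_right_mono) auto
        then show "2 * (L R * \<sigma>) \<le> L (Suc R) * \<sigma>" by simp
      qed (use pos D in auto)
      finally show ?case .
    qed
    also have "\<dots> \<le> D * 1" using D \<Psi>0 by (intro mult_left_mono) auto
    finally show "(\<Sum>i<R. (L i * \<sigma>) powr \<tau> * exp (- (L i * \<sigma>))) \<le> D" by simp
  qed
qed

section \<open>Sums of single terms over lacunary primes\<close>

definition single :: "nat \<Rightarrow> complex \<Rightarrow> nat \<Rightarrow> complex" where
  "single k x = (\<lambda>n. if n = k then x else 0)"

lemma single_support: "{n. single k x n \<noteq> 0} \<subseteq> {k}"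
  by (auto simp: single_def)

lemma dirichlet_polys_single: "0 < k \<Longrightarrow> single k x \<in> dirichlet_polys"
  using finite_subset[OF single_support[of k x]] by (simp add: dirichlet_polys_def single_def)

lemma HP_single:
  assumes "0 < k"
  shows "HP p (single k x) = norm x powr p"
proof -
  have "bohr_lift (single k x) z = x * bohr_monom k z" for z
    by (subst bohr_lift_altdef[OF _ single_support]) (simp_all add: single_def)
  then have "HP p (single k x) = (\<integral>z. norm x powr p \<partial>torus_measure)"
    unfolding HP_def
    by (intro Bochner_Integration.integral_cong refl) (simp add: norm_mult norm_bohr_monom[OF assms] norm_torus)
  then show ?thesis using torus.prob_space by simp
qed

lemma l1_single: "l1 s (single k x) = norm x * real k powr (-s)"
  by (subst l1_altdef[OF _ single_support]) (simp_all add: single_def)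

lemma HP_shift_le_l1:
  assumes a: "a \<in> dirichlet_polys" and p: "p > 0"
  shows "HP p (dp_shift \<sigma> a) \<le> l1 \<sigma> a powr p"
proof -
  have "HP p (dp_shift \<sigma> a) \<le> (\<integral>z. l1 \<sigma> a powr p \<partial>torus_measure)"
    unfolding HP_def
  proof (rule integral_mono[OF integrable_HP[OF dirichlet_polys_shift[OF a] p]])
    fix z assume z: "z \<in> space torus_measure"
    have "norm (bohr_lift (dp_shift \<sigma> a) z) \<le> l1 \<sigma> a"
      unfolding bohr_lift_shift[OF a] l1_def
    proof (rule order.trans[OF norm_sum], rule sum_mono)
      fix n assume "n \<in> {n. a n \<noteq> 0}"
      then have "0 < n" using dirichlet_polys_pos[OF a] by simp
      then show "norm (a n * of_real (real n powr - \<sigma>) * bohr_monom n z) \<le> norm (a n) * real n powr - \<sigma>"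
        using norm_torus[OF z] by (simp add: norm_mult norm_bohr_monom)
    qed
    then show "norm (bohr_lift (dp_shift \<sigma> a) z) powr p \<le> l1 \<sigma> a powr p" using p by (intro powr_mono2) auto
  qed simp
  then show ?thesis using torus.prob_space by simp
qed

text \<open>The factor exp(-2 \<sigma>) of the weight is bounded by 1, and each remaining term is a
  Gamma integral.\<close>

lemma AP_le_gamma_sum:
  assumes a: "a \<in> dirichlet_polys" and p: "p > 0" "\<alpha> > -1" and s: "s > 0" and I: "finite I"
    and A: "\<And>i. i \<in> I \<Longrightarrow> A i \<ge> 0" and b: "\<And>i. i \<in> I \<Longrightarrow> b i > 0"
    and le: "\<And>\<sigma>. \<sigma> > 0 \<Longrightarrow> \<sigma> powr \<alpha> * HP p (dp_shift \<sigma> a) \<le> (\<Sum>i\<in>I. A i * (\<sigma> powr (s - 1) * exp (- b i * \<sigma>)))"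
  shows "AP p \<alpha> a \<le> 2 powr (\<alpha>+1) / Gamma (\<alpha>+1) * (\<Sum>i\<in>I. A i * (Gamma s / b i powr s))"
proof -
  define k where "k = 2 powr (\<alpha>+1) / Gamma (\<alpha>+1)"
  have k: "k > 0" using Gamma_real_pos[of "\<alpha>+1"] p by (auto simp: k_def)
  have G: "Gamma s > 0" using s by (rule Gamma_real_pos)
  have "ennreal (AP p \<alpha> a) \<le> (\<integral>\<^sup>+\<sigma>. (\<Sum>i\<in>I. ennreal (k * A i) * ennreal (indicator {0<..} \<sigma> * (\<sigma> powr (s - 1) * exp (- b i * \<sigma>)))) \<partial>lborel)"
    unfolding ennreal_AP[OF a p]
  proof (rule nn_integral_mono)
    fix \<sigma> :: real
    show "ennreal (mu_density \<alpha> \<sigma> * HP p (dp_shift \<sigma> a)) \<le> (\<Sum>i\<in>I. ennreal (k * A i) * ennreal (indicator {0<..} \<sigma> * (\<sigma> powr (s - 1) * exp (- b i * \<sigma>))))"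
    proof (cases "\<sigma> > 0")
      case True
      have "mu_density \<alpha> \<sigma> * HP p (dp_shift \<sigma> a) = k * exp (-2 * \<sigma>) * (\<sigma> powr \<alpha> * HP p (dp_shift \<sigma> a))"
        using True by (simp add: mu_density_def k_def)
      also have "\<dots> \<le> k * 1 * (\<sigma> powr \<alpha> * HP p (dp_shift \<sigma> a))"
        using k True by (intro mult_right_mono mult_left_mono mult_nonneg_nonneg HP_nonneg) auto
      also have "\<dots> \<le> k * 1 * (\<Sum>i\<in>I. A i * (\<sigma> powr (s - 1) * exp (- b i * \<sigma>)))"
        using k by (intro mult_left_mono le True) auto
      also have "\<dots> = (\<Sum>i\<in>I. (k * A i) * (indicator {0<..} \<sigma> * (\<sigma> powr (s - 1) * exp (- b i * \<sigma>))))"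
        using True by (simp add: sum_distrib_left mult_ac)
      finally have "ennreal (mu_density \<alpha> \<sigma> * HP p (dp_shift \<sigma> a))
          \<le> ennreal (\<Sum>i\<in>I. (k * A i) * (indicator {0<..} \<sigma> * (\<sigma> powr (s - 1) * exp (- b i * \<sigma>))))"
        by (rule ennreal_leI)
      also have "\<dots> = (\<Sum>i\<in>I. ennreal ((k * A i) * (indicator {0<..} \<sigma> * (\<sigma> powr (s - 1) * exp (- b i * \<sigma>)))))"
        using k A by (intro sum_ennreal[symmetric]) auto
      also have "\<dots> = (\<Sum>i\<in>I. ennreal (k * A i) * ennreal (indicator {0<..} \<sigma> * (\<sigma> powr (s - 1) * exp (- b i * \<sigma>))))"
        using k A by (intro sum.cong refl ennreal_mult) auto
      finally show ?thesis .
    qed (simp add: mu_density_def)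
  qed
  also have "\<dots> = (\<Sum>i\<in>I. ennreal (k * A i) * ennreal (Gamma s / b i powr s))"
  proof (subst nn_integral_sum)
    show "(\<Sum>i\<in>I. \<integral>\<^sup>+\<sigma>. ennreal (k * A i) * ennreal (indicator {0<..} \<sigma> * (\<sigma> powr (s - 1) * exp (- b i * \<sigma>))) \<partial>lborel)
        = (\<Sum>i\<in>I. ennreal (k * A i) * ennreal (Gamma s / b i powr s))"
      using nn_integral_powr_exp[OF s b] by (intro sum.cong refl) (subst nn_integral_cmult, simp_all)
  qed simp
  also have "\<dots> = (\<Sum>i\<in>I. ennreal (k * A i * (Gamma s / b i powr s)))"
    using k A b G by (intro sum.cong refl ennreal_mult[symmetric]) (auto intro!: mult_nonneg_nonneg)
  also have "\<dots> = ennreal (\<Sum>i\<in>I. k * A i * (Gamma s / b i powr s))"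
    using k A G by (intro sum_ennreal mult_nonneg_nonneg divide_nonneg_nonneg) auto
  finally have "AP p \<alpha> a \<le> (\<Sum>i\<in>I. k * A i * (Gamma s / b i powr s))"
    using k A G by (subst (asm) ennreal_le_iff) (auto intro!: sum_nonneg mult_nonneg_nonneg)
  then show ?thesis by (simp add: k_def sum_distrib_left mult.assoc)
qed

lemma powr_sum_le_subadd:
  fixes x :: "'i \<Rightarrow> real"
  assumes "0 < p" "p \<le> 1" "finite I" "\<And>i. i \<in> I \<Longrightarrow> x i \<ge> 0"
  shows "(\<Sum>i\<in>I. x i) powr p \<le> (\<Sum>i\<in>I. x i powr p)"
  using assms(3,4)
proof (induction I rule: finite_induct)
  case (insert i I)
  have "(x i + (\<Sum>i\<in>I. x i)) powr p \<le> x i powr p + (\<Sum>i\<in>I. x i) powr p"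
    using insert.prems by (intro powr_add_le_subadd assms(1,2) sum_nonneg) auto
  then show ?case using insert by simp
qed simp

text \<open>The marking variable z_J times a sum over primes of indices \<open>m i\<close>. With
  \<tau> = (\<alpha> + 1) / p, the power of the logarithm compensates the decay of the norm of the
  single term in the source space, so all terms have comparable size there.\<close>

definition lac_poly :: "nat \<Rightarrow> (nat \<Rightarrow> nat) \<Rightarrow> real \<Rightarrow> real \<Rightarrow> nat \<Rightarrow> nat \<Rightarrow> complex" where
  "lac_poly J m \<tau> c R = (\<lambda>n. \<Sum>i<R. single (nth_prime J * nth_prime (m i)) (of_real (c * ln (real (nth_prime (m i))) powr \<tau>)) n)"

lemma dirichlet_polys_lac_poly: "lac_poly J m \<tau> c R \<in> dirichlet_polys"
  unfolding lac_poly_def by (intro dirichlet_polys_sum dirichlet_polys_single) simp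

lemma nth_prime_powr_minus: "real (nth_prime j) powr (-s) = exp (- (ln (real (nth_prime j)) * s))"
  by (simp add: powr_def mult.commute)

lemma ln_nth_prime_pos: "0 < ln (real (nth_prime j))"
  using prime_gt_1_nat[OF prime_nth_prime[of j]] by simp

lemma l1_lac_poly_le:
  assumes c: "c \<ge> 0" and s: "s \<ge> 0"
  shows "l1 s (lac_poly J m \<tau> c R) \<le> (\<Sum>i<R. c * (ln (real (nth_prime (m i))) powr \<tau> * exp (- (ln (real (nth_prime (m i))) * s))))"
proof -
  have "l1 s (lac_poly J m \<tau> c R) \<le> (\<Sum>i<R. l1 s (single (nth_prime J * nth_prime (m i)) (of_real (c * ln (real (nth_prime (m i))) powr \<tau>))))"
    unfolding lac_poly_def by (intro l1_sum_le dirichlet_polys_single) auto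
  also have "\<dots> \<le> (\<Sum>i<R. c * (ln (real (nth_prime (m i))) powr \<tau> * exp (- (ln (real (nth_prime (m i))) * s))))"
  proof (rule sum_mono)
    fix i
    have "real (nth_prime J) powr (-s) \<le> 1"
      unfolding nth_prime_powr_minus using ln_nth_prime_pos[of J] s by simp
    then have "real (nth_prime J) powr (-s) * real (nth_prime (m i)) powr (-s) \<le> 1 * real (nth_prime (m i)) powr (-s)"
      by (intro mult_right_mono) auto
    then have 1: "real (nth_prime J * nth_prime (m i)) powr (-s) \<le> exp (- (ln (real (nth_prime (m i))) * s))"
      by (simp add: powr_mult nth_prime_powr_minus[of "m i"])
    have "l1 s (single (nth_prime J * nth_prime (m i)) (of_real (c * ln (real (nth_prime (m i))) powr \<tau>)))
        = c * ln (real (nth_prime (m i))) powr \<tau> * real (nth_prime J * nth_prime (m i)) powr (-s)"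
      using c unfolding l1_single by (simp add: norm_mult)
    also have "\<dots> \<le> c * ln (real (nth_prime (m i))) powr \<tau> * exp (- (ln (real (nth_prime (m i))) * s))"
      using 1 c by (intro mult_left_mono) auto
    finally show "l1 s (single (nth_prime J * nth_prime (m i)) (of_real (c * ln (real (nth_prime (m i))) powr \<tau>)))
        \<le> c * (ln (real (nth_prime (m i))) powr \<tau> * exp (- (ln (real (nth_prime (m i))) * s)))" by (simp only: mult.assoc)
  qed
  finally show ?thesis .
qed

text \<open>The terms act at separate scales \<sigma> of order 1 / ln p, so the \<open>p\<close>-th
  powers of their norms add up as for disjoint supports. For \<open>p \<le> 1\<close> subadditivity
  of the power suffices. For \<open>p > 1\<close> lacunarity bounds the normalised sum by
  \<open>D\<close>, and a \<open>p\<close>-th power of a bounded quantity is at most a constant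
  times the quantity itself, which can be integrated termwise.\<close>

lemma AP_lac_poly_le:
  assumes p: "p > 0" "\<alpha> > -1" and \<tau>: "\<tau> = (\<alpha> + 1) / p"
  obtains C where "C > 0"
    and "\<And>J m c R. c \<ge> 0 \<Longrightarrow> (\<And>i. 2 * ln (real (nth_prime (m i))) \<le> ln (real (nth_prime (m (Suc i))))) \<Longrightarrow>
       AP p \<alpha> (lac_poly J m \<tau> c R) \<le> C * (c powr p * real R)"
proof -
  have \<tau>0: "\<tau> > 0" and \<tau>p: "\<tau> * p = \<alpha> + 1" using p by (simp_all add: \<tau>)
  define k where "k = 2 powr (\<alpha>+1) / Gamma (\<alpha>+1)"
  have k: "k > 0" using Gamma_real_pos[of "\<alpha>+1"] p by (auto simp: k_def)
  show thesis
  proof (cases "p \<le> 1")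
    case True
    define C where "C = k * (Gamma (\<alpha>+1) / p powr (\<alpha>+1))"
    have "C > 0" using k p Gamma_real_pos[of "\<alpha>+1"] by (simp add: C_def)
    then show thesis
    proof (rule that)
      fix J R and m :: "nat \<Rightarrow> nat" and c :: real assume c: "c \<ge> 0"
      define L where "L i = ln (real (nth_prime (m i)))" for i
      have L: "L i > 0" for i by (simp add: L_def ln_nth_prime_pos)
      have "AP p \<alpha> (lac_poly J m \<tau> c R) \<le> k * (\<Sum>i<R. (c powr p * L i powr (\<alpha>+1)) * (Gamma (\<alpha>+1) / (p * L i) powr (\<alpha>+1)))"
        unfolding k_def
      proof (rule AP_le_gamma_sum[OF dirichlet_polys_lac_poly p])
        fix \<sigma> :: real assume \<sigma>: "\<sigma> > 0"
        have "HP p (dp_shift \<sigma> (lac_poly J m \<tau> c R)) \<le> l1 \<sigma> (lac_poly J m \<tau> c R) powr p"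
          by (rule HP_shift_le_l1[OF dirichlet_polys_lac_poly p(1)])
        also have "\<dots> \<le> (\<Sum>i<R. c * (L i powr \<tau> * exp (- (L i * \<sigma>)))) powr p"
          unfolding L_def using p c \<sigma> by (intro powr_mono2 l1_lac_poly_le l1_nonneg) auto
        also have "\<dots> \<le> (\<Sum>i<R. (c * (L i powr \<tau> * exp (- (L i * \<sigma>)))) powr p)"
          using c by (intro powr_sum_le_subadd p True) auto
        also have "\<dots> = (\<Sum>i<R. c powr p * L i powr (\<alpha>+1) * exp (- (p * L i) * \<sigma>))"
          by (intro sum.cong refl) (simp add: powr_mult powr_powr \<tau>p exp_powr_real mult_ac)
        finally have "\<sigma> powr \<alpha> * HP p (dp_shift \<sigma> (lac_poly J m \<tau> c R))
            \<le> \<sigma> powr \<alpha> * (\<Sum>i<R. c powr p * L i powr (\<alpha>+1) * exp (- (p * L i) * \<sigma>))"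
          by (intro mult_left_mono) auto
        also have "\<dots> = (\<Sum>i<R. c powr p * L i powr (\<alpha>+1) * (\<sigma> powr (\<alpha> + 1 - 1) * exp (- (p * L i) * \<sigma>)))"
          by (simp add: sum_distrib_left mult_ac)
        finally show "\<sigma> powr \<alpha> * HP p (dp_shift \<sigma> (lac_poly J m \<tau> c R))
            \<le> (\<Sum>i<R. c powr p * L i powr (\<alpha>+1) * (\<sigma> powr (\<alpha> + 1 - 1) * exp (- (p * L i) * \<sigma>)))" .
      qed (use p L c in auto)
      also have "(\<Sum>i<R. (c powr p * L i powr (\<alpha>+1)) * (Gamma (\<alpha>+1) / (p * L i) powr (\<alpha>+1)))
          = (\<Sum>i<R. c powr p * (Gamma (\<alpha>+1) / p powr (\<alpha>+1)))"
      proof (intro sum.cong refl)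
        fix i
        have "L i powr (\<alpha>+1) > 0" using L[of i] by simp
        then show "(c powr p * L i powr (\<alpha>+1)) * (Gamma (\<alpha>+1) / (p * L i) powr (\<alpha>+1)) = c powr p * (Gamma (\<alpha>+1) / p powr (\<alpha>+1))"
          using L[of i] by (simp add: powr_mult del: powr_gt_zero)
      qed
      finally show "AP p \<alpha> (lac_poly J m \<tau> c R) \<le> C * (c powr p * real R)"
        by (simp add: C_def mult_ac)
    qed
  next
    case False
    obtain D where D: "D > 0" "\<And>L R \<sigma>. (\<And>i. L i > 0) \<Longrightarrow> (\<And>i. 2 * L i \<le> L (Suc i)) \<Longrightarrow> \<sigma> > 0 \<Longrightarrow>
           (\<Sum>i<R. (L i * \<sigma>) powr \<tau> * exp (- (L i * \<sigma>))) \<le> D"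
    proof (rule lacunary_sum_le[OF \<tau>0], goal_cases)
      case (1 d)
      show thesis by (rule 1(1), rule 1(2), rule 1(3))
    qed
    define C where "C = k * (D powr (p - 1) * Gamma \<tau>)"
    have "C > 0" using k D Gamma_real_pos[OF \<tau>0] by (simp add: C_def)
    then show thesis
    proof (rule that)
      fix J R and m :: "nat \<Rightarrow> nat" and c :: real assume c: "c \<ge> 0"
        and dbl: "\<And>i. 2 * ln (real (nth_prime (m i))) \<le> ln (real (nth_prime (m (Suc i))))"
      define L where "L i = ln (real (nth_prime (m i)))" for i
      have L: "L i > 0" for i by (simp add: L_def ln_nth_prime_pos)
      have dbl': "2 * L i \<le> L (Suc i)" for i unfolding L_def by (rule dbl)
      have "AP p \<alpha> (lac_poly J m \<tau> c R) \<le> k * (\<Sum>i<R. (c powr p * D powr (p - 1) * L i powr \<tau>) * (Gamma \<tau> / L i powr \<tau>))"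
        unfolding k_def
      proof (rule AP_le_gamma_sum[OF dirichlet_polys_lac_poly p \<tau>0])
        fix \<sigma> :: real assume \<sigma>: "\<sigma> > 0"
        \<comment> \<open>Scale-invariant form of the terms: extracting \<sigma>^(-\<tau>) leaves
          functions of \<open>L i * \<sigma>\<close> alone, to which \<open>lacunary_sum_le\<close>
          applies.\<close>
        define y where "y i = (L i * \<sigma>) powr \<tau> * exp (- (L i * \<sigma>))" for i
        define Y where "Y = (\<Sum>i<R. y i)"
        have Y0: "0 \<le> Y" unfolding Y_def y_def by (intro sum_nonneg) auto
        have YD: "Y \<le> D" unfolding Y_def y_def by (intro D(2) L dbl' \<sigma>)
        have xy: "L i powr \<tau> * exp (- (L i * \<sigma>)) = \<sigma> powr (-\<tau>) * y i" for i
          using \<sigma> by (simp add: y_def powr_mult powr_minus)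
        have "HP p (dp_shift \<sigma> (lac_poly J m \<tau> c R)) \<le> l1 \<sigma> (lac_poly J m \<tau> c R) powr p"
          by (rule HP_shift_le_l1[OF dirichlet_polys_lac_poly p(1)])
        also have "\<dots> \<le> (\<Sum>i<R. c * (L i powr \<tau> * exp (- (L i * \<sigma>)))) powr p"
          unfolding L_def using p c \<sigma> by (intro powr_mono2 l1_lac_poly_le l1_nonneg) auto
        also have "(\<Sum>i<R. c * (L i powr \<tau> * exp (- (L i * \<sigma>)))) = c * \<sigma> powr (-\<tau>) * Y"
          unfolding xy Y_def by (simp only: sum_distrib_left mult.assoc)
        also have "(c * \<sigma> powr (-\<tau>) * Y) powr p = c powr p * \<sigma> powr (- (\<alpha> + 1)) * Y powr p"
          by (simp add: powr_mult powr_powr \<tau>p)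
        also have "\<dots> \<le> c powr p * \<sigma> powr (- (\<alpha> + 1)) * (D powr (p - 1) * Y)"
        proof (rule mult_left_mono)
          show "Y powr p \<le> D powr (p - 1) * Y"
          proof (cases "Y = 0")
            case False
            then have "Y powr p = Y powr (p - 1) * Y" using Y0 by (simp add: powr_diff)
            also have "\<dots> \<le> D powr (p - 1) * Y"
              using Y0 YD \<open>\<not> p \<le> 1\<close> by (intro mult_right_mono powr_mono2) auto
            finally show ?thesis .
          qed simp
        qed simp
        finally have "\<sigma> powr \<alpha> * HP p (dp_shift \<sigma> (lac_poly J m \<tau> c R))
            \<le> \<sigma> powr \<alpha> * (c powr p * \<sigma> powr (- (\<alpha> + 1)) * (D powr (p - 1) * Y))"
          by (intro mult_left_mono) auto
        also have "\<dots> = (\<sigma> powr \<alpha> * \<sigma> powr (- (\<alpha> + 1))) * (c powr p * D powr (p - 1)) * Y" by simp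
        also have "\<sigma> powr \<alpha> * \<sigma> powr (- (\<alpha> + 1)) = \<sigma> powr (-1)" unfolding powr_add[symmetric] by simp
        also have "\<sigma> powr (-1) * (c powr p * D powr (p - 1)) * Y
            = (\<Sum>i<R. c powr p * D powr (p - 1) * L i powr \<tau> * (\<sigma> powr (\<tau> - 1) * exp (- L i * \<sigma>)))"
        proof -
          have "\<sigma> powr (-1) * y i = L i powr \<tau> * (\<sigma> powr (\<tau> - 1) * exp (- L i * \<sigma>))" for i
          proof -
            have "\<sigma> powr (-1) * \<sigma> powr \<tau> = \<sigma> powr (\<tau> - 1)" unfolding powr_add[symmetric] by simp
            moreover have "\<sigma> powr (-1) * y i = (\<sigma> powr (-1) * \<sigma> powr \<tau>) * (L i powr \<tau> * exp (- (L i * \<sigma>)))"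
              by (simp only: y_def powr_mult mult_ac)
            ultimately show ?thesis by (simp only: mult_minus_left mult_minus_right mult_ac)
          qed
          then have "\<sigma> powr (-1) * Y = (\<Sum>i<R. L i powr \<tau> * (\<sigma> powr (\<tau> - 1) * exp (- L i * \<sigma>)))"
            by (simp add: Y_def sum_distrib_left)
          note Y_eq = this
          have "\<sigma> powr (-1) * (c powr p * D powr (p - 1)) * Y = (c powr p * D powr (p - 1)) * (\<sigma> powr (-1) * Y)"
            by (simp only: mult_ac)
          then show ?thesis unfolding Y_eq by (simp only: sum_distrib_left mult.assoc)
        qed
        finally show "\<sigma> powr \<alpha> * HP p (dp_shift \<sigma> (lac_poly J m \<tau> c R))
            \<le> (\<Sum>i<R. c powr p * D powr (p - 1) * L i powr \<tau> * (\<sigma> powr (\<tau> - 1) * exp (- L i * \<sigma>)))" .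
      qed (use L in auto)
      also have "(\<Sum>i<R. (c powr p * D powr (p - 1) * L i powr \<tau>) * (Gamma \<tau> / L i powr \<tau>)) = (\<Sum>i<R. c powr p * D powr (p - 1) * Gamma \<tau>)"
      proof (intro sum.cong refl)
        fix i
        have "L i powr \<tau> > 0" using L[of i] by simp
        then show "(c powr p * D powr (p - 1) * L i powr \<tau>) * (Gamma \<tau> / L i powr \<tau>) = c powr p * D powr (p - 1) * Gamma \<tau>"
          using L[of i] by (simp del: powr_gt_zero)
      qed
      finally show "AP p \<alpha> (lac_poly J m \<tau> c R) \<le> C * (c powr p * real R)"
        by (simp add: C_def mult_ac)
    qed
  qed
qed

lemma dp_shift_single: "dp_shift \<sigma> (single k x) = single k (x * of_real (real k powr (-\<sigma>)))"
  by (simp add: dp_shift_def single_def fun_eq_iff)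

text \<open>Killing all variables except \<open>z J\<close> and \<open>z (m i)\<close> leaves a single term.\<close>

lemma HP_lac_poly_shift_ge:
  assumes r: "r > 0" and c: "c \<ge> 0" and m: "inj m" "\<And>i. J \<noteq> m i" and i: "i < R"
    and \<sigma>: "0 \<le> \<sigma>" "\<sigma> \<le> 1" "\<sigma> * ln (real (nth_prime (m i))) \<le> 1"
  shows "(c * ln (real (nth_prime (m i))) powr \<tau> * (exp (-1) / real (nth_prime J))) powr r
    \<le> HP r (dp_shift \<sigma> (lac_poly J m \<tau> c R))"
proof -
  define k where "k j = (of_bool (j \<noteq> J \<and> j \<noteq> m i) :: nat)" for j
  define K where "K i = nth_prime J * nth_prime (m i)" for i
  define x where "x i = complex_of_real (c * ln (real (nth_prime (m i))) powr \<tau>)" for i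
  have K0: "0 < K i'" for i' by (simp add: K_def)
  have expK: "expo j (K i') = (if J = j then 1 else 0) + (if m i' = j then 1 else 0)" for j i'
    unfolding K_def by (subst expo_mult) (simp_all add: expo_nth_prime)
  have wt_i: "wt k (K i) = 0"
    unfolding wt_eq_0_iff by (auto simp: expK k_def)
  have wt_ne: "wt k (K i') \<noteq> 0" if "i' \<noteq> i" for i'
  proof -
    have "k (m i') = 1" using that m(2)[of i'] inj_eq[OF m(1), of i' i] by (auto simp: k_def)
    moreover have "expo (m i') (K i') \<noteq> 0" unfolding expK by simp
    ultimately show ?thesis unfolding wt_eq_0_iff by (metis zero_neq_one)
  qed
  have tm: "of_bool (wt k n = 0) * single (K i') (x i') n = (if i' = i then single (K i) (x i) n else 0)" for i' n
  proof (cases "n = K i'")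
    case True
    then show ?thesis using wt_i wt_ne[of i'] by (cases "i' = i") simp_all
  qed (auto simp: single_def)
  have slice: "(\<lambda>n. of_bool (wt k n = 0) * lac_poly J m \<tau> c R n) = single (K i) (x i)"
  proof
    fix n
    have "of_bool (wt k n = 0) * lac_poly J m \<tau> c R n = (\<Sum>i'<R. of_bool (wt k n = 0) * single (K i') (x i') n)"
      by (simp add: lac_poly_def K_def x_def sum_distrib_left)
    also have "\<dots> = single (K i) (x i) n" unfolding tm using i by (simp add: sum.delta)
    finally show "of_bool (wt k n = 0) * lac_poly J m \<tau> c R n = single (K i) (x i) n" .
  qed
  have "HP r (single (K i) (x i * of_real (real (K i) powr (-\<sigma>)))) \<le> HP r (dp_shift \<sigma> (lac_poly J m \<tau> c R))"
    using HP_slice_le[OF dirichlet_polys_shift[OF dirichlet_polys_lac_poly] r, of k 0 \<sigma> J m \<tau> c R]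
    unfolding dp_shift_multiplier[symmetric] slice dp_shift_single by simp
  then have 1: "(norm (x i) * real (K i) powr (-\<sigma>)) powr r \<le> HP r (dp_shift \<sigma> (lac_poly J m \<tau> c R))"
    unfolding HP_single[OF K0] norm_mult by simp
  have "real (K i) powr (-\<sigma>) = real (nth_prime J) powr (-\<sigma>) * exp (- (\<sigma> * ln (real (nth_prime (m i)))))"
    by (simp add: K_def powr_mult nth_prime_powr_minus[of "m i"] mult.commute)
  also have "\<dots> \<ge> real (nth_prime J) powr (-1) * exp (-1)"
    using \<sigma> prime_gt_1_nat[OF prime_nth_prime[of J]] by (intro mult_mono powr_mono) auto
  finally have "exp (-1) / real (nth_prime J) \<le> real (K i) powr (-\<sigma>)"
    by (simp add: powr_minus divide_inverse mult.commute)
  moreover have "norm (x i) = c * ln (real (nth_prime (m i))) powr \<tau>" using c by (simp add: x_def norm_mult)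
  ultimately have "(c * ln (real (nth_prime (m i))) powr \<tau> * (exp (-1) / real (nth_prime J))) powr r
      \<le> (norm (x i) * real (K i) powr (-\<sigma>)) powr r"
    using c r by (intro powr_mono2 mult_mono) auto
  with 1 show ?thesis by linarith
qed

text \<open>There are two sources of growth. If \<open>r < p\<close>, many terms help through the
  power \<open>1 - r/p\<close> of \<open>R\<close>; if \<open>r = p\<close>, one term with a large
  logarithm suffices because then \<open>e0 > 0\<close>. The lower bound on \<open>B\<close> in
  terms of \<open>R\<close> is what the \<open>l1\<close> estimate requires.\<close>

lemma lacunary_parameters:
  fixes X F r p e0 :: real
  assumes X: "X > 0" and r: "0 < r" "r \<le> p" and e0: "e0 \<ge> 0" "r = p \<Longrightarrow> e0 > 0"
  obtains R :: nat and B :: real where "R \<ge> 1" "B \<ge> 1" "real R * F \<le> B" "1 \<le> X * (real R powr (1 - r/p) * B powr e0)"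
proof (cases "r = p")
  case True
  define B where "B = Max {1, F, (1/X) powr (1/e0)}"
  have B: "B \<ge> 1" "B \<ge> F" "B \<ge> (1/X) powr (1/e0)" by (simp_all add: B_def)
  have "1/X = ((1/X) powr (1/e0)) powr e0" using X e0(2)[OF True] by (simp add: powr_powr)
  also have "\<dots> \<le> B powr e0" using B e0 by (intro powr_mono2) auto
  finally have "1 \<le> X * B powr e0" using X by (simp add: field_simps)
  then show thesis by (intro that[of 1 B]) (use B in auto)
next
  case False
  define w where "w = 1 - r/p"
  have w: "w > 0" using False r by (simp add: w_def field_simps)
  define R where "R = Suc (nat \<lceil>(1/X) powr (1/w)\<rceil>)"
  have R: "R \<ge> 1" "real R \<ge> (1/X) powr (1/w)" unfolding R_def by linarith+
  define B where "B = max 1 (real R * F)"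
  have B: "B \<ge> 1" "real R * F \<le> B" by (simp_all add: B_def)
  have "1/X = ((1/X) powr (1/w)) powr w" using X w by (simp add: powr_powr)
  also have "\<dots> \<le> real R powr w" using R w by (intro powr_mono2) auto
  also have "\<dots> \<le> real R powr w * B powr e0"
    using mult_left_mono[OF ge_one_powr_ge_zero[OF B(1) e0(1)], of "real R powr w"] by simp
  finally have "1 \<le> X * (real R powr w * B powr e0)" using X by (simp add: field_simps)
  then show thesis by (intro that[of R B] R B) (simp add: w_def)
qed

text \<open>The next index is the square of the present prime. As the prime of index
  \<open>k\<close> is at least \<open>k\<close>, the next prime is at least that square and its
  logarithm doubles.\<close>

lemma lacunary_primes:
  obtains m :: "nat \<Rightarrow> nat" where "strict_mono m" "\<And>i. J < m i" "\<And>i. B \<le> ln (real (nth_prime (m i)))"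
    "\<And>i. 2 * ln (real (nth_prime (m i))) \<le> ln (real (nth_prime (m (Suc i))))"
proof -
  define m where "m = rec_nat (max (Suc J) (nat \<lceil>exp B\<rceil>)) (\<lambda>_ k. (nth_prime k)\<^sup>2)"
  have m0: "m 0 = max (Suc J) (nat \<lceil>exp B\<rceil>)" and mS: "m (Suc i) = (nth_prime (m i))\<^sup>2" for i by (simp_all add: m_def)
  have "m i < m (Suc i)" for i
  proof -
    have "m i \<le> nth_prime (m i)" by (rule le_nth_prime)
    also have "nth_prime (m i) < nth_prime (m i) * nth_prime (m i)"
      using prime_gt_1_nat[OF prime_nth_prime[of "m i"]] by simp
    finally show ?thesis by (simp add: mS power2_eq_square)
  qed
  then have sm: "strict_mono m" by (simp add: strict_mono_Suc_iff)
  have m0le: "m 0 \<le> m i" for i using sm by (simp add: strict_mono_less_eq)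
  show thesis
  proof (rule that[OF sm])
    fix i
    show "J < m i" using m0le[of i] m0 by simp
    have "exp B \<le> real (m 0)" unfolding m0 by linarith
    also have "\<dots> \<le> real (nth_prime (m i))" using m0le[of i] le_nth_prime[of "m i"] by simp
    finally show "B \<le> ln (real (nth_prime (m i)))"
      by (subst ln_ge_iff) simp_all
    have "real (nth_prime (m i)) ^ 2 \<le> real (nth_prime (m (Suc i)))"
      using le_nth_prime[of "m (Suc i)"] by (simp only: mS flip: of_nat_power of_nat_le_iff)
    then have "ln (real (nth_prime (m i)) ^ 2) \<le> ln (real (nth_prime (m (Suc i))))" by (subst ln_le_cancel_iff) simp_all
    then show "2 * ln (real (nth_prime (m i))) \<le> ln (real (nth_prime (m (Suc i))))"
      by (simp add: ln_realpow)
  qed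
qed

text \<open>At \<sigma> of order 1 / \<open>L i\<close> the \<open>i\<close>-th term alone
  contributes about c^r L_i^(\<tau> r), on an interval of mass about L_i^(-(\<beta> + 1)). With c =
  \<eta>' R^(-1/p) the sum over \<open>R\<close> terms is at least a constant times R^(1 - r/p)
  B^e0.\<close>

lemma has_test_polys_le:
  assumes p: "p > 0" "\<alpha> > -1" and q: "q > 0" "\<beta> > -1" and \<beta>: "\<beta> < \<alpha>" and N: "N > 0"
    and le: "q * real N \<le> p" and ge: "p * (\<beta> + 1) \<le> q * real N * (\<alpha> + 1)"
  shows "has_test_polys p \<alpha> q \<beta> N"
  unfolding has_test_polys_def
proof (intro allI impI)
  fix J and \<eta> K :: real assume \<eta>: "\<eta> > 0"
  define r where "r = q * real N"
  have r: "0 < r" "r \<le> p" using q N le by (simp_all add: r_def)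
  define \<tau> where "\<tau> = (\<alpha> + 1) / p"
  have \<tau>: "\<tau> > 0" using p by (simp add: \<tau>_def)
  \<comment> \<open>The net exponent of the logarithm in each contribution. It is nonnegative by the
    failing degree condition, and positive for \<open>r = p\<close> because \<beta> <
    \<alpha>.\<close>
  define e0 where "e0 = \<tau> * r - (\<beta> + 1)"
  have e0: "e0 \<ge> 0" using ge p by (simp add: e0_def \<tau>_def r_def field_simps)
  have e0': "e0 > 0" if "r = p" using that \<beta> p by (simp add: e0_def \<tau>_def)
  obtain C where C: "C > 0" "\<And>J m c R. c \<ge> 0 \<Longrightarrow> (\<And>i. 2 * ln (real (nth_prime (m i))) \<le> ln (real (nth_prime (m (Suc i))))) \<Longrightarrow>
       AP p \<alpha> (lac_poly J m \<tau> c R) \<le> C * (c powr p * real R)"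
  proof (rule AP_lac_poly_le[OF p \<tau>_def], goal_cases)
    case (1 d)
    show thesis by (rule 1(1), rule 1(2), rule 1(3))
  qed
  obtain \<kappa> where \<kappa>: "\<kappa> > 0" "\<And>\<delta>. 0 < \<delta> \<Longrightarrow> \<delta> \<le> 1 \<Longrightarrow> \<kappa> * \<delta> powr (\<beta> + 1) \<le> measure (mu_measure \<beta>) {\<delta>/2<..\<delta>}"
  proof (rule mu_measure_interval_ge[OF q(2)], goal_cases)
    case (1 d)
    show thesis by (rule 1(1), rule 1(2), rule 1(3))
  qed
  define W where "W = exp (-1) / real (nth_prime J)"
  have W: "W > 0" by (simp add: W_def)
  define K' where "K' = max 1 K"
  have K': "K' \<ge> 1" by (simp add: K'_def)
  \<comment> \<open>Absorbs the constant of \<open>AP_lac_poly_le\<close>, so that the source norm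
    comes out as at most \<eta>.\<close>
  define \<eta>' where "\<eta>' = \<eta> / C powr (1/p)"
  have \<eta>': "\<eta>' > 0" using \<eta> C(1) by (simp add: \<eta>'_def)
  define X where "X = \<eta>' powr r * W powr r * \<kappa> / K' powr r"
  have X: "X > 0" using \<eta>' W \<kappa>(1) K' by (simp add: X_def)
  \<comment> \<open>An upper bound for x^(\<tau> + 1) exp(-x / 2); one power of the logarithm is
    left over to make the \<open>l1\<close> norm at 1/2 small.\<close>
  define F where "F = 2 powr (\<tau>+1) * exp ((\<tau>+1) * ln (\<tau>+1) - (\<tau>+1))"
  have F: "F > 0" by (simp add: F_def)
  obtain R :: nat and B :: real where RB: "R \<ge> 1" "B \<ge> 1" "real R * (\<eta>' * F / \<eta>) \<le> B" "1 \<le> X * (real R powr (1 - r/p) * B powr e0)"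
    by (rule lacunary_parameters[OF X r e0 e0'])
  obtain m where m: "strict_mono m" "\<And>i. J < m i" "\<And>i. B \<le> ln (real (nth_prime (m i)))"
    "\<And>i. 2 * ln (real (nth_prime (m i))) \<le> ln (real (nth_prime (m (Suc i))))"
  proof (rule lacunary_primes[where J = J and B = B], goal_cases)
    case (1 m)
    show thesis by (rule 1(1), rule 1(2), rule 1(3), rule 1(4), rule 1(5))
  qed
  define L where "L i = ln (real (nth_prime (m i)))" for i
  have LB: "B \<le> L i" for i unfolding L_def by (rule m(3))
  have L1: "1 \<le> L i" and L0: "0 < L i" for i using LB[of i] RB(2) by linarith+
  have Ldbl: "2 * L i \<le> L (Suc i)" for i unfolding L_def by (rule m(4))
  have Lmono: "mono L" using Ldbl L0 by (intro incseq_SucI) (smt (verit))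
  define c where "c = \<eta>' * real R powr (-(1/p))"
  have c0: "c \<ge> 0" using \<eta>' by (simp add: c_def)
  have Rp: "real R > 0" using RB(1) by simp
  have "real R powr (-(1/p)) \<le> real R powr 0" using RB(1) p by (intro powr_mono) auto
  then have c\<eta>: "c \<le> \<eta>'" using \<eta>' Rp by (simp add: c_def mult_left_le)
  define h where "h = lac_poly J m \<tau> c R"
  have h: "h \<in> dirichlet_polys" unfolding h_def by (rule dirichlet_polys_lac_poly)
  have supp: "(\<forall>i<J. expo i n = 0) \<and> expo J n = 1" if "h n \<noteq> 0" for n
  proof -
    obtain i where "n = nth_prime J * nth_prime (m i)"
      using \<open>h n \<noteq> 0\<close> unfolding h_def lac_poly_def single_def by (auto elim!: sum.not_neutral_contains_not_neutral split: if_splits)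
    then have "expo j n = (if J = j then 1 else 0) + (if m i = j then 1 else 0)" for j
      by (simp add: expo_mult expo_nth_prime)
    then show ?thesis using m(2)[of i] by auto
  qed
  have norm_le: "dp_norm p \<alpha> h \<le> \<eta>"
  proof -
    have "AP p \<alpha> h \<le> C * (c powr p * real R)" unfolding h_def by (intro C(2) c0 m(4))
    also have "c powr p * real R = \<eta>' powr p"
    proof -
      have "c powr p = \<eta>' powr p * real R powr (-1)"
        unfolding c_def powr_mult powr_powr using p by simp
      then show ?thesis using Rp by (simp add: powr_minus)
    qed
    also have "C * \<eta>' powr p = \<eta> powr p"
      using p C(1) \<eta> by (simp add: \<eta>'_def powr_divide powr_powr)
    finally have "AP p \<alpha> h powr (1/p) \<le> (\<eta> powr p) powr (1/p)"
      using p by (intro powr_mono2 AP_nonneg) auto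
    then show ?thesis using p \<eta> by (simp add: dp_norm_altdef powr_powr)
  qed
  have l1_le: "l1 (1/2) h \<le> \<eta>"
  proof -
    have "l1 (1/2) h \<le> (\<Sum>i<R. c * (L i powr \<tau> * exp (- (L i * (1/2)))))"
      unfolding h_def L_def by (intro l1_lac_poly_le c0) simp
    also have "\<dots> \<le> (\<Sum>i<R. \<eta>' * (F / B))"
    proof (intro sum_mono mult_mono)
      fix i
      have "(L i / 2) powr (\<tau>+1) * exp (- (L i / 2)) \<le> exp ((\<tau>+1) * ln (\<tau>+1) - (\<tau>+1))"
        using L0[of i] \<tau> by (intro powr_exp_le) auto
      then have "2 powr (\<tau>+1) * ((L i / 2) powr (\<tau>+1) * exp (- (L i / 2))) \<le> F"
        unfolding F_def by (intro mult_left_mono) auto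
      then have "(2 powr (\<tau>+1) * (L i / 2) powr (\<tau>+1)) * exp (- (L i / 2)) \<le> F" by (simp only: mult.assoc)
      moreover have "2 powr (\<tau>+1) * (L i / 2) powr (\<tau>+1) = L i powr \<tau> * L i"
        using L0[of i] by (simp add: powr_add flip: powr_mult)
      ultimately have "L i powr \<tau> * exp (- (L i / 2)) * L i \<le> F" by (simp only: mult_ac)
      then have "L i powr \<tau> * exp (- (L i / 2)) \<le> F / L i" using L0[of i] by (simp add: pos_le_divide_eq)
      also have "\<dots> \<le> F / B" using F LB[of i] RB(2) by (intro divide_left_mono mult_pos_pos) auto
      finally show "L i powr \<tau> * exp (- (L i * (1/2))) \<le> F / B" by simp
    qed (use c\<eta> \<eta>' in auto)
    also have "\<dots> = (real R * (\<eta>' * F / \<eta>)) * \<eta> / B" using \<eta> by simp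
    also have "\<dots> \<le> B * \<eta> / B" using RB \<eta> by (intro divide_right_mono mult_right_mono) auto
    also have "\<dots> = \<eta>" using RB(2) by simp
    finally show ?thesis .
  qed
  \<comment> \<open>Up to 1 / \<open>L i\<close> the shift damps the \<open>i\<close>-th prime by at
    most exp(-1), and doubling of the logarithms makes the upper halves of these intervals
    disjoint.\<close>
  define \<delta> where "\<delta> i = 1 / L i" for i
  have \<delta>: "0 < \<delta> i" "\<delta> i \<le> 1" for i using L1[of i] L0[of i] by (simp_all add: \<delta>_def)
  have \<delta>half: "\<delta> j \<le> \<delta> i / 2" if "i < j" for i j
  proof -
    have "2 * L i \<le> L j" using Ldbl[of i] monoD[OF Lmono, of "Suc i" j] that by simp
    then have "1 / L j \<le> 1 / (2 * L i)" using L0[of i] by (intro divide_left_mono mult_pos_pos L0) auto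
    then show ?thesis by (simp add: \<delta>_def)
  qed
  have AP_ge: "K' powr r \<le> AP r \<beta> h"
  proof -
    have "(\<Sum>i<R. (c * L i powr \<tau> * W) powr r * measure (mu_measure \<beta>) {\<delta> i / 2<..\<delta> i}) \<le> AP r \<beta> h"
    proof (rule AP_ge_disjoint[OF h r(1) q(2)])
      fix i j \<sigma> assume "\<sigma> \<in> {\<delta> i / 2<..\<delta> i}" "\<sigma> \<in> {\<delta> j / 2<..\<delta> j}"
      then show "i = j" using \<delta>half[of i j] \<delta>half[of j i] by (cases i j rule: linorder_cases) auto
    next
      fix i \<sigma> assume i: "i \<in> {..<R}" and \<sigma>: "\<sigma> \<in> {\<delta> i / 2<..\<delta> i}"
      have "\<sigma> * L i \<le> \<delta> i * L i" using \<sigma> L0[of i] by (intro mult_right_mono) auto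
      then have "\<sigma> * L i \<le> 1" using L0[of i] by (simp add: \<delta>_def)
      moreover have "0 \<le> \<sigma>" "\<sigma> \<le> 1" using \<sigma> \<delta>[of i] by auto
      ultimately show "(c * L i powr \<tau> * W) powr r \<le> HP r (dp_shift \<sigma> h)"
        unfolding h_def L_def W_def
        by (intro HP_lac_poly_shift_ge r(1) c0 strict_mono_imp_inj_on[OF m(1)]) (use m(2) i in \<open>auto simp: less_imp_neq\<close>)
    qed auto
    moreover have "(\<Sum>i<R. c powr r * W powr r * \<kappa> * B powr e0)
        \<le> (\<Sum>i<R. (c * L i powr \<tau> * W) powr r * measure (mu_measure \<beta>) {\<delta> i / 2<..\<delta> i})"
    proof (rule sum_mono)
      fix i
      have "B powr e0 \<le> L i powr e0" using RB(2) LB[of i] e0 by (intro powr_mono2) auto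
      then have "c powr r * W powr r * \<kappa> * B powr e0 \<le> c powr r * W powr r * \<kappa> * L i powr e0"
        using \<kappa>(1) by (intro mult_left_mono) auto
      also have "L i powr e0 = L i powr (\<tau> * r) * \<delta> i powr (\<beta> + 1)"
        using L0[of i] by (simp add: e0_def \<delta>_def powr_diff powr_divide)
      also have "c powr r * W powr r * \<kappa> * (L i powr (\<tau> * r) * \<delta> i powr (\<beta> + 1)) = (c * L i powr \<tau> * W) powr r * (\<kappa> * \<delta> i powr (\<beta> + 1))"
        by (simp add: powr_mult powr_powr)
      also have "\<dots> \<le> (c * L i powr \<tau> * W) powr r * measure (mu_measure \<beta>) {\<delta> i / 2<..\<delta> i}"
        by (intro mult_left_mono \<kappa>(2) \<delta>) simp
      finally show "c powr r * W powr r * \<kappa> * B powr e0 \<le> (c * L i powr \<tau> * W) powr r * measure (mu_measure \<beta>) {\<delta> i / 2<..\<delta> i}" .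
    qed
    moreover have "(\<Sum>i<R. c powr r * W powr r * \<kappa> * B powr e0) = K' powr r * (X * (real R powr (1 - r/p) * B powr e0))"
    proof -
      have "real R * c powr r = \<eta>' powr r * real R powr (1 - r/p)"
      proof -
        have "c powr r = \<eta>' powr r * real R powr (- (r/p))"
          unfolding c_def powr_mult powr_powr by simp
        moreover have "real R powr (1 - r/p) = real R * real R powr (- (r/p))"
          using Rp by (simp add: powr_diff powr_minus divide_inverse)
        ultimately show ?thesis by (simp only: mult_ac)
      qed
      then have "real R * c powr r * (W powr r * \<kappa> * B powr e0) = \<eta>' powr r * real R powr (1 - r/p) * (W powr r * \<kappa> * B powr e0)"
        by simp
      then show ?thesis using K' by (simp add: X_def mult_ac)
    qed
    moreover have "K' powr r * 1 \<le> K' powr r * (X * (real R powr (1 - r/p) * B powr e0))"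
      using RB(4) by (intro mult_left_mono) auto
    ultimately show ?thesis by linarith
  qed
  have "K' = (K' powr r) powr (1/r)" using K' r by (simp add: powr_powr)
  also have "\<dots> \<le> AP r \<beta> h powr (1/r)" using AP_ge r by (intro powr_mono2) auto
  also have "\<dots> = dp_norm (q * real N) \<beta> h" using r by (simp add: dp_norm_altdef r_def)
  finally have "K \<le> dp_norm q \<beta> (dpow h N)" unfolding K'_def by (rule dp_norm_dpow_ge[OF h q(1) N])
  then show "\<exists>h j. h \<in> dirichlet_polys \<and> J \<le> j \<and> (\<forall>n. h n \<noteq> 0 \<longrightarrow> (\<forall>i<J. expo i n = 0) \<and> expo j n = 1) \<and>
      dp_norm p \<alpha> h \<le> \<eta> \<and> l1 (1/2) h \<le> \<eta> \<and> K \<le> dp_norm q \<beta> (dpow h N)"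
    using h supp norm_le l1_le by (intro exI[of _ h] exI[of _ J] conjI allI impI order_refl) simp_all
qed

section \<open>From Taylor coefficients to polynomials\<close>

lemma entire_eq_poly:
  assumes sums: "\<And>w. (\<lambda>n. c n * w ^ n) sums \<phi> w" and fin: "finite {n. c n \<noteq> (0::complex)}"
  obtains P where "\<phi> = poly P" "degree P = 0 \<or> c (degree P) \<noteq> 0"
proof -
  define P where "P = Abs_poly c"
  have cP: "coeff P = c" unfolding P_def
    using fin by (intro Abs_poly_inverse) (simp add: MOST_iff_cofinite)
  have "\<phi> w = poly P w" for w
  proof -
    have "(\<lambda>n. c n * w ^ n) sums (\<Sum>n\<le>degree P. c n * w ^ n)"
      by (rule sums_finite) (use coeff_eq_0[of P] in \<open>auto simp: cP\<close>)
    then show ?thesis using sums_unique2[OF sums] by (simp add: poly_altdef cP)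
  qed
  \<comment> \<open>The first alternative covers the zero polynomial, whose leading coefficient
    vanishes; degree 0 is always admissible.\<close>
  moreover have "degree P = 0 \<or> c (degree P) \<noteq> 0"
    using leading_coeff_neq_0[of P] by (cases "P = 0") (simp_all add: cP)
  ultimately show thesis by (intro that[of P]) auto
qed

lemma not_admissible_imp_test_polys:
  assumes p: "p > 0" "\<alpha> > -1" and q: "q > 0" "\<beta> > -1" and "\<not> admissible p \<alpha> q \<beta> N"
  shows "has_test_polys p \<alpha> q \<beta> N"
proof (cases "p < q * real N")
  case True
  then show ?thesis by (rule has_test_polys_gt[OF p q])
next
  case False
  then have "\<beta> < \<alpha>" and ge: "p * (\<beta> + 1) \<le> q * real N * (\<alpha> + 1)"
    using assms(5) by (auto simp: admissible_def)
  moreover have "0 < p * (\<beta> + 1)" using p q by simp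
  then have "N > 0" using ge by (cases N) auto
  ultimately show ?thesis using False by (intro has_test_polys_le p q) auto
qed

lemma superposition_maps_imp_poly:
  assumes maps: "superposition \<phi> \<in> bergman_space p \<alpha> \<rightarrow> bergman_space q \<beta>"
    and p: "p > 0" "\<alpha> > -1" and q: "q > 0" "\<beta> > -1"
  obtains P where "\<phi> = poly P" "admissible p \<alpha> q \<beta> (degree P)"
proof -
  have hol: "\<phi> holomorphic_on ball 0 r" for r
    using superposition_maps_entire[OF maps p q] by (rule holomorphic_on_subset) simp
  define c where "c n = (deriv ^^ n) \<phi> 0 / fact n" for n
  have sums: "(\<lambda>n. c n * w ^ n) sums \<phi> w" for w
    using holomorphic_power_series[OF hol, of w "norm w + 1"] by (simp add: c_def)
  have adm: "admissible p \<alpha> q \<beta> n" if "c n \<noteq> 0" for n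
  proof (rule ccontr)
    assume "\<not> admissible p \<alpha> q \<beta> n"
    from taylor_coeff_eq_0_of_test_polys[OF maps p q sums not_admissible_imp_test_polys[OF p q this]]
    show False using that by simp
  qed
  \<comment> \<open>A bound valid in both cases of the degree condition, serving only to show that
    finitely many Taylor coefficients survive.\<close>
  have le: "real n \<le> p * \<bar>\<beta> + 1\<bar> / (q * (\<alpha> + 1)) + p / q" if "admissible p \<alpha> q \<beta> n" for n
  proof (cases "\<alpha> \<le> \<beta>")
    case True
    then have "real n \<le> p / q" using that q by (simp add: admissible_def field_simps)
    moreover have "0 \<le> p * \<bar>\<beta> + 1\<bar> / (q * (\<alpha> + 1))" using p q by simp
    ultimately show ?thesis by linarith
  next
    case False
    then have "real n < p * (\<beta> + 1) / (q * (\<alpha> + 1))" using that p q by (simp add: admissible_def pos_less_divide_eq mult_ac)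
    moreover have "0 \<le> p / q" using p q by simp
    ultimately show ?thesis using q by simp
  qed
  have "{n. c n \<noteq> 0} \<subseteq> {..nat \<lceil>p * \<bar>\<beta> + 1\<bar> / (q * (\<alpha> + 1)) + p / q\<rceil>}"
  proof
    fix n assume "n \<in> {n. c n \<noteq> 0}"
    then have "real n \<le> p * \<bar>\<beta> + 1\<bar> / (q * (\<alpha> + 1)) + p / q" by (intro le adm) simp
    then have "n \<le> nat \<lceil>p * \<bar>\<beta> + 1\<bar> / (q * (\<alpha> + 1)) + p / q\<rceil>" by linarith
    then show "n \<in> {..nat \<lceil>p * \<bar>\<beta> + 1\<bar> / (q * (\<alpha> + 1)) + p / q\<rceil>}" by simp
  qed
  then have "finite {n. c n \<noteq> 0}" by (rule finite_subset) simp
  then obtain P where P: "\<phi> = poly P" "degree P = 0 \<or> c (degree P) \<noteq> 0"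
    using entire_eq_poly[OF sums] by blast
  moreover have "admissible p \<alpha> q \<beta> 0" using p q by (simp add: admissible_def)
  ultimately show thesis using adm by (intro that[of P]) auto
qed

theorem theorem1p7:
  fixes p q \<alpha> \<beta> :: real and \<phi> :: "complex \<Rightarrow> complex"
  assumes "0 < p" and "0 < q" and "\<alpha> > -1" and "\<beta> > -1"
  shows "(superposition \<phi> \<in> bergman_space p \<alpha> \<rightarrow> bergman_space q \<beta> \<longleftrightarrow>
            (\<exists>P :: complex poly. \<phi> = poly P \<and>
               (\<alpha> \<le> \<beta> \<longrightarrow> real (degree P) \<le> p / q) \<and>
               (\<alpha> > \<beta> \<longrightarrow> real (degree P) < p * (\<beta> + 1) / (q * (\<alpha> + 1))))) \<and>
         (superposition \<phi> \<in> bergman_space p \<alpha> \<rightarrow> bergman_space q \<beta> \<longrightarrow>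
            bergman_bounded_op p \<alpha> q \<beta> (superposition \<phi>) \<and>
            bergman_continuous_op p \<alpha> q \<beta> (superposition \<phi>))"
proof -
  have adm_iff: "admissible p \<alpha> q \<beta> n \<longleftrightarrow>
      (\<alpha> \<le> \<beta> \<longrightarrow> real n \<le> p / q) \<and> (\<alpha> > \<beta> \<longrightarrow> real n < p * (\<beta> + 1) / (q * (\<alpha> + 1)))" for n
    using assms by (simp add: admissible_def pos_le_divide_eq pos_less_divide_eq mult_ac)
  have poly: "superposition (poly P) \<in> bergman_space p \<alpha> \<rightarrow> bergman_space q \<beta>"
    "bergman_bounded_op p \<alpha> q \<beta> (superposition (poly P))"
    "bergman_continuous_op p \<alpha> q \<beta> (superposition (poly P))" if "admissible p \<alpha> q \<beta> (degree P)" for P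
    using superposition_poly_maps superposition_poly_bounded superposition_poly_continuous
      assms(1,3,2,4) that by simp_all
  have maps: "\<exists>P. \<phi> = poly P \<and> admissible p \<alpha> q \<beta> (degree P)"
    if "superposition \<phi> \<in> bergman_space p \<alpha> \<rightarrow> bergman_space q \<beta>"
    by (rule superposition_maps_imp_poly[OF that assms(1,3,2,4)]) (intro exI conjI)
  show ?thesis unfolding adm_iff[symmetric]
  proof (intro conjI impI iffI)
    assume "superposition \<phi> \<in> bergman_space p \<alpha> \<rightarrow> bergman_space q \<beta>"
    from maps[OF this] obtain P where P: "\<phi> = poly P" "admissible p \<alpha> q \<beta> (degree P)" by (elim exE conjE)
    show "\<exists>P. \<phi> = poly P \<and> admissible p \<alpha> q \<beta> (degree P)" using P by (intro exI conjI)
    show "bergman_bounded_op p \<alpha> q \<beta> (superposition \<phi>)" "bergman_continuous_op p \<alpha> q \<beta> (superposition \<phi>)"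
      unfolding P(1) by (intro poly P(2))+
  next
    assume "\<exists>P. \<phi> = poly P \<and> admissible p \<alpha> q \<beta> (degree P)"
    then obtain P where P: "\<phi> = poly P" "admissible p \<alpha> q \<beta> (degree P)" by (elim exE conjE)
    show "superposition \<phi> \<in> bergman_space p \<alpha> \<rightarrow> bergman_space q \<beta>"
      unfolding P(1) by (intro poly P(2))
  qed
qed

end
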